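(* Let $\mathbb{k}=\mathbb{F}_{3^6}$ and $\mathbb{W}=\mathbb{W}(\mathbb{k})$. Assume that there is an isomorphism of graded $\mathbb{W}[C_9]$-modules $\pi_*E_6\cong (M[\Delta^{-1}])^\wedge_I$, with $M,\Delta,I$ as in the context. Let $\tilde S^*_{\mathbb{k}}=(\mathbb{W}/9)[b_1^{\pm},s_3^{\pm}][[s_1,s_2]]$. Then, as a module over $\tilde S^*_{\mathbb{k}}$, the $E_2$-page $E_2^{n,t}=H^n(C_9;\pi_tE_6)$ of the homotopy fixed points spectral sequence converging to $\pi_{t-n}E_6^{hC_9}$ is isomorphic in degrees $n>0$ to $$\tilde S^*_{\mathbb{k}}\{1,\bar c,\delta,\bar c\delta,f_0,\dots,f_5,F_0,\dots,F_5\}\big/(3s_1,3s_2,3\delta,3\bar c\delta,3f_i,3F_i).$$ The degrees $(n,t)$ of the generators are: $|s_1|=(0,-6)$, $|s_2|=(0,-12)$, $|s_3|=(0,-18)$, $|\delta|=(0,-18)$, $|b_1|=(2,0)$, $|\bar c|=(3,-6)$, $|\bar c\delta|=(3,-24)$, $|f_0|=(1,-2)$, $|f_1|=|f_2|=(1,-8)$, $|f_3|=|f_4|=(1,-14)$, $|f_5|=(1,-20)$, $|F_0|=(2,-4)$, $|F_1|=|F_2|=(2,-10)$, $|F_3|=|F_4|=(2,-16)$, $|F_5|=(2,-22)$.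
   Context: $E_6$ is the height $6$ Lubin--Tate spectrum at $p=3$ (Honda formal group law over $\mathbb{F}_{3^6}$) with the action of a cyclic subgroup $C_9=\langle\gamma\rangle$ of order $9$ of the Morava stabilizer group. $M=\mathbb{W}[x_0,\dots,x_8]/(x_0+x_3+x_6,\,x_1+x_4+x_7,\,x_2+x_5+x_8)$ (this is $\mathrm{Sym}(\mathrm{Ind}_{C_3}^{C_9}\bar\rho)$ where $\bar\rho=\mathrm{coker}(\mathbb{W}\to\mathbb{W}[C_3],\ 1\mapsto \text{sum of the group elements})$), graded with $|x_i|=-2$, with $\gamma x_i=x_{i+1}$ (indices mod $9$); $\Delta=\prod_{i=0}^8x_i$; $I=(3,x_0-x_1,x_1-x_2,\dots,x_7-x_8)$. Completions and power series rings are formed in the graded sense. The module structure on the $E_2$-page is that of the Tate cohomology $\hat H^*(C_9;(\Delta^{-1}M)^\wedge_I)$, which agrees with $H^*$ in positive degrees, via the assumed isomorphism. $X\{g_1,\dots,g_r\}$ denotes the free $X$-module on the $g_i$; in the quotient, $3s_1$ and $3s_2$ annihilate every generator, and $3$ annihilates $\delta$, $\bar c\delta$, and all $f_i,F_i$ ($0\le i\le5$). Meaning of the classes: $C_3=\langle\gamma^3\rangle$, $d_1=x_0x_3x_6$, $d_2=x_1x_4x_7$, $d_3=x_2x_5x_8$; $s_1,s_2,s_3$ are the elementary symmetric polynomials in $d_1,d_2,d_3$; $b_1$ is the degree-$2$ periodicity class; $c_1$ generates $\hat H^1(C_3;\mathbb{W}\{x_0,x_3,x_6\}/(x_0+x_3+x_6))$,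 $c_2=\gamma c_1$, $c_3=\gamma c_2$. The other generators are detected, in the localized Serre spectral sequence for $C_3\to C_9\to C_9/C_3$, by the following elements of $\hat H^*(C_3;M)^{C_9/C_3}$, where $\mathrm{tr}(X)=X+\gamma X+\gamma^2X$: $\bar c=c_1c_2c_3$, $\delta=(d_1-d_2)(d_2-d_3)(d_3-d_1)$, $f_0=\mathrm{tr}(c_1)$, $f_1=\mathrm{tr}(c_1d_1)$, $f_2=\mathrm{tr}(c_1d_2)$, $f_3=\mathrm{tr}(c_1d_1d_2)$, $f_4=\mathrm{tr}(c_1d_2d_3)$, $f_5=\mathrm{tr}(c_1d_1^2d_2)$, and $F_i$ is given by the same formula as $f_i$ with the factor $c_1$ replaced by $c_1c_2$. *)

theory Defs
  imports
    "HOL-Library.Poly_Mapping"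
    "HOL-Library.Numeral_Type"
    "HOL-Library.Function_Algebras"
    "HOL-Library.Product_Plus"
    "HOL-Computational_Algebra.Formal_Power_Series"
    "HOL-Algebra.Coset"
    "HOL-Algebra.Elementary_Groups"
begin

unbundle fps_syntax

section \<open>Rings, ideals, Witt vectors\<close>

text \<open>The sort \<open>{comm_ring, comm_monoid_mult}\<close> is that of commutative rings with 1 in which 0 = 1 is
  not excluded. It is needed because the completion built below is the zero ring for some coefficient
  rings (though not over Witt vectors).\<close>

definition is_ring_hom ::
  "('a::{comm_ring,comm_monoid_mult} \<Rightarrow> 'b::{comm_ring,comm_monoid_mult}) \<Rightarrow> bool" where
  "is_ring_hom \<phi> \<longleftrightarrow> \<phi> 1 = 1 \<and> (\<forall>a b. \<phi> (a + b) = \<phi> a + \<phi> b) \<and> (\<forall>a b. \<phi> (a * b) = \<phi> a * \<phi> b)"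

definition is_ideal :: "'a::{comm_ring,comm_monoid_mult} set \<Rightarrow> bool" where
  "is_ideal J \<longleftrightarrow> 0 \<in> J \<and> (\<forall>a\<in>J. \<forall>b\<in>J. a + b \<in> J) \<and> (\<forall>r. \<forall>a\<in>J. r * a \<in> J)"

definition ideal_span :: "'a::{comm_ring,comm_monoid_mult} set \<Rightarrow> 'a set" where
  "ideal_span S = \<Inter>{J. is_ideal J \<and> S \<subseteq> J}"

primrec ideal_power :: "'a::{comm_ring,comm_monoid_mult} set \<Rightarrow> nat \<Rightarrow> 'a set" where
  "ideal_power I 0 = UNIV"
| "ideal_power I (Suc k) = ideal_span {a * b | a b. a \<in> I \<and> b \<in> ideal_power I k}"

text \<open>The ring of Witt vectors of a perfect field of characteristic \<open>p\<close> is the strict \<open>p\<close>-ring with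
  that residue field, which is unique up to a unique isomorphism over the field: it is \<open>p\<close>-torsion
  free, \<open>p\<close>-adically separated and complete, and \<open>p\<close> generates the kernel of the residue map.\<close>

definition witt_ring :: "nat \<Rightarrow> ('w::comm_ring_1 \<Rightarrow> 'k::field) \<Rightarrow> bool" where
  "witt_ring p res \<longleftrightarrow>
     is_ring_hom res \<and> surj res \<and> (\<forall>a. res a = 0 \<longleftrightarrow> of_nat p dvd a) \<and>
     (\<forall>a::'w. of_nat p * a = 0 \<longrightarrow> a = 0) \<and>
     (\<forall>a::'w. (\<forall>n. of_nat p ^ n dvd a) \<longrightarrow> a = 0) \<and>
     (\<forall>x::nat \<Rightarrow> 'w. (\<forall>n. of_nat p ^ n dvd x (Suc n) - x n) \<longrightarrow>
        (\<exists>y. \<forall>n. of_nat p ^ n dvd y - x n))"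

lemma ideal_uminus: "is_ideal J \<Longrightarrow> a \<in> J \<Longrightarrow> - a \<in> J"
proof -
  assume "is_ideal J" "a \<in> J"
  then have "(- 1) * a \<in> J" unfolding is_ideal_def by blast
  moreover have "(- 1) * a = - a" by (simp flip: minus_mult_left)
  ultimately show ?thesis by simp
qed

lemma ideal_minus: "is_ideal J \<Longrightarrow> a \<in> J \<Longrightarrow> b \<in> J \<Longrightarrow> a - b \<in> J"
proof -
  assume J: "is_ideal J" "a \<in> J" "b \<in> J"
  then have "a + (- b) \<in> J" using ideal_uminus[of J b] unfolding is_ideal_def by blast
  then show ?thesis by simp
qed

lemma is_ideal_span: "is_ideal (ideal_span S)"
  unfolding ideal_span_def is_ideal_def by blast

lemma ideal_span_base: "a \<in> S \<Longrightarrow> a \<in> ideal_span S"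
  unfolding ideal_span_def by blast

lemma is_ideal_power: "is_ideal (ideal_power I k)"
  by (cases k) (simp_all add: is_ideal_span, simp add: is_ideal_def)

lemma ideal_congs:
  assumes "is_ideal J" "a - b \<in> J" "c - d \<in> J"
  shows ideal_cong_add: "(a + c) - (b + d) \<in> J"
    and ideal_cong_minus: "(a - c) - (b - d) \<in> J"
    and ideal_cong_mult: "a * c - b * d \<in> J"
proof -
  have "(a - b) + (c - d) \<in> J" using assms unfolding is_ideal_def by blast
  then show "(a + c) - (b + d) \<in> J" by (simp add: algebra_simps)
  have "(a - b) - (c - d) \<in> J" using assms ideal_minus by blast
  then show "(a - c) - (b - d) \<in> J" by (simp add: algebra_simps)
  have "c * (a - b) \<in> J" "b * (c - d) \<in> J" using assms unfolding is_ideal_def by blast+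
  then have "c * (a - b) + b * (c - d) \<in> J" using assms unfolding is_ideal_def by blast
  moreover have "c * (a - b) + b * (c - d) = a * c - b * d" by (simp add: algebra_simps)
  ultimately show "a * c - b * d \<in> J" by simp
qed

lemma ideal_cong_uminus: "is_ideal J \<Longrightarrow> a - b \<in> J \<Longrightarrow> (- a) - (- b) \<in> J"
  using ideal_uminus[of J "a - b"] by (simp add: algebra_simps)

lemma ideal_trans: "is_ideal J \<Longrightarrow> a - b \<in> J \<Longrightarrow> b - c \<in> J \<Longrightarrow> a - c \<in> J"
proof -
  assume J: "is_ideal J" "a - b \<in> J" "b - c \<in> J"
  then have "(a - b) + (b - c) \<in> J" unfolding is_ideal_def by blast
  then show ?thesis by simp
qed

lemma ideal_sym: "is_ideal J \<Longrightarrow> a - b \<in> J \<Longrightarrow> b - a \<in> J"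
  using ideal_uminus[of J "a - b"] by simp

lemma ideal_refl: "is_ideal J \<Longrightarrow> a - a \<in> J"
  unfolding is_ideal_def by simp

lemma ring_hom_0: "is_ring_hom \<phi> \<Longrightarrow> \<phi> 0 = 0"
proof -
  assume "is_ring_hom \<phi>"
  then have "\<phi> (0 + 0) = \<phi> 0 + \<phi> 0" unfolding is_ring_hom_def by blast
  then show ?thesis by simp
qed

lemma ring_hom_minus: "is_ring_hom \<phi> \<Longrightarrow> \<phi> (a - b) = \<phi> a - \<phi> b"
proof -
  assume "is_ring_hom \<phi>"
  then have "\<phi> ((a - b) + b) = \<phi> (a - b) + \<phi> b" unfolding is_ring_hom_def by blast
  then show ?thesis by simp
qed

lemma ring_hom_ideal_span:
  assumes h: "is_ring_hom \<phi>" and S: "\<And>a. a \<in> S \<Longrightarrow> \<phi> a \<in> ideal_span T" and a: "a \<in> ideal_span S"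
  shows "\<phi> a \<in> ideal_span T"
proof -
  have "is_ideal {a. \<phi> a \<in> ideal_span T}"
    using is_ideal_span[of T] h ring_hom_0[OF h] unfolding is_ideal_def is_ring_hom_def by simp
  then have "ideal_span S \<subseteq> {a. \<phi> a \<in> ideal_span T}"
    using S unfolding ideal_span_def by blast
  then show ?thesis using a by blast
qed

lemma ring_hom_ideal_power:
  assumes h: "is_ring_hom \<phi>" and I: "\<And>a. a \<in> I \<Longrightarrow> \<phi> a \<in> J"
  shows "a \<in> ideal_power I k \<Longrightarrow> \<phi> a \<in> ideal_power J k"
proof (induction k arbitrary: a)
  case (Suc k)
  have "\<phi> b \<in> ideal_span {a * b | a b. a \<in> J \<and> b \<in> ideal_power J k}"
    if b: "b \<in> {a * b | a b. a \<in> I \<and> b \<in> ideal_power I k}" for b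
  proof -
    from b obtain x y where xy: "b = x * y" "x \<in> I" "y \<in> ideal_power I k" by blast
    have "\<phi> b = \<phi> x * \<phi> y" using xy(1) h unfolding is_ring_hom_def by blast
    then show ?thesis using I[OF xy(2)] Suc.IH[OF xy(3)] by (intro ideal_span_base) blast
  qed
  from ring_hom_ideal_span[OF h this Suc.prems[unfolded ideal_power.simps]]
  show ?case by simp
qed simp


section \<open>The \<open>C\<^sub>9\<close>-ring \<open>M\<close>\<close>

text \<open>The index type \<open>9\<close> is the ring of integers modulo 9, so that \<open>i + 1\<close> is taken modulo 9.\<close>

type_synonym mono = "9 \<Rightarrow>\<^sub>0 nat"
type_synonym 'w poly9 = "mono \<Rightarrow>\<^sub>0 'w"

definition pvar :: "9 \<Rightarrow> 'w::comm_ring_1 poly9" where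
  "pvar i = Poly_Mapping.single (Poly_Mapping.single i 1) 1"

definition pconst :: "'w::comm_ring_1 \<Rightarrow> 'w poly9" where
  "pconst w = Poly_Mapping.single 0 w"

definition poly9_part :: "int \<Rightarrow> 'w::comm_ring_1 poly9 set" where
  "poly9_part t = {p. \<forall>m \<in> Poly_Mapping.keys p. t = - 2 * int (\<Sum>i\<in>UNIV. Poly_Mapping.lookup m i)}"

text \<open>The monomial with exponents \<open>m i\<close> is sent to the one with exponents \<open>m (i - 1)\<close>, i.e.
  \<open>x\<^sub>i\<close> goes to \<open>x\<^sub>i\<^sub>+\<^sub>1\<close>.\<close>

definition poly9_gamma :: "'w::comm_ring_1 poly9 \<Rightarrow> 'w poly9" where
  "poly9_gamma p = Poly_Mapping.map_key (Poly_Mapping.map_key (\<lambda>i. i + 1)) p"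

definition rel_ideal :: "'w::comm_ring_1 poly9 set" where
  "rel_ideal = ideal_span {pvar 0 + pvar 3 + pvar 6, pvar 1 + pvar 4 + pvar 7, pvar 2 + pvar 5 + pvar 8}"

lemma map_key_shift_lookup: "Poly_Mapping.lookup (Poly_Mapping.map_key (\<lambda>i::9. i + 1) m) i = Poly_Mapping.lookup m (i + 1)"
  by (subst Poly_Mapping.map_key.rep_eq) (auto simp: inj_def)

lemma map_key_unshift_lookup: "Poly_Mapping.lookup (Poly_Mapping.map_key (\<lambda>i::9. i - 1) m) i = Poly_Mapping.lookup m (i - 1)"
  by (subst Poly_Mapping.map_key.rep_eq) (auto simp: inj_def)

lemma map_key_shift_unshift:
  "Poly_Mapping.map_key (\<lambda>i::9. i + 1) (Poly_Mapping.map_key (\<lambda>i. i - 1) m) = m"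
  "Poly_Mapping.map_key (\<lambda>i::9. i - 1) (Poly_Mapping.map_key (\<lambda>i. i + 1) m) = m"
  by (rule poly_mapping_eqI; simp add: map_key_shift_lookup map_key_unshift_lookup)+

lemma inj_map_key_shift: "inj (Poly_Mapping.map_key (\<lambda>i::9. i + 1))"
  by (rule inj_on_inverseI[where g = "Poly_Mapping.map_key (\<lambda>i. i - 1)"]) (rule map_key_shift_unshift(2))

lemma map_key_unshift_add:
  "Poly_Mapping.map_key (\<lambda>i::9. i - 1) (m + n :: mono) =
   Poly_Mapping.map_key (\<lambda>i::9. i - 1) m + Poly_Mapping.map_key (\<lambda>i::9. i - 1) n"
  by (rule poly_mapping_eqI) (simp add: map_key_unshift_lookup lookup_add)

lemma poly9_gamma_single:
  "poly9_gamma (Poly_Mapping.single m w) = Poly_Mapping.single (Poly_Mapping.map_key (\<lambda>i::9. i - 1) m) w"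
  unfolding poly9_gamma_def
  using map_key_single[OF inj_map_key_shift, of "Poly_Mapping.map_key (\<lambda>i. i - 1) m" w]
  by (simp add: map_key_shift_unshift)

lemma poly9_gamma_add: "poly9_gamma (p + q) = poly9_gamma p + poly9_gamma q"
  unfolding poly9_gamma_def by (rule map_key_plus[OF inj_map_key_shift])

lemma poly9_gamma_0: "poly9_gamma 0 = 0"
  using poly9_gamma_single[of 0 0] by simp

lemma poly9_induct:
  fixes P :: "'w::comm_ring_1 poly9 \<Rightarrow> bool"
  assumes "P 0" "\<And>m w. P (Poly_Mapping.single m w)" "\<And>p q. P p \<Longrightarrow> P q \<Longrightarrow> P (p + q)"
  shows "P p"
proof (induction p rule: update_induct)
  case const
  then show ?case using assms(1) by simp
next
  case (update p a b)
  have "Poly_Mapping.update a b p = p + Poly_Mapping.single a b"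
    using update(1) by (intro poly_mapping_eqI)
      (auto simp: lookup_update lookup_add lookup_single when_def in_keys_iff)
  then show ?case using assms update by metis
qed

lemma poly9_gamma_mult: "poly9_gamma (p * q) = poly9_gamma p * poly9_gamma q"
proof (induction p rule: poly9_induct)
  case (2 m w)
  show ?case
    by (induction q rule: poly9_induct)
       (simp_all add: poly9_gamma_0 poly9_gamma_add distrib_left mult_single poly9_gamma_single
         map_key_unshift_add)
qed (simp_all add: poly9_gamma_0 poly9_gamma_add distrib_right)

lemma poly9_gamma_hom: "is_ring_hom poly9_gamma"
proof -
  have "poly9_gamma (Poly_Mapping.single 0 1) = (Poly_Mapping.single 0 1 :: 'a poly9)"
    unfolding poly9_gamma_single
    by (rule arg_cong[of _ _ "\<lambda>m. Poly_Mapping.single m 1"], rule poly_mapping_eqI)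
       (simp add: map_key_unshift_lookup)
  then show ?thesis unfolding is_ring_hom_def
    by (simp add: poly9_gamma_add poly9_gamma_mult)
qed

lemma poly9_gamma_pvar: "poly9_gamma (pvar i) = pvar (i + 1)"
proof -
  have "Poly_Mapping.map_key (\<lambda>i::9. i - 1) (Poly_Mapping.single i 1) = Poly_Mapping.single (i + 1) (1::nat)"
    by (rule poly_mapping_eqI) (auto simp: map_key_unshift_lookup lookup_single when_def)
  then show ?thesis unfolding pvar_def poly9_gamma_single by simp
qed

lemma nine_eq_0: "(9::9) = 0"
  by simp

lemma poly9_gamma_rel_ideal: "p \<in> rel_ideal \<Longrightarrow> poly9_gamma p \<in> rel_ideal"
  unfolding rel_ideal_def
  by (rule ring_hom_ideal_span[OF poly9_gamma_hom])
     (auto simp: poly9_gamma_add poly9_gamma_pvar ac_simps nine_eq_0 intro: ideal_span_base)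

lemma is_ideal_rel_ideal: "is_ideal rel_ideal"
  unfolding rel_ideal_def by (rule is_ideal_span)

quotient_type (overloaded) 'w M = "'w::comm_ring_1 poly9" / "\<lambda>p q. p - q \<in> rel_ideal"
  by (rule equivpI)
     (blast intro: reflpI sympI transpI ideal_refl ideal_sym ideal_trans is_ideal_rel_ideal)+

instantiation M :: (comm_ring_1) "{comm_ring,comm_monoid_mult}"
begin

lift_definition zero_M :: "'a M" is 0 .
lift_definition one_M :: "'a M" is 1 .
lift_definition plus_M :: "'a M \<Rightarrow> 'a M \<Rightarrow> 'a M" is plus
  by (rule ideal_cong_add[OF is_ideal_rel_ideal])
lift_definition uminus_M :: "'a M \<Rightarrow> 'a M" is uminus
  by (rule ideal_cong_uminus[OF is_ideal_rel_ideal])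
lift_definition minus_M :: "'a M \<Rightarrow> 'a M \<Rightarrow> 'a M" is minus
  by (rule ideal_cong_minus[OF is_ideal_rel_ideal])
lift_definition times_M :: "'a M \<Rightarrow> 'a M \<Rightarrow> 'a M" is times
  by (rule ideal_cong_mult[OF is_ideal_rel_ideal])

instance
  by intro_classes (transfer; simp add: algebra_simps ideal_refl[OF is_ideal_rel_ideal, of 0, simplified])+

end

lift_definition M_gamma :: "'w::comm_ring_1 M \<Rightarrow> 'w M" is poly9_gamma
  by (metis poly9_gamma_hom poly9_gamma_rel_ideal ring_hom_minus)

definition M_part :: "int \<Rightarrow> 'w::comm_ring_1 M set" where
  "M_part t = abs_M ` poly9_part t"

definition M_Delta :: "'w::comm_ring_1 M" where
  "M_Delta = abs_M (\<Prod>i\<in>UNIV. pvar i)"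

lemma M_gamma_hom: "is_ring_hom M_gamma"
  unfolding is_ring_hom_def
proof (intro conjI allI)
  show "M_gamma 1 = (1 :: 'a M)"
    by transfer (metis poly9_gamma_hom is_ring_hom_def ideal_refl is_ideal_rel_ideal)
  show "M_gamma (a + b) = M_gamma a + M_gamma b" for a b :: "'a M"
    by transfer (simp add: poly9_gamma_add ideal_refl[OF is_ideal_rel_ideal, of 0, simplified])
  show "M_gamma (a * b) = M_gamma a * M_gamma b" for a b :: "'a M"
    by transfer (simp add: poly9_gamma_mult ideal_refl[OF is_ideal_rel_ideal, of 0, simplified])
qed

lemma ring_hom_power: "is_ring_hom \<phi> \<Longrightarrow> \<phi> (a ^ n) = \<phi> a ^ n"
  by (induction n) (simp_all add: is_ring_hom_def)

lemma poly9_gamma_prod: "finite A \<Longrightarrow> poly9_gamma (\<Prod>i\<in>A. f i) = (\<Prod>i\<in>A. poly9_gamma (f i))"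
  by (induction A rule: finite_induct)
     (simp_all add: poly9_gamma_mult poly9_gamma_hom[unfolded is_ring_hom_def])

lemma M_gamma_Delta: "M_gamma M_Delta = M_Delta"
proof -
  let ?D = "\<Prod>i\<in>UNIV. pvar i :: 'a poly9"
  have "bij (\<lambda>i::9. i + 1)" by (rule bijI') (auto intro: exI[of _ "_ - 1"])
  then have "(\<Prod>i\<in>UNIV. pvar (i + 1)) = ?D"
    by (rule prod.reindex_bij_betw)
  then have "poly9_gamma ?D = ?D"
    by (simp add: poly9_gamma_prod poly9_gamma_pvar)
  then show ?thesis unfolding M_Delta_def by (simp add: M_gamma.abs_eq)
qed


section \<open>The localization \<open>M[\<Delta>\<^sup>-\<^sup>1]\<close>\<close>

definition frac_rel :: "'a::{comm_ring,comm_monoid_mult} \<Rightarrow> 'a \<times> nat \<Rightarrow> 'a \<times> nat \<Rightarrow> bool" where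
  "frac_rel e = (\<lambda>(m, i) (n, j). \<exists>l. e ^ l * (m * e ^ j) = e ^ l * (n * e ^ i))"

lemma frac_rel_refl: "frac_rel e x x"
  unfolding frac_rel_def by auto

lemma frac_rel_sym: "frac_rel e x y \<Longrightarrow> frac_rel e y x"
  unfolding frac_rel_def by (auto intro: sym)

lemma frac_rel_trans:
  assumes "frac_rel e x y" "frac_rel e y z"
  shows "frac_rel e x z"
proof -
  obtain m i n j q p where xyz: "x = (m, i)" "y = (n, j)" "z = (q, p)"
    by (metis prod.exhaust)
  from assms xyz obtain l k where l: "e ^ l * (m * e ^ j) = e ^ l * (n * e ^ i)"
    and k: "e ^ k * (n * e ^ p) = e ^ k * (q * e ^ j)"
    unfolding frac_rel_def by auto
  have "e ^ (l + k + j) * (m * e ^ p) = e ^ k * e ^ p * (e ^ l * (m * e ^ j))"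
    by (simp add: power_add ac_simps)
  also have "\<dots> = e ^ l * e ^ i * (e ^ k * (n * e ^ p))"
    unfolding l by (simp add: ac_simps)
  also have "\<dots> = e ^ (l + k + j) * (q * e ^ i)"
    unfolding k by (simp add: power_add ac_simps)
  finally show ?thesis unfolding frac_rel_def xyz by auto
qed

lemma frac_rel_add:
  assumes "frac_rel e (m, i) (m', i')" "frac_rel e (n, j) (n', j')"
  shows "frac_rel e (m * e ^ j + n * e ^ i, i + j) (m' * e ^ j' + n' * e ^ i', i' + j')"
proof -
  from assms obtain l k where l: "e ^ l * (m * e ^ i') = e ^ l * (m' * e ^ i)"
    and k: "e ^ k * (n * e ^ j') = e ^ k * (n' * e ^ j)"
    unfolding frac_rel_def by auto
  have "e ^ (l + k) * ((m * e ^ j + n * e ^ i) * e ^ (i' + j')) =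
      e ^ k * e ^ j * e ^ j' * (e ^ l * (m * e ^ i')) + e ^ l * e ^ i * e ^ i' * (e ^ k * (n * e ^ j'))"
    by (simp add: power_add algebra_simps)
  also have "\<dots> = e ^ (l + k) * ((m' * e ^ j' + n' * e ^ i') * e ^ (i + j))"
    unfolding l k by (simp add: power_add algebra_simps)
  finally show ?thesis unfolding frac_rel_def by auto
qed

lemma frac_rel_mult:
  assumes "frac_rel e (m, i) (m', i')" "frac_rel e (n, j) (n', j')"
  shows "frac_rel e (m * n, i + j) (m' * n', i' + j')"
proof -
  from assms obtain l k where l: "e ^ l * (m * e ^ i') = e ^ l * (m' * e ^ i)"
    and k: "e ^ k * (n * e ^ j') = e ^ k * (n' * e ^ j)"
    unfolding frac_rel_def by auto
  have "e ^ (l + k) * ((m * n) * e ^ (i' + j')) = (e ^ l * (m * e ^ i')) * (e ^ k * (n * e ^ j'))"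
    by (simp add: power_add ac_simps)
  also have "\<dots> = e ^ (l + k) * ((m' * n') * e ^ (i + j))"
    unfolding l k by (simp add: power_add ac_simps)
  finally show ?thesis unfolding frac_rel_def by auto
qed

lemma frac_rel_uminus: "frac_rel e (m, i) (n, j) \<Longrightarrow> frac_rel e (- m, i) (- n, j)"
  unfolding frac_rel_def by auto

text \<open>The class of \<open>(m, i)\<close> is the fraction \<open>m / \<Delta>\<^sup>i\<close>.\<close>

quotient_type (overloaded) 'w Mloc = "'w::comm_ring_1 M \<times> nat" / "frac_rel M_Delta"
  by (rule equivpI)
     (blast intro: reflpI sympI transpI frac_rel_refl frac_rel_sym frac_rel_trans)+

instantiation Mloc :: (comm_ring_1) "{comm_ring,comm_monoid_mult}"
begin

lift_definition zero_Mloc :: "'a Mloc" is "(0, 0)" .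
lift_definition one_Mloc :: "'a Mloc" is "(1, 0)" .
lift_definition plus_Mloc :: "'a Mloc \<Rightarrow> 'a Mloc \<Rightarrow> 'a Mloc"
  is "\<lambda>(m, i) (n, j). (m * M_Delta ^ j + n * M_Delta ^ i, i + j)"
  by (auto intro: frac_rel_add)
lift_definition uminus_Mloc :: "'a Mloc \<Rightarrow> 'a Mloc" is "\<lambda>(m, i). (- m, i)"
  by (auto intro: frac_rel_uminus)
definition minus_Mloc :: "'a Mloc \<Rightarrow> 'a Mloc \<Rightarrow> 'a Mloc" where
  "minus_Mloc a b = a + (- b)"
lift_definition times_Mloc :: "'a Mloc \<Rightarrow> 'a Mloc \<Rightarrow> 'a Mloc"
  is "\<lambda>(m, i) (n, j). (m * n, i + j)"
  by (auto intro: frac_rel_mult)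

instance
proof
  fix a b c :: "'a Mloc"
  show "a - b = a + - b" by (rule minus_Mloc_def)
  show "a + b + c = a + (b + c)"
    by transfer (auto simp: frac_rel_def power_add algebra_simps)
  show "a + b = b + a"
    by transfer (auto simp: frac_rel_def power_add algebra_simps)
  show "0 + a = a"
    by transfer (auto simp: frac_rel_def power_add algebra_simps)
  show "- a + a = 0"
    by transfer (auto simp: frac_rel_def power_add algebra_simps)
  show "a * b * c = a * (b * c)"
    by transfer (auto simp: frac_rel_def power_add algebra_simps)
  show "a * b = b * a"
    by transfer (auto simp: frac_rel_def power_add algebra_simps)
  show "(a + b) * c = a * c + b * c"
    by transfer (auto simp: frac_rel_def power_add algebra_simps)
  show "1 * a = a"
    by transfer (auto simp: frac_rel_def power_add algebra_simps)
qed

end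

definition M_frac :: "'w::comm_ring_1 M \<Rightarrow> nat \<Rightarrow> 'w Mloc" where
  "M_frac m i = abs_Mloc (m, i)"

lift_definition Mloc_gamma :: "'w::comm_ring_1 Mloc \<Rightarrow> 'w Mloc" is "\<lambda>(m, i). (M_gamma m, i)"
proof -
  fix x y :: "'w M \<times> nat"
  assume "frac_rel M_Delta x y"
  then obtain m i n j l where xy: "x = (m, i)" "y = (n, j)"
    and l: "M_Delta ^ l * (m * M_Delta ^ j) = M_Delta ^ l * (n * M_Delta ^ i)"
    unfolding frac_rel_def by (cases x; cases y) auto
  have *: "M_gamma (a * b) = M_gamma a * M_gamma b" "M_gamma (M_Delta ^ k) = M_Delta ^ k"
    for a b :: "'w M" and k
    using M_gamma_hom ring_hom_power[OF M_gamma_hom] M_gamma_Delta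
    unfolding is_ring_hom_def by metis+
  from arg_cong[OF l, of M_gamma]
  show "frac_rel M_Delta (case x of (m, i) \<Rightarrow> (M_gamma m, i)) (case y of (m, i) \<Rightarrow> (M_gamma m, i))"
    unfolding xy frac_rel_def by (auto simp: *)
qed

text \<open>As \<open>\<Delta>\<close> has degree -18, the fraction \<open>m / \<Delta>\<^sup>i\<close> has degree \<open>deg m + 18 i\<close>.\<close>

definition Mloc_part :: "int \<Rightarrow> 'w::comm_ring_1 Mloc set" where
  "Mloc_part t = {M_frac m i | m i. m \<in> M_part (t - 18 * int i)}"

definition Mloc_of :: "'w::comm_ring_1 poly9 \<Rightarrow> 'w Mloc" where
  "Mloc_of p = M_frac (abs_M p) 0"

definition Mloc_I :: "'w::comm_ring_1 Mloc set" where
  "Mloc_I = ideal_span ({Mloc_of (pconst 3)} \<union>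
     (\<lambda>i. Mloc_of (pvar i - pvar (i + 1))) ` {0, 1, 2, 3, 4, 5, 6, 7})"

lemma Mloc_gamma_hom: "is_ring_hom Mloc_gamma"
proof -
  have *: "M_gamma (a * b) = M_gamma a * M_gamma b" "M_gamma (a + b) = M_gamma a + M_gamma b"
    "M_gamma (M_Delta ^ k) = M_Delta ^ k" "M_gamma 1 = 1"
    for a b :: "'a M" and k
    using M_gamma_hom ring_hom_power[OF M_gamma_hom] M_gamma_Delta
    unfolding is_ring_hom_def by metis+
  show ?thesis
    unfolding is_ring_hom_def
  proof (intro conjI allI)
    show "Mloc_gamma 1 = (1 :: 'a Mloc)" by transfer (auto simp: * frac_rel_refl)
    show "Mloc_gamma (a + b) = Mloc_gamma a + Mloc_gamma b" for a b :: "'a Mloc"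
      by transfer (auto simp: * frac_rel_refl)
    show "Mloc_gamma (a * b) = Mloc_gamma a * Mloc_gamma b" for a b :: "'a Mloc"
      by transfer (auto simp: * frac_rel_refl)
  qed
qed

lemma Mloc_gamma_of: "Mloc_gamma (Mloc_of p) = Mloc_of (poly9_gamma p)"
  unfolding Mloc_of_def M_frac_def by (simp add: Mloc_gamma.abs_eq M_gamma.abs_eq)

lemma Mloc_of_add: "Mloc_of (p + q) = Mloc_of p + Mloc_of q"
proof -
  have "M_frac (a + b) 0 = M_frac a 0 + M_frac b 0" for a b :: "'a M"
    unfolding M_frac_def by (simp add: plus_Mloc.abs_eq)
  then show ?thesis unfolding Mloc_of_def by (metis plus_M.abs_eq)
qed

lemma Mloc_gamma_I: "a \<in> Mloc_I \<Longrightarrow> Mloc_gamma a \<in> Mloc_I"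
proof -
  let ?S = "{Mloc_of (pconst 3)} \<union> (\<lambda>i. Mloc_of (pvar i - pvar (i + 1))) ` {0, 1, 2, 3, 4, 5, 6, 7} :: 'a Mloc set"
  have J: "is_ideal (ideal_span ?S)" by (rule is_ideal_span)
  have diff: "Mloc_of (pvar i - pvar (i + 1)) \<in> ideal_span ?S" if "i \<in> {0, 1, 2, 3, 4, 5, 6, 7}" for i :: 9
    using that by (intro ideal_span_base) blast
  have step: "Mloc_of (p - r) \<in> ideal_span ?S"
    if "Mloc_of (p - q) \<in> ideal_span ?S" "Mloc_of (q - r) \<in> ideal_span ?S" for p q r :: "'a poly9"
  proof -
    have "Mloc_of ((p - q) + (q - r)) \<in> ideal_span ?S"
      unfolding Mloc_of_add using that J unfolding is_ideal_def by blast
    then show ?thesis by simp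
  qed
  have Mloc_of_uminus: "Mloc_of (- p) = - Mloc_of p" for p :: "'a poly9"
  proof -
    have "Mloc_of (0 :: 'a poly9) = 0" using Mloc_of_add[of "0 :: 'a poly9" 0] by simp
    then have "Mloc_of (- p) + Mloc_of p = 0" by (metis Mloc_of_add add.left_inverse)
    then show ?thesis by (rule minus_unique[OF trans[OF add.commute], symmetric])
  qed
  have d: "Mloc_of (pvar 0 - pvar 1) \<in> ideal_span ?S" "Mloc_of (pvar 1 - pvar 2) \<in> ideal_span ?S"
    "Mloc_of (pvar 2 - pvar 3) \<in> ideal_span ?S" "Mloc_of (pvar 3 - pvar 4) \<in> ideal_span ?S"
    "Mloc_of (pvar 4 - pvar 5) \<in> ideal_span ?S" "Mloc_of (pvar 5 - pvar 6) \<in> ideal_span ?S"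
    "Mloc_of (pvar 6 - pvar 7) \<in> ideal_span ?S" "Mloc_of (pvar 7 - pvar 8) \<in> ideal_span ?S"
    using diff[of 0] diff[of 1] diff[of 2] diff[of 3] diff[of 4] diff[of 5] diff[of 6] diff[of 7]
    by simp_all
  have "Mloc_of (pvar 0 - pvar 8) \<in> ideal_span ?S"
    by (rule step[OF step[OF step[OF step[OF step[OF step[OF step[OF d(1) d(2)] d(3)] d(4)] d(5)] d(6)] d(7)] d(8)])
  then have last: "Mloc_of (pvar 8 - pvar 0) \<in> ideal_span ?S"
    using ideal_uminus[OF J, of "Mloc_of (pvar 0 - pvar 8)"] Mloc_of_uminus[of "pvar 0 - pvar 8"] by simp
  have c: "poly9_gamma (pconst 3) = (pconst 3 :: 'a poly9)"
  proof -
    have "Poly_Mapping.map_key (\<lambda>i::9. i - 1) 0 = (0 :: mono)"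
      by (rule poly_mapping_eqI) (simp add: map_key_unshift_lookup)
    then show ?thesis unfolding pconst_def poly9_gamma_single by simp
  qed
  have "Mloc_gamma b \<in> ideal_span ?S" if "b \<in> ?S" for b
  proof -
    from that consider "b = Mloc_of (pconst 3)"
      | i where "i \<in> {0, 1, 2, 3, 4, 5, 6, 7}" "b = Mloc_of (pvar i - pvar (i + 1))" by blast
    then show ?thesis
    proof cases
      case 1
      have "Mloc_gamma b = Mloc_of (pconst 3)" unfolding 1 Mloc_gamma_of c ..
      then show ?thesis by (intro ideal_span_base) blast
    next
      case (2 i)
      have "Mloc_gamma b = Mloc_of (pvar (i + 1) - pvar (i + 1 + 1))"
        unfolding 2(2) Mloc_gamma_of ring_hom_minus[OF poly9_gamma_hom] poly9_gamma_pvar ..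
      moreover have "i + 1 \<in> {0, 1, 2, 3, 4, 5, 6, 7} \<or> i + 1 = 8" using 2(1) by auto
      ultimately show ?thesis using diff[of "i + 1"] last by (auto simp: nine_eq_0)
    qed
  qed
  then show "a \<in> Mloc_I \<Longrightarrow> Mloc_gamma a \<in> Mloc_I"
    unfolding Mloc_I_def by (rule ring_hom_ideal_span[OF Mloc_gamma_hom])
qed


section \<open>The completion \<open>(M[\<Delta>\<^sup>-\<^sup>1])\<^sup>\<and>\<^sub>I\<close>\<close>

text \<open>An element of the inverse limit of the rings \<open>M[\<Delta>\<^sup>-\<^sup>1] / I\<^sup>k\<close> is represented by a sequence whose
  \<open>k\<close>-th term represents the component in \<open>M[\<Delta>\<^sup>-\<^sup>1] / I\<^sup>k\<close>. The completion in the graded sense is the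
  direct sum over \<open>t\<close> of the subgroups \<open>Mhat_part t\<close> below, which are the inverse limits of the degree
  \<open>t\<close> parts.\<close>

definition coherent :: "(nat \<Rightarrow> 'w::comm_ring_1 Mloc) \<Rightarrow> bool" where
  "coherent r \<longleftrightarrow> (\<forall>k. r (Suc k) - r k \<in> ideal_power Mloc_I k)"

definition seq_rel :: "(nat \<Rightarrow> 'w::comm_ring_1 Mloc) \<Rightarrow> (nat \<Rightarrow> 'w Mloc) \<Rightarrow> bool" where
  "seq_rel r s \<longleftrightarrow> coherent r \<and> coherent s \<and> (\<forall>k. r k - s k \<in> ideal_power Mloc_I k)"

lemma seq_relI: "coherent r \<Longrightarrow> coherent s \<Longrightarrow> (\<And>k. r k - s k \<in> ideal_power Mloc_I k) \<Longrightarrow> seq_rel r s"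
  unfolding seq_rel_def by blast

lemma seq_relD:
  assumes "seq_rel r s"
  shows "coherent r" "coherent s" "r k - s k \<in> ideal_power Mloc_I k"
  using assms unfolding seq_rel_def by blast+

lemma seq_rel_refl: "coherent r \<Longrightarrow> seq_rel r r"
  by (intro seq_relI ideal_refl is_ideal_power)

lemma coherent_const: "coherent (\<lambda>_. a)"
  unfolding coherent_def by (intro allI ideal_refl is_ideal_power)

lemma coherent_add: "coherent r \<Longrightarrow> coherent s \<Longrightarrow> coherent (\<lambda>k. r k + s k)"
  unfolding coherent_def by (intro allI ideal_cong_add is_ideal_power) blast+

lemma coherent_minus: "coherent r \<Longrightarrow> coherent s \<Longrightarrow> coherent (\<lambda>k. r k - s k)"
  unfolding coherent_def by (intro allI ideal_cong_minus is_ideal_power) blast+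

lemma coherent_uminus: "coherent r \<Longrightarrow> coherent (\<lambda>k. - r k)"
  unfolding coherent_def by (intro allI ideal_cong_uminus is_ideal_power) blast+

lemma coherent_mult: "coherent r \<Longrightarrow> coherent s \<Longrightarrow> coherent (\<lambda>k. r k * s k)"
  unfolding coherent_def by (intro allI ideal_cong_mult is_ideal_power) blast+

lemma Mloc_gamma_power: "a - b \<in> ideal_power Mloc_I k \<Longrightarrow> Mloc_gamma a - Mloc_gamma b \<in> ideal_power Mloc_I k"
  unfolding ring_hom_minus[OF Mloc_gamma_hom, symmetric]
  by (rule ring_hom_ideal_power[OF Mloc_gamma_hom Mloc_gamma_I])

lemma coherent_gamma: "coherent r \<Longrightarrow> coherent (\<lambda>k. Mloc_gamma (r k))"
  unfolding coherent_def by (intro allI Mloc_gamma_power) blast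

quotient_type (overloaded) 'w Mhat = "nat \<Rightarrow> 'w::comm_ring_1 Mloc" / partial: seq_rel
proof (rule part_equivpI)
  show "\<exists>r::nat \<Rightarrow> 'w Mloc. seq_rel r r"
    by (rule exI, rule seq_rel_refl, rule coherent_const)
  show "symp (seq_rel :: (nat \<Rightarrow> 'w Mloc) \<Rightarrow> _)"
    by (intro sympI seq_relI; (erule seq_relD)?) (rule ideal_sym[OF is_ideal_power], erule seq_relD)
  show "transp (seq_rel :: (nat \<Rightarrow> 'w Mloc) \<Rightarrow> _)"
    by (intro transpI seq_relI; (erule seq_relD)?)
       (rule ideal_trans[OF is_ideal_power], erule seq_relD, erule seq_relD)
qed

instantiation Mhat :: (comm_ring_1) "{comm_ring,comm_monoid_mult}"
begin

lift_definition zero_Mhat :: "'a Mhat" is "\<lambda>_. 0 :: 'a Mloc"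
  by (rule seq_rel_refl[OF coherent_const])
lift_definition one_Mhat :: "'a Mhat" is "\<lambda>_. 1 :: 'a Mloc"
  by (rule seq_rel_refl[OF coherent_const])
lift_definition plus_Mhat :: "'a Mhat \<Rightarrow> 'a Mhat \<Rightarrow> 'a Mhat" is "\<lambda>r s k. r k + s k :: 'a Mloc"
  by (intro seq_relI coherent_add ideal_cong_add is_ideal_power) (erule seq_relD)+
lift_definition uminus_Mhat :: "'a Mhat \<Rightarrow> 'a Mhat" is "\<lambda>r k. - r k :: 'a Mloc"
  by (intro seq_relI coherent_uminus ideal_cong_uminus is_ideal_power) (erule seq_relD)+
lift_definition minus_Mhat :: "'a Mhat \<Rightarrow> 'a Mhat \<Rightarrow> 'a Mhat" is "\<lambda>r s k. r k - s k :: 'a Mloc"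
  by (intro seq_relI coherent_minus ideal_cong_minus is_ideal_power) (erule seq_relD)+
lift_definition times_Mhat :: "'a Mhat \<Rightarrow> 'a Mhat \<Rightarrow> 'a Mhat" is "\<lambda>r s k. r k * s k :: 'a Mloc"
  by (intro seq_relI coherent_mult ideal_cong_mult is_ideal_power) (erule seq_relD)+

lemma Mhat_cases: "\<exists>r. coherent r \<and> (x :: 'a Mhat) = abs_Mhat r"
  by (induction x rule: Mhat.abs_induct) (auto simp: seq_rel_def)

lemma Mhat_ops:
  assumes "coherent r" "coherent (s :: nat \<Rightarrow> 'a Mloc)"
  shows "abs_Mhat r + abs_Mhat s = abs_Mhat (\<lambda>k. r k + s k)"
    and "abs_Mhat r - abs_Mhat s = abs_Mhat (\<lambda>k. r k - s k)"
    and "abs_Mhat r * abs_Mhat s = abs_Mhat (\<lambda>k. r k * s k)"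
  using assms by (simp_all add: plus_Mhat.abs_eq minus_Mhat.abs_eq times_Mhat.abs_eq seq_rel_refl)

lemma Mhat_uminus: "coherent (r :: nat \<Rightarrow> 'a Mloc) \<Longrightarrow> - abs_Mhat r = abs_Mhat (\<lambda>k. - r k)"
  by (simp add: uminus_Mhat.abs_eq seq_rel_refl)

instance
proof
  fix a b c :: "'a Mhat"
  obtain r s t where r: "coherent r" "a = abs_Mhat r" and s: "coherent s" "b = abs_Mhat s"
    and t: "coherent t" "c = abs_Mhat t"
    by (metis Mhat_cases)
  note simps = r s t Mhat_ops Mhat_uminus coherent_const coherent_add coherent_minus coherent_uminus
    coherent_mult zero_Mhat_def one_Mhat_def
  show "a - b = a + - b" by (simp add: simps)
  show "a + b + c = a + (b + c)" by (simp add: simps add.assoc)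
  show "a + b = b + a" by (simp add: simps add.commute)
  show "0 + a = a" by (simp add: simps)
  show "- a + a = 0" by (simp add: simps)
  show "a * b * c = a * (b * c)" by (simp add: simps mult.assoc)
  show "a * b = b * a" by (simp add: simps mult.commute)
  show "(a + b) * c = a * c + b * c" by (simp add: simps distrib_right)
  show "1 * a = a" by (simp add: simps)
qed

end

lift_definition Mhat_gamma :: "'w::comm_ring_1 Mhat \<Rightarrow> 'w Mhat" is "\<lambda>r k. Mloc_gamma (r k)"
  by (intro seq_relI coherent_gamma Mloc_gamma_power) (erule seq_relD)+

definition Mhat_of_Mloc :: "'w::comm_ring_1 Mloc \<Rightarrow> 'w Mhat" where
  "Mhat_of_Mloc a = abs_Mhat (\<lambda>k. a)"

definition Mhat_of :: "'w::comm_ring_1 poly9 \<Rightarrow> 'w Mhat" where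
  "Mhat_of p = Mhat_of_Mloc (Mloc_of p)"

definition Mhat_part :: "int \<Rightarrow> 'w::comm_ring_1 Mhat set" where
  "Mhat_part t = {abs_Mhat r | r. coherent r \<and> (\<forall>k. r k \<in> Mloc_part t)}"


section \<open>Group cohomology\<close>

text \<open>Inhomogeneous cochains of a group \<open>G\<close> acting through \<open>\<rho>\<close> on an additive subgroup \<open>A\<close> of the
  type \<open>'m\<close>: functions on \<open>n\<close>-tuples of elements of \<open>G\<close>, extended by 0 to all other lists.\<close>

definition add_grp :: "'m::ab_group_add set \<Rightarrow> 'm monoid" where
  "add_grp A = \<lparr>carrier = A, mult = (+), one = 0\<rparr>"

definition cochains :: "('g, 'x) monoid_scheme \<Rightarrow> nat \<Rightarrow> 'm::ab_group_add set \<Rightarrow> ('g list \<Rightarrow> 'm) set" where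
  "cochains G n A =
     {f. \<forall>gs. if length gs = n \<and> set gs \<subseteq> carrier G then f gs \<in> A else f gs = 0}"

text \<open>\<open>merge G i [g\<^sub>0, \<dots>, g\<^sub>n] = [g\<^sub>0, \<dots>, g\<^sub>i g\<^sub>i\<^sub>+\<^sub>1, \<dots>, g\<^sub>n]\<close>\<close>

definition merge :: "('g, 'x) monoid_scheme \<Rightarrow> nat \<Rightarrow> 'g list \<Rightarrow> 'g list" where
  "merge G i gs = take i gs @ (gs ! i \<otimes>\<^bsub>G\<^esub> gs ! Suc i) # drop (i + 2) gs"

definition coboundary_map ::
  "('g, 'x) monoid_scheme \<Rightarrow> ('g \<Rightarrow> 'm \<Rightarrow> 'm) \<Rightarrow> nat \<Rightarrow> ('g list \<Rightarrow> 'm::ab_group_add) \<Rightarrow> 'g list \<Rightarrow> 'm" where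
  "coboundary_map G \<rho> n f gs =
     (if length gs = Suc n \<and> set gs \<subseteq> carrier G
      then \<rho> (hd gs) (f (tl gs))
           + (\<Sum>i<n. if even i then - f (merge G i gs) else f (merge G i gs))
           + (if even n then - f (butlast gs) else f (butlast gs))
      else 0)"

definition cocycles where
  "cocycles G \<rho> n A = {f \<in> cochains G n A. coboundary_map G \<rho> n f = 0}"

primrec coboundaries where
  "coboundaries G \<rho> 0 A = {0}"
| "coboundaries G \<rho> (Suc n) A = coboundary_map G \<rho> n ` cochains G n A"

definition cohomology ::
  "('g, 'x) monoid_scheme \<Rightarrow> ('g \<Rightarrow> 'm \<Rightarrow> 'm) \<Rightarrow> nat \<Rightarrow> 'm::ab_group_add set \<Rightarrow> ('g list \<Rightarrow> 'm) set monoid" where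
  "cohomology G \<rho> n A = add_grp (cocycles G \<rho> n A) Mod coboundaries G \<rho> n A"

text \<open>Cup product of a \<open>p\<close>-cochain with a cochain, for coefficients in a ring.\<close>

definition cup ::
  "('g, 'x) monoid_scheme \<Rightarrow> ('g \<Rightarrow> 'r \<Rightarrow> 'r) \<Rightarrow> nat \<Rightarrow> ('g list \<Rightarrow> 'r::{comm_ring,comm_monoid_mult}) \<Rightarrow>
   ('g list \<Rightarrow> 'r) \<Rightarrow> 'g list \<Rightarrow> 'r" where
  "cup G \<rho> p f f' gs =
     f (take p gs) * \<rho> (foldr (mult G) (take p gs) \<one>\<^bsub>G\<^esub>) (f' (drop p gs))"

definition C9 :: "int monoid" where
  "C9 = integer_mod_group 9"

definition C3 :: "int monoid" where
  "C3 = C9\<lparr>carrier := {0, 3, 6}\<rparr>"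

definition cyc_act :: "('m \<Rightarrow> 'm) \<Rightarrow> int \<Rightarrow> 'm \<Rightarrow> 'm" where
  "cyc_act \<gamma> i = \<gamma> ^^ nat i"

definition res_C3 :: "(int list \<Rightarrow> 'm::ab_group_add) \<Rightarrow> int list \<Rightarrow> 'm" where
  "res_C3 f gs = (if set gs \<subseteq> carrier C3 then f gs else 0)"


section \<open>The homotopy of \<open>E\<^sub>6\<close> and the stabilizer action\<close>

text \<open>\<open>\<pi>\<^sub>0 E\<^sub>6 = \<bbbW>[[u\<^sub>1, \<dots>, u\<^sub>5]]\<close> is modelled by iterated power series, \<open>u\<^sub>1\<close> being the outermost
  variable, and \<open>\<pi>\<^sub>* E\<^sub>6 = \<pi>\<^sub>0 E\<^sub>6[u, u\<^sup>-\<^sup>1]\<close> with \<open>|u| = -2\<close> by Laurent polynomials.\<close>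

type_synonym 'a E0 = "'a fps fps fps fps fps"
type_synonym 'a E6 = "int \<Rightarrow>\<^sub>0 'a E0"

definition E0_const :: "'a::zero \<Rightarrow> 'a E0" where
  "E0_const a = fps_const (fps_const (fps_const (fps_const (fps_const a))))"

definition E6_part :: "int \<Rightarrow> 'a::zero E6 set" where
  "E6_part t = {p. \<forall>j \<in> Poly_Mapping.keys p. t = - 2 * j}"

text \<open>A series \<open>F\<close> in two variables \<open>x, y\<close> has type \<open>'a fps fps\<close>, with \<open>F $ m $ n\<close> the coefficient
  of \<open>x\<^sup>m y\<^sup>n\<close>. The truncated sums below are the full sums when the substituted series
  have no constant term.\<close>

definition subst1 :: "'a::comm_ring_1 fps \<Rightarrow> 'a fps fps \<Rightarrow> 'a fps fps" where
  "subst1 g A = Abs_fps (\<lambda>i. Abs_fps (\<lambda>j. \<Sum>m\<le>i + j. g $ m * (A ^ m) $ i $ j))"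

definition subst2 :: "'a::comm_ring_1 fps fps \<Rightarrow> 'a fps fps \<Rightarrow> 'a fps fps \<Rightarrow> 'a fps fps" where
  "subst2 F A B = Abs_fps (\<lambda>i. Abs_fps (\<lambda>j.
     \<Sum>m\<le>i + j. \<Sum>n\<le>i + j. F $ m $ n * (A ^ m * B ^ n) $ i $ j))"

abbreviation var_x :: "'a::comm_ring_1 fps fps" where "var_x \<equiv> fps_X"
abbreviation var_y :: "'a::comm_ring_1 fps fps" where "var_y \<equiv> fps_const fps_X"

definition map_fps2 :: "('a \<Rightarrow> 'b) \<Rightarrow> 'a fps fps \<Rightarrow> 'b fps fps" where
  "map_fps2 \<phi> F = Abs_fps (\<lambda>m. Abs_fps (\<lambda>n. \<phi> (F $ m $ n)))"

definition fgl_hom :: "'a::comm_ring_1 fps \<Rightarrow> 'a fps fps \<Rightarrow> 'a fps fps \<Rightarrow> bool" where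
  "fgl_hom h F F' \<longleftrightarrow> h $ 0 = 0 \<and> subst1 h F = subst2 F' (subst1 h var_x) (subst1 h var_y)"

text \<open>Hazewinkel's generators \<open>v\<^sub>k\<close> are specialized to \<open>u\<^sub>k\<close> for \<open>1 \<le> k \<le> 5\<close>, to 1 for \<open>k = 6\<close> and to 0
  for \<open>k > 6\<close>. The logarithm of the resulting 3-typical formal group law is \<open>\<Sum> l\<^sub>k x^(3^k)\<close> with
  \<open>3 l\<^sub>k = \<Sum>\<^bsub>i < k\<^esub> l\<^sub>i v\<^bsub>k - i\<^esub>^(3^i)\<close>.\<close>

definition haz_v :: "nat \<Rightarrow> rat E0" where
  "haz_v k =
     (if k = 1 then fps_X
      else if k = 2 then fps_const fps_X
      else if k = 3 then fps_const (fps_const fps_X)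
      else if k = 4 then fps_const (fps_const (fps_const fps_X))
      else if k = 5 then fps_const (fps_const (fps_const (fps_const fps_X)))
      else if k = 6 then 1 else 0)"

fun haz_log_coeff :: "nat \<Rightarrow> rat E0" where
  "haz_log_coeff 0 = 1"
| "haz_log_coeff (Suc k) =
     E0_const (1 / 3) * (\<Sum>i\<le>k. haz_log_coeff i * haz_v (Suc k - i) ^ (3 ^ i))"

definition haz_log :: "rat E0 fps" where
  "haz_log = Abs_fps (\<lambda>m. \<Sum>k\<le>m. if m = 3 ^ k then haz_log_coeff k else 0)"

text \<open>The formal group law with logarithm \<open>haz_log\<close> has coefficients in \<open>\<int>\<^bsub>(3)\<^esub>[u\<^sub>1, \<dots>, u\<^sub>5]\<close>; its
  image over \<open>\<bbbW>[[u\<^sub>1, \<dots>, u\<^sub>5]]\<close> is the universal deformation of its reduction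
  modulo \<open>(3, u\<^sub>1, \<dots>, u\<^sub>5)\<close>, the Honda formal group law of height 6.\<close>

definition lubin_tate_fgl :: "'w::comm_ring_1 E0 fps fps \<Rightarrow> bool" where
  "lubin_tate_fgl F \<longleftrightarrow>
     (\<exists>Q :: rat E0 fps fps.
        Q $ 0 $ 0 = 0 \<and> subst1 haz_log Q = subst1 haz_log var_x + subst1 haz_log var_y \<and>
        (\<forall>m n a b c d e. \<exists>p q :: int. \<not> 3 dvd q \<and>
           Q $ m $ n $ a $ b $ c $ d $ e = of_int p / of_int q \<and>
           of_int q * (F $ m $ n $ a $ b $ c $ d $ e) = of_int p))"

definition E0_res :: "('w \<Rightarrow> 'k) \<Rightarrow> 'w E0 \<Rightarrow> 'k" where
  "E0_res res f = res (f $ 0 $ 0 $ 0 $ 0 $ 0)"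

text \<open>\<open>g\<close> is an automorphism of order 9 of the formal group law \<open>H\<close>.\<close>

definition fgl_aut_order9 :: "'k::field fps fps \<Rightarrow> 'k fps \<Rightarrow> bool" where
  "fgl_aut_order9 H g \<longleftrightarrow> fgl_hom g H H \<and> g $ 1 \<noteq> 0 \<and>
     ((\<lambda>h. g oo h) ^^ 9) fps_X = fps_X \<and> ((\<lambda>h. g oo h) ^^ 3) fps_X \<noteq> fps_X"

text \<open>The action on \<open>\<pi>\<^sub>* E\<^sub>6\<close> of an element \<open>g\<close> of the Morava stabilizer group: by universality of the
  deformation \<open>F\<close> there are a unique local \<open>\<bbbW>\<close>-algebra endomorphism \<open>\<phi>\<close> of \<open>\<pi>\<^sub>0 E\<^sub>6\<close> and a unique
  isomorphism \<open>h\<close> from \<open>\<phi>F\<close> to \<open>F\<close> that lifts \<open>g\<close>; the action is \<open>\<phi>\<close> on \<open>\<pi>\<^sub>0\<close> and sends \<open>u\<close>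
  to \<open>h'(0) u\<close>.\<close>

definition stabilizer_action ::
  "('w::comm_ring_1 \<Rightarrow> 'k::field) \<Rightarrow> 'w E0 fps fps \<Rightarrow> 'k fps \<Rightarrow> ('w E6 \<Rightarrow> 'w E6) \<Rightarrow> bool" where
  "stabilizer_action res F g \<Gamma> \<longleftrightarrow>
     is_ring_hom \<Gamma> \<and>
     (\<exists>\<phi> h. is_ring_hom \<phi> \<and> (\<forall>w. \<phi> (E0_const w) = E0_const w) \<and>
        (\<forall>a. E0_res res (\<phi> a) = E0_res res a) \<and>
        fgl_hom h (map_fps2 \<phi> F) F \<and> (\<forall>n. E0_res res (h $ n) = g $ n) \<and>
        (\<forall>a. \<Gamma> (Poly_Mapping.single 0 a) = Poly_Mapping.single 0 (\<phi> a)) \<and>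
        \<Gamma> (Poly_Mapping.single 1 1) = Poly_Mapping.single 1 (h $ 1))"

text \<open>\<open>\<Gamma>\<close> is the action on \<open>\<pi>\<^sub>* E\<^sub>6\<close> of a generator of a cyclic subgroup of order 9 of the Morava
  stabilizer group.\<close>

definition E6_C9_action :: "('w::comm_ring_1 \<Rightarrow> 'k::field) \<Rightarrow> ('w E6 \<Rightarrow> 'w E6) \<Rightarrow> bool" where
  "E6_C9_action res \<Gamma> \<longleftrightarrow>
     (\<exists>F g. lubin_tate_fgl F \<and> fgl_aut_order9 (map_fps2 (E0_res res) F) g \<and>
        stabilizer_action res F g \<Gamma>)"

definition E2_page :: "('w::comm_ring_1 E6 \<Rightarrow> 'w E6) \<Rightarrow> nat \<Rightarrow> int \<Rightarrow> (int list \<Rightarrow> 'w E6) set monoid" where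
  "E2_page \<Gamma> n t = cohomology C9 (cyc_act \<Gamma>) n (E6_part t)"

text \<open>As \<open>\<pi>\<^sub>* E\<^sub>6\<close> is the direct sum of its homogeneous parts, an additive map \<open>\<theta>\<close> that is bijective
  between the parts of each degree is an isomorphism onto the direct sum of the \<open>Mhat_part t\<close>.\<close>

definition graded_WC9_iso :: "('w::comm_ring_1 E6 \<Rightarrow> 'w E6) \<Rightarrow> ('w E6 \<Rightarrow> 'w Mhat) \<Rightarrow> bool" where
  "graded_WC9_iso \<Gamma> \<theta> \<longleftrightarrow>
     (\<forall>p q. \<theta> (p + q) = \<theta> p + \<theta> q) \<and>
     (\<forall>w p. \<theta> (Poly_Mapping.single 0 (E0_const w) * p) = Mhat_of (pconst w) * \<theta> p) \<and>
     (\<forall>p. \<theta> (\<Gamma> p) = Mhat_gamma (\<theta> p)) \<and>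
     (\<forall>t. bij_betw \<theta> (E6_part t) (Mhat_part t))"


section \<open>The ring \<open>S\<close> and the presented module\<close>

definition ideal9 :: "'w::comm_ring_1 set" where
  "ideal9 = {a. 9 dvd a}"

lemma is_ideal_9: "is_ideal ideal9"
  unfolding is_ideal_def ideal9_def by simp

quotient_type (overloaded) 'w mod9 = "'w::comm_ring_1" / "\<lambda>a b. a - b \<in> ideal9"
  by (rule equivpI)
     (blast intro: reflpI sympI transpI ideal_refl ideal_sym ideal_trans is_ideal_9)+

instantiation mod9 :: (comm_ring_1) "{comm_ring,comm_monoid_mult}"
begin

lift_definition zero_mod9 :: "'a mod9" is 0 .
lift_definition one_mod9 :: "'a mod9" is 1 .
lift_definition plus_mod9 :: "'a mod9 \<Rightarrow> 'a mod9 \<Rightarrow> 'a mod9" is plus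
  by (rule ideal_cong_add[OF is_ideal_9])
lift_definition uminus_mod9 :: "'a mod9 \<Rightarrow> 'a mod9" is uminus
  by (rule ideal_cong_uminus[OF is_ideal_9])
lift_definition minus_mod9 :: "'a mod9 \<Rightarrow> 'a mod9 \<Rightarrow> 'a mod9" is minus
  by (rule ideal_cong_minus[OF is_ideal_9])
lift_definition times_mod9 :: "'a mod9 \<Rightarrow> 'a mod9 \<Rightarrow> 'a mod9" is times
  by (rule ideal_cong_mult[OF is_ideal_9])

instance
  by intro_classes (transfer; simp add: algebra_simps ideal_refl[OF is_ideal_9, of 0, simplified])+

end

text \<open>The coefficient \<open>a $ i $ j\<close> of \<open>s\<^sub>1\<^sup>i s\<^sub>2\<^sup>j\<close> is a Laurent polynomial in \<open>b\<^sub>1\<close> and \<open>s\<^sub>3\<close>, the key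
  \<open>(m, k)\<close> standing for \<open>b\<^sub>1\<^sup>m s\<^sub>3\<^sup>k\<close>. The power series ring in the graded sense is the direct sum over
  \<open>(n, t)\<close> of the subgroups \<open>S_part n t\<close>.\<close>

type_synonym 'w S = "((int \<times> int) \<Rightarrow>\<^sub>0 'w mod9) fps fps"

definition S_part :: "int \<Rightarrow> int \<Rightarrow> 'w::comm_ring_1 S set" where
  "S_part n t = {a. \<forall>i j. \<forall>(m, k) \<in> Poly_Mapping.keys (a $ i $ j).
     n = 2 * m \<and> t = - 6 * int i - 12 * int j - 18 * k}"

text \<open>\<open>w b\<^sub>1\<^sup>m s\<^sub>1\<^sup>i s\<^sub>2\<^sup>j s\<^sub>3\<^sup>k\<close>\<close>

definition S_monom :: "'w::comm_ring_1 \<Rightarrow> int \<Rightarrow> nat \<Rightarrow> nat \<Rightarrow> int \<Rightarrow> 'w S" where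
  "S_monom w m i j k = Abs_fps (\<lambda>i'. Abs_fps (\<lambda>j'.
     if i' = i \<and> j' = j then Poly_Mapping.single (m, k) (abs_mod9 w) else 0))"

text \<open>\<open>Gen_c\<close>, \<open>Gen_delta\<close> and \<open>Gen_c_delta\<close> are the generators \<open>c\<close> (with a bar), \<open>\<delta>\<close> and their
  product.\<close>

datatype gen = Gen_1 | Gen_c | Gen_delta | Gen_c_delta
  | Gen_f0 | Gen_f1 | Gen_f2 | Gen_f3 | Gen_f4 | Gen_f5 | Gen_F0 | Gen_F1 | Gen_F2 | Gen_F3 | Gen_F4 | Gen_F5

fun gen_deg :: "gen \<Rightarrow> nat \<times> int" where
  "gen_deg Gen_1 = (0, 0)"
| "gen_deg Gen_c = (3, - 6)"
| "gen_deg Gen_delta = (0, - 18)"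
| "gen_deg Gen_c_delta = (3, - 24)"
| "gen_deg Gen_f0 = (1, - 2)"
| "gen_deg Gen_f1 = (1, - 8)"
| "gen_deg Gen_f2 = (1, - 8)"
| "gen_deg Gen_f3 = (1, - 14)"
| "gen_deg Gen_f4 = (1, - 14)"
| "gen_deg Gen_f5 = (1, - 20)"
| "gen_deg Gen_F0 = (2, - 4)"
| "gen_deg Gen_F1 = (2, - 10)"
| "gen_deg Gen_F2 = (2, - 10)"
| "gen_deg Gen_F3 = (2, - 16)"
| "gen_deg Gen_F4 = (2, - 16)"
| "gen_deg Gen_F5 = (2, - 22)"

definition free_part :: "nat \<Rightarrow> int \<Rightarrow> (gen \<Rightarrow> 'w::comm_ring_1 S) set" where
  "free_part n t = {v. \<forall>x. v x \<in> S_part (int n - int (fst (gen_deg x))) (t - snd (gen_deg x))}"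

text \<open>The submodule generated by \<open>3s\<^sub>1 x\<close> and \<open>3s\<^sub>2 x\<close> for all generators \<open>x\<close>, and by \<open>3x\<close> for all
  generators \<open>x\<close> other than \<open>Gen_1\<close> and \<open>Gen_c\<close>. In \<open>pres_rel\<close> the cofactors \<open>p\<close>, \<open>q\<close>, \<open>r\<close> can be
  taken homogeneous, so that it is the homogeneous part of the submodule generated in the graded
  sense.\<close>

definition relations :: "(gen \<Rightarrow> 'w::comm_ring_1 S) set" where
  "relations = {v. \<exists>p q r. \<forall>x.
     v x = p x * S_monom 3 0 1 0 0 + q x * S_monom 3 0 0 1 0
           + (if x \<in> {Gen_1, Gen_c} then 0 else r x * S_monom 3 0 0 0 0)}"

definition pres_rel :: "nat \<Rightarrow> int \<Rightarrow> (gen \<Rightarrow> 'w::comm_ring_1 S) set" where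
  "pres_rel n t = relations \<inter> free_part n t"

text \<open>The part of degree \<open>(n, t)\<close> of the presented module, and the class in it of an element of the
  free module.\<close>

definition pres_module :: "nat \<Rightarrow> int \<Rightarrow> (gen \<Rightarrow> 'w::comm_ring_1 S) set monoid" where
  "pres_module n t = add_grp (free_part n t) Mod pres_rel n t"

definition pres_class :: "nat \<Rightarrow> int \<Rightarrow> (gen \<Rightarrow> 'w::comm_ring_1 S) \<Rightarrow> (gen \<Rightarrow> 'w S) set" where
  "pres_class n t v = pres_rel n t #>\<^bsub>add_grp (free_part n t)\<^esub> v"

definition gen_mult :: "'w::comm_ring_1 S \<Rightarrow> gen \<Rightarrow> gen \<Rightarrow> 'w S" where
  "gen_mult a x = (\<lambda>y. if y = x then a else 0)"


section \<open>The action of \<open>S\<close> on the \<open>E\<^sub>2\<close>-page\<close>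

text \<open>The periodicity class: the 2-cocycle of the extension of \<open>C\<^sub>9\<close> by \<open>\<int>\<close> with total group \<open>\<int>\<close>, with
  coefficients mapped to the completed ring.\<close>

definition b1_cocycle :: "int list \<Rightarrow> 'w::comm_ring_1 Mhat" where
  "b1_cocycle gs =
     (if length gs = 2 \<and> set gs \<subseteq> carrier C9 \<and> gs ! 0 + gs ! 1 \<ge> 9 then 1 else 0)"

primrec b1_power :: "nat \<Rightarrow> int list \<Rightarrow> 'w::comm_ring_1 Mhat" where
  "b1_power 0 = (\<lambda>gs. if gs = [] then 1 else 0)"
| "b1_power (Suc k) = cup C9 (cyc_act Mhat_gamma) 2 b1_cocycle (b1_power k)"

definition d_poly :: "9 \<Rightarrow> 'w::comm_ring_1 poly9" where
  "d_poly i = pvar i * pvar (i + 3) * pvar (i + 6)"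

definition s1_poly :: "'w::comm_ring_1 poly9" where
  "s1_poly = d_poly 0 + d_poly 1 + d_poly 2"

definition s2_poly :: "'w::comm_ring_1 poly9" where
  "s2_poly = d_poly 0 * d_poly 1 + d_poly 1 * d_poly 2 + d_poly 2 * d_poly 0"

text \<open>\<open>s\<^sub>3 = d\<^sub>1 d\<^sub>2 d\<^sub>3 = \<Delta>\<close>\<close>

definition s3_power :: "int \<Rightarrow> 'w::comm_ring_1 Mloc" where
  "s3_power k = M_frac (M_Delta ^ nat k) (nat (- k))"

text \<open>The element of the completed ring obtained from a homogeneous element \<open>a\<close> of \<open>S\<close> by lifting its
  coefficients from \<open>\<bbbW>/9\<close> to \<open>\<bbbW>\<close> and setting \<open>b\<^sub>1 = 1\<close>. The sums converge since \<open>s\<^sub>1\<close> and \<open>s\<^sub>2\<close> lie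
  in \<open>I\<close>. The choice of lifts does not matter for the action on cohomology in positive degrees,
  which is annihilated by 9.\<close>

definition S_value :: "'w::comm_ring_1 S \<Rightarrow> 'w Mhat" where
  "S_value a = abs_Mhat (\<lambda>K. \<Sum>i<K. \<Sum>j<K. \<Sum>(m, k) \<in> Poly_Mapping.keys (a $ i $ j).
     Mloc_of (pconst (rep_mod9 (Poly_Mapping.lookup (a $ i $ j) (m, k))) * s1_poly ^ i * s2_poly ^ j)
     * s3_power k)"

text \<open>\<open>E2_smult \<theta> m s a n t f f'\<close> says that the cocycle \<open>f'\<close> represents the product of
  \<open>a \<in> S_part (2 * m) s\<close> with the class of degree \<open>(n, t)\<close> of the cocycle \<open>f\<close>, where \<open>n > 0\<close> and
  \<open>n + 2 m > 0\<close>. Multiplication by \<open>b\<^sub>1\<close> being bijective in positive degrees, a negative power of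
  \<open>b\<^sub>1\<close> in \<open>a\<close> is moved to the other side. The isomorphism \<open>\<theta>\<close> transports the ring structure of
  the completed ring.\<close>

definition E2_smult ::
  "('w::comm_ring_1 E6 \<Rightarrow> 'w Mhat) \<Rightarrow> int \<Rightarrow> int \<Rightarrow> 'w S \<Rightarrow> nat \<Rightarrow> int \<Rightarrow>
   (int list \<Rightarrow> 'w E6) \<Rightarrow> (int list \<Rightarrow> 'w E6) \<Rightarrow> bool" where
  "E2_smult \<theta> m s a n t f f' \<longleftrightarrow>
     cup C9 (cyc_act Mhat_gamma) (2 * nat (- m)) (b1_power (nat (- m))) (\<lambda>gs. \<theta> (f' gs))
     - cup C9 (cyc_act Mhat_gamma) (2 * nat m) (b1_power (nat m)) (\<lambda>gs. S_value a * \<theta> (f gs))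
     \<in> coboundaries C9 (cyc_act Mhat_gamma) (n + 2 * nat m) (Mhat_part (t + s))"


section \<open>The classes detecting the generators\<close>

definition rho_bar :: "'w::comm_ring_1 Mhat set" where
  "rho_bar = range (\<lambda>(a, b, c). Mhat_of (pconst a * pvar 0 + pconst b * pvar 3 + pconst c * pvar 6))"

text \<open>\<open>c\<close> is a cocycle whose class generates the \<open>\<bbbW>\<close>-module \<open>H\<^sup>1(C\<^sub>3; rho_bar)\<close>.\<close>

definition generates_H1 :: "(int list \<Rightarrow> 'w::comm_ring_1 Mhat) \<Rightarrow> bool" where
  "generates_H1 c \<longleftrightarrow>
     c \<in> cocycles C3 (cyc_act Mhat_gamma) 1 rho_bar \<and>
     (\<forall>f \<in> cocycles C3 (cyc_act Mhat_gamma) 1 rho_bar.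
        \<exists>w. f - (\<lambda>gs. Mhat_of (pconst w) * c gs) \<in> coboundaries C3 (cyc_act Mhat_gamma) 1 rho_bar)"

text \<open>On cochains of \<open>C\<^sub>3\<close>, \<open>\<gamma>\<close> acts through the coefficients only, since \<open>C\<^sub>9\<close> is abelian.\<close>

definition tr3 :: "(int list \<Rightarrow> 'w::comm_ring_1 Mhat) \<Rightarrow> int list \<Rightarrow> 'w Mhat" where
  "tr3 c = (\<lambda>gs. c gs + Mhat_gamma (c gs) + Mhat_gamma (Mhat_gamma (c gs)))"

definition poly_mult :: "'w::comm_ring_1 poly9 \<Rightarrow> (int list \<Rightarrow> 'w Mhat) \<Rightarrow> int list \<Rightarrow> 'w Mhat" where
  "poly_mult p c = (\<lambda>gs. Mhat_of p * c gs)"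

definition delta_poly :: "'w::comm_ring_1 poly9" where
  "delta_poly = (d_poly 0 - d_poly 1) * (d_poly 1 - d_poly 2) * (d_poly 2 - d_poly 0)"

text \<open>For a cocycle \<open>c1\<close> as above, the cocycle on \<open>C\<^sub>3\<close> representing the element of
  \<open>H\<^sup>*(C\<^sub>3; M)\<close> that detects a generator.\<close>

definition detecting :: "(int list \<Rightarrow> 'w::comm_ring_1 Mhat) \<Rightarrow> gen \<Rightarrow> int list \<Rightarrow> 'w Mhat" where
  "detecting c1 x =
     (let one = b1_power 0;
          c2 = Mhat_gamma \<circ> c1;
          c3 = Mhat_gamma \<circ> c2;
          c12 = cup C3 (cyc_act Mhat_gamma) 1 c1 c2;
          c123 = cup C3 (cyc_act Mhat_gamma) 1 c1 (cup C3 (cyc_act Mhat_gamma) 1 c2 c3);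
          d1 = d_poly 0; d2 = d_poly 1; d3 = d_poly 2
      in case x of
           Gen_1 \<Rightarrow> one
         | Gen_c \<Rightarrow> c123
         | Gen_delta \<Rightarrow> poly_mult delta_poly one
         | Gen_c_delta \<Rightarrow> poly_mult delta_poly c123
         | Gen_f0 \<Rightarrow> tr3 c1
         | Gen_f1 \<Rightarrow> tr3 (poly_mult d1 c1)
         | Gen_f2 \<Rightarrow> tr3 (poly_mult d2 c1)
         | Gen_f3 \<Rightarrow> tr3 (poly_mult (d1 * d2) c1)
         | Gen_f4 \<Rightarrow> tr3 (poly_mult (d2 * d3) c1)
         | Gen_f5 \<Rightarrow> tr3 (poly_mult (d1\<^sup>2 * d2) c1)
         | Gen_F0 \<Rightarrow> tr3 c12
         | Gen_F1 \<Rightarrow> tr3 (poly_mult d1 c12)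
         | Gen_F2 \<Rightarrow> tr3 (poly_mult d2 c12)
         | Gen_F3 \<Rightarrow> tr3 (poly_mult (d1 * d2) c12)
         | Gen_F4 \<Rightarrow> tr3 (poly_mult (d2 * d3) c12)
         | Gen_F5 \<Rightarrow> tr3 (poly_mult (d1\<^sup>2 * d2) c12))"

text \<open>\<open>f\<close> represents a class that can be called \<open>b\<^sub>1\<^sup>k x\<close>: its restriction to \<open>C\<^sub>3\<close>,
  that is, its image under the edge homomorphism of the Serre spectral sequence, is \<open>b\<^sub>1\<^sup>k\<close> times the
  element detecting \<open>x\<close>. Powers of \<open>b\<^sub>1\<close> are needed because \<open>1\<close> and \<open>\<delta>\<close> themselves have degree
  \<open>n = 0\<close>. For \<open>x = 1\<close> the class itself has to be \<open>b\<^sub>1\<^sup>k\<close>.\<close>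

definition E2_detected ::
  "('w::comm_ring_1 E6 \<Rightarrow> 'w Mhat) \<Rightarrow> (int list \<Rightarrow> 'w Mhat) \<Rightarrow> nat \<Rightarrow> gen \<Rightarrow> (int list \<Rightarrow> 'w E6) \<Rightarrow> bool" where
  "E2_detected \<theta> c1 k x f \<longleftrightarrow>
     res_C3 (\<lambda>gs. \<theta> (f gs))
     - cup C3 (cyc_act Mhat_gamma) (2 * k) (res_C3 (b1_power k)) (detecting c1 x)
     \<in> coboundaries C3 (cyc_act Mhat_gamma) (fst (gen_deg x) + 2 * k) (Mhat_part (snd (gen_deg x))) \<and>
     (x = Gen_1 \<longrightarrow>
        (\<lambda>gs. \<theta> (f gs)) - b1_power k \<in> coboundaries C9 (cyc_act Mhat_gamma) (2 * k) (Mhat_part 0))"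

end

theory Submission
  imports Defs
begin

text \<open>Up to powers of \<open>s\<^sub>3\<close>, which the grading determines, the completed ring is the free module over
\<open>W[[s\<^sub>1, s\<^sub>2]]\<close> on the products of one letter for each of the three blocks of variables and one of
\<open>1, d\<^sub>1, d\<^sub>2, d\<^sub>1d\<^sub>2, d\<^sub>2d\<^sub>3, d\<^sub>1\<^sup>2d\<^sub>2\<close>. A letter is \<open>1\<close>, one of the two basis vectors \<open>x\<close>, \<open>y\<close> of the
reduced regular representation of \<open>C\<^sub>3\<close>, or an element of a free orbit, and \<open>\<gamma>\<close> moves the blocks
cyclically. In these coordinates the quotients of the kernels by the images of the norm and of \<open>\<gamma> - 1\<close>
can be computed: free orbits do not contribute, and the other letters leave the generators and relations.
Dimension shifting in the bar complex gives a map \<open>\<kappa>\<close> that undoes the cup product with \<open>b\<^sub>1\<close>, so that every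
class of positive degree comes from an element of one of these quotients. Restricted to \<open>C\<^sub>3\<close>, a class is
determined by its image under \<open>\<kappa>\<close>, which identifies the generators.\<close>

text \<open>The obstacle is that the construction of the completed ring exhibits no basis. For
  polynomials the labels are matched with the monomials of the same degree, so the claimed basis
  elements only have to span: over the finite residue field a surjective endomorphism of a graded
  piece is injective, and 3-adic separatedness lifts this to W. The basis survives completion
  because on homogeneous elements the I-adic topology is that of 3, s1, s2 and the second elementary
  symmetric polynomials e2 of the blocks: modulo these x^3 = d and d^3 = s3, so every x_i^9 is
  congruent to the unit s3. Scalars lifted from W/9 to W respect sums and products only modulo 9, so
  classes are handled by congruences. The class c1 is an arbitrary generator; if its value at 3 is
  al x_0 + be x_3, it is al + be times the class through x_0. This is a unit modulo 3, and the
  isomorphism is rescaled on each generator by the unit that results. The dimension shift is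
  normalised so that \<open>kap\<close> undoes \<open>carry\<close> on cochains and not just on
  classes; detection thus comes down to single values.\<close>

lemmas alg = algebra_simps

abbreviation "lookup == Poly_Mapping.lookup"
abbreviation "single == Poly_Mapping.single"
abbreviation "keys == Poly_Mapping.keys"
abbreviation "gamP == poly9_gamma"
abbreviation "gamH == Mhat_gamma"

abbreviation iffb :: "bool => bool => bool" (infixr "<->" 25)
 where "A <-> B == A = B"

subsection \<open>The free module with its action\<close>

datatype z3 = Z0 | Z1 | Z2

fun prev3 :: "z3 => z3" where
 "prev3 Z0 = Z2" | "prev3 Z1 = Z0" | "prev3 Z2 = Z1"

datatype letter = One | LX | LY | Fr nat bool z3

datatype dbasis = B1 | Bd1 | Bd2 | Bd12 | Bd23 | Bu

type_synonym 'w L = "'w fps fps"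
type_synonym 'w DV = "dbasis => 'w L"
type_synonym 'w V = "letter => letter => letter => 'w DV"

abbreviation s1L :: "'w::comm_ring_1 L" where "s1L == fps_X"
abbreviation s2L :: "'w::comm_ring_1 L" where "s2L == fps_const fps_X"

text \<open>The rows collect d1 -> d2 -> d3 = s1 - d1 - d2, d1 d2 -> d2 d3 -> d3 d1 = s2 - d1 d2 -
  d2 d3 and d1^2 d2 -> d2^2 d3 = d1^2 d2 + s2 d2 - s1 d1 d2.\<close>

fun gD :: "'w::comm_ring_1 DV => 'w DV" where
 "gD c B1 = c B1 + s1L * c Bd2 + s2L * c Bd23"
| "gD c Bd1 = - c Bd2"
| "gD c Bd2 = c Bd1 - c Bd2 + s2L * c Bu"
| "gD c Bd12 = - c Bd23 - s1L * c Bu"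
| "gD c Bd23 = c Bd12 - c Bd23"
| "gD c Bu = c Bu"

definition sc :: "'w::comm_ring_1 L => 'w DV => 'w DV" where
 "sc p c = (%e. p * c e)"

definition dsg :: "dbasis => 'w::comm_ring_1 L => 'w DV" where
 "dsg e p = (%e'. if e' = e then p else 0)"

text \<open>The coordinates of (d1 - d2)(d2 - d3)(d3 - d1) = s1 s2 - 3 s3 - 2 T, where T is the
  trace of d1^2 d2, with s3 set to 1. This is the origin of the summand -3 and of the -6.\<close>

fun deltaD :: "'w::comm_ring_1 DV" where
 "deltaD B1 = - s1L * s2L - 3"
| "deltaD Bd1 = 2 * s2L"
| "deltaD Bd2 = - 2 * s2L"
| "deltaD Bd12 = 4 * s1L"
| "deltaD Bd23 = 2 * s1L"
| "deltaD Bu = - 6"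

definition invD :: "'w::comm_ring_1 L => 'w L => 'w DV" where
 "invD p q = dsg B1 p + sc q deltaD"

definition trD :: "'w::comm_ring_1 DV => 'w DV" where
 "trD c = c + gD c + gD (gD c)"

lemma dbasis_all: "(ALL e. P e) <-> P B1 & P Bd1 & P Bd2 & P Bd12 & P Bd23 & P Bu"
 by (metis dbasis.exhaust)

lemma DV_eq_iff: "c = c' <-> c B1 = c' B1 & c Bd1 = c' Bd1 & c Bd2 = c' Bd2 &
  c Bd12 = c' Bd12 & c Bd23 = c' Bd23 & c Bu = c' Bu"
 unfolding fun_eq_iff dbasis_all ..

lemma gD_add: "gD (c + c') = gD c + gD c'"
 and gD_diff: "gD (c - c') = gD c - gD c'"
 and gD_minus: "gD (- c) = - gD c"
 and gD_0: "gD 0 = 0"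
 and gD_sc: "gD (sc p c) = sc p (gD c)"
 by (simp_all add: DV_eq_iff sc_def alg)

lemma gD_3: "gD (gD (gD c)) = c"
 by (simp add: DV_eq_iff alg)

lemma gD_invD: "gD (invD p q) = invD p q"
 by (simp add: DV_eq_iff invD_def dsg_def sc_def alg)

lemma s2L_nth: "(s2L * p) $ i $ j = (if j = 0 then 0 else p $ i $ (j - 1))"
 and s1L_nth: "(s1L * p) $ i $ j = (if i = 0 then 0 else p $ (i - 1) $ j)"
 by simp_all

lemma three_nth: "(3 * p) $ i $ j = 3 * (p $ i $ j :: 'w::comm_ring_1)"
proof -
 have "3 * p = (1 + 1 + 1) * p" "3 * (p $ i $ j) = (1 + 1 + 1) * (p $ i $ j)" by simp_all
 thus ?thesis by (simp only: distrib_right mult_1_left fps_add_nth)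
qed

section \<open>Invariants and traces for the cyclic permutation of d1, d2, d3\<close>

context
 fixes w_type :: "'w::comm_ring_1 itself"
 assumes tf: "!!a::'w. 3 * a = 0 ==> a = 0"
begin

lemma tfL: "3 * (p::'w L) = 0 ==> p = 0"
proof -
 assume a: "3 * p = 0"
 have "p $ i $ j = 0" for i j
  using arg_cong[OF a, of "%p. p $ i $ j"] tf by (simp add: three_nth)
 thus ?thesis by (simp add: fps_eq_iff)
qed

lemma tfL_eq: "3 * p = 3 * q ==> p = (q::'w L)"
 using tfL[of "p - q"] by (simp add: right_diff_distrib)

text \<open>Regularity of the sequence 3, s2: the coefficient of s2^(j+1) on the left is the j-th
  coefficient of p.\<close>

lemma s2_3: "s2L * p = 3 * q ==> EX e. p = 3 * e & q = s2L * (e::'w L)"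
proof -
 assume a: "s2L * p = 3 * q"
 define e where "e = Abs_fps (%i. Abs_fps (%j. q $ i $ Suc j))"
 have "p $ i $ j = (3 * e) $ i $ j" for i j
  using arg_cong[OF a, of "%p. p $ i $ Suc j"] by (simp add: three_nth e_def)
 hence p: "p = 3 * e" by (simp add: fps_eq_iff)
 have "3 * q = 3 * (s2L * e)" using a unfolding p by (simp add: alg)
 thus ?thesis using p tfL_eq by blast
qed

text \<open>Comparing coefficients, s2 times the coefficient of d1^2 d2 is 3 times that of d2, so by
  regularity the former is 3 y. All coefficients except the constant one then agree with those of y
  T, where T is the trace of d1^2 d2.\<close>

lemma gD_inv:
 fixes c :: "'w DV"
 assumes "gD c = c"
 shows "EX p q m. c = invD p q + sc 3 (trD m)"
proof -
 have e: "c Bd1 = - c Bd2" "c Bd1 - c Bd2 + s2L * c Bu = c Bd2" "- c Bd23 - s1L * c Bu = c Bd12"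
  "c Bd12 - c Bd23 = c Bd23"
  using arg_cong[OF assms, of "%c. c Bd1"] arg_cong[OF assms, of "%c. c Bd2"]
   arg_cong[OF assms, of "%c. c Bd12"] arg_cong[OF assms, of "%c. c Bd23"] by simp_all
 have "s2L * c Bu = 3 * c Bd2" using e(1,2) by (simp add: alg)
 from s2_3[OF this] obtain y where y: "c Bu = 3 * y" "c Bd2 = s2L * y" by blast
 have "c Bd12 = 2 * c Bd23" using e(4) by (simp add: alg)
 hence "s1L * c Bu + 3 * c Bd23 = 0" using e(3) by (simp add: alg)
 hence "3 * c Bd23 = - (s1L * (3 * y))" unfolding y(1) by (simp only: add_eq_0_iff)
 hence "3 * c Bd23 = 3 * (- s1L * y)" by (simp add: alg)
 hence d23: "c Bd23 = - s1L * y" by (rule tfL_eq)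
 have "c Bd12 = c Bd23 + c Bd23" using e(4) by (simp add: diff_eq_eq)
 hence d12: "c Bd12 = - 2 * s1L * y" unfolding d23 by (simp add: alg)
 \<comment> \<open>For the trace T of d1^2 d2 one has T = 2 (s1 s2 - 3) - 2 delta - 3 T when s3 = 1.
   The first two summands go into \<open>invD\<close>, the last is three times a trace.\<close>
 have "c = invD (c B1 + y * s1L * s2L - 6 * y) (- 2 * y) + sc 3 (trD (dsg Bu (- y)))"
  by (simp add: DV_eq_iff invD_def dsg_def sc_def trD_def y d23 d12 e(1) alg)
 thus ?thesis by blast
qed

text \<open>The constant coordinate of the trace gives a syzygy 3 c(1) + s1 P + s2 Q = 0 of the
  regular sequence 3, s1, s2. It is a combination of Koszul relations, whose coefficients are
  \<open>m\<close>, \<open>P'\<close> and \<open>e\<close>, and \<open>M\<close> assembles them into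
  a primitive.\<close>

lemma trD_0:
 fixes c :: "'w DV"
 assumes "trD c = 0"
 shows "EX m. c = gD m - m"
proof -
 have "3 * c Bu = 0" using arg_cong[OF assms, of "%c. c Bu"] by (simp add: trD_def)
 hence u: "c Bu = 0" by (rule tfL)
 define P Q where PQ: "P = c Bd1 + c Bd2" "Q = c Bd12 + c Bd23"
 have eq: "3 * c B1 + s1L * P + s2L * Q = 0"
  using arg_cong[OF assms, of "%c. c B1"] u by (simp add: trD_def PQ alg)
 define m where "m = Abs_fps (%i. Abs_fps (%j. P $ i $ Suc j))"
 define P' where "P' = Abs_fps (%i. fps_const (- (c B1 $ Suc i $ 0)))"
 have P0: "P $ i $ 0 = - (3 * c B1 $ Suc i $ 0)" for i
  using arg_cong[OF eq, of "%c. c $ Suc i $ 0"] by (simp add: three_nth eq_neg_iff_add_eq_0 add.commute)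
 have "P $ i $ j = (s2L * m + 3 * P') $ i $ j" for i j
  by (cases j) (simp_all add: m_def P'_def P0 three_nth)
 hence P: "P = s2L * m + 3 * P'" by (simp add: fps_eq_iff)
 have "s2L * (Q + s1L * m) = 3 * (- c B1 - s1L * P')"
  using eq unfolding P by (simp add: alg eq_neg_iff_add_eq_0)
 from s2_3[OF this] obtain e where e: "Q + s1L * m = 3 * e" "- c B1 - s1L * P' = s2L * e" by blast
 have c: "c Bd2 = s2L * m + 3 * P' - c Bd1" "c Bd12 = 3 * e - s1L * m - c Bd23"
  "c B1 = - s1L * P' - s2L * e"
 proof -
  show "c Bd2 = s2L * m + 3 * P' - c Bd1" using P unfolding PQ by (simp add: alg)
  show "c Bd12 = 3 * e - s1L * m - c Bd23" using e(1) unfolding PQ by (simp add: alg)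
  have "c B1 = - (- c B1 - s1L * P') - s1L * P'" by simp
  thus "c B1 = - s1L * P' - s2L * e" unfolding e(2) by simp
 qed
 define M where "M = dsg Bd1 (- c Bd1 + P') + dsg Bd2 (- P') + dsg Bd12 (c Bd23 - 2 * e)
  + dsg Bd23 (- e) + dsg Bu m"
 have "c = gD M - M"
  unfolding DV_eq_iff by (simp add: u c M_def dsg_def alg)
 thus ?thesis by blast
qed

text \<open>The ideals (9, 3 s1, 3 s2) and (3) are the relations of the generators 1 and delta, and
  again of c-bar and c-bar delta. The 9 appears because scalars are taken in W and not in
  W/9.\<close>

definition small :: "'w L => 'w L => bool" where
 "small p q <-> (EX x y z. p = 9 * x + 3 * s1L * y + 3 * s2L * z) & (EX x. q = 3 * x)"

lemma two_mult_3: "2 * p = 3 * q ==> p = 3 * (p - q)" for p q :: "'w L"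
 by (simp add: alg)

text \<open>On the label without letters gamma^3 acts trivially, so the norm of C9 is 3 tr. Its
  image is read off from tr(1) = 3, tr(d1) = s1, tr(d1 d2) = s2 and, with s3 = 1, delta = tr(-1 + s2
  d1 - 2 d1^2 d2).\<close>

lemma invD_norm_iff: "small p q <-> (EX c. invD p q = sc 3 (trD c))"
proof
 assume "small p q"
 then obtain x y z k where a: "p = 9 * x + 3 * s1L * y + 3 * s2L * z" "q = 3 * k"
  unfolding small_def by blast
 have "invD p q = sc 3 (trD (dsg B1 (x - k) + dsg Bd1 (y + k * s2L) + dsg Bd12 z + dsg Bu (- 2 * k)))"
  by (simp add: DV_eq_iff invD_def dsg_def sc_def trD_def a alg)
 thus "EX c. invD p q = sc 3 (trD c)" by blast
next
 assume "EX c. invD p q = sc 3 (trD c)"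
 then obtain c where c: "invD p q = sc 3 (trD c)" by blast
 have "3 * (2 * q) = 3 * (3 * (- c Bu))"
 proof -
  have "q * (- 6) = 3 * (c Bu + c Bu + c Bu)"
   using arg_cong[OF c, of "%c. c Bu"] by (simp add: invD_def dsg_def sc_def trD_def)
  hence "- (q * (- 6)) = - (3 * (c Bu + c Bu + c Bu))" by simp
  thus ?thesis by (simp add: alg)
 qed
 hence "2 * q = 3 * (- c Bu)" by (rule tfL_eq)
 from two_mult_3[OF this] obtain k where k: "q = 3 * k" by blast
 hence cu: "c Bu = - 2 * k"   proof -
  have "3 * (- c Bu) = 3 * (2 * k)" using \<open>2 * q = 3 * (- c Bu)\<close> unfolding k by (simp add: alg)
  hence "- c Bu = 2 * k" by (rule tfL_eq)
  thus ?thesis by (metis minus_minus mult_minus_left)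
 qed
 have "p = 9 * (c B1 + k) + 3 * s1L * (c Bd1 + c Bd2 - s2L * k) + 3 * s2L * (c Bd12 + c Bd23)"
  using arg_cong[OF c, of "%c. c B1"]
  by (simp add: invD_def dsg_def sc_def trD_def k cu alg)
 thus "small p q" unfolding small_def using k by blast
qed

end

text \<open>The action is on coefficient functions, so the letters move by \<open>LX\<close> ->
  \<open>LY\<close> -> -\<open>LX\<close> - \<open>LY\<close>, as x_0 and x_3 do under gamma^3
  modulo x_0 + x_3 + x_6. This twist occurs when gamma carries the last block to the first.\<close>

fun gact :: "(letter => 'd::ab_group_add) => letter => 'd" where
 "gact f One = f One"
| "gact f LX = - f LY"
| "gact f LY = f LX - f LY"
| "gact f (Fr a v z) = f (Fr a v (prev3 z))"

definition vs :: "letter => letter => letter => 'd::ab_group_add => letter => letter => letter => 'd" where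
 "vs a b l c = (%l1 l2 l3. if l1 = a & l2 = b & l3 = l then c else 0)"

fun isF :: "letter => bool" where
 "isF (Fr a v z) = True" | "isF _ = False"

text \<open>The labels with a free letter form a free \<open>C\<^sub>9\<close>-set; \<open>trans\<close> is a transversal.\<close>

fun trans :: "letter => letter => letter => bool" where
 "trans (Fr a v z) (Fr a' v' z') (Fr a'' v'' z'') <->
   (z, z', z'') \<in> {(Z0, Z0, Z0), (Z0, Z1, Z2), (Z0, Z2, Z1)}"
| "trans (Fr a v z) _ l <-> z = Z0 & ~ isF l"
| "trans _ _ _ <-> False"

fun lprev :: "letter => letter" where
 "lprev (Fr a v z) = Fr a v (prev3 z)"
| "lprev l = l"

definition proj :: "(letter => letter => letter => bool) =>
  (letter => letter => letter => 'd::ab_group_add) => letter => letter => letter => 'd" where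
 "proj P u = (%l1 l2 l3. if P l1 l2 l3 then u l1 l2 l3 else 0)"

definition rotP :: "(letter => letter => letter => bool) => letter => letter => letter => bool" where
 "rotP P = (%l1 l2 l3. P l2 l3 (lprev l1))"

text \<open>The twist mixes \<open>LX\<close> and \<open>LY\<close>, so restriction to a set of
  labels is compatible with gamma only if the set does not separate these two letters.\<close>

definition sat :: "(letter => letter => letter => bool) => bool" where
 "sat P <-> (ALL a b. P LX a b = P LY a b & P a LX b = P a LY b & P a b LX = P a b LY)"

definition anyF :: "letter => letter => letter => bool" where
 "anyF l1 l2 l3 <-> isF l1 | isF l2 | isF l3"

lemma sat_rotP: "sat P ==> sat (rotP P)"
 by (auto simp: sat_def rotP_def)

lemma sat_trans: "sat trans"
proof -
 have "trans LX a b = trans LY a b & trans a LX b = trans a LY b & trans a b LX = trans a b LY" for a b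
  by (cases a; cases b) auto
 thus ?thesis by (simp add: sat_def)
qed

lemma sat_anyF: "sat anyF"
 by (simp add: sat_def anyF_def)

lemma rotP_anyF: "rotP anyF = anyF"
proof -
 have "isF (lprev l) = isF l" for l by (cases l) auto
 thus ?thesis by (auto simp: rotP_def anyF_def fun_eq_iff)
qed

lemma letter_cases:
 obtains "l = One" | "l = LX" | "l = LY" | a v where "l = Fr a v Z0" | a v where "l = Fr a v Z1"
  | a v where "l = Fr a v Z2"
 by (cases l; metis z3.exhaust)

lemma sum_9: "(\<Sum>k<9. F k) = F 0 + F 1 + F 2 + F 3 + F 4 + F 5 + F 6 + F 7 + F (8::nat)"
 for F :: "nat => 'a::comm_monoid_add"
 by (simp add: numeral_eq_Suc)

lemma sum_proj_trans: "(\<Sum>k<9. proj ((rotP ^^ k) trans) u) = proj anyF u"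
proof (intro ext)
 fix l1 l2 l3
 have "proj trans u l1 l2 l3 + proj (rotP trans) u l1 l2 l3 + proj (rotP (rotP trans)) u l1 l2 l3
   + proj (rotP (rotP (rotP trans))) u l1 l2 l3 + proj (rotP (rotP (rotP (rotP trans)))) u l1 l2 l3
   + proj (rotP (rotP (rotP (rotP (rotP trans))))) u l1 l2 l3
   + proj (rotP (rotP (rotP (rotP (rotP (rotP trans)))))) u l1 l2 l3
   + proj (rotP (rotP (rotP (rotP (rotP (rotP (rotP trans))))))) u l1 l2 l3
   + proj (rotP (rotP (rotP (rotP (rotP (rotP (rotP (rotP trans)))))))) u l1 l2 l3 = proj anyF u l1 l2 l3"
  unfolding proj_def rotP_def anyF_def
  by (rule letter_cases[of l1]; rule letter_cases[of l2]; rule letter_cases[of l3]; simp)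
 thus "(\<Sum>k<9. proj ((rotP ^^ k) trans) u) l1 l2 l3 = proj anyF u l1 l2 l3"
  by (simp add: sum_9 numeral_eq_Suc)
qed

text \<open>The coefficients are abstract so that the bookkeeping of letters does not meet that of
  d1, d2, d3; the instance is \<open>gD\<close>.\<close>

locale dmod =
 fixes g :: "'d::ab_group_add => 'd"
 assumes g_add: "g (x + y) = g x + g y" and g_3: "g (g (g x)) = x"
  and tf: "x + x + x = 0 ==> x = 0"
begin

lemma g_diff: "g (x - y) = g x - g y"
 using g_add[of "x - y" y] by (simp add: alg)

lemma g_0: "g 0 = 0" and g_minus: "g (- x) = - g x"
 using g_diff[of 0 0] g_diff[of 0 x] by simp_all

definition gV :: "(letter => letter => letter => 'd) => letter => letter => letter => 'd" where
 "gV u l1 l2 l3 = g (gact (u l2 l3) l1)"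

lemma gV_add: "gV (u + v) = gV u + gV v"
 and gV_diff: "gV (u - v) = gV u - gV v"
proof -
 have "gV (u + v) l1 l2 l3 = (gV u + gV v) l1 l2 l3" "gV (u - v) l1 l2 l3 = (gV u - gV v) l1 l2 l3" for l1 l2 l3
  by (cases l1; simp add: gV_def g_add g_diff g_minus)+
 thus "gV (u + v) = gV u + gV v" "gV (u - v) = gV u - gV v" by blast+
qed

lemma gV_0: "gV 0 = 0" and gV_minus: "gV (- u) = - gV u"
 using gV_diff[of 0 0] gV_diff[of 0 u] by simp_all

lemma gV_pow_add: "(gV ^^ k) (u + v) = (gV ^^ k) u + (gV ^^ k) v"
 and gV_pow_diff: "(gV ^^ k) (u - v) = (gV ^^ k) u - (gV ^^ k) v"
 by (induction k) (simp_all add: gV_add gV_diff)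

lemma gV_pow_sum: "finite X ==> (gV ^^ k) (sum F X) = (SUM i:X. (gV ^^ k) (F i))"
proof (induction X rule: finite_induct)
 case empty
 have "(gV ^^ k) 0 = 0" by (induction k) (simp_all only: funpow.simps id_apply comp_apply gV_0)
 thus ?case by (simp only: sum.empty)
next
 case (insert x X)
 thus ?case by (simp only: sum.insert not_False_eq_True gV_pow_add)
qed

definition nV :: "(letter => letter => letter => 'd) => letter => letter => letter => 'd" where
 "nV u = (\<Sum>k<9. (gV ^^ k) u)"

lemma gV_vs:
 "gV (vs a b One c) = vs One a b (g c)"
 "gV (vs a b LX c) = vs LY a b (g c)"
 "gV (vs a b LY c) = - vs LX a b (g c) - vs LY a b (g c)"
proof -
 have "gV (vs a b One c) l1 l2 l3 = vs One a b (g c) l1 l2 l3"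
  "gV (vs a b LX c) l1 l2 l3 = vs LY a b (g c) l1 l2 l3"
  "gV (vs a b LY c) l1 l2 l3 = (- vs LX a b (g c) - vs LY a b (g c)) l1 l2 l3" for l1 l2 l3
  by (cases l1; simp add: gV_def vs_def g_0 g_minus)+
 thus "gV (vs a b One c) = vs One a b (g c)"
  "gV (vs a b LX c) = vs LY a b (g c)"
  "gV (vs a b LY c) = - vs LX a b (g c) - vs LY a b (g c)"
  by blast+
qed

lemma gV_proj:
 assumes "sat P"
 shows "gV (proj P u) = proj (rotP P) (gV u)"
proof (intro ext)
 show "gV (proj P u) l1 l2 l3 = proj (rotP P) (gV u) l1 l2 l3" for l1 l2 l3
  using assms by (cases l1) (auto simp: gV_def proj_def rotP_def sat_def g_0)
qed

lemma gV_pow_proj: "sat P ==> (gV ^^ k) (proj P u) = proj ((rotP ^^ k) P) ((gV ^^ k) u) & sat ((rotP ^^ k) P)"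
 by (induction k) (simp_all add: gV_proj sat_rotP)

lemma gV_3: "gV (gV (gV u)) l1 l2 l3 =
  gact (%m1. gact (%m2. gact (%m3. u m1 m2 m3) l3) l2) l1"
 by (cases l1; cases l2; cases l3; simp add: gV_def g_minus g_diff g_3)

lemma gV_9: "(gV ^^ 9) u = u"
proof -
 let ?g = "%u. gV (gV (gV u))"
 have p: "prev3 (prev3 (prev3 z)) = z" for z by (cases z) auto
 have "?g (?g (?g u)) l1 l2 l3 = u l1 l2 l3" for l1 l2 l3
  unfolding gV_3 by (cases l1; cases l2; cases l3; simp add: p)
 hence "?g (?g (?g u)) = u" by blast
 thus ?thesis by (simp add: numeral_eq_Suc)
qed

lemma sum_shift: "(\<Sum>k<n. F (Suc k)) + F 0 = (\<Sum>k<n. F k) + F n"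
 for F :: "nat => 'a::ab_group_add" and n :: nat
 by (induction n) (simp_all add: alg)

lemma nV_gV: "nV (gV u) = nV u" and gV_nV: "gV (nV u) = nV u"
proof -
 have "(\<Sum>k<9. (gV ^^ Suc k) u) + (gV ^^ 0) u = (\<Sum>k<9. (gV ^^ k) u) + (gV ^^ 9) u"
  by (rule sum_shift)
 hence *: "(\<Sum>k<9. (gV ^^ Suc k) u) = nV u"
  unfolding nV_def gV_9 funpow_0 by (rule add_right_imp_eq)
 have "nV (gV u) = (\<Sum>k<9. (gV ^^ Suc k) u)" unfolding nV_def funpow_Suc_right by simp
 thus "nV (gV u) = nV u" using * by simp
 have "gV (nV u) = (gV ^^ 1) (\<Sum>k<9. (gV ^^ k) u)" by (simp add: nV_def)
 also have "... = (\<Sum>k<9. (gV ^^ Suc k) u)" by (subst gV_pow_sum) simp_all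
 finally show "gV (nV u) = nV u" using * by simp
qed

lemma nV_add: "nV (u + v) = nV u + nV v" and nV_diff: "nV (u - v) = nV u - nV v"
 by (simp_all add: nV_def gV_pow_add gV_pow_diff sum.distrib sum_subtractf)

lemma nV_eq: "nV u = (let v = u + gV u + gV (gV u) in v + gV (gV (gV v)) + gV (gV (gV (gV (gV (gV v))))))"
 by (simp add: nV_def sum_9 numeral_eq_Suc gV_add Let_def alg)

definition eqv :: "(letter => letter => letter => 'd) => (letter => letter => letter => 'd) => bool" where
 "eqv u v <-> (EX b. u = v + (gV b - b))"

lemma eqv_refl: "eqv u u"
 unfolding eqv_def by (intro exI[of _ 0]) (simp only: gV_0 diff_0_right add_0_right)

lemma eqv_sym: "eqv u v ==> eqv v u"
 unfolding eqv_def
proof (elim exE)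
 fix b assume "u = v + (gV b - b)"
 hence "v = u + (gV (- b) - (- b))" by (simp add: gV_minus)
 thus "EX b. v = u + (gV b - b)" by blast
qed

lemma eqv_add: "eqv u v ==> eqv u' v' ==> eqv (u + u') (v + v')"
 unfolding eqv_def
proof (elim exE)
 fix b b' assume "u = v + (gV b - b)" "u' = v' + (gV b' - b')"
 hence "u + u' = (v + v') + (gV (b + b') - (b + b'))" by (simp add: gV_add)
 thus "EX b. u + u' = v + v' + (gV b - b)" by blast
qed

lemma eqv_minus: "eqv u v ==> eqv (- u) (- v)"
 unfolding eqv_def
proof (elim exE)
 fix b assume "u = v + (gV b - b)"
 hence "- u = - v + (gV (- b) - (- b))" by (simp add: gV_minus)
 thus "EX b. - u = - v + (gV b - b)" by blast
qed

lemma eqv_diff: "eqv u v ==> eqv u' v' ==> eqv (u - u') (v - v')"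
 using eqv_add[of u v "- u'" "- v'"] eqv_minus[of u' v'] by simp

lemma eqv_trans: "eqv u v ==> eqv v w ==> eqv u w"
 unfolding eqv_def
proof (elim exE)
 fix b b' assume "u = v + (gV b - b)" "v = w + (gV b' - b')"
 hence "u = w + (gV (b + b') - (b + b'))" by (simp add: gV_add)
 thus "EX b. u = w + (gV b - b)" by blast
qed

lemma eqv_gV: "eqv (gV u) u"
 unfolding eqv_def by (intro exI[of _ u]) simp

lemma eqv_pow: "eqv ((gV ^^ k) u) u"
 by (induction k) (auto intro: eqv_refl eqv_trans[OF eqv_gV])

lemma eqv_sum: "(!!i. i \<in> X ==> eqv (F i) (F' i)) ==> eqv (sum F X) (sum F' X)"
 by (induction X rule: infinite_finite_induct) (auto intro: eqv_refl eqv_add simp del: plus_fun_apply)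

lemma eqv_nV: "eqv u v ==> nV u = nV v"
 unfolding eqv_def by (auto simp: nV_add nV_diff nV_gV)

text \<open>The translates of the transversal partition the labels with a free letter, and for an
  invariant u the k-th translate of its part on \<open>trans\<close> is its part on the k-th
  translated set.\<close>

lemma proj_anyF_nV: "nV (proj trans u) = proj anyF u" if "gV u = u"
proof -
 have "(gV ^^ k) u = u" for k by (induction k) (simp_all add: that)
 thus ?thesis
  unfolding nV_def using gV_pow_proj[OF sat_trans] sum_proj_trans[of u] by simp
qed

lemma proj_add: "proj P (u + v) = proj P u + proj P v"
 by (auto simp: proj_def fun_eq_iff)

lemma proj_0: "proj P 0 = 0"
 by (auto simp: proj_def fun_eq_iff)

lemma proj_sum: "finite X ==> proj P (sum F X) = (SUM i:X. proj P (F i))"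
proof (induction X rule: finite_induct)
 case (insert x X)
 thus ?case by (simp only: sum.insert not_False_eq_True proj_add)
qed (simp only: sum.empty proj_0)

text \<open>Modulo gamma - 1 the nine parts can all be moved back to the transversal, where they add
  up to the transversal part of the norm.\<close>

lemma eqv_proj_anyF:
 assumes "nV u = 0"
 shows "eqv (proj anyF u) 0"
proof -
 define x where "x k = proj trans ((gV ^^ (9 - k)) u)" for k
 have "(gV ^^ k) (x k) = proj ((rotP ^^ k) trans) u" if "k < 9" for k
 proof -
  have "(gV ^^ k) ((gV ^^ (9 - k)) u) = (gV ^^ (k + (9 - k))) u" by (simp add: funpow_add)
  also have "... = u" using that gV_9 by simp
  finally show ?thesis unfolding x_def using gV_pow_proj[OF sat_trans] by simp
 qed
 hence 1: "proj anyF u = (\<Sum>k<9. (gV ^^ k) (x k))"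
  unfolding sum_proj_trans[symmetric] by simp
 have "(\<Sum>k<9. x k) = proj trans (\<Sum>k<9. (gV ^^ (9 - k)) u)" unfolding x_def proj_sum[OF finite_lessThan] ..
 also have "(\<Sum>k<9. (gV ^^ (9 - k)) u) = (\<Sum>k<9. (gV ^^ Suc k) u)"
  by (simp add: sum_9 numeral_eq_Suc add_ac)
 also have "... = nV (gV u)" by (simp add: nV_def funpow_swap1)
 also have "... = 0" using assms nV_gV by simp
 also have "proj trans 0 = 0" by (auto simp: proj_def fun_eq_iff)
 finally have 2: "(\<Sum>k<9. x k) = 0" .
 have "eqv (\<Sum>k<9. (gV ^^ k) (x k)) (\<Sum>k<9. x k)" by (intro eqv_sum eqv_pow)
 thus ?thesis unfolding 1 2 .
qed

definition Fzero :: "(letter => letter => letter => 'd) => bool" where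
 "Fzero u <-> (ALL l1 l2 l3. anyF l1 l2 l3 --> u l1 l2 l3 = 0)"

lemma Fzero_diff: "Fzero u ==> Fzero v ==> Fzero (u - v)"
 and Fzero_add: "Fzero u ==> Fzero v ==> Fzero (u + v)"
 and Fzero_minus: "Fzero u ==> Fzero (- u)"
 by (auto simp: Fzero_def)

lemma Fzero_proj: "Fzero (u - proj anyF u)"
 by (auto simp: Fzero_def proj_def)

lemma gV_proj_anyF: "gV (proj anyF u) = proj anyF (gV u)"
 using gV_proj[OF sat_anyF] by (simp add: rotP_anyF)

lemma proj_Fzero: "Fzero u ==> proj anyF u = 0"
 by (auto simp: Fzero_def proj_def fun_eq_iff)

lemma Fzero_gV: "Fzero u ==> Fzero (gV u)"
proof -
 assume "Fzero u"
 hence "proj anyF (gV u) = 0" using gV_proj_anyF[of u] proj_Fzero gV_0 by metis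
 thus ?thesis using Fzero_proj[of "gV u"] by simp
qed

lemma Fzero_nV: "Fzero u ==> Fzero (nV u)"
proof -
 assume u: "Fzero u"
 have "Fzero ((gV ^^ k) u)" for k by (induction k) (simp_all add: u Fzero_gV)
 thus ?thesis unfolding nV_def sum_9 by (intro Fzero_add)
qed

lemma Fzero_vs: "~ anyF a b l ==> Fzero (vs a b l c)"
 by (auto simp: Fzero_def vs_def)

section \<open>Invariants modulo norms\<close>

abbreviation (input) "trg x == x + g x + g (g x)"

text \<open>Invariance expresses each coordinate by one or two others. On labels without free
  letters the four given coordinates start this recursion; the coordinates with a single letter come
  out as solutions of 3 y = 0.\<close>

lemma invariant_zero:
 assumes "gV c = c" "Fzero c" "c One One One = 0" "c LX LX One = 0" "c LX LY One = 0" "c LY LY LY = 0"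
 shows "c = 0"
proof -
 have I: "c l1 l2 l3 = g (gact (c l2 l3) l1)" for l1 l2 l3
  using assms(1) gV_def[of c l1 l2 l3] by simp
 have O: "c One a b = g (c a b One)" for a b using I[of One a b] by simp
 have o: "c One One l = g (g (c l One One))" for l using O[of One l] O[of l One] by metis
 have s: "c LX One One = - c LY One One" "c LY One One = c LX One One - c LY One One"
  using I[of LX One One, unfolded gact.simps] I[of LY One One, unfolded gact.simps]
  unfolding o[of LX] o[of LY] g_minus g_diff g_3 by blast+
 hence "c LY One One + c LY One One + c LY One One = 0" by (metis add.commute add.right_inverse diff_add_cancel add.assoc)
 hence 1: "c LY One One = 0" by (rule tf)
 hence 1: "c LY One One = 0" "c LX One One = 0" using s(1) by simp_all
 have "c LX LX One = c LY LY One"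
  using I[of LX LX One] I[of LX One LY] O[of LY LY] by (simp add: g_3 g_minus)
 moreover have "c LX LY One = c LY LY One - c LY LX One"
  using I[of LX LY One] I[of LY One LY] O[of LY LX] O[of LY LY] by (simp add: g_3 g_diff g_minus)
 ultimately have 2: "c LY LY One = 0" "c LY LX One = 0" using assms(4,5) by simp_all
 have 3: "c LX LY LY = 0" using I[of LX LY LY] assms(6) by (simp add: g_0)
 have 4: "c LX LX LY = 0" using I[of LX LX LY] 3 by (simp add: g_0)
 have 5: "c LX LX LX = 0" using I[of LX LX LX] 4 by (simp add: g_0)
 have 6: "c LY LX LX = 0" using I[of LY LX LX] 4 5 by (simp add: g_0)
 have g0: "x = 0" if "g x = 0" for x using that g_3[of x] g_0 by simp
 have "g (c LY LY LX) = 0" using I[of LY LY LY, unfolded gact.simps] unfolding assms(6) by simp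
 hence 7: "c LY LY LX = 0" by (rule g0)
 have "g (- c LY LX LY) = 0" using I[of LY LY LX, unfolded gact.simps] unfolding 6 7 by simp
 hence 8: "c LY LX LY = 0" using g0 by force
 have 9: "c LX LY LX = 0" using I[of LX LY LX] 8 by (simp add: g_0)
 note z = assms(3-6) 1 2 3 4 5 6 7 8 9
 have a: "c l1 l2 One = 0" if "~ anyF l1 l2 One" "l1 ~= One" for l1 l2
  using that by (cases l1; cases l2) (auto simp: z anyF_def)
 have b: "c One l2 l3 = 0" if "~ anyF One l2 l3" for l2 l3
  using that a[of l2 l3] O[of l2 l3] O[of One l3] O[of l3 One] a[of l3 One] z(1)
  by (cases l2; cases l3) (auto simp: z anyF_def g_0)
 have d: "c l1 One l3 = 0" if "~ anyF l1 One l3" for l1 l3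
  using that b I[of l1 One l3] by (cases l1) (auto simp: anyF_def g_0)
 have "c l1 l2 l3 = 0" if "~ anyF l1 l2 l3" for l1 l2 l3
  using that a b d z by (cases l1; cases l2; cases l3) (auto simp: anyF_def)
 hence "c l1 l2 l3 = 0" for l1 l2 l3 using assms(2) unfolding Fzero_def by blast
 thus ?thesis by (simp add: fun_eq_iff)
qed

text \<open>For two blocks, x x' + y x' + y y' is fixed by gamma^3, so its three translates add up
  to an invariant. These are the normal forms of the classes F_i.\<close>

definition trpair :: "'d => letter => letter => letter => 'd" where
 "trpair q = (let H = vs LX LX One q + vs LY LX One q + vs LY LY One q in H + gV H + gV (gV H))"

lemma vs_add: "vs a b l (c + c') = vs a b l c + vs a b l c'"
 and vs_diff: "vs a b l (c - c') = vs a b l c - vs a b l c'"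
 and vs_minus: "vs a b l (- c) = - vs a b l c"
 by (auto simp: fun_eq_iff vs_def)

lemmas calc = gV_vs gV_add gV_diff gV_minus g_3 g_add g_diff g_minus g_0 vs_add vs_diff vs_minus

lemma gV_trpair: "gV (trpair q) = trpair q"
 by (simp add: trpair_def Let_def calc)

lemma nV_vs: "nV (vs LX LX One B) LX LX One = B + B" "nV (vs LX LX One B) LX LY One = B"
 "nV (vs LX LX One B) One One One = 0" "nV (vs LX LX One B) LY LY LY = 0"
 "nV (vs LX LX LX p) LX LX One = 0" "nV (vs LX LX LX p) LX LY One = 0"
 "nV (vs LX LX LX p) One One One = 0" "nV (vs LX LX LX p) LY LY LY = g (g p) - g p"
 by (simp_all add: nV_def sum_9 numeral_eq_Suc calc) (simp_all add: vs_def)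

lemma trpair_nth: "trpair q LX LX One = q" "trpair q LX LY One = 0" "trpair q One One One = 0"
 "trpair q LY LY LY = 0"
 by (simp_all add: trpair_def Let_def calc) (simp_all add: vs_def)

text \<open>Invariance expresses the eight coordinates at triples of \<open>LX\<close> and
  \<open>LY\<close> by the one at \<open>LY LY LY\<close>; the last equation, which closes the
  circle, says that three times its trace vanishes.\<close>

lemma trg_0: "trg (c LY LY LY) = 0" if "gV c = c"
proof -
 have I: "c l1 l2 l3 = g (gact (c l2 l3) l1)" for l1 l2 l3
  using that gV_def[of c l1 l2 l3] by simp
 define y where "y = c LY LY LY"
 have 3: "c LX LY LY = - g y" using I[of LX LY LY] by (simp add: g_minus y_def)
 have 4: "c LX LX LY = g (g y)" using I[of LX LX LY] 3 by (simp add: g_minus)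
 have 5: "c LX LX LX = - y" using I[of LX LX LX] 4 by (simp add: g_minus g_3)
 have 6: "c LY LX LX = - g y - y" using I[of LY LX LX] 4 5 by (simp add: g_diff g_minus g_3)
 have "g (g (c LY LY LY)) = c LY LY LX - c LY LY LY"
  using I[of LY LY LY] by (metis g_3 gact.simps(3))
 hence 7: "c LY LY LX = g (g y) + y" by (simp add: y_def alg)
 have "g (g (c LY LY LX)) = c LY LX LX - c LY LX LY"
  using I[of LY LY LX] by (metis g_3 gact.simps(3))
 hence 8: "c LY LX LY = - g y - y - g y - g (g y)"
  unfolding 6 7 by (simp add: g_add g_3 alg)
 have 9: "c LX LY LX = g (g y) + g y + g (g y) + y"
  using I[of LX LY LX] 8 by (simp add: g_diff g_minus g_3)
 have "c LY LX LY = g (c LX LY LX - c LX LY LY)" by (rule I[of LY LX LY, unfolded gact.simps])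
 hence "g (c LX LY LX - c LX LY LY) - c LY LX LY = 0" by simp
 hence "trg y + trg y + trg y = 0"
  unfolding 3 8 9 by (simp add: g_diff g_add g_minus g_3 alg)
 thus ?thesis unfolding y_def using tf by blast
qed

theorem even_surj:
 assumes kertr: "!!x. trg x = 0 ==> EX m. x = g m - m" and a: "gV a = a"
 shows "EX p q b. g p = p & a = vs One One One p + trpair q + nV b"
proof -
 define a' where "a' = a - proj anyF a"
 have a': "gV a' = a'" "Fzero a'" unfolding a'_def using a
  by (simp_all add: gV_diff gV_proj_anyF Fzero_proj)
 obtain m where m: "a' LY LY LY = g m - m" using kertr trg_0[OF a'(1)] by blast
 define p B q where pBq: "p = a' One One One" "B = a' LX LY One" "q = a' LX LX One - B - B"
 have a'_nth: "a' One One One = p" "a' LX LY One = B" "a' LX LX One = q + B + B"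
  unfolding pBq by simp_all
 have p: "g p = p" using arg_cong[OF a'(1), of "%u. u One One One"] by (simp add: gV_def a'_nth)
 \<comment> \<open>By \<open>nV_vs\<close> the first norm contributes 2 B and B at
   \<open>LX LX One\<close> and \<open>LX LY One\<close>. The second contributes g m - m at
   \<open>LY LY LY\<close>, which is why its coefficient is \<open>g (g m)\<close>.\<close>
 define c where "c = a' - vs One One One p - trpair q - nV (vs LX LX One B) - nV (vs LX LX LX (g (g m)))"
 have v: "vs One One One p One One One = p" "vs One One One p LX LX One = 0"
  "vs One One One p LX LY One = 0" "vs One One One p LY LY LY = 0" by (simp_all add: vs_def)
 have "Fzero (trpair q)" unfolding trpair_def Let_def
  by (intro Fzero_add Fzero_gV Fzero_vs) (simp_all add: anyF_def)
 hence "c = 0"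
  by (intro invariant_zero)
    (simp_all add: c_def gV_diff a' gV_nV gV_trpair gV_vs p Fzero_diff Fzero_nV Fzero_vs anyF_def
     v trpair_nth nV_vs a'_nth m g_3)
 hence "a' = vs One One One p + trpair q + nV (vs LX LX One B + vs LX LX LX (g (g m)))"
  unfolding c_def nV_add by (simp add: alg)
 hence "a = vs One One One p + trpair q + nV (vs LX LX One B + vs LX LX LX (g (g m)) + proj trans a)"
  unfolding nV_add[of "vs LX LX One B + vs LX LX LX (g (g m))"] proj_anyF_nV[OF a] a'_def
  by (simp add: alg)
 thus ?thesis using p by blast
qed

theorem even_inj:
 assumes "vs One One One p + trpair q = nV b"
 shows "EX c. p = trg c + trg c + trg c" "EX c. q = c + c + c"
proof -
 define v where "v = b + gV b + gV (gV b)"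
 have n: "nV b l1 l2 l3 = v l1 l2 l3 + gV (gV (gV v)) l1 l2 l3 + gV (gV (gV (gV (gV (gV v))))) l1 l2 l3" for l1 l2 l3
  by (simp add: nV_eq Let_def v_def)
 have *: "vs One One One p l1 l2 l3 + trpair q l1 l2 l3 = nV b l1 l2 l3" for l1 l2 l3
  using arg_cong[OF assms, of "%u. u l1 l2 l3"] by simp
 have "v One One One = trg (b One One One)" by (simp add: v_def gV_def)
 thus "EX c. p = trg c + trg c + trg c"
  using *[of One One One] by (auto simp: trpair_nth vs_def n gV_3)
 have 1: "q = nV b LX LX One" "0 = nV b LX LY One"
  using *[of LX LX One] *[of LX LY One] by (simp_all add: trpair_nth vs_def)
 \<comment> \<open>The coordinate of the norm at \<open>LX LX One\<close> differs from a multiple of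
   3 by twice the coordinate at \<open>LX LY One\<close>, which vanishes.\<close>
 have "q = (v LY LX One - v LX LY One) + (v LY LX One - v LX LY One) + (v LY LX One - v LX LY One)
   + nV b LX LY One + nV b LX LY One"
  unfolding 1(1) n gV_3 by (simp add: alg)
 thus "EX c. q = c + c + c" using 1(2) by auto
qed

text \<open>The pair part rests on x x' - x y', whose norm is three times the orbit sum
  \<open>trpair\<close>.\<close>

theorem even_conv: "vs One One One (trg c + trg c + trg c) + trpair (q + q + q) =
  nV (vs One One One c + vs LX LX One q - vs LX LY One q)"
 by (rule ext)+ (simp add: nV_def sum_9 numeral_eq_Suc trpair_def Let_def calc)

section \<open>Kernel of the norm modulo the image of gamma - 1\<close>

lemma eqv_move: "eqv (vs One a b c) (vs a b One (g (g c)))" "eqv (vs LY a b c) (vs a b LX (g (g c)))"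
 using eqv_gV[of "vs a b One (g (g c))"] eqv_gV[of "vs a b LX (g (g c))"] by (simp_all add: gV_vs g_3)

lemma eqv_LX: "eqv (vs LX a b c) (- vs LY a b c - vs a b LY (g (g c)))"
 unfolding eqv_def by (intro exI[of _ "- vs a b LY (g (g c))"]) (simp add: calc)

lemma eqv_single:
 "eqv (vs One a One c) (vs a One One (g (g c)))"
 "eqv (vs One One a c) (vs a One One (g c))"
 "eqv (vs LY One One c) (vs LX One One c)"
proof -
 show 1: "eqv (vs One a One c) (vs a One One (g (g c)))" for a c by (rule eqv_move)
 show 2: "eqv (vs One One a c) (vs a One One (g c))" for a c
 proof (rule eqv_trans)
  show "eqv (vs One One a c) (vs One a One (g (g c)))" by (rule eqv_move)
  show "eqv (vs One a One (g (g c))) (vs a One One (g c))" using 1[of a "g (g c)"] by (simp add: g_3)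
 qed
 show "eqv (vs LY One One c) (vs LX One One c)"
 proof (rule eqv_trans)
  show "eqv (vs LY One One c) (vs One One LX (g (g c)))" by (rule eqv_move)
  show "eqv (vs One One LX (g (g c))) (vs LX One One c)" using 2[of LX "g (g c)"] by (simp add: g_3)
 qed
qed

lemma eqv_pair:
 "eqv (vs One a b c) (vs a b One (g (g c)))"
 "eqv (vs LY One b c) (vs b LX One (g c))"
 "eqv (vs LX One b c) (- vs b LX One (g c) - vs b LY One (g c))"
proof -
 show 1: "eqv (vs One a b c) (vs a b One (g (g c)))" for a b c by (rule eqv_move)
 show 2: "eqv (vs LY One b c) (vs b LX One (g c))" for c
 proof (rule eqv_trans)
  show "eqv (vs LY One b c) (vs One b LX (g (g c)))" by (rule eqv_move)
  show "eqv (vs One b LX (g (g c))) (vs b LX One (g c))" using 1[of b LX "g (g c)"] by (simp add: g_3)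
 qed
 have "eqv (vs One b LY (g (g c))) (vs b LY One (g c))" using 1[of b LY "g (g c)"] by (simp add: g_3)
 hence "eqv (- vs LY One b c - vs One b LY (g (g c))) (- vs b LX One (g c) - vs b LY One (g c))"
  by (intro eqv_diff eqv_minus 2)
 with eqv_LX show "eqv (vs LX One b c) (- vs b LX One (g c) - vs b LY One (g c))" by (rule eqv_trans)
qed

text \<open>Modulo gamma - 1 one triple label generates all the others. For a coefficient fixed by g
  the factors are 1, 1, 1, -2, -2, 4, 4, all congruent to 1 modulo 3.\<close>

lemma eqv_triple:
 "eqv (vs LY LX LX c) (vs LX LX LX (g (g c)))"
 "eqv (vs LY LY LX c) (vs LX LX LX (g c))"
 "eqv (vs LY LY LY c) (vs LX LX LX c)"
 "eqv (vs LX LX LY c) (vs LX LX LX (- g c - c))"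
 "eqv (vs LX LY LY c) (vs LX LX LX (- c - g (g c)))"
 "eqv (vs LY LX LY c) (vs LX LX LX (g c + c + g (g c) + g c))"
 "eqv (vs LX LY LX c) (vs LX LX LX (g (g c) + g c + c + g (g c)))"
proof -
 show 1: "eqv (vs LY LX LX c) (vs LX LX LX (g (g c)))" for c by (rule eqv_move)
 show 2: "eqv (vs LY LY LX c) (vs LX LX LX (g c))" for c
 proof (rule eqv_trans)
  show "eqv (vs LY LY LX c) (vs LY LX LX (g (g c)))" by (rule eqv_move)
  show "eqv (vs LY LX LX (g (g c))) (vs LX LX LX (g c))" using 1[of "g (g c)"] by (simp add: g_3)
 qed
 show 3: "eqv (vs LY LY LY c) (vs LX LX LX c)" for c
 proof (rule eqv_trans)
  show "eqv (vs LY LY LY c) (vs LY LY LX (g (g c)))" by (rule eqv_move)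
  show "eqv (vs LY LY LX (g (g c))) (vs LX LX LX c)" using 2[of "g (g c)"] by (simp add: g_3)
 qed
 show 5: "eqv (vs LX LY LY c) (vs LX LX LX (- c - g (g c)))" for c
  using eqv_trans[OF eqv_LX[of LY LY c] eqv_diff[OF eqv_minus[OF 3[of c]] 3[of "g (g c)"]]]
  by (simp add: calc)
 have 8: "eqv (vs LY LX LY c) (vs LX LY LX (g (g c)))" for c by (rule eqv_move)
 show 4: "eqv (vs LX LX LY c) (vs LX LX LX (- g c - c))" for c
 proof (rule eqv_trans)
  show "eqv (vs LX LX LY c) (- vs LX LX LX (g c) - vs LY LX LX (g c))"
   unfolding eqv_def by (intro exI[of _ "- vs LX LX LY c"]) (simp add: calc)
  show "eqv (- vs LX LX LX (g c) - vs LY LX LX (g c)) (vs LX LX LX (- g c - c))"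
   using eqv_diff[OF eqv_refl[of "- vs LX LX LX (g c)"] 1[of "g c"]] by (simp add: calc)
 qed
 show 6: "eqv (vs LY LX LY c) (vs LX LX LX (g c + c + g (g c) + g c))" for c
 proof (rule eqv_trans)
  show "eqv (vs LY LX LY c) (- vs LX LX LY c - vs LX LY LY (g (g c)))"
   unfolding eqv_def by (intro exI[of _ "- vs LX LY LY (g (g c))"]) (simp add: calc)
  show "eqv (- vs LX LX LY c - vs LX LY LY (g (g c))) (vs LX LX LX (g c + c + g (g c) + g c))"
   using eqv_diff[OF eqv_minus[OF 4[of c]] 5[of "g (g c)"]] by (simp add: calc alg)
 qed
 show "eqv (vs LX LY LX c) (vs LX LX LX (g (g c) + g c + c + g (g c)))"
 proof (rule eqv_trans[OF eqv_sym])
  show "eqv (vs LY LX LY (g c)) (vs LX LY LX c)" using 8[of "g c"] by (simp add: g_3)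
  show "eqv (vs LY LX LY (g c)) (vs LX LX LX (g (g c) + g c + c + g (g c)))"
   using 6[of "g c"] by (simp add: g_3 add_ac)
 qed
qed

lemma Fzero_expand:
 assumes "Fzero u"
 shows "u = (vs One One One (u One One One))
  + (vs LX One One (u LX One One) + vs LY One One (u LY One One) + vs One LX One (u One LX One)
   + vs One LY One (u One LY One) + vs One One LX (u One One LX) + vs One One LY (u One One LY))
  + ((vs LX LX One (u LX LX One) + vs LX LY One (u LX LY One) + vs LY LX One (u LY LX One) + vs LY LY One (u LY LY One))
   + (vs One LX LX (u One LX LX) + vs One LX LY (u One LX LY) + vs One LY LX (u One LY LX) + vs One LY LY (u One LY LY))
   + (vs LX One LX (u LX One LX) + vs LX One LY (u LX One LY) + vs LY One LX (u LY One LX) + vs LY One LY (u LY One LY)))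
  + (vs LX LX LX (u LX LX LX) + vs LX LX LY (u LX LX LY) + vs LX LY LX (u LX LY LX) + vs LX LY LY (u LX LY LY)
   + vs LY LX LX (u LY LX LX) + vs LY LX LY (u LY LX LY) + vs LY LY LX (u LY LY LX) + vs LY LY LY (u LY LY LY))"
 (is "u = ?r")
proof (intro ext)
 fix l1 l2 l3
 show "u l1 l2 l3 = ?r l1 l2 l3"
  using assms by (cases l1; cases l2; cases l3; simp add: vs_def Fzero_def anyF_def)
qed

lemma eqv_ex_add:
 "EX c. eqv u (vs a b l c) ==> EX c. eqv v (vs a b l c) ==> EX c. eqv (u + v) (vs a b l c)"
 using eqv_add vs_add by metis

definition pairs :: "'d => 'd => 'd => 'd => letter => letter => letter => 'd" where
 "pairs A B C E = vs LX LX One A + vs LX LY One B + vs LY LX One C + vs LY LY One E"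

lemma eqv_ex_pairs_add:
 "EX A B C E. eqv u (pairs A B C E) ==> EX A B C E. eqv v (pairs A B C E) ==>
  EX A B C E. eqv (u + v) (pairs A B C E)"
proof (elim exE)
 fix A B C E A' B' C' E'
 assume "eqv u (pairs A B C E)" "eqv v (pairs A' B' C' E')"
 from eqv_add[OF this] have "eqv (u + v) (pairs (A + A') (B + B') (C + C') (E + E'))"
  by (simp add: pairs_def vs_add add_ac)
 thus "EX A B C E. eqv (u + v) (pairs A B C E)" by blast
qed

lemma vs_0: "vs a b l 0 = 0"
 by (auto simp: vs_def fun_eq_iff)

lemma eqv_normal_form:
 assumes "Fzero u"
 shows "EX c q A B C E p. eqv u (vs One One One c + vs LX One One q + pairs A B C E + vs LX LX LX p)"
proof -
 have p: "EX A B C E. eqv (vs LX LX One c) (pairs A B C E)" "EX A B C E. eqv (vs LX LY One c) (pairs A B C E)"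
  "EX A B C E. eqv (vs LY LX One c) (pairs A B C E)" "EX A B C E. eqv (vs LY LY One c) (pairs A B C E)" for c
 proof -
  have "pairs c 0 0 0 = vs LX LX One c" "pairs 0 c 0 0 = vs LX LY One c"
   "pairs 0 0 c 0 = vs LY LX One c" "pairs 0 0 0 c = vs LY LY One c"
   by (simp_all only: pairs_def vs_0 add_0_left add_0_right)
  thus "EX A B C E. eqv (vs LX LX One c) (pairs A B C E)" "EX A B C E. eqv (vs LX LY One c) (pairs A B C E)"
   "EX A B C E. eqv (vs LY LX One c) (pairs A B C E)" "EX A B C E. eqv (vs LY LY One c) (pairs A B C E)"
   using eqv_refl by metis+
 qed
 have p2: "EX A B C E. eqv v (pairs A B C E)" if "eqv v w" "EX A B C E. eqv w (pairs A B C E)" for v w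
  using that eqv_trans by blast
 have p3: "EX A B C E. eqv (- vs b LX One c - vs b LY One c) (pairs A B C E)" if "b = LX | b = LY" for b c
 proof -
  have "EX A B C E. eqv (vs b LX One (- c) + vs b LY One (- c)) (pairs A B C E)"
   using that by (intro eqv_ex_pairs_add) (auto simp only: p)
  thus ?thesis by (simp only: vs_minus diff_conv_add_uminus)
 qed
 obtain q where q: "eqv (vs LX One One (u LX One One) + vs LY One One (u LY One One) + vs One LX One (u One LX One)
   + vs One LY One (u One LY One) + vs One One LX (u One One LX) + vs One One LY (u One One LY)) (vs LX One One q)"
 proof -
  have "EX q. eqv (vs One LY One c) (vs LX One One q)" "EX q. eqv (vs One One LY c) (vs LX One One q)" for c
   using eqv_trans[OF eqv_single(1) eqv_single(3)] eqv_trans[OF eqv_single(2) eqv_single(3)] by blast+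
  hence "EX q. eqv (vs LX One One (u LX One One) + vs LY One One (u LY One One) + vs One LX One (u One LX One)
   + vs One LY One (u One LY One) + vs One One LX (u One One LX) + vs One One LY (u One One LY)) (vs LX One One q)"
   using eqv_refl eqv_single by (intro eqv_ex_add) blast+
  thus ?thesis using that by blast
 qed
 obtain A B C E where pr: "eqv ((vs LX LX One (u LX LX One) + vs LX LY One (u LX LY One) + vs LY LX One (u LY LX One) + vs LY LY One (u LY LY One))
   + (vs One LX LX (u One LX LX) + vs One LX LY (u One LX LY) + vs One LY LX (u One LY LX) + vs One LY LY (u One LY LY))
   + (vs LX One LX (u LX One LX) + vs LX One LY (u LX One LY) + vs LY One LX (u LY One LX) + vs LY One LY (u LY One LY)))
   (pairs A B C E)"
 proof -
  have "EX A B C E. eqv ((vs LX LX One (u LX LX One) + vs LX LY One (u LX LY One) + vs LY LX One (u LY LX One) + vs LY LY One (u LY LY One))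
   + (vs One LX LX (u One LX LX) + vs One LX LY (u One LX LY) + vs One LY LX (u One LY LX) + vs One LY LY (u One LY LY))
   + (vs LX One LX (u LX One LX) + vs LX One LY (u LX One LY) + vs LY One LX (u LY One LX) + vs LY One LY (u LY One LY)))
   (pairs A B C E)"
   by (intro eqv_ex_pairs_add p p2[OF eqv_pair(1)] p2[OF eqv_pair(2)] p2[OF eqv_pair(3)] p3) auto
  thus ?thesis using that by blast
 qed
 obtain r where r: "eqv (vs LX LX LX (u LX LX LX) + vs LX LX LY (u LX LX LY) + vs LX LY LX (u LX LY LX) + vs LX LY LY (u LX LY LY)
   + vs LY LX LX (u LY LX LX) + vs LY LX LY (u LY LX LY) + vs LY LY LX (u LY LY LX) + vs LY LY LY (u LY LY LY)) (vs LX LX LX r)"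
 proof -
  have "EX r. eqv (vs LX LX LX (u LX LX LX) + vs LX LX LY (u LX LX LY) + vs LX LY LX (u LX LY LX) + vs LX LY LY (u LX LY LY)
   + vs LY LX LX (u LY LX LX) + vs LY LX LY (u LY LX LY) + vs LY LY LX (u LY LY LX) + vs LY LY LY (u LY LY LY)) (vs LX LX LX r)"
   using eqv_refl eqv_triple by (intro eqv_ex_add) blast+
  thus ?thesis using that by blast
 qed
 have "eqv u (vs One One One (u One One One) + vs LX One One q + pairs A B C E + vs LX LX LX r)"
  by (subst Fzero_expand[OF assms]) (intro eqv_add eqv_refl q pr r)
 thus ?thesis by blast
qed

text \<open>In the normal form of \<open>eqv_normal_form\<close>, vanishing of the norm forces tr c
  = 0, C = B, E = B - A and g p = p. A constant with trace zero is trivial by \<open>kertr\<close>,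
  and pairs (A, B, B, B - A) lie in the image of gamma^3 - 1, so only one letter or three letters
  remain.\<close>

theorem odd_surj:
 assumes kertr: "!!x. trg x = 0 ==> EX m. x = g m - m" and a: "nV a = 0"
 shows "EX q p. g p = p & eqv a (vs LX One One q + vs LX LX LX p)"
proof -
 have "eqv (a - proj anyF a) (a - 0)" by (intro eqv_diff eqv_refl eqv_proj_anyF a)
 from eqv_sym[OF this] have 1: "eqv a (a - proj anyF a)" by (simp only: diff_0_right)
 obtain c q A B C E p where
  "eqv (a - proj anyF a) (vs One One One c + vs LX One One q + pairs A B C E + vs LX LX LX p)" (is "eqv _ ?r")
  using eqv_normal_form[OF Fzero_proj] by blast
 hence r: "eqv a ?r" using 1 eqv_trans by blast
 hence n: "nV ?r = 0" using eqv_nV a by simp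
 define v where "v = ?r + gV ?r + gV (gV ?r)"
 have n': "v l1 l2 l3 + gV (gV (gV v)) l1 l2 l3 + gV (gV (gV (gV (gV (gV v))))) l1 l2 l3 = 0" for l1 l2 l3
  using arg_cong[OF n, of "%u. u l1 l2 l3"] unfolding nV_eq Let_def v_def[symmetric] by simp
 have v: "v One One One = trg c" "v LX LX One = A" "v LX LY One = B" "v LY LX One = C" "v LY LY One = E"
  unfolding v_def pairs_def by (simp_all add: calc) (simp_all add: vs_def)
 have "trg c + trg c + trg c = 0" using n'[of One One One] by (simp add: gV_3 v)
 hence "trg c = 0" by (rule tf)
 with kertr obtain m where m: "c = g m - m" by blast
 have A: "A + A + E + E = B + C"
  using n'[of LX LX One] by (simp add: gV_3 v alg)
 have B: "A + B + E = C + C"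
  using n'[of LX LY One] by (simp add: gV_3 v alg)
 have "(B - C) + (B - C) + (B - C) = ((A + B + E) + (A + B + E) - (A + A + E + E)) + B - C - C - C"
  by (simp add: alg)
 also have "... = 0" unfolding A B by (simp add: alg)
 finally have C: "C = B" using tf[of "B - C"] by simp
 have E: "E = B - A" using B unfolding C by (simp add: alg)
 have "nV ?r LY LY LY = g (g p) - g p"
  unfolding nV_add pairs_def by (simp add: nV_def sum_9 numeral_eq_Suc calc) (simp add: vs_def)
 hence "g (g p) = g p" using n by simp
 hence p: "g p = p" by (metis g_3)
 have "eqv (vs One One One c) 0"
  unfolding m eqv_def by (intro exI[of _ "vs One One One m"]) (simp add: calc)
 moreover have "eqv (pairs A B C E) 0"
 proof -
  let ?w = "vs LX LX One (B - A) + vs LY LY One B"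
  have "pairs A B C E = gV (gV (gV ?w)) - ?w"
   unfolding pairs_def C E by (simp add: calc alg)
  moreover have "eqv (gV (gV (gV ?w)) - ?w) (?w - ?w)"
   by (intro eqv_diff eqv_refl eqv_trans[OF eqv_gV eqv_trans[OF eqv_gV eqv_gV]])
  ultimately show ?thesis by (simp only: diff_self)
 qed
 ultimately have "eqv ?r (0 + vs LX One One q + 0 + vs LX LX LX p)" by (intro eqv_add eqv_refl)
 hence "eqv a (vs LX One One q + vs LX LX LX p)" using eqv_trans[OF r] by (simp only: add_0_left add_0_right)
 thus ?thesis using p by blast
qed

theorem odd_inj:
 assumes p: "g p = p" and e: "eqv (vs LX One One q + vs LX LX LX p) 0"
 shows "EX c. p = trg c + trg c + trg c" "EX c. q = c + c + c"
proof -
 obtain b where "vs LX One One q + vs LX LX LX p = gV b - b"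
  using e unfolding eqv_def by (auto simp only: add_0_left)
 hence E: "b l1 l2 l3 = g (gact (b l2 l3) l1) - (vs LX One One q + vs LX LX LX p) l1 l2 l3" for l1 l2 l3
  by (simp add: gV_def)
 note v = vs_def
 have E0: "b l1 l2 l3 = g (gact (b l2 l3) l1)" if "(l1, l2, l3) \<notin> {(LX, One, One), (LX, LX, LX)}" for l1 l2 l3
 proof -
  have "(vs LX One One q + vs LX LX LX p) l1 l2 l3 = 0" using that by (auto simp: vs_def)
  thus ?thesis using E[of l1 l2 l3] by simp
 qed
 have o: "b One One l = g (g (b l One One))" for l
  using E0[of One One l] E0[of One l One] by simp
 have "b LX One One = g (- b One One LY) - q"
  using E[of LX One One, unfolded gact.simps] by (simp add: vs_def)
 hence X: "b LX One One = - b LY One One - q" unfolding o g_minus g_3 .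
 have "b LY One One = b LX One One - b LY One One"
  using E0[of LY One One, unfolded gact.simps] unfolding o g_diff g_3 by simp
 hence "b LY One One = (- b LY One One - q) - b LY One One" unfolding X .
 hence "q = - b LY One One + - b LY One One + - b LY One One" by (simp add: alg)
 thus "EX c. q = c + c + c" by blast
 define y where "y = b LY LY LY"
 have 3: "b LX LY LY = - g y" using E[of LX LY LY] by (simp add: v g_minus y_def)
 have 4: "b LX LX LY = g (g y)" using E[of LX LX LY] 3 by (simp add: v g_minus)
 have 5: "b LX LX LX = - y - p" using E[of LX LX LX] 4 by (simp add: v g_minus g_3)
 have 6: "b LY LX LX = - g y - p - y" using E[of LY LX LX] 4 5 by (simp add: v g_diff g_minus g_3 p)
 have "b LY LY LY = g (b LY LY LX - b LY LY LY)" using E[of LY LY LY] by (simp add: v)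
 hence "g (g (b LY LY LY)) = b LY LY LX - b LY LY LY" by (metis g_3)
 hence 7: "b LY LY LX = g (g y) + y" by (simp add: y_def alg)
 have "b LY LY LX = g (b LY LX LX - b LY LX LY)" using E[of LY LY LX] by (simp add: v)
 hence "g (g (b LY LY LX)) = b LY LX LX - b LY LX LY" by (metis g_3)
 hence 8: "b LY LX LY = - g y - p - y - g y - g (g y)"
  unfolding 6 7 by (simp add: g_add g_3 alg)
 have 9: "b LX LY LX = g (g y) + p + g y + g (g y) + y"
  using E[of LX LY LX] 8 by (simp add: v g_diff g_minus g_3 p)
 have "b LY LX LY = g (b LX LY LX - b LX LY LY)" using E[of LY LX LY] by (simp add: v)
 hence "g (b LX LY LX - b LX LY LY) - b LY LX LY = 0" by simp
 hence P: "p + p + trg y + trg y + trg y = 0"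
  unfolding 3 8 9 by (simp add: g_diff g_add g_minus g_3 p alg)
 \<comment> \<open>From 2 p + 3 tr y = 0, adding four times this relation to p gives 9 p + 12 tr y,
   and this is 3 tr (p + 4 y) because g fixes p.\<close>
 have "trg (p + y + y + y + y) + trg (p + y + y + y + y) + trg (p + y + y + y + y)
   = p + ((p + p + trg y + trg y + trg y) + (p + p + trg y + trg y + trg y)
    + (p + p + trg y + trg y + trg y) + (p + p + trg y + trg y + trg y))"
  by (simp add: g_add p alg)
 hence "p = trg (p + y + y + y + y) + trg (p + y + y + y + y) + trg (p + y + y + y + y)"
  unfolding P by simp
 thus "EX c. p = trg c + trg c + trg c" by blast
qed

theorem odd_conv: "eqv (vs LX One One (q + q + q) + vs LX LX LX (trg c + trg c + trg c)) 0"
proof -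
 let ?w = "vs LX One One (- q - q) - vs LY One One q"
 have "vs LX One One (q + q + q) = gV (gV (gV ?w)) - ?w"
  by (simp add: calc alg)
 moreover have "eqv (gV (gV (gV ?w)) - ?w) (?w - ?w)"
  by (intro eqv_diff eqv_refl eqv_trans[OF eqv_gV eqv_trans[OF eqv_gV eqv_gV]])
 ultimately have 1: "eqv (vs LX One One (q + q + q)) 0" by (simp only: diff_self)
 \<comment> \<open>The nine translates of \<open>LX LX LX\<close> with equal coefficients add up to
   0. The power of g in the coefficient is chosen so that after translation all of them carry the
   coefficient c.\<close>
 define x where "x k = vs LX LX LX ((g ^^ (9 - k)) c)" for k
 have "(\<Sum>k<9. x k) = vs LX LX LX (trg c + trg c + trg c)"
  unfolding x_def by (simp add: sum_9 numeral_eq_Suc g_3 vs_add add_ac)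
 moreover have "(\<Sum>k<9. (gV ^^ k) (x k)) = 0"
  unfolding x_def by (simp add: sum_9 numeral_eq_Suc calc alg)
 moreover have "eqv (\<Sum>k<9. (gV ^^ k) (x k)) (\<Sum>k<9. x k)" by (intro eqv_sum eqv_pow)
 ultimately have "eqv (vs LX LX LX (trg c + trg c + trg c)) 0" using eqv_sym by metis
 from eqv_add[OF 1 this] show ?thesis by (simp only: add_0_left)
qed

end

subsection \<open>Cochains of cyclic groups\<close>

definition mul9 :: "int => int => int" where
 "mul9 a b = (a + b) mod 9"

lemma neg_mod9: "(- (a mod 9) - b) mod 9 = (- a - b) mod (9::int)"
proof -
 have "- (a mod 9) - b = - b - a mod 9" "- a - b = - b - a" by simp_all
 thus ?thesis by (simp only: mod_diff_right_eq)
qed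

lemma mul9_assoc: "mul9 (mul9 a b) c = mul9 a (mul9 b c)"
 by (simp add: mul9_def mod_simps add.assoc)

lemma mul9_commute: "mul9 a b = mul9 b a"
 by (simp add: mul9_def add.commute)

text \<open>The bar differential without its first term. Freezing the first argument produces the
  alternating signs and turns d d = 0 into a structural induction.\<close>

fun btl :: "(int list => 'm::ab_group_add) => int list => 'm" where
 "btl f [] = 0"
| "btl f [g] = - f []"
| "btl f (g # h # gs) = - f (mul9 g h # gs) - btl (%hs. f (g # hs)) (h # gs)"

definition bar_diff :: "(int => 'm => 'm) => (int list => 'm::ab_group_add) => int list => 'm" where
 "bar_diff \<rho> f gs = \<rho> (hd gs) (f (tl gs)) + btl f gs"

lemma bar_tail_cong:
 assumes "!!hs. length hs = m ==> set hs <= C ==> f hs = f' hs"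
  and "!!a b. a \<in> C ==> b \<in> C ==> mul9 a b \<in> C"
  and "length gs = Suc m" "set gs <= C"
 shows "btl f gs = btl f' gs"
 using assms(1,3,4)
proof (induction f gs arbitrary: m f' rule: btl.induct)
 case (3 f g h gs)
 hence "m ~= 0" by auto
 have "f (mul9 g h # gs) = f' (mul9 g h # gs)"
  using 3(3,4) assms(2)[of g h] by (intro 3(2)) auto
 moreover have "btl (%hs. f (g # hs)) (h # gs) = btl (%hs. f' (g # hs)) (h # gs)"
 proof (rule 3(1)[where m = "m - 1"])
  show "f (g # hs) = f' (g # hs)" if "length hs = m - 1" "set hs <= C" for hs
   using 3(4) that \<open>m ~= 0\<close> by (intro 3(2)) auto
 qed (use 3 in auto)
 ultimately show ?case by simp
qed auto

lemma bar_tail_add: "btl (%hs. f hs + f' hs) gs = btl f gs + btl f' gs"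
proof (induction f gs arbitrary: f' rule: btl.induct)
 case (3 f g h gs)
 show ?case using 3[of "%hs. f' (g # hs)"] by (simp add: alg)
qed simp_all

lemma bar_tail_diff: "btl (%hs. f hs - f' hs) gs = btl f gs - btl f' gs"
proof (induction f gs arbitrary: f' rule: btl.induct)
 case (3 f g h gs)
 show ?case using 3[of "%hs. f' (g # hs)"] by (simp add: alg)
qed simp_all

lemma bar_tail_hom:
 assumes "!!x y. \<rho> (x + y) = \<rho> x + \<rho> y"
 shows "btl (%hs. \<rho> (f hs)) gs = \<rho> (btl f gs)"
proof -
 have 0: "\<rho> 0 = 0" using assms[of 0 0] by simp
 have m: "\<rho> (- x) = - \<rho> x" for x
  using assms[of x "- x"] 0 by (simp add: eq_neg_iff_add_eq_0 add.commute)
 have d: "\<rho> (x - y) = \<rho> x - \<rho> y" for x y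
  using assms[of x "- y"] m by simp
 show ?thesis
  by (induction f gs rule: btl.induct) (simp_all add: 0 m d)
qed

lemma bar_tail_apply: "btl F gs x = btl (%hs. F hs x) gs"
 by (induction F gs rule: btl.induct) simp_all

lemma bar_tail_0: "btl (%_. 0) gs = 0"
 using bar_tail_add[of "%_. 0" "%_. 0" gs] by simp

text \<open>The part of d d = 0 that does not involve the action; only associativity enters. The
  first two arguments are split off so that the induction hypothesis applies to
  \<open>%hs. f (g0 # hs)\<close>.\<close>

lemma bar_tail_bar_tail:
 "btl (%hs. btl f (g0 # hs)) (g1 # gs) = - btl f (mul9 g0 g1 # gs)"
proof (induction gs arbitrary: f g0 g1)
 case (Cons g2 gs)
 have "btl (%hs. btl f (g0 # hs)) (g1 # g2 # gs) =
   - btl f (g0 # mul9 g1 g2 # gs) - btl (%hs. btl f (g0 # g1 # hs)) (g2 # gs)"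
  by simp
 also have "btl (%hs. btl f (g0 # g1 # hs)) (g2 # gs) =
   - btl (%hs. f (mul9 g0 g1 # hs)) (g2 # gs)
   - btl (%hs. btl (%hs. f (g0 # hs)) (g1 # hs)) (g2 # gs)"
  using bar_tail_add[of "%hs. - f (mul9 g0 g1 # hs)"
    "%hs. - btl (%hs. f (g0 # hs)) (g1 # hs)" "g2 # gs"]
  by (simp add: bar_tail_hom[of uminus])
 also have "btl (%hs. btl (%hs. f (g0 # hs)) (g1 # hs)) (g2 # gs) =
   - btl (%hs. f (g0 # hs)) (mul9 g1 g2 # gs)"
  by (rule Cons.IH)
 finally show ?case by (simp add: mul9_assoc)
qed simp

lemma bar_diff_bar_diff:
 assumes add: "!!g x y. \<rho> g (x + y) = \<rho> g x + \<rho> g y"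
  and comp: "!!x. \<rho> (mul9 g h) x = \<rho> g (\<rho> h x)"
 shows "bar_diff \<rho> (bar_diff \<rho> f) (g # h # gs) = 0"
proof -
 have "btl (bar_diff \<rho> f) (g # h # gs) =
   - bar_diff \<rho> f (mul9 g h # gs) - (\<rho> g (btl f (h # gs)) - btl f (mul9 g h # gs))"
  unfolding bar_diff_def[abs_def]
  by (simp add: bar_tail_add[of "%hs. \<rho> g (f hs)"] bar_tail_hom[of "\<rho> g", OF add] bar_tail_bar_tail)
 thus ?thesis
  by (simp add: bar_diff_def[of \<rho> "bar_diff \<rho> f"] bar_diff_def[of \<rho> f] add comp)
qed

lemma bar_tail_eq:
 assumes "length gs = Suc n"
  and G: "mult G = mul9"
 shows "btl f gs = (\<Sum>i<n. if even i then - f (merge G i gs) else f (merge G i gs))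
      + (if even n then - f (butlast gs) else f (butlast gs))"
 using assms(1)
proof (induction f gs arbitrary: n rule: btl.induct)
 case (3 f g h gs)
 then obtain k where n: "n = Suc k" by (cases n) auto
 with 3 have l: "length (h # gs) = Suc k" by simp
 have m0: "merge G 0 (g # h # gs) = mul9 g h # gs" by (simp add: merge_def G)
 have mS: "merge G (Suc i) (g # h # gs) = g # merge G i (h # gs)" for i
  by (simp add: merge_def)
 show ?case
  unfolding n btl.simps(3) 3(1)[OF l] sum.lessThan_Suc_shift m0 mS
  by (auto simp: sum_negf[symmetric] alg intro!: sum.cong)
qed auto

lemma cobmap_bar:
 assumes "mult G = mul9"
 shows "coboundary_map G \<rho> n f gs =
  (if length gs = Suc n & set gs <= carrier G then bar_diff \<rho> f gs else 0)"
 unfolding coboundary_map_def bar_diff_def using bar_tail_eq[OF _ assms, of gs n f]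
 by (auto simp: add.assoc)

text \<open>The subgroup of index \<open>s\<close> of the cyclic group of order 9, with an action on the abelian group \<open>A\<close>.\<close>

locale cyc =
 fixes G :: "int monoid" and \<gamma> :: "'m::ab_group_add => 'm" and s n :: nat and A :: "'m set"
 assumes sn: "s * n = 9" "n > 1"
  and carrier_G: "carrier G = (%i. int (s * i)) ` {..<n}"
  and mult_G: "mult G = mul9" and one_G: "one G = 0"
  and \<gamma>_add: "\<gamma> (x + y) = \<gamma> x + \<gamma> y"
  and \<gamma>_9: "(\<gamma> ^^ 9) x = x"
  and A_0: "0 \<in> A" and A_add: "x \<in> A ==> y \<in> A ==> x + y \<in> A"
  and A_minus: "x \<in> A ==> - x \<in> A" and A_\<gamma>: "x \<in> A ==> \<gamma> x \<in> A"
begin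

abbreviation "act == cyc_act \<gamma>"
abbreviation "C == carrier G"
abbreviation "d == bar_diff act"
abbreviation "shift == (%g u x. u (mul9 x g)) :: int => (int => 'm) => int => 'm"
abbreviation "d' == bar_diff shift"
abbreviation "t == act (int s)"

definition tup :: "nat => int list => bool" where
 "tup m gs <-> length gs = m & set gs <= C"

lemma tup_Cons: "tup (Suc m) (g # gs) <-> g \<in> C & tup m gs"
 by (auto simp: tup_def)

lemma tup_0: "tup 0 gs <-> gs = []"
 by (auto simp: tup_def)

lemma tup_Suc: "tup (Suc m) gs <-> (EX h hs. gs = h # hs & h \<in> C & tup m hs)"
 by (cases gs) (auto simp: tup_def)

lemma s_pos: "s > 0" and s_le: "s < 9"
proof -
 show "s > 0" using sn(1) by (cases s) auto
 hence "s * 1 < s * n" using sn(2) by simp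
 thus "s < 9" using sn(1) by simp
qed

lemma C_cases: "x \<in> C ==> (!!i. x = int (s * i) ==> i < n ==> thesis) ==> thesis"
 unfolding carrier_G by (auto simp del: of_nat_mult)

lemma C_mult: "a \<in> C ==> b \<in> C ==> mul9 a b \<in> C"
proof -
 assume "a \<in> C" "b \<in> C"
 then obtain i j where ij: "a = int (s * i)" "b = int (s * j)" unfolding carrier_G by auto
 have "mul9 a b = int ((s * (i + j)) mod (s * n))"
  unfolding mul9_def ij sn(1) by (simp add: zmod_int alg)
 also have "... = int (s * ((i + j) mod n))" by simp
 finally show ?thesis unfolding carrier_G using sn(2) by auto
qed

lemma C_range: "a \<in> C ==> 0 \<le> a & a < 9"
proof -
 assume "a \<in> C"
 then obtain i where i: "a = int (s * i)" "i < n" unfolding carrier_G by auto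
 hence "s * i < s * n" using s_pos by simp
 hence "int (s * i) < 9" unfolding sn(1) by linarith
 thus ?thesis using i by simp
qed

lemma C_0: "0 \<in> C" and C_s: "int s \<in> C"
 unfolding carrier_G using sn(2) by (auto intro: image_eqI[of _ _ 0] image_eqI[of _ _ 1])

lemma C_finite: "finite C"
 unfolding carrier_G by simp

lemma act_add: "act g (x + y) = act g x + act g y"
proof -
 have "(\<gamma> ^^ k) (x + y) = (\<gamma> ^^ k) x + (\<gamma> ^^ k) y" for k by (induction k) (simp_all add: \<gamma>_add)
 thus ?thesis by (simp add: cyc_act_def)
qed

lemma act_hom: "act g 0 = 0" "act g (- x) = - act g x" "act g (x - y) = act g x - act g y"
  "act g (sum F X) = (SUM i:X. act g (F i))"
proof -
 show 0: "act g 0 = 0" using act_add[of g 0 0] by simp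
 show m: "act g (- x) = - act g x" for x
  using act_add[of g x "- x"] 0 by (simp add: eq_neg_iff_add_eq_0 add.commute)
 show "act g (x - y) = act g x - act g y" using act_add[of g x "- y"] m by simp
 show "act g (sum F X) = (SUM i:X. act g (F i))"
  by (induction X rule: infinite_finite_induct) (simp_all add: 0 act_add)
qed

lemma act_A: "x \<in> A ==> act g x \<in> A"
proof -
 have "x \<in> A ==> (\<gamma> ^^ k) x \<in> A" for k by (induction k) (simp_all add: A_\<gamma>)
 thus "x \<in> A ==> act g x \<in> A" by (simp add: cyc_act_def)
qed

lemma A_diff: "x \<in> A ==> y \<in> A ==> x - y \<in> A"
 using A_add[of x "- y"] A_minus by simp

lemma A_sum: "(!!i. i \<in> X ==> F i \<in> A) ==> sum F X \<in> A"
 by (induction X rule: infinite_finite_induct) (auto simp: A_0 A_add)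

lemma act_0: "act 0 x = x"
 by (simp add: cyc_act_def)

lemma pow_mod: "(\<gamma> ^^ (k mod 9)) x = (\<gamma> ^^ k) x"
proof -
 have *: "((\<gamma> ^^ 9) ^^ j) x = x" for j x by (induction j) (simp_all add: \<gamma>_9)
 have "(\<gamma> ^^ k) x = (\<gamma> ^^ (k mod 9)) (((\<gamma> ^^ 9) ^^ (k div 9)) x)"
  by (metis comp_apply funpow_add funpow_mult mod_mult_div_eq)
 thus ?thesis by (simp add: *)
qed

lemma act_mul9: "a \<ge> 0 ==> b \<ge> 0 ==> act (mul9 a b) x = act a (act b x)"
proof -
 assume ab: "a \<ge> 0" "b \<ge> 0"
 have "nat (mul9 a b) = (nat a + nat b) mod 9"
  unfolding mul9_def using ab by (simp add: nat_mod_distrib nat_add_distrib)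
 thus ?thesis unfolding cyc_act_def by (simp add: pow_mod funpow_add)
qed

lemma act_mul: "a \<in> C ==> b \<in> C ==> act (mul9 a b) x = act a (act b x)"
 using act_mul9 C_range by blast

lemma mul9_0: "x \<in> C ==> mul9 0 x = x" "x \<in> C ==> mul9 x 0 = x"
 using C_range[of x] by (simp_all add: mul9_def)

lemma bar_tail_A: "tup (Suc m) gs ==> (!!hs. tup m hs ==> f hs \<in> A) ==> btl f gs \<in> A"
proof (induction f gs arbitrary: m rule: btl.induct)
 case (3 f g h gs)
 then obtain k where m: "m = Suc k" by (cases m) (auto simp: tup_def)
 have g: "g \<in> C" "h \<in> C" "tup k gs" using 3(2) unfolding m by (auto simp: tup_Cons)
 have "btl (%hs. f (g # hs)) (h # gs) \<in> A"
  using g 3(3) unfolding m by (intro 3(1)[of k]) (auto simp: tup_Cons)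
 moreover have "f (mul9 g h # gs) \<in> A"
  using g 3(3) unfolding m by (auto simp: tup_Cons C_mult)
 ultimately show ?case by (simp add: A_minus A_diff)
qed (auto simp: A_0 A_minus tup_def)

lemma d_A: "tup (Suc m) gs ==> (!!hs. tup m hs ==> f hs \<in> A) ==> d f gs \<in> A"
 unfolding bar_diff_def by (intro A_add act_A bar_tail_A) (auto simp: tup_Suc)

lemma d_cong: "tup (Suc m) gs ==> (!!hs. tup m hs ==> f hs = f' hs) ==> d f gs = d f' gs"
 unfolding bar_diff_def using bar_tail_cong[of m C f f' gs] C_mult
 by (auto simp: tup_Suc) (auto simp: tup_def)

lemma d_add: "d (%hs. f hs + f' hs) gs = d f gs + d f' gs"
 and d_diff: "d (%hs. f hs - f' hs) gs = d f gs - d f' gs"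
 and d_uminus: "d (%hs. - f hs) gs = - d f gs"
 and d_0: "d (%hs. 0) gs = 0"
 unfolding bar_diff_def
 by (simp_all add: bar_tail_add bar_tail_diff bar_tail_hom[of uminus] bar_tail_0 act_add act_hom)

lemma d_d: "tup (Suc (Suc m)) gs ==> d (d f) gs = 0"
 by (auto simp: tup_Suc intro!: bar_diff_bar_diff act_add act_mul)

lemma d'_d': "d' (d' U) (g # h # gs) x = 0"
 using bar_diff_bar_diff[of shift g h U gs]
 by (simp add: fun_eq_iff mul9_assoc)

lemma d'_apply: "d' U (g # gs) x = U gs (mul9 x g) + btl (%hs. U hs x) (g # gs)"
 by (simp add: bar_diff_def bar_tail_apply)

lemma d'_cong:
 assumes "tup (Suc m) gs" "x \<in> C" "!!hs y. tup m hs ==> y \<in> C ==> U hs y = U' hs y"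
 shows "d' U gs x = d' U' gs x"
proof -
 obtain g hs where g: "gs = g # hs" "g \<in> C" "tup m hs" using assms(1) by (auto simp: tup_Suc)
 have "btl (%hs. U hs x) gs = btl (%hs. U' hs x) gs"
  using assms C_mult by (intro bar_tail_cong[of m C]) (auto simp: tup_def)
 thus ?thesis unfolding g d'_apply using g assms C_mult by simp
qed

text \<open>The coinduced module consists of the functions on the group, with \<open>(g u)(x) = u(x g)\<close>; it contains
 the original module as \<open>a \<mapsto> (x \<mapsto> x a)\<close> and \<open>contr\<close> contracts its bar complex.\<close>

abbreviation embed :: "(int list => 'm) => int list => int => 'm" where
 "embed f == (%gs x. act x (f gs))"

abbreviation contr :: "(int list => int => 'm) => int list => int => 'm" where
 "contr U == (%gs x. U (x # gs) 0)"

lemma d'_embed: "tup (Suc m) gs ==> x \<in> C ==> d' (embed f) gs x = act x (d f gs)"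
proof -
 assume g: "tup (Suc m) gs" and x: "x \<in> C"
 then obtain h hs where gs: "gs = h # hs" "h \<in> C" by (auto simp: tup_Suc)
 have *: "btl (%hs. act x (f hs)) gs = act x (btl f gs)"
  by (rule bar_tail_hom) (rule act_add)
 have "d' (embed f) gs x = act (mul9 x h) (f hs) + act x (btl f gs)"
  unfolding gs d'_apply using * gs by simp
 thus ?thesis using x gs by (simp add: bar_diff_def act_mul act_add)
qed

lemma contr_homotopy:
 "x \<in> C ==> tup (Suc m) gs ==> d' (contr U) gs x + contr (d' U) gs x = U gs x"
 by (auto simp: tup_Suc d'_apply mul9_0 bar_tail_apply)

text \<open>The kernel of \<open>delta\<close> consists of the functions x |-> x a, and its image is
  the kernel of \<open>total\<close>. The resulting exact sequence from A to A through two copies of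
  the coinduced module is the one along which the degree is shifted by two.\<close>

definition delta :: "(int => 'm) => int => 'm" where
 "delta u x = u (mul9 (int s) x) - t (u x)"

lemma d'_delta: "d' (%gs. delta (U gs)) (g # gs) x = delta (d' U (g # gs)) x"
proof -
 have *: "(%hs. delta (U hs) x) = (%hs. U hs (mul9 (int s) x) - t (U hs x))"
  by (simp add: delta_def)
 show ?thesis
  unfolding d'_apply * bar_tail_diff bar_tail_hom[of t, OF act_add]
  by (simp add: delta_def d'_apply mul9_assoc act_add)
qed

text \<open>The exponent -x - s instead of -x is a normalisation: it makes \<open>kap\<close> undo
  \<open>carry\<close> exactly and not only up to a translate by the generator.\<close>

definition total :: "(int => 'm) => 'm" where
 "total u = (SUM x:C. act ((- x - int s) mod 9) (u x))"

lemma bij_mul9: "g \<in> C ==> bij_betw (mul9 g) C C"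
proof -
 assume g: "g \<in> C"
 have "inj_on (mul9 g) C"
 proof (rule inj_onI)
  fix a b assume ab: "a \<in> C" "b \<in> C" "mul9 g a = mul9 g b"
  from ab(3) have "(g + a) mod 9 = (g + b) mod 9" unfolding mul9_def .
  hence "(g + a - g) mod 9 = (g + b - g) mod 9" by (metis mod_diff_left_eq)
  thus "a = b" using C_range[OF ab(1)] C_range[OF ab(2)] by simp
 qed
 moreover have "mul9 g ` C <= C" using g C_mult by blast
 ultimately show ?thesis
  by (simp add: bij_betw_def endo_inj_surj[OF C_finite])
qed

lemma total_shift: "g \<in> C ==> total (shift g u) = act g (total u)"
proof -
 assume g: "g \<in> C"
 have "act g (total u) = (SUM x:C. act (mul9 g ((- x - int s) mod 9)) (u x))"
  unfolding total_def act_hom using g C_range by (intro sum.cong refl act_mul9[symmetric]) auto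
 also have "... = (SUM x:C. act (mul9 g ((- mul9 g x - int s) mod 9)) (u (mul9 g x)))"
  by (rule sum.reindex_bij_betw[OF bij_mul9[OF g], symmetric])
 also have "... = total (shift g u)"
  unfolding total_def
 proof (intro sum.cong refl arg_cong2[of _ _ _ _ act])
  fix x
  have "(g + (- ((x + g) mod 9) - int s) mod 9) mod 9 = (g + (- (x + g) - int s)) mod 9"
   unfolding neg_mod9 by (simp only: mod_add_right_eq)
  thus "mul9 g ((- mul9 g x - int s) mod 9) = (- x - int s) mod 9"
   by (simp add: mul9_def add.commute)
 qed (simp add: mul9_commute)
 finally show ?thesis ..
qed

lemma total_delta: "total (delta u) = 0"
proof -
 have "total (delta u) = (SUM x:C. act ((- x - int s) mod 9) (u (mul9 (int s) x)))
   - (SUM x:C. act (mul9 ((- x - int s) mod 9) (int s)) (u x))"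
  unfolding total_def delta_def
  by (simp add: act_hom sum_subtractf act_mul9 cong: sum.cong)
 also have "(SUM x:C. act (mul9 ((- x - int s) mod 9) (int s)) (u x)) =
   (SUM x:C. act (mul9 ((- mul9 (int s) x - int s) mod 9) (int s)) (u (mul9 (int s) x)))"
  by (rule sum.reindex_bij_betw[OF bij_mul9[OF C_s], symmetric])
 also have "... = (SUM x:C. act ((- x - int s) mod 9) (u (mul9 (int s) x)))"
 proof (intro sum.cong refl arg_cong2[of _ _ _ _ act])
  fix x
  have "((- ((int s + x) mod 9) - int s) mod 9 + int s) mod 9 = (- (int s + x) - int s + int s) mod 9"
   unfolding neg_mod9 by (simp only: mod_add_left_eq)
  thus "mul9 ((- mul9 (int s) x - int s) mod 9) (int s) = (- x - int s) mod 9"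
   by (simp add: mul9_def alg)
 qed
 finally show ?thesis by simp
qed

lemma total_diff: "total (%x. u x - v x) = total u - total v"
 and total_add: "total (%x. u x + v x) = total u + total v"
 unfolding total_def by (simp_all add: act_hom act_add sum_subtractf sum.distrib)

lemma total_cong: "(!!x. x \<in> C ==> u x = v x) ==> total u = total v"
 unfolding total_def by (intro sum.cong) auto

lemma total_A: "(!!x. x \<in> C ==> u x \<in> A) ==> total u \<in> A"
 unfolding total_def by (intro A_sum act_A) auto

lemma total_bar_tail: "btl (%hs. total (U hs)) gs = total (btl U gs)"
proof (induction U gs rule: btl.induct)
 case (1 f) thus ?case using total_diff[of "%_. 0" "%_. 0"] by (simp add: zero_fun_def)
next
 case (2 f g) thus ?case using total_diff[of "%_. 0" "f []"] total_diff[of "%_. 0" "%_. 0"]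
  by (simp add: fun_Compl_def)
next
 case (3 f g h gs)
 thus ?case
  using total_diff[of "%_. 0" "f (mul9 g h # gs)"] total_diff[of "%_. 0" "%_. 0"]
   total_diff[of "- f (mul9 g h # gs)" "btl (%hs. f (g # hs)) (h # gs)"]
  by (simp add: fun_diff_def fun_Compl_def)
qed

lemma d_total: "tup (Suc m) gs ==> d (%hs. total (U hs)) gs = total (d' U gs)"
 by (auto simp: tup_Suc bar_diff_def total_bar_tail total_shift[symmetric] total_add[symmetric]
   plus_fun_def)

definition nrm :: "'m => 'm" where
 "nrm a = (SUM x:C. act x a)"

lemma total_const: "total (%x. a) = nrm a"
proof -
 let ?r = "%x::int. (- x - int s) mod 9"
 have r: "?r x \<in> C" if "x \<in> C" for x
 proof -
  obtain i where i: "x = int (s * i)" "i < n" using C_cases[OF \<open>x \<in> C\<close>] by blast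
  have "int (s * n) - int (s * (i + 1)) = - x - int s + 9"
   unfolding i(1) sn(1) by (simp add: alg)
  hence "?r x = (int (s * n) - int (s * (i + 1))) mod 9" by (simp only: mod_add_self2)
  also have "int (s * n) - int (s * (i + 1)) = int (s * (n - (i + 1)))"
   using mult_le_mono2[of "i + 1" n s] i(2)
   by (simp only: diff_mult_distrib2 of_nat_diff)
  also have "... mod 9 = int (s * (n - (i + 1)))"
  proof -
   have "s * (n - (i + 1)) < s * n" using s_pos i(2) by simp
   thus ?thesis unfolding sn(1) by (intro mod_pos_pos_trivial) linarith+
  qed
  finally show ?thesis unfolding carrier_G using i(2) by (simp only: image_eqI[where x = "n - (i + 1)"] lessThan_iff)
 qed
 have "?r (?r x) = x" if "x \<in> C" for x
 proof -
  have "(- (?r x) - int s) mod 9 = (- (- x - int s) - int s) mod 9"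
   by (rule neg_mod9)
  also have "... = x" using C_range[OF that] by simp
  finally show ?thesis .
 qed
 hence "bij_betw ?r C C" by (intro bij_betwI[where g = ?r]) (auto simp: r)
 from sum.reindex_bij_betw[OF this, of "%x. act x a"]
 show ?thesis unfolding total_def nrm_def .
qed

text \<open>The solution of u(s (i + 1)) = t u(s i) + w(s i) with u(0) = 0. Vanishing of
  \<open>total w\<close> is the condition that it closes up after n steps.\<close>

definition pre :: "(int => 'm) => int => 'm" where
 "pre w x = (\<Sum>j<nat x div s. act (int (s * (nat x div s - 1 - j))) (w (int (s * j))))"

lemma pre_A: "(!!x. x \<in> C ==> w x \<in> A) ==> x \<in> C ==> pre w x \<in> A"
proof -
 assume w: "!!x. x \<in> C ==> w x \<in> A" and x: "x \<in> C"
 obtain i where i: "x = int (s * i)" "i < n" using C_cases[OF x] .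
 have "nat x div s = i" unfolding i nat_int using s_pos by simp
 thus ?thesis unfolding pre_def using i(2)
  by (intro A_sum act_A w) (auto simp: carrier_G simp del: of_nat_mult)
qed

lemma delta_pre:
 assumes "total w = 0" "x \<in> C"
 shows "delta (pre w) x = w x"
proof -
 obtain i where i: "x = int (s * i)" "i < n" using C_cases[OF assms(2)] .
 have px: "pre w (int (s * i)) = (\<Sum>j<i. act (int (s * (i - 1 - j))) (w (int (s * j))))" for i
 proof -
  have "nat (int (s * i)) div s = i" unfolding nat_int using s_pos by simp
  thus ?thesis unfolding pre_def by simp
 qed
 have tp: "t (pre w x) = (\<Sum>j<i. act (int (s * (i - j))) (w (int (s * j))))"
  unfolding i(1) px act_hom
 proof (intro sum.cong refl)
  fix j assume j: "j \<in> {..<i}"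
  have "s * (i - j) \<le> s * (n - 1)" using i(2) by (intro mult_le_mono) auto
  also have "... < 9" using sn(2) s_pos sn(1) by (simp add: diff_mult_distrib2)
  finally have l: "s * (i - j) < 9" .
  have "s + s * (i - 1 - j) = s * (i - j)"
   using j by (simp flip: mult_Suc_right add: Suc_diff_Suc)
  hence "int s + int (s * (i - 1 - j)) = int (s * (i - j))" by linarith
  hence "mul9 (int s) (int (s * (i - 1 - j))) = int (s * (i - j))"
   unfolding mul9_def using l by (simp del: of_nat_mult)
  thus "t (act (int (s * (i - 1 - j))) (w (int (s * j)))) = act (int (s * (i - j))) (w (int (s * j)))"
   using act_mul9[of "int s" "int (s * (i - 1 - j))"] by simp
 qed
 show ?thesis
 proof (cases "Suc i < n")
  case True
  hence "s * Suc i < s * n" using s_pos by (simp del: mult_Suc_right)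
  hence "int (s * Suc i) < 9" unfolding sn(1) by linarith
  moreover have eq: "int s + int (s * i) = int (s * Suc i)" by simp
  ultimately have "mul9 (int s) x = int (s * Suc i)"
   unfolding mul9_def i(1) eq by (intro mod_pos_pos_trivial of_nat_0_le_iff)
  hence "pre w (mul9 (int s) x) = (\<Sum>j<Suc i. act (int (s * (i - j))) (w (int (s * j))))"
   using px[of "Suc i"] by simp
  thus ?thesis unfolding delta_def tp by (simp add: act_0 i(1))
 next
  case False
  have n: "n = Suc i" using i(2) False by linarith
  have "int s + int (s * i) = int (s * n)" unfolding n by simp
  hence "mul9 (int s) x = int (s * 0)" unfolding mul9_def i(1) sn(1) by simp
  hence 0: "pre w (mul9 (int s) x) = 0" using px[of 0] by simp
  have "total w = (\<Sum>j<n. act ((- int (s * j) - int s) mod 9) (w (int (s * j))))"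
   unfolding total_def carrier_G using s_pos by (subst sum.reindex) (auto simp: inj_on_def)
  also have "... = (\<Sum>j<n. act (int (s * (i - j))) (w (int (s * j))))"
  proof (intro sum.cong refl arg_cong2[of _ _ _ _ act])
   fix j assume "j \<in> {..<n}"
   hence j: "j \<le> i" using n by simp
   have "int (s * n) - int (s * j) - int s = - int (s * j) - int s + 9"
    unfolding sn(1) by simp
   hence "(- int (s * j) - int s) mod 9 = (int (s * n) - int (s * j) - int s) mod 9" by (simp only: mod_add_self2)
   also have "int (s * n) - int (s * j) - int s = int (s * (i - j))"
    using j n by (simp add: of_nat_diff alg)
   also have "... mod 9 = int (s * (i - j))"
   proof -
    have "s * (i - j) < s * n" using n s_pos by (intro mult_strict_left_mono) auto
    thus ?thesis unfolding sn(1) by (intro mod_pos_pos_trivial) linarith+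
   qed
   finally show "(- int (s * j) - int s) mod 9 = int (s * (i - j))" .
  qed
  also have "... = t (pre w x) + w x"
   unfolding tp n by (simp add: act_0 i(1))
  finally have "t (pre w x) + w x = 0" using assms(1) by simp
  thus ?thesis unfolding delta_def 0 by (simp add: minus_unique)
 qed
qed

lemma d'_diff: "d' (%hs x. U hs x - V hs x) (g # gs) x = d' U (g # gs) x - d' V (g # gs) x"
 by (simp add: d'_apply bar_tail_diff)

section \<open>Dimension shifting by two degrees\<close>

lemma mul9_s_0: "mul9 (int s) 0 = int s"
 using s_le by (simp add: mul9_def)

text \<open>For a cocycle f, \<open>first f\<close> is a primitive of \<open>embed f\<close> among
  cochains with values in functions. Its image under \<open>delta\<close> is again a cocycle,
  \<open>contr\<close> gives a primitive of that, and \<open>total\<close> returns to A; the formula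
  is this composite written out.\<close>

definition kap :: "(int list => 'm) => int list => 'm" where
 "kap f gs = total (%x. f (int s # x # gs) - t (f (0 # x # gs)))"

definition coc :: "nat => (int list => 'm) => bool" where
 "coc m f <-> (ALL gs. tup m gs --> f gs \<in> A) & (ALL gs. tup (Suc m) gs --> d f gs = 0)"

definition cob :: "nat => (int list => 'm) => bool" where
 "cob m f <-> (EX z. (ALL hs. tup m hs --> z hs \<in> A) & (ALL gs. tup (Suc m) gs --> f gs = d z gs))"

abbreviation first :: "(int list => 'm) => int list => int => 'm" where
 "first f == (%hs x. f (x # hs))"

abbreviation kfun :: "(int list => 'm) => int list => int => 'm" where
 "kfun f == (%hs. delta (first f hs))"

lemma kap_kfun: "kap f gs = total (contr (kfun f) gs)"
 by (simp add: kap_def delta_def mul9_s_0)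

lemma d'_first:
 assumes "tup (Suc m) hs" "x \<in> C"
 shows "d' (first f) hs x + d f (x # hs) = act x (f hs)"
 using contr_homotopy[OF assms(2,1), of "embed f"] d'_embed[of "Suc m" "x # hs" 0 f] assms
 by (simp add: act_0 C_0 tup_Cons)

lemma d'_kfun:
 assumes "tup (Suc m) hs" "x \<in> C" "!!y. y \<in> C ==> d f (y # hs) = 0"
 shows "d' (kfun f) hs x = 0"
proof -
 obtain g gs where hs: "hs = g # gs" using assms(1) by (auto simp: tup_Suc)
 have "d' (first f) hs y = act y (f hs)" if "y \<in> C" for y
  using d'_first[OF assms(1) that, of f] assms(3)[OF that] by simp
 hence "delta (d' (first f) hs) x = 0"
  using assms(2) C_s C_mult by (simp add: delta_def act_mul)
 thus ?thesis unfolding hs d'_delta .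
qed

lemma d'_contr_kfun:
 assumes "tup (Suc m) gs" "x \<in> C" "!!hs. tup (Suc (Suc (Suc m))) hs ==> d f hs = 0"
 shows "d' (contr (kfun f)) gs x = kfun f gs x"
proof -
 have "d' (kfun f) (x # gs) 0 = 0"
  using assms by (intro d'_kfun[of "Suc m"]) (auto simp: tup_Cons C_0)
 thus ?thesis using contr_homotopy[OF assms(2,1), of "kfun f"] by simp
qed

lemma kap_A:
 assumes "tup m gs" "!!hs. tup (Suc (Suc m)) hs ==> f hs \<in> A"
 shows "kap f gs \<in> A"
 unfolding kap_def using assms C_0 C_s by (intro total_A A_diff act_A) (auto simp: tup_Cons)

lemma kap_cong:
 assumes "tup m gs" "!!hs. tup (Suc (Suc m)) hs ==> f hs = f' hs"
 shows "kap f gs = kap f' gs"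
 unfolding kap_def using assms C_0 C_s by (intro total_cong) (auto simp: tup_Cons)

lemma kap_diff: "kap (%gs. f gs - f' gs) gs = kap f gs - kap f' gs"
 unfolding kap_def total_diff[symmetric] by (simp add: act_hom alg)

lemma coc_kap: "coc (Suc (Suc m)) f ==> coc m (kap f)"
proof -
 assume f: "coc (Suc (Suc m)) f"
 have "d (kap f) gs = 0" if gs: "tup (Suc m) gs" for gs
 proof -
  have "d (kap f) gs = total (d' (contr (kfun f)) gs)"
   unfolding kap_kfun[abs_def] by (rule d_total[OF gs])
  also have "... = total (kfun f gs)"
   using f gs by (intro total_cong d'_contr_kfun) (auto simp: coc_def)
  finally show ?thesis by (simp add: total_delta)
 qed
 thus ?thesis using f kap_A unfolding coc_def by blast
qed

text \<open>The diagram chase of dimension shifting: w = delta y with y = pre w, so Z = d' y - first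
  f is killed by \<open>delta\<close> and hence is the embedded cochain Z(0). Applying the
  differential to Z leaves -f.\<close>

lemma cob_if_lift:
 assumes f: "coc (Suc (Suc m)) f"
  and w_A: "!!gs x. tup m gs ==> x \<in> C ==> w gs x \<in> A"
  and w_0: "!!gs. tup m gs ==> total (w gs) = 0"
  and d'_w: "!!hs x. tup (Suc m) hs ==> x \<in> C ==> d' w hs x = kfun f hs x"
 shows "cob (Suc m) f"
proof -
 define y where "y = (%gs. pre (w gs))"
 define Z where "Z = (%hs x. d' y hs x - first f hs x)"
 have step: "Z hs (mul9 (int s) x) = t (Z hs x)" if hs: "tup (Suc m) hs" and x: "x \<in> C" for hs x
 proof -
  obtain g gs where g: "hs = g # gs" using hs by (auto simp: tup_Suc)
  have "delta (d' y hs) x = d' (%gs. delta (y gs)) hs x"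
   unfolding g by (rule d'_delta[symmetric])
  also have "... = d' w hs x"
   using hs x w_0 unfolding y_def by (intro d'_cong[of m] delta_pre) auto
  also have "... = kfun f hs x" by (rule d'_w[OF hs x])
  finally show ?thesis by (simp add: delta_def Z_def act_hom alg)
 qed
 have Z_act: "Z hs x = act x (Z hs 0)" if hs: "tup (Suc m) hs" and x: "x \<in> C" for hs x
 proof -
  have "Z hs (int (s * i)) = act (int (s * i)) (Z hs 0)" if "i < n" for i
   using that
  proof (induction i)
   case (Suc i)
   hence "s * Suc i < s * n" using s_pos by (intro mult_strict_left_mono) auto
   hence l: "int (s * Suc i) < 9" unfolding sn(1) by linarith
   have "int s + int (s * i) = int (s * Suc i)" by simp
   hence m: "mul9 (int s) (int (s * i)) = int (s * Suc i)"
    unfolding mul9_def using l by (metis mod_pos_pos_trivial of_nat_0_le_iff)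
   have i: "int (s * i) \<in> C" unfolding carrier_G using Suc.prems by auto
   show ?case
    using step[OF hs i] Suc act_mul9[of "int s" "int (s * i)" "Z hs 0"] unfolding m by simp
  qed (simp add: act_0)
  with C_cases[OF x] show ?thesis by metis
 qed
 have "d (%hs. Z hs 0) gs = - f gs" if gs: "tup (Suc (Suc m)) gs" for gs
 proof -
  obtain g h hs where g: "gs = g # h # hs" using gs by (auto simp: tup_Suc)
  have "d (%hs. Z hs 0) gs = d' (embed (%hs. Z hs 0)) gs 0"
   using d'_embed[OF gs C_0] by (simp add: act_0)
  also have "... = d' Z gs 0"
   using gs C_0 by (intro d'_cong[of "Suc m"] Z_act[symmetric])
  also have "... = - d' (first f) gs 0"
   unfolding Z_def g d'_diff d'_d' by simp
  also have "... = - f gs"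
   using d'_first[OF gs C_0, of f] f gs unfolding coc_def by (simp add: act_0 C_0 tup_Cons)
  finally show ?thesis .
 qed
 hence "ALL gs. tup (Suc (Suc m)) gs --> f gs = d (%hs. - Z hs 0) gs"
  by (simp add: d_uminus)
 moreover have "- Z hs 0 \<in> A" if hs: "tup (Suc m) hs" for hs
 proof -
  obtain g gs where g: "hs = g # gs" "g \<in> C" "tup m gs" using hs by (auto simp: tup_Suc)
  have "btl (%hs. y hs 0) hs \<in> A"
   using hs w_A C_0 unfolding y_def by (intro bar_tail_A pre_A) auto
  moreover have "y gs (mul9 0 g) \<in> A"
   using g w_A C_0 C_mult unfolding y_def by (intro pre_A) auto
  ultimately have "d' y hs 0 \<in> A" unfolding g(1) d'_apply by (intro A_add) auto
  moreover have "f (0 # hs) \<in> A" using f hs C_0 unfolding coc_def by (simp add: tup_Cons)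
  ultimately show ?thesis unfolding Z_def by (intro A_minus A_diff)
 qed
 ultimately show ?thesis unfolding cob_def by (intro exI[of _ "%hs. - Z hs 0"]) simp
qed

lemma total_single: "total (%x. if x = 0 then t a else 0) = a"
proof -
 have "total (%x. if x = 0 then t a else 0)
   = (SUM x:C. if x = 0 then act ((- int s) mod 9) (t a) else 0)"
  unfolding total_def by (intro sum.cong) (auto simp: act_hom)
 also have "... = act ((- int s) mod 9) (t a)"
  using C_finite C_0 by (simp add: sum.delta')
 also have "... = act (mul9 ((- int s) mod 9) (int s)) a"
  by (rule act_mul9[symmetric]) auto
 also have "mul9 ((- int s) mod 9) (int s) = 0" by (simp add: mul9_def mod_simps)
 finally show ?thesis by (simp add: act_0)
qed

lemma cob_if_kap:
 assumes f: "coc (Suc (Suc (Suc m))) f" and k: "cob m (kap f)"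
 shows "cob (Suc (Suc m)) f"
proof -
 from k obtain e where e_A: "!!hs. tup m hs ==> e hs \<in> A"
  and e: "!!gs. tup (Suc m) gs ==> kap f gs = d e gs"
  unfolding cob_def by blast
 \<comment> \<open>A function concentrated at 0 whose total is \<open>e gs\<close>; subtracting its
   differential from the lift makes the total of the lift vanish.\<close>
 define e' where "e' = (%gs x::int. if x = 0 then t (e gs) else 0)"
 define w where "w = (%gs x. contr (kfun f) gs x - d' e' gs x)"
 have f_A: "!!gs. tup (Suc (Suc (Suc m))) gs ==> f gs \<in> A" using f by (simp add: coc_def)
 show ?thesis
 proof (rule cob_if_lift[OF f, of w])
  fix gs x assume gs: "tup (Suc m) gs" and x: "x \<in> C"
  obtain g hs where g: "gs = g # hs" "g \<in> C" "tup m hs" using gs by (auto simp: tup_Suc)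
  have "btl (%hs. e' hs x) gs \<in> A"
   using gs e_A unfolding e'_def by (intro bar_tail_A[of m]) (auto intro: act_A A_0)
  moreover have "e' hs (mul9 x g) \<in> A" using g e_A by (auto simp: e'_def intro: act_A A_0)
  ultimately have "d' e' gs x \<in> A" unfolding g(1) d'_apply by (intro A_add)
  moreover have "contr (kfun f) gs x \<in> A"
   unfolding delta_def mul9_s_0 using f_A gs x C_0 C_s by (intro A_diff act_A) (auto simp: tup_Cons)
  ultimately show "w gs x \<in> A" unfolding w_def by (intro A_diff)
 next
  fix gs assume gs: "tup (Suc m) gs"
  have "total (w gs) = kap f gs - total (d' e' gs)"
   unfolding w_def total_diff kap_kfun ..
  also have "total (d' e' gs) = d e gs"
   unfolding d_total[OF gs, symmetric] e'_def total_single ..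
  finally show "total (w gs) = 0" using e[OF gs] by simp
 next
  fix hs x assume hs: "tup (Suc (Suc m)) hs" and x: "x \<in> C"
  obtain g h ks where g: "hs = g # h # ks" using hs by (auto simp: tup_Suc)
  have "d' w hs x = d' (contr (kfun f)) hs x - d' (d' e') hs x"
   unfolding w_def g by (rule d'_diff)
  also have "d' (d' e') hs x = 0" unfolding g by (rule d'_d')
  also have "d' (contr (kfun f)) hs x = kfun f hs x"
   using f unfolding coc_def by (intro d'_contr_kfun[OF hs x]) auto
  finally show "d' w hs x = kfun f hs x" by simp
 qed
qed

text \<open>In the lowest degree no cochain is left to correct the lift with. A constant function
  takes its place, and its total is a norm.\<close>

lemma cob_if_kap_0:
 assumes f: "coc (Suc (Suc 0)) f" and a: "a \<in> A" "kap f [] = nrm a"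
 shows "cob (Suc 0) f"
proof (rule cob_if_lift[OF f, of "%gs x. contr (kfun f) gs x - a"])
 have f_A: "!!gs. tup (Suc (Suc 0)) gs ==> f gs \<in> A" using f by (simp add: coc_def)
 fix gs x assume gs: "tup 0 gs" and x: "x \<in> C"
 show "contr (kfun f) gs x - a \<in> A"
  unfolding delta_def mul9_s_0 using f_A gs x C_0 C_s a by (intro A_diff act_A) (auto simp: tup_Cons)
next
 fix gs assume gs: "tup 0 gs"
 show "total (%x. contr (kfun f) gs x - a) = 0"
  using gs a(2) unfolding total_diff total_const kap_kfun by (simp add: tup_0)
next
 fix hs x assume hs: "tup (Suc 0) hs" and x: "x \<in> C"
 obtain g where g: "hs = [g]" using hs by (auto simp: tup_Suc tup_0)
 have "d' (%gs x. contr (kfun f) gs x - a) hs x = d' (contr (kfun f)) hs x - d' (%_ _. a) hs x"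
  unfolding g by (rule d'_diff)
 also have "d' (%_ _. a) hs x = 0" unfolding g by (simp add: d'_apply)
 also have "d' (contr (kfun f)) hs x = kfun f hs x"
  using f unfolding coc_def by (intro d'_contr_kfun[OF hs x]) auto
 finally show "d' (%gs x. contr (kfun f) gs x - a) hs x = kfun f hs x" by simp
qed

section \<open>Cup product with the periodicity class\<close>

fun carry :: "(int list => 'm) => int list => 'm" where
 "carry f (g # h # gs) = (if g + h \<ge> 9 then act (mul9 g h) (f gs) else 0)"
| "carry f gs = 0"

text \<open>This is the cocycle identity of the carry: the carries of (b, c) and of (a, b + c mod 9)
  are together as many as those of (a, b) and of (a + b mod 9, c).\<close>

lemma d_carry: "tup (Suc (Suc (Suc m))) gs ==> d (carry f) gs = carry (d f) gs"
proof -
 assume "tup (Suc (Suc (Suc m))) gs"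
 then obtain a b c hs where gs: "gs = a # b # c # hs" and abc: "a \<in> C" "b \<in> C" "c \<in> C"
  by (auto simp: tup_Suc)
 define u where "u = act (mul9 (mul9 a b) c) (f hs)"
 have 0: "0 \<le> a" "a < 9" "0 \<le> b" "b < 9" "0 \<le> c" "c < 9" using abc C_range by auto
 have u: "act a (act (mul9 b c) (f hs)) = u" "act (mul9 a (mul9 b c)) (f hs) = u"
  "act (mul9 a b) (act c (f hs)) = u"
  unfolding u_def using abc C_mult by (simp_all add: act_mul mul9_assoc)
 have "btl (%hs. carry f (a # b # hs)) (c # hs)
   = (if a + b \<ge> 9 then act (mul9 a b) (btl f (c # hs)) else 0)"
  by (simp add: bar_tail_0 bar_tail_hom[of "act (mul9 a b)", OF act_add])
 hence 1: "d (carry f) gs = (if b + c \<ge> 9 then u else 0) - (if mul9 a b + c \<ge> 9 then u else 0)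
   + (if a + mul9 b c \<ge> 9 then u else 0) + (if a + b \<ge> 9 then act (mul9 a b) (btl f (c # hs)) else 0)"
  unfolding gs by (simp add: bar_diff_def u u_def[symmetric] act_hom)
 have 2: "carry (d f) gs = (if a + b \<ge> 9 then u + act (mul9 a b) (btl f (c # hs)) else 0)"
  unfolding gs by (simp add: bar_diff_def act_add u)
 have "mul9 a b = (if a + b \<ge> 9 then a + b - 9 else a + b)"
  "mul9 b c = (if b + c \<ge> 9 then b + c - 9 else b + c)"
  unfolding mul9_def using 0 mod_pos_pos_trivial[of "a + b" 9] mod_pos_pos_trivial[of "b + c" 9]
   mod_pos_pos_trivial[of "a + b - 9" 9] mod_pos_pos_trivial[of "b + c - 9" 9]
   minus_mod_self2[of "a + b" 9] minus_mod_self2[of "b + c" 9]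
  by auto
 thus ?thesis unfolding 1 2 using 0 by auto
qed

lemma carry_A: "tup (Suc (Suc m)) gs ==> (!!hs. tup m hs ==> f hs \<in> A) ==> carry f gs \<in> A"
 by (auto simp: tup_Suc intro!: act_A A_0)

lemma coc_carry: "coc m f ==> coc (Suc (Suc m)) (carry f)"
 unfolding coc_def using d_carry[of m _ f] carry_A[of m _ f]
 by (auto simp: tup_Suc act_hom)

lemma cob_carry: "cob m f ==> cob (Suc (Suc m)) (carry f)"
proof -
 assume "cob m f"
 then obtain z where z: "!!hs. tup m hs ==> z hs \<in> A" "!!gs. tup (Suc m) gs ==> f gs = d z gs"
  unfolding cob_def by blast
 have "carry f gs = d (carry z) gs" if gs: "tup (Suc (Suc (Suc m))) gs" for gs
  using gs z(2) unfolding d_carry[OF gs] by (auto simp: tup_Suc)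
 thus ?thesis unfolding cob_def using z(1) carry_A by blast
qed

text \<open>Among the elements of the group only x = 9 - s produces a carry with s, none does with
  0, and at x = 9 - s the exponents of all actions vanish.\<close>

lemma kap_carry: "tup m gs ==> kap (carry f) gs = f gs"
proof -
 have "s < s * n" using sn(2) s_pos by simp
 hence s': "int s < 9" unfolding sn(1) by simp
 have c: "9 - int s \<in> C"
 proof -
  have "s * (n - 1) + s = s * n" using sn(2) by (cases n) auto
  hence "int (s * (n - 1)) = 9 - int s" unfolding sn(1) by linarith
  thus ?thesis unfolding carrier_G using sn(2) by (metis diff_less imageI lessThan_iff less_trans zero_less_one)
 qed
 have max: "x \<le> 9 - int s" if x: "x \<in> C" for x
 proof -
  obtain i where i: "x = int (s * i)" "i < n" using C_cases[OF x] by blast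
  hence "s * (i + 1) \<le> s * n" by (intro mult_le_mono2) simp
  hence "s * i + s \<le> 9" unfolding sn(1) by simp
  thus ?thesis unfolding i(1) by linarith
 qed
 have "kap (carry f) gs = (SUM x:C. if x = 9 - int s then f gs else 0)"
  unfolding kap_def total_def
 proof (intro sum.cong refl)
  fix x assume x: "x \<in> C"
  thus "act ((- x - int s) mod 9) (carry f (int s # x # gs) - t (carry f (0 # x # gs))) =
    (if x = 9 - int s then f gs else 0)"
   using C_range[OF x] max[OF x] by (auto simp: act_hom mul9_def act_0)
 qed
 thus ?thesis using C_finite c by simp
qed

lemma kfun_d:
 assumes "tup (Suc m) hs" "x \<in> C"
 shows "kfun (d z) hs x = - d' (kfun z) hs x"
proof -
 obtain g gs where hs: "hs = g # gs" using assms(1) by (auto simp: tup_Suc)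
 have *: "d z (y # hs) = act y (z hs) - d' (first z) hs y" if "y \<in> C" for y
  using d'_first[OF assms(1) that, of z] by (simp add: alg)
 have "kfun (d z) hs x = - delta (d' (first z) hs) x"
  using assms(2) C_s C_mult by (simp add: delta_def * act_mul act_hom)
 thus ?thesis unfolding hs d'_delta .
qed

lemma kap_d: "tup (Suc m) gs ==> kap (d z) gs = d (kap z) gs"
proof -
 assume gs: "tup (Suc m) gs"
 have "kap (d z) gs = total (%x. d' (contr (kfun z)) gs x - kfun z gs x)"
  unfolding kap_kfun
 proof (rule total_cong)
  fix x assume x: "x \<in> C"
  hence "kfun (d z) (x # gs) 0 = - d' (kfun z) (x # gs) 0"
   using gs C_0 by (intro kfun_d[of "Suc m"]) (auto simp: tup_Cons)
  thus "contr (kfun (d z)) gs x = d' (contr (kfun z)) gs x - kfun z gs x"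
   using contr_homotopy[OF x gs, of "kfun z"] by (simp add: alg)
 qed
 also have "... = d (kap z) gs"
  unfolding total_diff total_delta kap_kfun[abs_def] d_total[OF gs] by simp
 finally show ?thesis .
qed

lemma kap_d_0: "kap (d z) [] = nrm (z [int s] - t (z [0]))"
proof -
 have "kap (d z) [] = total (%x. kfun z [] 0 - kfun z [] x)"
  unfolding kap_kfun
 proof (rule total_cong)
  fix x assume x: "x \<in> C"
  hence "kfun (d z) [x] 0 = - d' (kfun z) [x] 0"
   using C_0 by (intro kfun_d[of 0]) (auto simp: tup_Suc tup_0)
  thus "contr (kfun (d z)) [] x = kfun z [] 0 - kfun z [] x"
   using x by (simp add: d'_apply mul9_0)
 qed
 thus ?thesis unfolding total_diff total_delta total_const by (simp add: delta_def mul9_s_0)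
qed

lemma cob_diff: "cob m f ==> cob m f' ==> cob m (%gs. f gs - f' gs)"
proof -
 assume "cob m f" "cob m f'"
 then obtain z z' where "!!hs. tup m hs ==> z hs \<in> A" "!!gs. tup (Suc m) gs ==> f gs = d z gs"
  "!!hs. tup m hs ==> z' hs \<in> A" "!!gs. tup (Suc m) gs ==> f' gs = d z' gs"
  unfolding cob_def by blast
 thus ?thesis unfolding cob_def
  by (intro exI[of _ "%hs. z hs - z' hs"]) (auto simp: d_diff A_diff)
qed

lemma cob_add: "cob m f ==> cob m f' ==> cob m (%gs. f gs + f' gs)"
proof -
 assume "cob m f" "cob m f'"
 then obtain z z' where "!!hs. tup m hs ==> z hs \<in> A" "!!gs. tup (Suc m) gs ==> f gs = d z gs"
  "!!hs. tup m hs ==> z' hs \<in> A" "!!gs. tup (Suc m) gs ==> f' gs = d z' gs"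
  unfolding cob_def by blast
 thus ?thesis unfolding cob_def
  by (intro exI[of _ "%hs. z hs + z' hs"]) (auto simp: d_add A_add)
qed

lemma cob_zero: "(!!gs. tup (Suc m) gs ==> f gs = 0) ==> cob m f"
 unfolding cob_def by (intro exI[of _ "%_. 0"]) (auto simp: d_0 A_0)

lemma cob_cong: "cob m f ==> (!!gs. tup (Suc m) gs ==> f gs = f' gs) ==> cob m f'"
 unfolding cob_def by auto

lemma coc_diff: "coc m f ==> coc m f' ==> coc m (%gs. f gs - f' gs)"
 unfolding coc_def by (auto simp: d_diff A_diff)

text \<open>As \<open>kap\<close> is a left inverse of \<open>carry\<close>, it kills the
  difference, and a cocycle killed by \<open>kap\<close> is a coboundary.\<close>

lemma reduce: "coc (Suc (Suc m)) f ==> cob (Suc m) (%gs. f gs - carry (kap f) gs)"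
proof -
 assume f: "coc (Suc (Suc m)) f"
 let ?g = "%gs. f gs - carry (kap f) gs"
 have g: "coc (Suc (Suc m)) ?g" by (intro coc_diff f coc_carry coc_kap)
 have k: "kap ?g gs = 0" if "tup m gs" for gs
  unfolding kap_diff kap_carry[OF that] by simp
 show ?thesis
 proof (cases m)
  case 0
  thus ?thesis using cob_if_kap_0[of ?g 0] g k[of "[]"] A_0 by (simp add: tup_0 nrm_def act_hom)
 next
  case (Suc m')
  thus ?thesis using cob_if_kap[of m' ?g] g k cob_zero[of m' "kap ?g"] by simp
 qed
qed

lemma cob_carryD: "cob (Suc (Suc m)) (carry f) ==> cob m f"
proof -
 assume "cob (Suc (Suc m)) (carry f)"
 then obtain z where z: "!!hs. tup (Suc (Suc m)) hs ==> z hs \<in> A"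
  "!!gs. tup (Suc (Suc (Suc m))) gs ==> carry f gs = d z gs"
  unfolding cob_def by blast
 have "f gs = d (kap z) gs" if gs: "tup (Suc m) gs" for gs
  using kap_carry[OF gs, of f] kap_cong[OF gs z(2)] kap_d[OF gs, of z] by simp
 thus ?thesis unfolding cob_def using kap_A z(1) by blast
qed

text \<open>Norms appear because of \<open>kap_d_0\<close>: on coboundaries of degree 2 the value of
  \<open>kap\<close> is a norm. The converse is \<open>cob_if_kap_0\<close>.\<close>

lemma cob_carry_0: "a \<in> A ==> t a = a ==> cob (Suc 0) (carry (%_. a)) <-> (EX b:A. a = nrm b)"
proof
 assume "cob (Suc 0) (carry (%_. a))"
 then obtain z where z: "!!hs. tup (Suc 0) hs ==> z hs \<in> A"
  "!!gs. tup (Suc (Suc 0)) gs ==> carry (%_. a) gs = d z gs"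
  unfolding cob_def by blast
 have "tup 0 []" by (simp add: tup_0)
 from kap_cong[OF this z(2)] have "a = nrm (z [int s] - t (z [0]))"
  using kap_carry[OF \<open>tup 0 []\<close>, of "%_. a"] kap_d_0[of z] by simp
 thus "EX b:A. a = nrm b"
  using z(1)[of "[int s]"] z(1)[of "[0]"] C_s C_0 by (auto simp: tup_Suc tup_0 intro!: A_diff act_A)
next
 assume a: "a \<in> A" "t a = a" and "EX b:A. a = nrm b"
 then obtain b where b: "b \<in> A" "a = nrm b" by blast
 have "act x a = a" if "x \<in> C" for x
 proof -
  have "act (int (s * i)) a = a" for i
  proof (induction i)
   case (Suc i)
   have "(\<gamma> ^^ (s * Suc i)) a = (\<gamma> ^^ s) ((\<gamma> ^^ (s * i)) a)" by (simp add: funpow_add)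
   thus ?case using Suc a(2) unfolding cyc_act_def nat_int by simp
  qed (simp add: act_0)
  thus ?thesis using C_cases[OF that] by blast
 qed
 hence "coc 0 (%_. a)"
  unfolding coc_def using a(1) by (auto simp: tup_Suc tup_0 bar_diff_def)
 thus "cob (Suc 0) (carry (%_. a))"
  using b kap_carry[of 0 "[]" "%_. a"] by (intro cob_if_kap_0[of _ b] coc_carry) (auto simp: tup_0)
qed

lemma carry_diff: "carry (%gs. f gs - f' gs) gs = carry f gs - carry f' gs"
 by (cases "(f, gs)" rule: carry.cases) (auto simp: act_hom)

section \<open>Crossed homomorphisms and representatives in all positive degrees\<close>

definition psum :: "'m => nat => 'm" where
 "psum y i = (\<Sum>j<i. act (int (s * j)) y)"

definition cross :: "'m => int list => 'm" where
 "cross y gs = psum y (nat (hd gs) div s)"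

lemma cross_C: "cross y [int (s * i)] = psum y i"
proof -
 have "nat (int (s * i)) div s = i" unfolding nat_int using s_pos by simp
 thus ?thesis unfolding cross_def by simp
qed

lemma cross_s: "cross y [int s] = y"
 using cross_C[of y 1] by (simp add: psum_def act_0)

lemma psum_add: "psum y (i + j) = psum y i + act (int (s * i)) (psum y j)"
proof (induction j)
 case (Suc j)
 have "act (int (s * (i + j))) y = act (int (s * i)) (act (int (s * j)) y)"
  unfolding cyc_act_def nat_int distrib_left funpow_add by simp
 thus ?case using Suc by (simp add: psum_def act_add act_hom)
qed (simp add: psum_def act_hom)

lemma nrm_psum: "nrm y = psum y n"
 unfolding nrm_def psum_def carrier_G using s_pos by (subst sum.reindex) (auto simp: inj_on_def)

lemma psum_A: "y \<in> A ==> psum y i \<in> A"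
 unfolding psum_def by (intro A_sum act_A)

lemma mul9_C: "i < n ==> j < n ==> mul9 (int (s * i)) (int (s * j)) = int (s * ((i + j) mod n))"
proof -
 have "mul9 (int (s * i)) (int (s * j)) = int ((s * (i + j)) mod (s * n))"
  unfolding mul9_def sn(1) by (simp add: zmod_int alg)
 thus ?thesis by simp
qed

text \<open>The partial sums of the translates of y are periodic because the sum over a full period
  is the norm of y.\<close>

lemma coc_cross:
 assumes "y \<in> A" "nrm y = 0"
 shows "coc 1 (cross y)"
proof -
 have "d (cross y) [g, h] = 0" if gh: "g \<in> C" "h \<in> C" for g h
 proof -
  obtain i j where ij: "g = int (s * i)" "i < n" "h = int (s * j)" "j < n"
   using C_cases[OF gh(1)] C_cases[OF gh(2)] by metis
  have "psum y ((i + j) mod n) = psum y (i + j)"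
  proof (cases "i + j < n")
   case False
   hence "(i + j) mod n = i + j - n" using ij by (simp add: mod_if)
   thus ?thesis using psum_add[of y n "i + j - n"] False assms(2) act_mul9
    by (simp add: nrm_psum sn(1) cyc_act_def \<gamma>_9)
  qed simp
  thus ?thesis
   unfolding ij(1,3) bar_diff_def
   by (simp add: mul9_C ij cross_C psum_add del: of_nat_mult)
 qed
 thus ?thesis
  unfolding coc_def using assms(1) by (auto simp: tup_Suc tup_0 cross_def psum_A)
qed

lemma coc_1:
 assumes "coc 1 f"
 shows "f [int s] \<in> A" "nrm (f [int s]) = 0" "!!gs. tup 1 gs ==> f gs = cross (f [int s]) gs"
proof -
 let ?y = "f [int s]"
 have f: "f [mul9 g h] = f [g] + act g (f [h])" if "g \<in> C" "h \<in> C" for g h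
 proof -
  have "d f [g, h] = 0" using assms that unfolding coc_def by (auto simp: tup_Suc tup_0)
  thus ?thesis by (simp add: bar_diff_def alg)
 qed
 have "f [0] = f [0] + f [0]" using f[OF C_0 C_0] by (simp add: mul9_def act_0)
 hence f0: "f [0] = 0" by simp
 have *: "f [int (s * i)] = psum ?y i" if "i < n" for i
  using that
 proof (induction i)
  case 0
  thus ?case by (simp add: f0 psum_def)
 next
  case (Suc i)
  have i: "int (s * i) \<in> C" unfolding carrier_G using Suc.prems by auto
  have "mul9 (int (s * i)) (int (s * 1)) = int (s * ((i + 1) mod n))"
   using Suc.prems sn(2) by (intro mul9_C) auto
  hence "mul9 (int (s * i)) (int s) = int (s * Suc i)" using Suc.prems by simp
  hence "f [int (s * Suc i)] = f [int (s * i)] + act (int (s * i)) ?y"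
   using f[OF i C_s] by metis
  thus ?case using Suc by (simp add: psum_def)
 qed
 show "?y \<in> A" using assms C_s unfolding coc_def by (auto simp: tup_Suc tup_0)
 obtain m where m: "n = Suc m" using sn(2) by (cases n) auto
 have i: "int (s * m) \<in> C" unfolding carrier_G m by auto
 have "mul9 (int (s * m)) (int (s * 1)) = int (s * ((m + 1) mod n))"
  using m sn(2) by (intro mul9_C) auto
 hence "mul9 (int (s * m)) (int s) = 0" using m by simp
 hence "f [0] = f [int (s * m)] + act (int (s * m)) ?y"
  using f[OF i C_s] by metis
 thus "nrm ?y = 0"
  unfolding nrm_psum m f0 using *[of m] m by (simp add: psum_def)
 show "f gs = cross ?y gs" if gs: "tup 1 gs" for gs
 proof -
  obtain g where g: "gs = [g]" "g \<in> C" using gs by (auto simp: tup_def length_Suc_conv)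
  obtain i where "g = int (s * i)" "i < n" using C_cases[OF g(2)] .
  thus ?thesis using * cross_C g by metis
 qed
qed

lemma cob_cross: "cob 0 (cross y) <-> (EX b:A. y = t b - b)"
proof
 assume "cob 0 (cross y)"
 then obtain z where z: "z [] \<in> A" "!!gs. tup 1 gs ==> cross y gs = d z gs"
  unfolding cob_def by (auto simp: tup_0)
 have "y = t (z []) - z []"
  using z(2)[of "[int s]"] C_s by (simp add: tup_Suc tup_0 cross_s bar_diff_def)
 thus "EX b:A. y = t b - b" using z(1) by blast
next
 assume "EX b:A. y = t b - b"
 then obtain b where b: "b \<in> A" "y = t b - b" by blast
 have "psum y i = act (int (s * i)) b - b" for i
 proof (induction i)
  case (Suc i)
  have "act (int (s * i)) (t b) = act (int (s * Suc i)) b"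
   unfolding cyc_act_def nat_int using funpow_add[of "s * i" s \<gamma>] by (simp add: add.commute)
  thus ?case using Suc by (simp add: psum_def b(2) act_hom del: of_nat_mult)
 qed (simp add: psum_def act_0)
 hence "cross y [g] = d (%_. b) [g]" if "g \<in> C" for g
  using C_cases[OF that] cross_C by (metis bar_diff_def btl.simps(2) list.sel(1) uminus_add_conv_diff add.commute)
 thus "cob 0 (cross y)"
  unfolding cob_def using b(1) by (intro exI[of _ "%_. b"]) (auto simp: tup_Suc tup_0)
qed

lemma coc_const: "a \<in> A ==> t a = a ==> coc 0 (%_. a)"
proof -
 assume a: "a \<in> A" "t a = a"
 have "act x a = a" if "x \<in> C" for x
 proof -
  have "act (int (s * i)) a = a" for i
  proof (induction i)
   case (Suc i)
   have "(\<gamma> ^^ (s * Suc i)) a = (\<gamma> ^^ s) ((\<gamma> ^^ (s * i)) a)" by (simp add: funpow_add)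
   thus ?case using Suc a(2) unfolding cyc_act_def nat_int by simp
  qed (simp add: act_0)
  thus ?thesis using C_cases[OF that] by blast
 qed
 thus ?thesis unfolding coc_def using a(1) by (auto simp: tup_Suc tup_0 bar_diff_def)
qed

lemma coc_carry_pow: "coc m f ==> coc (2 * k + m) ((carry ^^ k) f)"
 by (induction k) (simp_all add: coc_carry)

lemma cob_carry_pow: "cob m f ==> cob (2 * k + m) ((carry ^^ k) f)"
 by (induction k) (simp_all add: cob_carry)

lemma cob_carry_powD: "cob (2 * k + m) ((carry ^^ k) f) ==> cob m f"
 by (induction k) (auto dest: cob_carryD)

lemma carry_pow_diff: "(carry ^^ k) (%gs. f gs - f' gs) = (%gs. (carry ^^ k) f gs - (carry ^^ k) f' gs)"
 by (induction k) (simp_all add: carry_diff[abs_def])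

lemma even_cob:
 assumes "a \<in> A" "t a = a"
 shows "cob (2 * k + 1) ((carry ^^ Suc k) (%_. a)) <-> (EX b:A. a = nrm b)"
 using cob_carry_0[OF assms] cob_carry_pow[of 1 _ k] cob_carry_powD[of k 1]
 by (auto simp: funpow_Suc_right simp del: funpow.simps)

lemma odd_cob: "cob (2 * k) ((carry ^^ k) (cross y)) <-> (EX b:A. y = t b - b)"
 using cob_cross cob_carry_pow[of 0 _ k] cob_carry_powD[of k 0] by (metis add_0_right)

text \<open>Applying \<open>kap\<close> k times lowers the degree to the one where P gives a
  representative; \<open>reduce\<close> and \<open>cob_carry\<close> carry it back up.\<close>

lemma coc_rep:
 assumes P: "!!f. coc (Suc (Suc m)) f ==> EX u. Q u & cob (Suc m) (%gs. f gs - F u gs)"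
  and f: "coc (2 * k + Suc (Suc m)) f"
 shows "EX u. Q u & cob (2 * k + Suc m) (%gs. f gs - (carry ^^ k) (F u) gs)"
 using f
proof (induction k arbitrary: f)
 case (Suc k)
 hence "coc (2 * k + Suc (Suc m)) (kap f)" using coc_kap by simp
 from Suc.IH[OF this] obtain u where u: "Q u"
  "cob (2 * k + Suc m) (%gs. kap f gs - (carry ^^ k) (F u) gs)" by blast
 have "cob (2 * Suc k + Suc m) (%gs. carry (kap f) gs - carry ((carry ^^ k) (F u)) gs)"
  using cob_carry[OF u(2)] by (simp add: carry_diff[abs_def])
 moreover have "cob (2 * Suc k + Suc m) (%gs. f gs - carry (kap f) gs)"
  using reduce[of "2 * k + Suc (Suc m)" f] Suc.prems by simp
 from cob_add[OF calculation this]
 have "cob (2 * Suc k + Suc m) (%gs. f gs - (carry ^^ Suc k) (F u) gs)" by simp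
 thus ?case using u(1) by blast
qed (use P in auto)

lemma even_rep:
 assumes "coc (2 * k + 2) f"
 shows "EX a:A. t a = a & cob (2 * k + 1) (%gs. f gs - (carry ^^ Suc k) (%_. a) gs)"
proof -
 have "EX a. (a \<in> A & t a = a) & cob (Suc 0) (%gs. f gs - carry (%_. a) gs)"
  if f: "coc (Suc (Suc 0)) f" for f
 proof -
  have k: "coc 0 (kap f)" by (rule coc_kap[OF f])
  have "carry (kap f) gs = carry (%_. kap f []) gs" if "tup (Suc (Suc 0)) gs" for gs
   using that by (auto simp: tup_Suc tup_0)
  hence "cob (Suc 0) (%gs. f gs - carry (%_. kap f []) gs)"
   using cob_cong[OF reduce[OF f]] by simp
  moreover have "kap f [] \<in> A" "t (kap f []) = kap f []"
   using k C_s unfolding coc_def by (auto simp: tup_Suc tup_0 bar_diff_def)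
  ultimately show ?thesis by blast
 qed
 from coc_rep[OF this, of k f] assms show ?thesis
  by (auto simp: funpow_Suc_right simp del: funpow.simps)
qed

lemma odd_rep:
 assumes "coc (2 * k + 1) f"
 shows "EX y:A. nrm y = 0 & cob (2 * k) (%gs. f gs - (carry ^^ k) (cross y) gs)"
 using assms
proof (induction k arbitrary: f)
 case 0
 hence f: "coc 1 f" by simp
 have "cob 0 (%gs. f gs - cross (f [int s]) gs)"
  using coc_1(3)[OF f] by (intro cob_zero) simp
 thus ?case using coc_1[OF f] by auto
next
 case (Suc k)
 hence "coc (2 * k + 1) (kap f)" using coc_kap by simp
 from Suc.IH[OF this] obtain y where y: "y \<in> A" "nrm y = 0"
  "cob (2 * k) (%gs. kap f gs - (carry ^^ k) (cross y) gs)" by blast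
 have "cob (2 * Suc k) (%gs. carry (kap f) gs - carry ((carry ^^ k) (cross y)) gs)"
  using cob_carry[OF y(3)] by (simp add: carry_diff[abs_def])
 moreover have "cob (2 * Suc k) (%gs. f gs - carry (kap f) gs)"
  using reduce[of "2 * k + 1" f] Suc.prems by simp
 from cob_add[OF calculation this]
 have "cob (2 * Suc k) (%gs. f gs - (carry ^^ Suc k) (cross y) gs)" by simp
 thus ?case using y(1,2) by blast
qed

lemma cocycles_iff:
 "f \<in> cocycles G act m A <-> coc m f & (ALL gs. ~ tup m gs --> f gs = 0)"
 unfolding cocycles_def cochains_def coc_def fun_eq_iff
 by (auto simp: cobmap_bar[OF mult_G] tup_def)

lemma coboundaries_iff:
 "f \<in> coboundaries G act (Suc m) A <-> cob m f & (ALL gs. ~ tup (Suc m) gs --> f gs = 0)"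
proof
 assume "f \<in> coboundaries G act (Suc m) A"
 then obtain z where z: "z \<in> cochains G m A" "f = coboundary_map G act m z" by auto
 thus "cob m f & (ALL gs. ~ tup (Suc m) gs --> f gs = 0)"
  unfolding cob_def cochains_def
  by (auto simp: cobmap_bar[OF mult_G] tup_def intro!: exI[of _ z])
next
 assume f: "cob m f & (ALL gs. ~ tup (Suc m) gs --> f gs = 0)"
 then obtain z where z: "!!hs. tup m hs ==> z hs \<in> A" "!!gs. tup (Suc m) gs ==> f gs = d z gs"
  unfolding cob_def by blast
 define z' where "z' = (%gs. if tup m gs then z gs else 0)"
 have "f = coboundary_map G act m z'"
 proof
  fix gs
  show "f gs = coboundary_map G act m z' gs"
  proof (cases "tup (Suc m) gs")
   case True
   have "d z gs = d z' gs" by (rule d_cong[OF True]) (simp add: z'_def)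
   thus ?thesis using True z(2)[OF True]
    by (simp add: cobmap_bar[OF mult_G] tup_def)
  next
   case False
   thus ?thesis using f by (auto simp: cobmap_bar[OF mult_G] tup_def)
  qed
 qed
 moreover have "z' \<in> cochains G m A"
  unfolding cochains_def z'_def using z(1) by (auto simp: tup_def)
 ultimately show "f \<in> coboundaries G act (Suc m) A" by auto
qed

lemma cob_coc: "cob m f ==> coc (Suc m) f"
 unfolding cob_def coc_def using d_A d_cong d_d by (metis (no_types, lifting))

end

subsection \<open>A basis of the polynomial ring\<close>

lemma UNIV_9: "(UNIV :: 9 set) = {0, 1, 2, 3, 4, 5, 6, 7, 8}"
proof -
 have "card {0, 1, 2, 3, 4, 5, 6, 7, 8 :: 9} = CARD(9)" by simp
 thus ?thesis by (metis card_subset_eq finite_UNIV_card_ge_0 finite subset_UNIV)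
qed

definition degm :: "mono => nat" where
 "degm m = (SUM i:UNIV. lookup m i)"

definition lin :: "(mono => 'w => 'v) => 'w::comm_ring_1 poly9 => 'v::ab_group_add" where
 "lin f p = (SUM m:keys p. f m (lookup p m))"

lemma lin_superset:
 assumes "!!m. f m 0 = 0" "finite X" "keys p <= X"
 shows "lin f p = (SUM m:X. f m (lookup p m))"
 unfolding lin_def using assms by (intro sum.mono_neutral_left) (auto simp: in_keys_iff)

lemma lin_add:
 assumes "!!m a b. f m (a + b) = f m a + f m b"
 shows "lin f (p + q) = lin f p + lin f q"
proof -
 have 0: "f m 0 = 0" for m using assms[of m 0 0] by simp
 let ?X = "keys p \<union> keys q"
 have s: "lin f r = (SUM m:?X. f m (lookup r m))" if "keys r <= ?X" for r
  using that 0 by (intro lin_superset) auto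
 show ?thesis
  using s[of "p + q"] s[of p] s[of q] Poly_Mapping.keys_add[of p q]
  by (simp add: lookup_add assms sum.distrib)
qed

lemma lin_single:
 assumes "!!m. f m 0 = 0"
 shows "lin f (single m w) = f m w"
 using lin_superset[of f "{m}" "single m w"] assms by simp

lemma pconst_add: "pconst (a + b) = pconst a + pconst b"
 and pconst_mult: "pconst (a * b) = pconst a * pconst b"
 and pconst_0: "pconst 0 = 0" and pconst_1: "pconst 1 = 1"
 by (simp_all add: pconst_def single_add mult_single)

lemma pconst_minus: "pconst (- a) = - pconst a"
 by (simp add: pconst_def single_uminus)

lemma pconst_single: "pconst w * single m v = single m (w * v)"
 by (simp add: pconst_def mult_single)

text \<open>Over W[xyz] the ring W[x, y, z]/(x + y + z) is free on 1, x, y and the orbits of e2^a xy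
  and e2^a x^2 y. The Hilbert series fit because (1 + 2t)(1 - t^2) + 3t^2 + 3t^3 = (1 + t)(1 + t +
  t^2).\<close>

fun letr :: "'a::comm_ring_1 => 'a => 'a => letter => 'a" where
 "letr x y z One = 1"
| "letr x y z LX = x"
| "letr x y z LY = y"
| "letr x y z (Fr a False Z0) = (x * y + y * z + z * x) ^ a * (x * y)"
| "letr x y z (Fr a False Z1) = (x * y + y * z + z * x) ^ a * (y * z)"
| "letr x y z (Fr a False Z2) = (x * y + y * z + z * x) ^ a * (z * x)"
| "letr x y z (Fr a True Z0) = (x * y + y * z + z * x) ^ a * (x * x * y)"
| "letr x y z (Fr a True Z1) = (x * y + y * z + z * x) ^ a * (y * y * z)"
| "letr x y z (Fr a True Z2) = (x * y + y * z + z * x) ^ a * (z * z * x)"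

fun dbr :: "'a::comm_ring_1 => 'a => 'a => dbasis => 'a" where
 "dbr d1 d2 d3 B1 = 1"
| "dbr d1 d2 d3 Bd1 = d1"
| "dbr d1 d2 d3 Bd2 = d2"
| "dbr d1 d2 d3 Bd12 = d1 * d2"
| "dbr d1 d2 d3 Bd23 = d2 * d3"
| "dbr d1 d2 d3 Bu = d1 * d1 * d2"

definition letp :: "9 => letter => 'w::comm_ring_1 poly9" where
 "letp i = letr (pvar i) (pvar (i + 3)) (pvar (i + 6))"

definition dbp :: "dbasis => 'w::comm_ring_1 poly9" where
 "dbp = dbr (d_poly 0) (d_poly 1) (d_poly 2)"

definition e1p :: "9 => 'w::comm_ring_1 poly9" where
 "e1p i = pvar i + pvar (i + 3) + pvar (i + 6)"

definition e2p :: "9 => 'w::comm_ring_1 poly9" where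
 "e2p i = pvar i * pvar (i + 3) + pvar (i + 3) * pvar (i + 6) + pvar (i + 6) * pvar i"

definition s3_poly :: "'w::comm_ring_1 poly9" where
 "s3_poly = d_poly 0 * d_poly 1 * d_poly 2"

text \<open>The last three exponents belong to x_i + x_(i+3) + x_(i+6), which vanish in M. They are
  kept so that labels index a basis of the full polynomial ring and can be counted against
  monomials.\<close>

datatype label = Label (la1: letter) (la2: letter) (la3: letter) (lae: dbasis) (lai: nat) (laj: nat)
 (lak: nat) (lac1: nat) (lac2: nat) (lac3: nat)

definition labp :: "label => 'w::comm_ring_1 poly9" where
 "labp l = e1p 0 ^ lac1 l * e1p 1 ^ lac2 l * e1p 2 ^ lac3 l * s3_poly ^ lak l * s1_poly ^ lai l * s2_poly ^ laj l
   * dbp (lae l) * letp 0 (la1 l) * letp 1 (la2 l) * letp 2 (la3 l)"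

fun let_deg :: "letter => nat" where
 "let_deg One = 0" | "let_deg LX = 1" | "let_deg LY = 1"
| "let_deg (Fr a v z) = 2 * a + (if v then 3 else 2)"

fun db_deg :: "dbasis => nat" where
 "db_deg B1 = 0" | "db_deg Bd1 = 3" | "db_deg Bd2 = 3" | "db_deg Bd12 = 6" | "db_deg Bd23 = 6" | "db_deg Bu = 9"

definition lab_deg :: "label => nat" where
 "lab_deg l = lac1 l + lac2 l + lac3 l + 9 * lak l + 3 * lai l + 6 * laj l + db_deg (lae l)
   + let_deg (la1 l) + let_deg (la2 l) + let_deg (la3 l)"

text \<open>Labels correspond to monomials of the same degree: the letter with codes \<open>i < 3\<close> and \<open>j\<close> stands
 for a monomial \<open>x\<^sup>i y\<^sup>j\<close>, and the exponents of \<open>d\<^sub>1\<close>, \<open>d\<^sub>2\<close>, \<open>s\<^sub>1\<close>, \<open>s\<^sub>2\<close>, \<open>s\<^sub>3\<close> are added to those of the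
 \<open>x\<close>'s after multiplication by 3, 3, 3, 6, 9.\<close>

fun lx :: "letter => nat" where
 "lx One = 0" | "lx LX = 1" | "lx LY = 0"
| "lx (Fr a False Z0) = 1" | "lx (Fr a False Z1) = 2" | "lx (Fr a False Z2) = 0"
| "lx (Fr a True Z0) = 2" | "lx (Fr a True Z1) = 1" | "lx (Fr a True Z2) = 0"

fun ly :: "letter => nat" where
 "ly One = 0" | "ly LX = 0" | "ly LY = 1"
| "ly (Fr a False Z0) = 2 * a + 1" | "ly (Fr a False Z1) = 2 * a" | "ly (Fr a False Z2) = 2 * a + 2"
| "ly (Fr a True Z0) = 2 * a + 1" | "ly (Fr a True Z1) = 2 * a + 2" | "ly (Fr a True Z2) = 2 * a + 3"

definition let_dec :: "nat => nat => letter" where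
 "let_dec i j =
   (if i = 0 then (if j = 0 then One else if j = 1 then LY else if even j then Fr (j div 2 - 1) False Z2
    else Fr (j div 2 - 1) True Z2)
   else if i = 1 then (if j = 0 then LX else if odd j then Fr (j div 2) False Z0 else Fr (j div 2 - 1) True Z1)
   else (if even j then Fr (j div 2) False Z1 else Fr (j div 2) True Z0))"

fun dx :: "dbasis => nat" where
 "dx B1 = 0" | "dx Bd1 = 1" | "dx Bd2 = 0" | "dx Bd12 = 1" | "dx Bd23 = 2" | "dx Bu = 2"

fun dy :: "dbasis => nat" where
 "dy B1 = 0" | "dy Bd1 = 0" | "dy Bd2 = 1" | "dy Bd12 = 1" | "dy Bd23 = 0" | "dy Bu = 1"

definition db_dec :: "nat => nat => dbasis" where
 "db_dec i j = (if j = 0 then (if i = 0 then B1 else if i = 1 then Bd1 else Bd23)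
   else (if i = 0 then Bd2 else if i = 1 then Bd12 else Bu))"

lemma letter_cases9:
 obtains "l = One" | "l = LX" | "l = LY" | a where "l = Fr a False Z0" | a where "l = Fr a False Z1"
  | a where "l = Fr a False Z2" | a where "l = Fr a True Z0" | a where "l = Fr a True Z1"
  | a where "l = Fr a True Z2"
proof (cases l)
 case (Fr a v z)
 thus ?thesis using that by (cases v; cases z) auto
qed (use that in auto)

lemma let_dec_code: "let_dec (lx l) (ly l) = l" "lx l < 3" "lx l + ly l = let_deg l"
 by (cases l rule: letter_cases9; simp add: let_dec_def)+

lemma lx_let_dec: "i < 3 ==> let_deg (let_dec i j) = i + j"
 unfolding let_dec_def by (auto elim!: evenE oddE)

lemma db_dec_code: "db_dec (dx e) (dy e) = e" "dx e < 3" "dy e < 2" "3 * dx e + 3 * dy e = db_deg e"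
 by (cases e; simp add: db_dec_def)+

lemma dx_db_dec: "i < 3 ==> j < 2 ==> db_deg (db_dec i j) = 3 * i + 3 * j"
 by (auto simp: db_dec_def)

definition mono_of :: "(9 => nat) => mono" where
 "mono_of = Abs_poly_mapping"

lemma lookup_mono_of: "lookup (mono_of f) = f"
 unfolding mono_of_def by (rule Abs_poly_mapping_inverse) simp

definition ldec :: "mono => label" where
 "ldec m = (let f = lookup m in
   Label (let_dec (f 0 mod 3) (f 3)) (let_dec (f 1 mod 3) (f 4)) (let_dec (f 2 mod 3) (f 5))
    (db_dec (f 0 div 3 mod 3) (f 1 div 3 mod 2)) (f 2 div 3) (f 1 div 6) (f 0 div 9) (f 6) (f 7) (f 8))"

definition lab_code :: "label => mono" where
 "lab_code l = mono_of (%i. if i = 0 then lx (la1 l) + 3 * dx (lae l) + 9 * lak l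
   else if i = 1 then lx (la2 l) + 3 * dy (lae l) + 6 * laj l
   else if i = 2 then lx (la3 l) + 3 * lai l
   else if i = 3 then ly (la1 l) else if i = 4 then ly (la2 l) else if i = 5 then ly (la3 l)
   else if i = 6 then lac1 l else if i = 7 then lac2 l else lac3 l)"

lemma lab_dec_code: "ldec (lab_code l) = l"
proof -
 have d: "x div 9 = x div 3 div 3" "x div 6 = x div 3 div 2" for x :: nat
  by (simp_all flip: div_mult2_eq)
 have a: "(x + 3 * y + 9 * z) mod 3 = x" "(x + 3 * y + 9 * z) div 3 mod 3 = y"
  "(x + 3 * y + 9 * z) div 9 = z" if "x < 3" "y < 3" for x y z :: nat
 proof -
  have *: "x + 3 * y + 9 * z = x + 3 * (y + 3 * z)" by simp
  have **: "(x + 3 * (y + 3 * z)) div 3 = y + 3 * z" using that by (subst div_mult_self2) auto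
  show "(x + 3 * y + 9 * z) mod 3 = x" "(x + 3 * y + 9 * z) div 3 mod 3 = y"
   "(x + 3 * y + 9 * z) div 9 = z" unfolding d * ** mod_mult_self2 using that by simp_all
 qed
 have b: "(x + 3 * y + 6 * z) mod 3 = x" "(x + 3 * y + 6 * z) div 3 mod 2 = y"
  "(x + 3 * y + 6 * z) div 6 = z" if "x < 3" "y < 2" for x y z :: nat
 proof -
  have *: "x + 3 * y + 6 * z = x + 3 * (y + 2 * z)" by simp
  have **: "(x + 3 * (y + 2 * z)) div 3 = y + 2 * z" using that by (subst div_mult_self2) auto
  show "(x + 3 * y + 6 * z) mod 3 = x" "(x + 3 * y + 6 * z) div 3 mod 2 = y"
   "(x + 3 * y + 6 * z) div 6 = z" unfolding d * ** mod_mult_self2 using that by simp_all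
 qed
 have c: "(x + 3 * z) mod 3 = x" "(x + 3 * z) div 3 = z" if "x < 3" for x z :: nat
  using that by simp_all
 have e: "(lx l + 3 * dx e) div 9 = 0" "(lx l + 3 * dy e) div 6 = 0" for l e
  using let_dec_code(2)[of l] db_dec_code(2,3)[of e] by auto
 show ?thesis
  by (cases l) (simp add: ldec_def lab_code_def lookup_mono_of Let_def a b c e let_dec_code db_dec_code)
qed

lemma degm_expand: "degm m = lookup m 0 + lookup m 1 + lookup m 2
  + lookup m 3 + lookup m 4 + lookup m 5
  + lookup m 6 + lookup m 7 + lookup m 8"
 unfolding degm_def UNIV_9 by (simp add: add_ac)

lemma lab_deg_dec: "lab_deg (ldec m) = degm m"
proof -
 have c: "3 * (x div 3) + x mod 3 = x" for x :: nat by simp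
 have a: "3 * (x div 3 mod 3) + 9 * (x div 9) + x mod 3 = x" for x :: nat
 proof -
  have "x div 9 = x div 3 div 3" by (simp flip: div_mult2_eq)
  thus ?thesis using c[of "x div 3"] c[of x] by linarith
 qed
 have b: "3 * (x div 3 mod 2) + 6 * (x div 6) + x mod 3 = x" for x :: nat
 proof -
  have "x div 6 = x div 3 div 2" by (simp flip: div_mult2_eq)
  moreover have "2 * (x div 3 div 2) + x div 3 mod 2 = x div 3" by simp
  ultimately show ?thesis using c[of x] by linarith
 qed
 show ?thesis
  unfolding degm_expand lab_deg_def ldec_def Let_def label.sel
  using a[of "lookup m 0"] b[of "lookup m 1"] c[of "lookup m 2"]
  by (subst lx_let_dec, simp, subst lx_let_dec, simp, subst lx_let_dec, simp, subst dx_db_dec, simp, simp, linarith)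
qed

text \<open>A degree-preserving endomorphism that puts the claimed basis elements in the place of
  the monomials; they form a basis if and only if it is bijective.\<close>

definition expand :: "'w::comm_ring_1 poly9 => 'w poly9" where
 "expand = lin (%m w. pconst w * labp (ldec m))"

lemma expand_add: "expand (p + q) = expand p + expand q"
 unfolding expand_def by (rule lin_add) (simp add: pconst_add distrib_right)

lemma expand_single: "expand (single m w) = pconst w * labp (ldec m)"
 unfolding expand_def by (rule lin_single) (simp add: pconst_0)

lemma expand_0: "expand 0 = 0"
 using expand_add[of 0 0] by simp

lemma expand_pconst: "expand (pconst w * p) = pconst w * expand p"
 by (induction p rule: poly9_induct)
   (simp_all add: expand_0 pconst_single expand_single pconst_mult mult.assoc distrib_left expand_add)

lemma expand_minus: "expand (- p) = - expand p"
 using expand_add[of p "- p"] by (simp add: expand_0 eq_neg_iff_add_eq_0 add.commute)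

lemma expand_code: "expand (single (lab_code l) w) = pconst w * labp l"
 by (simp add: expand_single lab_dec_code)

section \<open>The products indexed by labels span\<close>

definition rng :: "'w::comm_ring_1 poly9 set" where
 "rng = range expand"

lemma rng_0: "0 \<in> rng" and rng_add: "p \<in> rng ==> q \<in> rng ==> p + q \<in> rng"
 and rng_minus: "p \<in> rng ==> - p \<in> rng" and rng_pconst: "p \<in> rng ==> pconst w * p \<in> rng"
 and rng_lab: "labp l \<in> rng"
proof -
 show "0 \<in> rng" unfolding rng_def by (rule image_eqI[of _ _ 0]) (simp_all add: expand_0)
 show "p \<in> rng ==> q \<in> rng ==> p + q \<in> rng" by (auto simp: rng_def expand_add[symmetric])
 show "p \<in> rng ==> - p \<in> rng" by (auto simp: rng_def expand_minus[symmetric])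
 show "p \<in> rng ==> pconst w * p \<in> rng" by (auto simp: rng_def expand_pconst[symmetric])
 show "labp l \<in> rng" unfolding rng_def
  by (rule image_eqI[of _ _ "single (lab_code l) 1"]) (simp_all add: expand_code pconst_1)
qed

lemma rng_diff: "p \<in> rng ==> q \<in> rng ==> p - q \<in> rng"
 using rng_add[of p "- q"] rng_minus[of q] by simp

lemma rng_mult:
 assumes "!!l. f * labp l \<in> rng" "p \<in> rng"
 shows "f * p \<in> rng"
proof -
 have "f * expand q \<in> rng" for q
 proof (induction q rule: poly9_induct)
  case (2 m w)
  have "f * expand (single m w) = pconst w * (f * labp (ldec m))"
   by (simp add: expand_single alg)
  thus ?case using assms(1) rng_pconst by metis
 qed (auto simp: expand_0 rng_0 expand_add distrib_left rng_add)
 thus ?thesis using assms(2) by (auto simp: rng_def)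
qed

lemma lab_poly_Suc:
 "s1_poly * labp (Label a b c e i j k c1 c2 c3) = labp (Label a b c e (Suc i) j k c1 c2 c3)"
 "s2_poly * labp (Label a b c e i j k c1 c2 c3) = labp (Label a b c e i (Suc j) k c1 c2 c3)"
 "s3_poly * labp (Label a b c e i j k c1 c2 c3) = labp (Label a b c e i j (Suc k) c1 c2 c3)"
 "e1p 0 * labp (Label a b c e i j k c1 c2 c3) = labp (Label a b c e i j k (Suc c1) c2 c3)"
 "e1p 1 * labp (Label a b c e i j k c1 c2 c3) = labp (Label a b c e i j k c1 (Suc c2) c3)"
 "e1p 2 * labp (Label a b c e i j k c1 c2 c3) = labp (Label a b c e i j k c1 c2 (Suc c3))"
 by (simp_all add: labp_def mult_ac)

lemma rng_s: "p \<in> rng ==> s1_poly * p \<in> rng" "p \<in> rng ==> s2_poly * p \<in> rng"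
 "p \<in> rng ==> s3_poly * p \<in> rng" "p \<in> rng ==> e1p 0 * p \<in> rng"
 "p \<in> rng ==> e1p 1 * p \<in> rng" "p \<in> rng ==> e1p 2 * p \<in> rng"
proof -
 have l: "s1_poly * labp l \<in> rng" "s2_poly * labp l \<in> rng" "s3_poly * labp l \<in> rng"
  "e1p 0 * labp l \<in> rng" "e1p 1 * labp l \<in> rng" "e1p 2 * labp l \<in> rng" for l
  by (cases l; simp add: lab_poly_Suc rng_lab)+
 show "p \<in> rng ==> s1_poly * p \<in> rng" by (rule rng_mult[OF l(1)])
 show "p \<in> rng ==> s2_poly * p \<in> rng" by (rule rng_mult[OF l(2)])
 show "p \<in> rng ==> s3_poly * p \<in> rng" by (rule rng_mult[OF l(3)])
 show "p \<in> rng ==> e1p 0 * p \<in> rng" by (rule rng_mult[OF l(4)])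
 show "p \<in> rng ==> e1p 1 * p \<in> rng" by (rule rng_mult[OF l(5)])
 show "p \<in> rng ==> e1p 2 * p \<in> rng" by (rule rng_mult[OF l(6)])
qed

text \<open>X collects the other factors of a basis element, so that a single slot can be rewritten
  at a time. The rewriting costs only factors s1 and s2, under which the range is closed.\<close>

lemma rng_dbp_gamma:
 assumes "!!e. X * dbp e \<in> rng"
 shows "X * dbr (d_poly 1) (d_poly 2) (d_poly 0) e \<in> rng"
proof -
 define a b c :: "'a poly9" where "a = d_poly 0" "b = d_poly 1" "c = d_poly 2"
 have A: "X * dbr a b c e \<in> rng" for e using assms[of e] by (simp add: dbp_def a_b_c_def)
 have s: "s1_poly = a + b + c" "s2_poly = a * b + b * c + c * a"
  by (simp_all add: a_b_c_def s1_poly_def s2_poly_def)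
 have 2: "X * c = s1_poly * (X * dbr a b c B1) - X * dbr a b c Bd1 - X * dbr a b c Bd2"
  "X * (c * a) = s2_poly * (X * dbr a b c B1) - X * dbr a b c Bd12 - X * dbr a b c Bd23"
  "X * (b * b * c) = X * dbr a b c Bu + s2_poly * (X * dbr a b c Bd2) - s1_poly * (X * dbr a b c Bd12)"
  unfolding s by (simp_all add: alg)
 have "X * dbr b c a e \<in> rng"
 proof (cases e)
  case B1 thus ?thesis using A[of B1] by simp
 next
  case Bd1
  show ?thesis unfolding Bd1 using A[of Bd2] by (simp only: dbr.simps)
 next
  case Bd2
  show ?thesis unfolding Bd2 dbr.simps(3) by (subst 2(1)) (intro rng_diff rng_s A)
 next
  case Bd12 thus ?thesis using A[of Bd23] by simp
 next
  case Bd23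
  show ?thesis unfolding Bd23 dbr.simps(5) by (subst 2(2)) (intro rng_diff rng_s A)
 next
  case Bu
  show ?thesis unfolding Bu dbr.simps(6) by (subst 2(3)) (intro rng_diff rng_add rng_s A)
 qed
 thus ?thesis by (simp add: a_b_c_def)
qed

lemma rng_letp_gamma:
 assumes "!!l. X * letp 0 l \<in> rng"
 shows "X * letr (pvar 3) (pvar 6) (pvar 0) l \<in> rng"
proof -
 define x y z :: "'a poly9" where "x = pvar 0" "y = pvar 3" "z = pvar 6"
 have A: "X * letr x y z l \<in> rng" for l using assms[of l] by (simp add: letp_def x_y_z_def)
 have e: "e1p 0 = x + y + z" by (simp add: e1p_def x_y_z_def)
 have 1: "X * z = e1p 0 * (X * letr x y z One) - X * letr x y z LX - X * letr x y z LY"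
  unfolding e by (simp add: alg)
 have e2: "y * z + z * x + x * y = x * y + y * z + z * x" by simp
 have F: "letr y z x (Fr a v Z0) = letr x y z (Fr a v Z1)" "letr y z x (Fr a v Z1) = letr x y z (Fr a v Z2)"
  "letr y z x (Fr a v Z2) = letr x y z (Fr a v Z0)" for a v
  by (cases v; simp add: e2)+
 have "X * letr y z x l \<in> rng"
 proof (cases l rule: letter_cases)
  case 1 thus ?thesis using A[of One] by simp
 next
  case 2
  show ?thesis unfolding 2 using A[of LY] by (simp only: letr.simps)
 next
  case 3
  show ?thesis unfolding 3 letr.simps(3) by (subst 1) (intro rng_diff rng_s A)
 qed (simp_all only: F A)
 thus ?thesis by (simp add: x_y_z_def)
qed

text \<open>The cubic equation of d1 over the symmetric polynomials and d1 d2 d3 = s3 bring the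
  products back to the six basis elements.\<close>

lemma dbp_deriv:
 assumes "!!e. X * dbp e \<in> rng"
 shows "X * (d_poly 0 * dbp e) \<in> rng"
proof -
 define a b c :: "'a poly9" where "a = d_poly 0" "b = d_poly 1" "c = d_poly 2"
 have A: "X * dbr a b c e \<in> rng" for e using assms[of e] by (simp add: dbp_def a_b_c_def)
 have s: "s1_poly = a + b + c" "s2_poly = a * b + b * c + c * a" "s3_poly = a * b * c"
  by (simp_all add: a_b_c_def s1_poly_def s2_poly_def s3_poly_def)
 have "X * (a * dbr a b c e) \<in> rng"
 proof (cases e)
  case B1
  have "X * (a * dbr a b c B1) = X * dbr a b c Bd1" by simp
  thus ?thesis unfolding B1 using A by metis
 next
  case Bd1
  have "X * (a * dbr a b c Bd1) = s1_poly * (X * dbr a b c Bd1) - s2_poly * (X * dbr a b c B1) + X * dbr a b c Bd23"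
   unfolding s by (simp add: alg)
  thus ?thesis unfolding Bd1 by (simp only:) (intro rng_diff rng_add rng_s A)
 next
  case Bd2
  have "X * (a * dbr a b c Bd2) = X * dbr a b c Bd12" by simp
  thus ?thesis unfolding Bd2 using A by metis
 next
  case Bd12
  have "X * (a * dbr a b c Bd12) = X * dbr a b c Bu" by (simp add: mult.assoc)
  thus ?thesis unfolding Bd12 using A by metis
 next
  case Bd23
  have "X * (a * dbr a b c Bd23) = s3_poly * (X * dbr a b c B1)" unfolding s by (simp add: alg)
  thus ?thesis unfolding Bd23 by (simp only:) (intro rng_s A)
 next
  case Bu
  have "X * (a * dbr a b c Bu) = s1_poly * (X * dbr a b c Bu) - s2_poly * (X * dbr a b c Bd12)
    + s3_poly * (X * dbr a b c Bd2)"
   unfolding s by (simp add: alg)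
  thus ?thesis unfolding Bu by (simp only:) (intro rng_diff rng_add rng_s A)
 qed
 thus ?thesis by (simp add: a_b_c_def dbp_def)
qed

text \<open>The letters 1, x, y carry no power of e2. Positive powers come from free letters:
  e2^(a+1) is the sum of the orbit of e2^a xy, and its products with x and y use the orbit of e2^a
  x^2 y and multiples of e1.\<close>

lemma letp_eps:
 assumes "!!l. X * letp 0 l \<in> rng"
 shows "X * e2p 0 ^ a \<in> rng" "X * (e2p 0 ^ a * pvar 0) \<in> rng" "X * (e2p 0 ^ a * pvar 3) \<in> rng"
proof -
 define x y z :: "'a poly9" where "x = pvar 0" "y = pvar 3" "z = pvar 6"
 have A: "X * letr x y z l \<in> rng" for l using assms[of l] by (simp add: letp_def x_y_z_def)
 define q where "q = x * y + y * z + z * x"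
 have e: "e1p 0 = x + y + z" by (simp add: e1p_def x_y_z_def)
 have "X * q ^ a \<in> rng & X * (q ^ a * x) \<in> rng & X * (q ^ a * y) \<in> rng"
 proof (cases a)
  case 0
  thus ?thesis using A[of One] A[of LX] A[of LY] by simp
 next
  case (Suc a)
  have "X * q ^ Suc a = X * letr x y z (Fr a False Z0) + X * letr x y z (Fr a False Z1) + X * letr x y z (Fr a False Z2)"
   "X * (q ^ Suc a * x) = X * letr x y z (Fr a True Z0) + e1p 0 * (X * letr x y z (Fr a False Z2)) - X * letr x y z (Fr a True Z2)"
   "X * (q ^ Suc a * y) = X * letr x y z (Fr a True Z1) + e1p 0 * (X * letr x y z (Fr a False Z0)) - X * letr x y z (Fr a True Z0)"
   unfolding letr.simps q_def[symmetric] power_Suc by (simp_all add: q_def e alg)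
  thus ?thesis unfolding Suc by (simp only:) (intro conjI rng_diff rng_add rng_s A)
 qed
 thus "X * e2p 0 ^ a \<in> rng" "X * (e2p 0 ^ a * pvar 0) \<in> rng" "X * (e2p 0 ^ a * pvar 3) \<in> rng"
  by (simp_all add: e2p_def q_def x_y_z_def)
qed

text \<open>A product x yz equals d and leaves the block for the factor in d1, d2, d3. The second
  hypothesis provides the room for it.\<close>

lemma letp_pvar:
 assumes "!!l. X * letp 0 l \<in> rng" "!!l. X * d_poly 0 * letp 0 l \<in> rng"
 shows "X * (pvar 0 * letp 0 l) \<in> rng"
proof -
 define x y z :: "'a poly9" where "x = pvar 0" "y = pvar 3" "z = pvar 6"
 define q d where "q = x * y + y * z + z * x" and "d = x * y * z"
 have A: "X * letr x y z l \<in> rng" for l using assms(1)[of l] by (simp add: letp_def x_y_z_def)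
 have e: "e1p 0 = x + y + z" by (simp add: e1p_def x_y_z_def)
 have dd: "d_poly 0 = d" by (simp add: d_poly_def x_y_z_def d_def)
 have E: "X * (q ^ a) \<in> rng" "X * (q ^ a * x) \<in> rng" "X * (q ^ a * y) \<in> rng" for a
  using letp_eps[OF assms(1), of a] by (simp_all add: e2p_def q_def x_y_z_def)
 have D: "X * d * (q ^ a) \<in> rng" "X * d * (q ^ a * x) \<in> rng" "X * d * (q ^ a * y) \<in> rng" for a
  using letp_eps[OF assms(2), of a] by (simp_all add: e2p_def q_def x_y_z_def d_def d_poly_def)
 have "X * (x * letr x y z l) \<in> rng"
 proof (cases l rule: letter_cases9)
  case 1 thus ?thesis using A[of LX] by simp
 next
  case 2
  have "X * (x * letr x y z l) = e1p 0 * (X * letr x y z LX) - X * letr x y z (Fr 0 False Z0) - X * letr x y z (Fr 0 False Z2)"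
   unfolding 2 by (simp add: e alg)
  thus ?thesis by (simp only:) (intro rng_diff rng_s A)
 next
  case 3
  have "X * (x * letr x y z l) = X * letr x y z (Fr 0 False Z0)" unfolding 3 by simp
  thus ?thesis using A by metis
 next
  case (4 a)
  have "X * (x * letr x y z l) = X * letr x y z (Fr a True Z0)" unfolding 4 by (simp add: mult_ac)
  thus ?thesis using A by metis
 next
  case (5 a)
  have "X * (x * letr x y z l) = X * d * q ^ a" unfolding 5 by (simp add: d_def q_def mult_ac)
  thus ?thesis using D by metis
 next
  case (6 a)
  have "X * (x * letr x y z l) = e1p 0 * (X * letr x y z (Fr a False Z2)) - X * d * q ^ a - X * letr x y z (Fr a True Z2)"
   unfolding 6 letr.simps q_def[symmetric] by (simp add: d_def e alg)
  thus ?thesis by (simp only:) (intro rng_diff rng_s A D)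
 next
  case (7 a)
  have "X * (x * letr x y z l) = e1p 0 * (X * letr x y z (Fr a True Z0)) - X * letr x y z (Fr (Suc a) False Z0) + X * d * (q ^ a * y)"
   unfolding 7 letr.simps q_def[symmetric] power_Suc by (simp add: d_def e q_def alg)
  thus ?thesis by (simp only:) (intro rng_diff rng_add rng_s A D)
 next
  case (8 a)
  have "X * (x * letr x y z l) = X * d * (q ^ a * y)" unfolding 8 by (simp add: d_def q_def mult_ac)
  thus ?thesis using D by metis
 next
  case (9 a)
  have "X * (x * letr x y z l) = X * d * (q ^ a * y) - e1p 0 * (X * d * q ^ a) + X * letr x y z (Fr (Suc a) False Z2)"
   unfolding 9 letr.simps q_def[symmetric] power_Suc by (simp add: d_def e q_def alg)
  thus ?thesis by (simp only:) (intro rng_diff rng_add rng_s A D)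
 qed
 thus ?thesis by (simp add: letp_def x_y_z_def)
qed

lemma rng_slot:
 "e1p 0 ^ c1 * e1p 1 ^ c2 * e1p 2 ^ c3 * s3_poly ^ k * s1_poly ^ i * s2_poly ^ j
   * dbp e * letp 0 l1 * letp 1 l2 * letp 2 l3 \<in> rng"
 using rng_lab[of "Label l1 l2 l3 e i j k c1 c2 c3"] by (simp add: labp_def)

lemma rng_pvar_0:
 fixes p :: "'a::comm_ring_1 poly9"
 assumes "p \<in> rng"
 shows "pvar 0 * p \<in> rng"
proof (rule rng_mult[OF _ assms])
 fix l
 define S :: "'a poly9" where "S = e1p 0 ^ lac1 l * e1p 1 ^ lac2 l * e1p 2 ^ lac3 l * s3_poly ^ lak l
   * s1_poly ^ lai l * s2_poly ^ laj l * letp 1 (la2 l) * letp 2 (la3 l)"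
 have 1: "S * dbp e * letp 0 l1 \<in> rng" for e l1
  using rng_slot[of "lac1 l" "lac2 l" "lac3 l" "lak l" "lai l" "laj l" e l1 "la2 l" "la3 l"]
  by (simp add: S_def mult_ac)
 have 2: "S * letp 0 l1 * (d_poly 0 * dbp e) \<in> rng" for e l1
  by (rule dbp_deriv) (use 1 in \<open>simp add: mult_ac\<close>)
 have "S * dbp (lae l) * (pvar 0 * letp 0 (la1 l)) \<in> rng"
 proof (rule letp_pvar)
  show "S * dbp (lae l) * letp 0 l1 \<in> rng" for l1 by (rule 1)
  show "S * dbp (lae l) * d_poly 0 * letp 0 l1 \<in> rng" for l1
   using 2[of l1 "lae l"] by (simp only: mult_ac)
 qed
 thus "pvar 0 * labp l \<in> (rng :: 'a poly9 set)" by (simp add: labp_def S_def mult_ac)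
qed

lemma poly9_gamma_pow: "gamP (p ^ k) = gamP p ^ k"
 by (rule ring_hom_power[OF poly9_gamma_hom])

lemma gamma_1: "gamP 1 = 1"
 using poly9_gamma_hom unfolding is_ring_hom_def by blast

lemma gamma_letr: "gamP (letr x y z l) = letr (gamP x) (gamP y) (gamP z) l"
 by (cases l rule: letter_cases9) (simp_all add: gamma_1 poly9_gamma_pow poly9_gamma_mult poly9_gamma_add)

lemma gamma_dbr: "gamP (dbr x y z l) = dbr (gamP x) (gamP y) (gamP z) l"
 by (cases l) (simp_all add: gamma_1 poly9_gamma_mult)

lemma gamma_d_poly: "gamP (d_poly i) = d_poly (i + 1)"
 by (simp add: d_poly_def poly9_gamma_mult poly9_gamma_pvar add_ac)

lemma d_poly_3: "d_poly 3 = d_poly 0"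
 by (simp add: d_poly_def nine_eq_0 mult_ac)

lemma gamma_sym:
 "gamP s1_poly = s1_poly" "gamP s2_poly = s2_poly" "gamP s3_poly = s3_poly"
 "gamP (e1p 0) = e1p 1" "gamP (e1p 1) = e1p 2" "gamP (e1p 2) = e1p 0"
 by (simp_all add: s1_poly_def s2_poly_def s3_poly_def e1p_def poly9_gamma_add poly9_gamma_mult
   gamma_d_poly poly9_gamma_pvar d_poly_3 nine_eq_0 add_ac mult_ac)

lemma gamma_dbp: "gamP (dbp e) = dbr (d_poly 1) (d_poly 2) (d_poly 0) e"
 by (simp add: dbp_def gamma_dbr gamma_d_poly d_poly_3)

lemma gamma_letp: "gamP (letp 0 l) = letp 1 l" "gamP (letp 1 l) = letp 2 l"
 "gamP (letp 2 l) = letr (pvar 3) (pvar 6) (pvar 0) l"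
 by (simp_all add: letp_def gamma_letr poly9_gamma_pvar nine_eq_0)

lemma rng_gamma:
 fixes p :: "'a::comm_ring_1 poly9"
 assumes "p \<in> rng"
 shows "gamP p \<in> rng"
proof -
 have l: "gamP (labp l :: 'a poly9) \<in> rng" for l
 proof -
  define S :: "'a poly9" where "S = e1p 1 ^ lac1 l * e1p 2 ^ lac2 l * e1p 0 ^ lac3 l * s3_poly ^ lak l
    * s1_poly ^ lai l * s2_poly ^ laj l * letp 1 (la1 l) * letp 2 (la2 l)"
  have 1: "S * letp 0 l1 * dbp e \<in> rng" for e l1
   using rng_slot[of "lac3 l" "lac1 l" "lac2 l" "lak l" "lai l" "laj l" e l1 "la1 l" "la2 l"]
   by (simp add: S_def mult_ac)
  have 2: "S * letp 0 l1 * dbr (d_poly 1) (d_poly 2) (d_poly 0) e \<in> rng" for e l1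
   by (rule rng_dbp_gamma) (rule 1)
  have "S * dbr (d_poly 1) (d_poly 2) (d_poly 0) (lae l) * letr (pvar 3) (pvar 6) (pvar 0) (la3 l) \<in> rng"
   by (rule rng_letp_gamma) (use 2 in \<open>simp add: mult_ac\<close>)
  thus ?thesis
   by (simp add: labp_def S_def poly9_gamma_mult poly9_gamma_pow gamma_sym gamma_dbp gamma_letp mult_ac)
 qed
 have c: "gamP (pconst w) = pconst w" for w :: 'a
 proof -
  have "Poly_Mapping.map_key (%i::9. i - 1) 0 = (0 :: mono)"
   by (rule poly_mapping_eqI) (simp add: map_key_unshift_lookup)
  thus ?thesis unfolding pconst_def poly9_gamma_single by simp
 qed
 have "gamP (expand q) \<in> rng" for q :: "'a poly9"
  by (induction q rule: poly9_induct)
    (auto simp: expand_0 poly9_gamma_0 rng_0 expand_add poly9_gamma_add rng_add expand_single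
     poly9_gamma_mult c l intro!: rng_pconst)
 thus ?thesis using assms by (auto simp: rng_def)
qed

lemma gamma_pow_pvar: "(gamP ^^ k) (pvar i) = pvar (i + of_nat k)"
 by (induction k) (simp_all add: poly9_gamma_pvar add_ac)

lemma poly9_gamma_9: "(gamP ^^ 9) p = p"
proof -
 let ?u = "Poly_Mapping.map_key (%i::9. i - 1) :: mono => mono"
 have u: "lookup (?u m) i = lookup m (i - 1)" for m i
  by (rule map_key_unshift_lookup)
 have "k - 1 - 1 - 1 - 1 - 1 - 1 - 1 - 1 - 1 = k" for k :: 9
  by (simp add: diff_diff_eq nine_eq_0)
 hence "?u (?u (?u (?u (?u (?u (?u (?u (?u m)))))))) = m" for m
  by (intro poly_mapping_eqI) (simp only: u)
 thus ?thesis
  by (induction p rule: poly9_induct)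
    (simp_all add: numeral_eq_Suc poly9_gamma_0 poly9_gamma_single poly9_gamma_add)
qed

text \<open>The span is stable under gamma, so conjugation with a power of gamma reduces every
  variable to x_0.\<close>

lemma rng_pvar: "p \<in> rng ==> pvar i * p \<in> rng"
proof -
 assume p: "p \<in> rng"
 have g: "q \<in> rng ==> (gamP ^^ k) q \<in> rng" for k and q :: "'a poly9"
  by (induction k) (simp_all add: rng_gamma)
 have gm: "(gamP ^^ k) (q * r) = (gamP ^^ k) q * (gamP ^^ k) r" for k and q r :: "'a poly9"
  by (induction k) (simp_all add: poly9_gamma_mult)
 have "i \<in> {0, 1, 2, 3, 4, 5, 6, 7, 8}" using UNIV_9 by blast
 then obtain k where k: "i = of_nat k" "k \<le> 9"
 proof -
  show ?thesis using \<open>i \<in> _\<close> that[of 0] that[of 1] that[of 2] that[of 3] that[of 4] that[of 5]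
   that[of 6] that[of 7] that[of 8] by auto
 qed
 have "pvar 0 * (gamP ^^ (9 - k)) p \<in> rng" by (intro rng_pvar_0 g p)
 hence "(gamP ^^ k) (pvar 0 * (gamP ^^ (9 - k)) p) \<in> rng" by (rule g)
 moreover have "(gamP ^^ k) ((gamP ^^ (9 - k)) p) = p"
  using k(2) poly9_gamma_9[of p] by (simp flip: funpow_add comp_apply[of "gamP ^^ k"])
 ultimately show ?thesis by (simp add: gm gamma_pow_pvar k(1))
qed

lemma expand_surj: "p \<in> rng"
proof -
 have 1: "(1 :: 'a poly9) \<in> rng"
  using rng_slot[of 0 0 0 0 0 0 B1 One One One] by (simp add: dbp_def letp_def)
 have "single m (1 :: 'a) \<in> rng" for m
 proof (induction "degm m" arbitrary: m)
  case 0
  hence "m = 0" by (intro poly_mapping_eqI) (simp add: degm_def)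
  thus ?case using 1 by simp
 next
  case (Suc k)
  then obtain i where i: "lookup m i ~= 0" unfolding degm_def
   by (metis nat.distinct(1) sum.neutral)
  define n where "n = m - single i 1"
  have m: "m = single i 1 + n"
   using i by (intro poly_mapping_eqI) (auto simp: n_def lookup_add lookup_minus lookup_single when_def)
  have "degm m = Suc (degm n)"
   unfolding m degm_def lookup_add sum.distrib lookup_single when_def by simp
  hence "single n (1 :: 'a) \<in> rng" using Suc by simp
  hence "pvar i * single n (1 :: 'a) \<in> rng" by (rule rng_pvar)
  thus ?case unfolding m pvar_def mult_single by simp
 qed
 hence "single m w \<in> rng" for m and w :: 'a
  using rng_pconst[of "single m 1" w] by (simp add: pconst_single)
 thus ?thesis by (induction p rule: poly9_induct) (auto simp: rng_0 rng_add)
qed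

section \<open>Grading, reduction modulo 3 and linear independence\<close>

definition hmg :: "nat => 'w::comm_ring_1 poly9 => bool" where
 "hmg n p <-> (ALL m:keys p. degm m = n)"

lemma degm_add: "degm (m + n) = degm m + degm n"
 by (simp add: degm_def lookup_add sum.distrib)

lemma hmg_add: "hmg n p ==> hmg n q ==> hmg n (p + q)"
 using Poly_Mapping.keys_add[of p q] by (auto simp: hmg_def)

lemma hmg_mult: "hmg n p ==> hmg m q ==> hmg (n + m) (p * q)"
 using Poly_Mapping.keys_mult[of p q] by (fastforce simp: hmg_def degm_add)

lemma hmg_1: "hmg 0 1"
 by (auto simp: hmg_def degm_def)

lemma poly9_expansion:
 "(SUM m:keys p. single m (lookup p m)) = (p :: 'w::comm_ring_1 poly9)"
proof -
 have "lin single p = p"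
 proof (induction p rule: poly9_induct)
  case (2 m w)
  show ?case by (rule lin_single) simp
 next
  case (3 p q)
  have "lin single (p + q) = lin single p + lin single q"
   by (rule lin_add) (rule single_add)
  thus ?case using 3 by simp
 qed (simp add: lin_def)
 thus ?thesis by (simp add: lin_def)
qed

lemma hmg_0: "hmg n 0"
 by (auto simp: hmg_def)

lemma hmg_power: "hmg n p ==> hmg (n * k) (p ^ k)"
 by (induction k) (auto simp: hmg_1 intro: hmg_mult)

lemma hmg_pvar: "hmg 1 (pvar i)"
 by (auto simp: hmg_def pvar_def degm_def lookup_single when_def)

lemma hmg_pconst: "hmg 0 (pconst w)"
 by (auto simp: hmg_def pconst_def degm_def)

lemma hmg_eq: "hmg n p ==> n = m ==> hmg m p"
 by simp

lemma hmg_letp: "hmg (let_deg l) (letp i l)"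
 unfolding letp_def
 by (cases l rule: letter_cases9; simp add: hmg_1;
   rule hmg_eq, (rule hmg_mult hmg_power hmg_add hmg_pvar)+, simp)

lemma hmg_d_poly: "hmg 3 (d_poly i)"
 unfolding d_poly_def by (rule hmg_eq, (rule hmg_mult hmg_pvar)+, simp)

lemma hmg_dbp: "hmg (db_deg e) (dbp e)"
 unfolding dbp_def
 by (cases e; simp add: hmg_1 hmg_d_poly; rule hmg_eq, (rule hmg_mult hmg_d_poly)+, simp)

lemma hmg_s1: "hmg 3 s1_poly"
 unfolding s1_poly_def by (intro hmg_add hmg_d_poly)

lemma hmg_s2: "hmg 6 s2_poly"
 unfolding s2_poly_def by (rule hmg_eq, (rule hmg_add hmg_mult hmg_d_poly)+, simp)

lemma hmg_s3: "hmg 9 s3_poly"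
 unfolding s3_poly_def by (rule hmg_eq, (rule hmg_mult hmg_d_poly)+, simp)

lemma hmg_e1p: "hmg 1 (e1p i)"
 unfolding e1p_def by (intro hmg_add hmg_pvar)

lemma hmg_lab_poly: "hmg (lab_deg l) (labp l)"
 unfolding labp_def
 by (rule hmg_eq, (rule hmg_mult hmg_power hmg_s1 hmg_s2 hmg_s3 hmg_e1p hmg_dbp hmg_letp)+, simp add: lab_deg_def)

lemma hmg_pconst_mult: "hmg n p ==> hmg n (pconst w * p)"
 using hmg_mult[OF hmg_pconst] by fastforce

definition part :: "nat => 'w::comm_ring_1 poly9 => 'w poly9" where
 "part n = lin (%m w. if degm m = n then single m w else 0)"

lemma part_add: "part n (p + q) = part n p + part n q"
 unfolding part_def by (rule lin_add) (simp add: single_add)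

lemma part_single: "part n (single m w) = (if degm m = n then single m w else 0)"
 unfolding part_def by (rule lin_single) simp

lemma part_0: "part n 0 = 0"
 using part_add[of n 0 0] by simp

lemma part_hmg: "hmg m p ==> part n p = (if m = n then p else 0)"
proof -
 assume p: "hmg m p"
 have "part n p = (SUM k:keys p. if m = n then single k (lookup p k) else 0)"
  unfolding part_def lin_def using p by (intro sum.cong) (auto simp: hmg_def)
 thus ?thesis by (simp add: poly9_expansion)
qed

lemma hmg_part: "hmg n (part n p)"
 by (induction p rule: poly9_induct) (auto simp: part_0 hmg_0 part_single part_add intro: hmg_add, auto simp: hmg_def)

lemma part_expand: "part n (expand p) = expand (part n p)"
proof (induction p rule: poly9_induct)
 case (2 m w)
 have "hmg (degm m) (pconst w * labp (ldec m))"
  using hmg_pconst_mult[OF hmg_lab_poly] by (metis lab_deg_dec)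
 thus ?case by (simp add: expand_single part_hmg part_single expand_0)
qed (simp_all add: part_0 expand_0 expand_add part_add)

lemma hmg_expand: "hmg n p ==> hmg n (expand p)"
 using part_expand[of n p] hmg_part[of n "expand p"] part_hmg[of n p n] by simp

lemma finite_monos: "finite {m :: mono. degm m = n}"
proof (rule finite_imageD)
 have "lookup ` {m :: mono. degm m = n} <= Pi\<^sub>E UNIV (%_. {..n})"
 proof
  fix f assume "f \<in> lookup ` {m :: mono. degm m = n}"
  then obtain m where m: "degm m = n" "f = lookup m" by auto
  have "f i \<le> n" for i unfolding m(1)[symmetric] m(2) degm_def by (rule member_le_sum) auto
  thus "f \<in> Pi\<^sub>E UNIV (%_. {..n})" by auto
 qed
 thus "finite (lookup ` {m :: mono. degm m = n})"
  by (rule finite_subset) (auto intro: finite_PiE)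
 show "inj_on lookup {m :: mono. degm m = n}"
  by (auto simp: inj_on_def poly_mapping_eqI)
qed

lemma finite_hmg:
 assumes "finite (UNIV :: 'k::comm_ring_1 set)"
 shows "finite {p :: 'k poly9. hmg n p}"
proof (rule finite_imageD)
 let ?M = "{m :: mono. degm m = n}"
 let ?r = "%p::'k poly9. restrict (lookup p) ?M"
 have "?r ` {p. hmg n p} <= Pi\<^sub>E ?M (%_. UNIV)"
  by (rule image_subsetI) (simp add: PiE_def)
 thus "finite (?r ` {p. hmg n p})"
  by (rule finite_subset) (intro finite_PiE finite_monos assms)
 show "inj_on ?r {p. hmg n p}"
 proof (rule inj_onI, rule poly_mapping_eqI)
  fix p q :: "'k poly9" and m
  assume pq: "p \<in> {p. hmg n p}" "q \<in> {p. hmg n p}" "?r p = ?r q"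
  show "lookup p m = lookup q m"
  proof (cases "degm m = n")
   case True thus ?thesis using fun_cong[OF pq(3), of m] by simp
  next
   case False
   hence "m \<notin> keys p" "m \<notin> keys q" using pq(1,2) unfolding hmg_def by auto
   thus ?thesis by (simp add: in_keys_iff)
  qed
 qed
qed

text \<open>A surjective endomorphism of a finite set is injective.\<close>

lemma expand_inj_finite:
 assumes "finite (UNIV :: 'k::comm_ring_1 set)" "expand (p :: 'k poly9) = 0"
 shows "p = 0"
proof -
 have "part n p = 0" for n
 proof -
  let ?P = "{p :: 'k poly9. hmg n p}"
  have "?P <= expand ` ?P"
  proof
   fix q :: "'k poly9" assume q: "q \<in> ?P"
   obtain r where r: "q = expand r" using expand_surj[of q] by (auto simp: rng_def)
   have "q = part n q" using q part_hmg[of n q n] by simp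
   also have "... = expand (part n r)" unfolding r part_expand ..
   finally show "q \<in> expand ` ?P" using hmg_part by blast
  qed
  moreover have "expand ` ?P <= ?P" using hmg_expand by blast
  ultimately have "expand ` ?P = ?P" by blast
  hence "inj_on expand ?P" using finite_surj_inj[OF finite_hmg[OF assms(1)]] by blast
  moreover have "expand (part n p) = expand 0" using part_expand[of n p] assms(2) by (simp add: part_0 expand_0)
  ultimately show ?thesis using hmg_part[of n p] hmg_0 by (auto dest: inj_onD)
 qed
 moreover have "lookup p m = lookup (part (degm m) p) m" for m
  by (induction p rule: poly9_induct) (auto simp: part_0 part_single part_add lookup_add lookup_single when_def)
 ultimately show ?thesis by (intro poly_mapping_eqI) simp
qed

definition cmap :: "('w => 'k) => 'w::comm_ring_1 poly9 => 'k::comm_ring_1 poly9" where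
 "cmap \<phi> = lin (%m w. single m (\<phi> w))"

context
 fixes res :: "'w::comm_ring_1 => 'k::field"
 assumes witt: "witt_ring 3 res" and fin: "finite (UNIV :: 'k set)"
begin

lemma res_hom: "is_ring_hom res" and res_0: "res a = 0 <-> 3 dvd a"
 and tf: "3 * (a :: 'w) = 0 ==> a = 0" and sep: "(!!n. 3 ^ n dvd (a :: 'w)) ==> a = 0"
proof -
 note w = witt[unfolded witt_ring_def of_nat_numeral]
 show "is_ring_hom res" by (rule conjunct1[OF w])
 show "res a = 0 <-> 3 dvd a" using w by meson
 show "3 * (a :: 'w) = 0 ==> a = 0" using w by meson
 show "(!!n. 3 ^ n dvd (a :: 'w)) ==> a = 0" using w by meson
qed

lemma res_simps: "res (a + b) = res a + res b" "res (a * b) = res a * res b" "res 1 = 1" "res 0 = 0"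
 using res_hom ring_hom_0[OF res_hom] unfolding is_ring_hom_def by blast+

lemma cmap_add: "cmap res (p + q) = cmap res p + cmap res q"
proof -
 have "res (a + b) = res a + res b" for a b using res_hom unfolding is_ring_hom_def by blast
 thus ?thesis unfolding cmap_def by (intro lin_add) (simp only: single_add)
qed

lemma cmap_single: "cmap res (single m w) = single m (res w)"
 unfolding cmap_def by (intro lin_single) (simp only: ring_hom_0[OF res_hom] single_zero)

lemma cmap_0: "cmap res 0 = 0"
 unfolding cmap_def lin_def by simp

lemma cmap_mult: "cmap res (p * q) = cmap res p * cmap res q"
proof (induction p rule: poly9_induct)
 case (2 m w)
 show ?case
  by (induction q rule: poly9_induct)
   (simp_all add: cmap_0 cmap_add distrib_left mult_single cmap_single res_simps)
qed (simp_all add: cmap_0 cmap_add distrib_right)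

lemma cmap_pconst: "cmap res (pconst w) = pconst (res w)" and cmap_pvar: "cmap res (pvar i) = pvar i"
 and cmap_1: "cmap res 1 = 1"
proof -
 note r = res_simps(3)
 show "cmap res (pconst w) = pconst (res w)" "cmap res (pvar i) = pvar i"
  by (simp_all add: pconst_def pvar_def cmap_single r)
 show "cmap res 1 = 1" using cmap_single[of 0 1] by (simp add: r)
qed

lemma cmap_power: "cmap res (p ^ n) = cmap res p ^ n"
 by (induction n) (simp_all add: cmap_1 cmap_mult)

lemmas cmap_simps = cmap_1 cmap_add cmap_mult cmap_power cmap_pvar cmap_pconst

lemma cmap_letp: "cmap res (letp i l) = letp i l"
 unfolding letp_def by (cases l rule: letter_cases9) (simp_all add: cmap_simps)

lemma cmap_lab_poly: "cmap res (labp l) = labp l"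
proof -
 have "cmap res (d_poly i) = d_poly i" for i by (simp add: d_poly_def cmap_simps)
 moreover from this have "cmap res (dbp e) = dbp e" for e
  unfolding dbp_def by (cases e) (simp_all add: cmap_simps)
 ultimately show ?thesis
  by (simp add: labp_def cmap_simps cmap_letp s1_poly_def s2_poly_def s3_poly_def e1p_def)
qed

lemma cmap_expand: "cmap res (expand p) = expand (cmap res p)"
 by (induction p rule: poly9_induct)
   (simp_all add: cmap_0 expand_0 cmap_add expand_add expand_single cmap_mult cmap_pconst cmap_lab_poly cmap_single)

lemma lookup_cmap: "lookup (cmap res p) m = res (lookup p m)"
 by (induction p rule: poly9_induct)
   (auto simp: cmap_0 cmap_add cmap_single lookup_add lookup_single when_def res_simps)

lemma pconst_3_cancel: "pconst 3 * p = 0 ==> p = (0 :: 'w poly9)"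
proof -
 assume a: "pconst 3 * p = 0"
 have l: "lookup (pconst w * p) m = w * lookup p m" for w :: 'w and p m
  by (induction p rule: poly9_induct)
    (auto simp: pconst_single distrib_left lookup_add lookup_single when_def)
 show ?thesis using l[of 3 p] a tf by (intro poly_mapping_eqI) (metis lookup_zero)
qed

lemma pconst_3_div:
 assumes "!!m. 3 dvd lookup (p :: 'w poly9) m"
 shows "EX q. p = pconst 3 * q"
proof -
 obtain f where f: "!!m. lookup p m = 3 * f m" using assms unfolding dvd_def by metis
 have "p = (SUM m:keys p. single m (3 * f m))"
  unfolding f[symmetric] by (rule poly9_expansion[symmetric])
 also have "... = pconst 3 * (SUM m:keys p. single m (f m))"
  by (simp add: sum_distrib_left pconst_single)
 finally show ?thesis by blast
qed

text \<open>By injectivity over the residue field an element of the kernel is divisible by 3. The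
  quotient lies in the kernel again, as there is no 3-torsion, so the division can be repeated and
  separatedness gives 0.\<close>

lemma expand_inj_0: "expand (p :: 'w poly9) = 0 ==> p = 0"
proof -
 assume p: "expand p = 0"
 have "EX q. p = pconst (3 ^ n) * q & expand q = 0" for n
 proof (induction n)
  case 0
  thus ?case using p by (auto simp: pconst_1)
 next
  case (Suc n)
  then obtain q where q: "p = pconst (3 ^ n) * q" "expand q = 0" by blast
  have "expand (cmap res q) = 0" using cmap_expand[of q] q(2) cmap_0 by simp
  hence "cmap res q = 0" by (rule expand_inj_finite[OF fin])
  hence "3 dvd lookup q m" for m
   using lookup_cmap[of q m] res_0 by simp
  then obtain r where r: "q = pconst 3 * r" using pconst_3_div by blast
  hence "pconst 3 * expand r = 0" using q(2) by (simp add: expand_pconst)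
  hence "expand r = 0" by (rule pconst_3_cancel)
  moreover have "p = pconst (3 ^ Suc n) * r" unfolding q(1) r by (simp add: pconst_mult mult_ac)
  ultimately show ?case by blast
 qed
 hence d: "3 ^ n dvd lookup p m" for n m
 proof -
  have l: "lookup (pconst w * p) m = w * lookup p m" for w :: 'w and p m
   by (induction p rule: poly9_induct)
     (auto simp: pconst_single distrib_left lookup_add lookup_single when_def)
  obtain q where "p = pconst (3 ^ n) * q" using \<open>!!n. EX q. p = pconst (3 ^ n) * q & expand q = 0\<close> by blast
  thus ?thesis using l by (metis dvd_triv_left)
 qed
 show ?thesis using sep d by (intro poly_mapping_eqI) (metis lookup_zero)
qed

lemma bij_expand: "bij (expand :: 'w poly9 => 'w poly9)"
proof (rule bijI)
 show "inj (expand :: 'w poly9 => _)"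
 proof (rule injI)
  fix p q :: "'w poly9" assume "expand p = expand q"
  hence "expand (p - q) = 0" using expand_add[of p "- q"] expand_minus[of q] by simp
  thus "p = q" using expand_inj_0[of "p - q"] by simp
 qed
 show "surj (expand :: 'w poly9 => _)" using expand_surj unfolding rng_def by blast
qed

end

subsection \<open>Powers of ideals\<close>

lemma ideal_spanI: "is_ideal J ==> S <= J ==> a \<in> ideal_span S ==> a \<in> J"
 unfolding ideal_span_def by blast

lemma ideal_0: "is_ideal J ==> 0 \<in> J" and ideal_add: "is_ideal J ==> a \<in> J ==> b \<in> J ==> a + b \<in> J"
 and ideal_mult: "is_ideal J ==> a \<in> J ==> r * a \<in> J"
 unfolding is_ideal_def by blast+

lemma ideal_mult_right: "is_ideal J ==> a \<in> J ==> a * r \<in> J"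
 using ideal_mult[of J a r] by (simp add: mult.commute)

lemma ideal_sum: "is_ideal J ==> (!!i. i \<in> X ==> f i \<in> J) ==> sum f X \<in> J"
 by (induction X rule: infinite_finite_induct) (auto simp: ideal_0 ideal_add)

lemma power_in_Suc: "a \<in> A ==> b \<in> ideal_power A k ==> a * b \<in> ideal_power A (Suc k)"
 unfolding ideal_power.simps by (rule ideal_span_base) blast

lemma power_mult: "a \<in> ideal_power A n ==> b \<in> ideal_power A m ==> a * b \<in> ideal_power A (n + m)"
proof (induction n arbitrary: a)
 case 0
 thus ?case by (simp add: ideal_mult is_ideal_power)
next
 case (Suc n)
 have "is_ideal {a. a * b \<in> ideal_power A (Suc n + m)}"
  using is_ideal_power[of A "Suc n + m"] unfolding is_ideal_def by (auto simp: distrib_right mult.assoc)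
 moreover have "{a * b | a b. a \<in> A & b \<in> ideal_power A n} <= {a. a * b \<in> ideal_power A (Suc n + m)}"
  using Suc.IH[OF _ Suc.prems(2)] power_in_Suc by (fastforce simp: mult.assoc)
 ultimately have "a \<in> {a. a * b \<in> ideal_power A (Suc n + m)}"
  by (rule ideal_spanI) (use Suc.prems(1) in simp)
 thus ?case by blast
qed

lemma power_antimono: "m \<le> n ==> ideal_power A n <= ideal_power A m"
proof (induction n)
 case (Suc n)
 have "ideal_power A (Suc n) <= ideal_power A n"
  unfolding ideal_power.simps(2)
  by (intro subsetI, erule ideal_spanI[OF is_ideal_power, rotated]) (use ideal_mult[OF is_ideal_power] in blast)
 thus ?case using Suc by (cases "m = Suc n") auto
qed simp

lemma power_in: "a \<in> A ==> a ^ n \<in> ideal_power A n"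
 by (induction n) (auto intro: power_in_Suc simp del: ideal_power.simps(2))

lemma power_add_span:
 "x \<in> ideal_power A (n + m) ==> x \<in> ideal_span {a * b | a b. a \<in> ideal_power A n & b \<in> ideal_power A m}"
 (is "_ ==> x \<in> ideal_span (?S n)")
proof (induction n arbitrary: x)
 case 0
 have "1 * x \<in> ideal_span (?S 0)"
  by (intro ideal_span_base CollectI exI[of _ 1] exI[of _ x]) (use 0 in simp)
 thus ?case by simp
next
 case (Suc n)
 have J: "is_ideal {y. ALL a:A. a * y \<in> ideal_span (?S (Suc n))}"
  using is_ideal_span[of "?S (Suc n)"] unfolding is_ideal_def by (auto simp: distrib_left mult.left_commute)
 have "?S n <= {y. ALL a:A. a * y \<in> ideal_span (?S (Suc n))}"
 proof clarify
  fix a u v assume "a \<in> A" "u \<in> ideal_power A n" "v \<in> ideal_power A m"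
  hence "(a * u) * v \<in> ?S (Suc n)" using power_in_Suc by blast
  thus "a * (u * v) \<in> ideal_span (?S (Suc n))" unfolding mult.assoc[symmetric] by (rule ideal_span_base)
 qed
 hence "{a * y | a y. a \<in> A & y \<in> ideal_power A (n + m)} <= ideal_span (?S (Suc n))"
  using Suc.IH ideal_spanI[OF J] by blast
 thus ?case using Suc.prems ideal_spanI[OF is_ideal_span] unfolding add_Suc ideal_power.simps(2) by blast
qed

lemma power_power:
 assumes "ideal_power A k <= B"
 shows "ideal_power A (k * m) <= ideal_power B m"
proof (induction m)
 case (Suc m)
 have "{a * b | a b. a \<in> ideal_power A k & b \<in> ideal_power A (k * m)} <= ideal_power B (Suc m)"
  using assms Suc power_in_Suc by blast
 thus ?case
  using power_add_span[of _ A k "k * m"] ideal_spanI[OF is_ideal_power] unfolding mult_Suc_right by blast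
qed simp

text \<open>By induction every element of the j-th power has the form k + r g^j with k in K.\<close>

lemma power_insert_nilpotent:
 assumes K: "is_ideal K" and g: "g ^ n \<in> K"
 shows "ideal_power (ideal_span (insert g K)) n <= K"
proof -
 have id: "is_ideal {k + r * g ^ j | k r. k \<in> K}" for j
  unfolding is_ideal_def
 proof (intro conjI ballI allI)
  show "0 \<in> {k + r * g ^ j | k r. k \<in> K}" using ideal_0[OF K] by (auto intro!: exI[of _ 0])
  fix a assume "a \<in> {k + r * g ^ j | k r. k \<in> K}"
  then obtain k r where a: "a = k + r * g ^ j" "k \<in> K" by blast
  { fix s
   have "s * a = s * k + (s * r) * g ^ j" unfolding a by (simp add: distrib_left mult.assoc)
   thus "s * a \<in> {k + r * g ^ j | k r. k \<in> K}" using ideal_mult[OF K a(2)] by blast }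
  fix b assume "b \<in> {k + r * g ^ j | k r. k \<in> K}"
  then obtain k' r' where b: "b = k' + r' * g ^ j" "k' \<in> K" by blast
  have "a + b = (k + k') + (r + r') * g ^ j" unfolding a b by (simp add: alg)
  thus "a + b \<in> {k + r * g ^ j | k r. k \<in> K}" using ideal_add[OF K a(2) b(2)] by blast
 qed
 have 1: "ideal_span (insert g K) <= {k + r * g ^ 1 | k r. k \<in> K}"
 proof (rule subsetI, rule ideal_spanI[OF id])
  have "g = 0 + 1 * g ^ 1" "k = k + 0 * g ^ 1" for k by simp_all
  thus "insert g K <= {k + r * g ^ 1 | k r. k \<in> K}" using ideal_0[OF K] by blast
 qed
 have "ideal_power (ideal_span (insert g K)) j <= {k + r * g ^ j | k r. k \<in> K}" for j
 proof (induction j)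
  case 0
  have "x = 0 + x * g ^ 0" for x :: 'a by simp
  thus ?case using ideal_0[OF K] by blast
 next
  case (Suc j)
  have "a * b \<in> {k + r * g ^ Suc j | k r. k \<in> K}"
   if ab: "a \<in> ideal_span (insert g K)" "b \<in> ideal_power (ideal_span (insert g K)) j" for a b
  proof -
   obtain k r where a: "a = k + r * g ^ 1" "k \<in> K" using 1 ab(1) by blast
   obtain k' r' where b: "b = k' + r' * g ^ j" "k' \<in> K" using Suc ab(2) by blast
   have "a * b = (b * k + (r * g) * k') + (r * r') * g ^ Suc j"
    unfolding a b by (simp add: alg)
   moreover have "b * k + (r * g) * k' \<in> K" using a b K by (intro ideal_add ideal_mult)
   ultimately show ?thesis by blast
  qed
  hence "{a * b | a b. a \<in> ideal_span (insert g K) & b \<in> ideal_power (ideal_span (insert g K)) j}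
    <= {k + r * g ^ Suc j | k r. k \<in> K}" by blast
  thus ?case unfolding ideal_power.simps(2) using ideal_spanI[OF id] by blast
 qed
 from this[of n] show ?thesis using ideal_add[OF K _ ideal_mult[OF K g]] by blast
qed

subsection \<open>The completion\<close>

abbreviation "Ipow == ideal_power Mloc_I"

definition Fil :: "nat => 'w::comm_ring_1 Mhat set" where
 "Fil K = {abs_Mhat r | r. coherent r & r K \<in> Ipow K}"

lemma coherent_le: "coherent r ==> K \<le> k ==> r k - r K \<in> Ipow K"
proof (induction k)
 case (Suc k)
 show ?case
 proof (cases "K = Suc k")
  case False
  hence "r (Suc k) - r k \<in> Ipow K"
   using Suc power_antimono[of K k Mloc_I] unfolding coherent_def by auto
  thus ?thesis using Suc False ideal_trans[OF is_ideal_power] by (metis le_Suc_eq)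
 qed (simp add: ideal_0[OF is_ideal_power] del: ideal_power.simps)
qed (simp add: ideal_0[OF is_ideal_power] del: ideal_power.simps)

lemma Mhat_eq_iff: "coherent r ==> coherent s ==> abs_Mhat r = abs_Mhat s <-> (ALL k. r k - s k \<in> Ipow k)"
 using Quotient3_rel[OF Quotient3_Mhat, of r s] unfolding seq_rel_def
 by (simp add: ideal_0[OF is_ideal_power] del: ideal_power.simps)

lemma Fil_abs: "coherent r ==> abs_Mhat r \<in> Fil K <-> r K \<in> Ipow K"
proof
 assume r: "coherent r" and "abs_Mhat r \<in> Fil K"
 then obtain s where s: "coherent s" "abs_Mhat r = abs_Mhat s" "s K \<in> Ipow K" unfolding Fil_def by blast
 hence "r K - s K \<in> Ipow K" using Mhat_eq_iff r by blast
 hence "(r K - s K) + s K \<in> Ipow K" using s(3) by (intro ideal_add is_ideal_power)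
 thus "r K \<in> Ipow K" by simp
qed (auto simp: Fil_def)

lemma is_ideal_Fil: "is_ideal (Fil K)"
 unfolding is_ideal_def
proof (intro conjI ballI allI)
 show "0 \<in> Fil K" unfolding zero_Mhat_def
  by (simp add: Fil_abs coherent_const ideal_0 is_ideal_power)
 fix a :: "'a Mhat" assume a: "a \<in> Fil K"
 obtain r where r: "coherent r" "a = abs_Mhat r" using Mhat_cases by blast
 { fix b :: "'a Mhat" assume b: "b \<in> Fil K"
  obtain s where s: "coherent s" "b = abs_Mhat s" using Mhat_cases by blast
  show "a + b \<in> Fil K" using a b unfolding r s
   by (simp add: r s Mhat_ops Fil_abs coherent_add ideal_add is_ideal_power) }
 fix b :: "'a Mhat"
 obtain s where s: "coherent s" "b = abs_Mhat s" using Mhat_cases by blast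
 show "b * a \<in> Fil K" using a unfolding r s
  by (simp add: r s Mhat_ops Fil_abs coherent_mult ideal_mult is_ideal_power)
qed

lemmas Fil_add = ideal_add[OF is_ideal_Fil] and Fil_mult = ideal_mult[OF is_ideal_Fil]
 and Fil_diff = ideal_minus[OF is_ideal_Fil] and Fil_zero = ideal_0[OF is_ideal_Fil]
 and Fil_sum = ideal_sum[OF is_ideal_Fil] and Fil_mult_right = ideal_mult_right[OF is_ideal_Fil]
 and Fil_uminus = ideal_uminus[OF is_ideal_Fil] and Fil_trans = ideal_trans[OF is_ideal_Fil]
 and Fil_sym = ideal_sym[OF is_ideal_Fil]

lemma Fil_antimono: "m \<le> n ==> x \<in> Fil n ==> x \<in> Fil m"
proof -
 assume mn: "m \<le> n" and x: "x \<in> Fil n"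
 obtain r where r: "coherent r" "x = abs_Mhat r" using Mhat_cases by blast
 have "r n \<in> Ipow m" using x power_antimono[OF mn] r by (auto simp: Fil_abs)
 moreover have "r n - r m \<in> Ipow m" by (rule coherent_le[OF r(1) mn])
 ultimately have "r n - (r n - r m) \<in> Ipow m" by (rule ideal_minus[OF is_ideal_power])
 hence "r m \<in> Ipow m" by simp
 thus ?thesis by (simp add: r Fil_abs)
qed

lemma Fil_separated: "(!!K. x \<in> Fil K) ==> x = 0"
proof -
 assume x: "!!K. x \<in> Fil K"
 obtain r where r: "coherent r" "x = abs_Mhat r" using Mhat_cases by blast
 have "r k - 0 \<in> Ipow k" for k using x[of k] by (simp add: r Fil_abs)
 thus ?thesis unfolding r zero_Mhat_def using Mhat_eq_iff[OF r(1) coherent_const] by blast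
qed

abbreviation "ofl == Mhat_of_Mloc"

lemma ofl_simps: "ofl (a + b) = ofl a + ofl b" "ofl (a * b) = ofl a * ofl b" "ofl 0 = 0" "ofl 1 = 1"
 "ofl (a - b) = ofl a - ofl b" "ofl (- a) = - ofl a"
 unfolding Mhat_of_Mloc_def zero_Mhat_def one_Mhat_def
 by (simp_all add: Mhat_ops Mhat_uminus coherent_const)

lemma ofl_Fil: "ofl a \<in> Fil K <-> a \<in> Ipow K"
 unfolding Mhat_of_Mloc_def by (simp add: Fil_abs coherent_const)

lemma abs_approx: "coherent r ==> abs_Mhat r - ofl (r K) \<in> Fil K"
 unfolding Mhat_of_Mloc_def
 by (simp add: Mhat_ops coherent_const Fil_abs coherent_minus ideal_0 is_ideal_power)

subsection \<open>The group action and the grading\<close>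

lemma Mhat_gamma_abs: "coherent r ==> gamH (abs_Mhat r) = abs_Mhat (%k. Mloc_gamma (r k))"
 by (simp add: Mhat_gamma.abs_eq seq_rel_refl)

lemma Mloc_gamma_simps: "Mloc_gamma (a + b) = Mloc_gamma a + Mloc_gamma b"
 "Mloc_gamma (a * b) = Mloc_gamma a * Mloc_gamma b" "Mloc_gamma 1 = 1" "Mloc_gamma 0 = 0"
 "Mloc_gamma (a - b) = Mloc_gamma a - Mloc_gamma b"
 using Mloc_gamma_hom ring_hom_0[OF Mloc_gamma_hom] ring_hom_minus[OF Mloc_gamma_hom]
 unfolding is_ring_hom_def by blast+

lemma hg_simps:
 fixes a b :: "'a::comm_ring_1 Mhat"
 shows "gamH (a + b) = gamH a + gamH b"
 "gamH (a * b) = gamH a * gamH b" "gamH (1 :: 'a Mhat) = 1" "gamH (0 :: 'a Mhat) = 0"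
 "gamH (a - b) = gamH a - gamH b" "gamH (- a) = - gamH a"
proof -
 obtain r s where r: "coherent r" "a = abs_Mhat r" and s: "coherent s" "b = abs_Mhat s"
  using Mhat_cases by metis
 show "gamH (a + b) = gamH a + gamH b" "gamH (a * b) = gamH a * gamH b"
  and d: "gamH (a - b) = gamH a - gamH b"
  by (simp_all add: r s Mhat_ops Mhat_gamma_abs coherent_add coherent_mult coherent_minus coherent_gamma Mloc_gamma_simps)
 show "gamH (1 :: 'a Mhat) = 1" and z: "gamH (0 :: 'a Mhat) = 0"
  by (simp_all add: one_Mhat_def zero_Mhat_def Mhat_gamma_abs coherent_const Mloc_gamma_simps)
 have "gamH (- abs_Mhat r) = - gamH (abs_Mhat r)"
 proof -
  have "Mloc_gamma (- x) = - Mloc_gamma x" for x :: "'a Mloc"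
   using Mloc_gamma_simps(5)[of 0 x] by (simp add: Mloc_gamma_simps(4))
  thus ?thesis using r(1) by (simp add: Mhat_uminus Mhat_gamma_abs coherent_uminus coherent_gamma)
 qed
 thus "gamH (- a) = - gamH a" by (simp add: r)
qed

lemma hg_Fil: "x \<in> Fil K ==> gamH x \<in> Fil K"
proof -
 assume x: "x \<in> Fil K"
 obtain r where r: "coherent r" "x = abs_Mhat r" using Mhat_cases by blast
 have "Mloc_gamma (r K) - Mloc_gamma 0 \<in> Ipow K"
  using x by (intro Mloc_gamma_power) (simp add: r Fil_abs)
 thus ?thesis by (simp add: r Mhat_gamma_abs Fil_abs coherent_gamma Mloc_gamma_simps)
qed

lemma hg_ofl: "gamH (ofl a) = ofl (Mloc_gamma a)"
 unfolding Mhat_of_Mloc_def by (simp add: Mhat_gamma_abs coherent_const)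

lemma p9_ops:
 "p \<in> poly9_part t ==> q \<in> poly9_part t ==> p + q \<in> poly9_part t"
 "p \<in> poly9_part t ==> q \<in> poly9_part s ==> p * q \<in> poly9_part (t + s)"
 "p \<in> poly9_part t ==> - p \<in> poly9_part t" "0 \<in> poly9_part t" "1 \<in> poly9_part 0"
 "pvar i \<in> poly9_part (- 2)" "pconst w \<in> poly9_part 0"
proof -
 show "p \<in> poly9_part t ==> q \<in> poly9_part t ==> p + q \<in> poly9_part t"
  using Poly_Mapping.keys_add[of p q] unfolding poly9_part_def by blast
 show "p \<in> poly9_part t ==> q \<in> poly9_part s ==> p * q \<in> poly9_part (t + s)"
  using Poly_Mapping.keys_mult[of p q] unfolding poly9_part_def
  by (fastforce simp: lookup_add sum.distrib)
 show "p \<in> poly9_part t ==> - p \<in> poly9_part t" unfolding poly9_part_def by simp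
 show "0 \<in> poly9_part t" "1 \<in> poly9_part 0" unfolding poly9_part_def by auto
 show "pvar i \<in> poly9_part (- 2)" "pconst w \<in> poly9_part 0"
  by (auto simp: poly9_part_def pvar_def pconst_def lookup_single when_def simp del: of_nat_sum)
qed

lemma M_part_ops:
 "a \<in> M_part t ==> b \<in> M_part t ==> a + b \<in> M_part t"
 "a \<in> M_part t ==> b \<in> M_part s ==> a * b \<in> M_part (t + s)"
 "a \<in> M_part t ==> - a \<in> M_part t"
 unfolding M_part_def
 by (auto simp: plus_M.abs_eq times_M.abs_eq uminus_M.abs_eq intro!: imageI p9_ops)

lemma M_Delta_part: "M_Delta \<in> M_part (- 18)" and M_1_part: "1 \<in> M_part 0" and M_0_part: "0 \<in> M_part t"
proof -
 have "(\<Prod>i\<in>X. pvar i) \<in> poly9_part (- 2 * int (card X))" if "finite X" for X :: "9 set"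
  using that
 proof (induction X rule: finite_induct)
  case (insert x X)
  from p9_ops(2)[OF p9_ops(6) insert.IH, of x] insert.hyps
  show ?case by (simp add: alg)
 qed (simp add: p9_ops)
 from this[of UNIV] show "M_Delta \<in> M_part (- 18)" unfolding M_Delta_def M_part_def by (intro imageI) simp
 show "1 \<in> M_part 0" "0 \<in> M_part t"
  unfolding M_part_def one_M_def zero_M_def using p9_ops(4,5) by blast+
qed

lemma M_Delta_pow_part: "M_Delta ^ i \<in> M_part (- 18 * int i)"
 by (induction i) (auto simp: M_1_part alg dest: M_part_ops(2)[OF M_Delta_part])

lemma M_frac_simps:
 "M_frac a i + M_frac b j = M_frac (a * M_Delta ^ j + b * M_Delta ^ i) (i + j)"
 "M_frac a i * M_frac b j = M_frac (a * b) (i + j)" "- M_frac a i = M_frac (- a) i"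
 "M_frac 1 0 = 1" "M_frac 0 0 = 0"
 unfolding M_frac_def by (simp_all add: plus_Mloc.abs_eq times_Mloc.abs_eq uminus_Mloc.abs_eq one_Mloc_def zero_Mloc_def)

lemma M_frac_eq: "M_frac a i = M_frac b j <-> frac_rel M_Delta (a, i) (b, j)"
 unfolding M_frac_def by (rule Mloc.abs_eq_iff)

lemma lp_ops:
 "a \<in> Mloc_part t ==> b \<in> Mloc_part t ==> a + b \<in> Mloc_part t"
 "a \<in> Mloc_part t ==> b \<in> Mloc_part s ==> a * b \<in> Mloc_part (t + s)"
 "a \<in> Mloc_part t ==> - a \<in> Mloc_part t" "0 \<in> Mloc_part t"
proof -
 show "a + b \<in> Mloc_part t" if ab: "a \<in> Mloc_part t" "b \<in> Mloc_part t"
 proof -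
  obtain x i y j where x: "a = M_frac x i" "x \<in> M_part (t - 18 * int i)"
   and y: "b = M_frac y j" "y \<in> M_part (t - 18 * int j)" using ab unfolding Mloc_part_def by blast
  have "x * M_Delta ^ j \<in> M_part (t - 18 * int (i + j))" "y * M_Delta ^ i \<in> M_part (t - 18 * int (i + j))"
   using M_part_ops(2)[OF x(2) M_Delta_pow_part[of j]] M_part_ops(2)[OF y(2) M_Delta_pow_part[of i]]
   by (simp_all add: alg)
  thus ?thesis unfolding x(1) y(1) M_frac_simps Mloc_part_def using M_part_ops(1) by blast
 qed
 show "a * b \<in> Mloc_part (t + s)" if ab: "a \<in> Mloc_part t" "b \<in> Mloc_part s"
 proof -
  obtain x i y j where x: "a = M_frac x i" "x \<in> M_part (t - 18 * int i)"
   and y: "b = M_frac y j" "y \<in> M_part (s - 18 * int j)" using ab unfolding Mloc_part_def by blast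
  have "x * y \<in> M_part (t + s - 18 * int (i + j))"
   using M_part_ops(2)[OF x(2) y(2)] by (simp add: alg)
  thus ?thesis unfolding x(1) y(1) M_frac_simps Mloc_part_def by blast
 qed
 show "- a \<in> Mloc_part t" if "a \<in> Mloc_part t"
  using that M_part_ops(3) unfolding Mloc_part_def by (auto simp: M_frac_simps) blast
 have "0 = M_frac 0 0" by (simp add: M_frac_simps)
 thus "0 \<in> Mloc_part t" unfolding Mloc_part_def using M_0_part by blast
qed

lemma hp_ops:
 "a \<in> Mhat_part t ==> b \<in> Mhat_part t ==> a + b \<in> Mhat_part t"
 "a \<in> Mhat_part t ==> b \<in> Mhat_part s ==> a * b \<in> Mhat_part (t + s)"
 "a \<in> Mhat_part t ==> - a \<in> Mhat_part t" "0 \<in> Mhat_part t"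
proof -
 show "a + b \<in> Mhat_part t" if ab: "a \<in> Mhat_part t" "b \<in> Mhat_part t"
 proof -
  obtain r s where r: "a = abs_Mhat r" "coherent r" "ALL k. r k \<in> Mloc_part t"
   and s: "b = abs_Mhat s" "coherent s" "ALL k. s k \<in> Mloc_part t" using ab unfolding Mhat_part_def by blast
  hence "a + b = abs_Mhat (%k. r k + s k)" "coherent (%k. r k + s k)" "ALL k. r k + s k \<in> Mloc_part t"
   by (simp_all add: Mhat_ops coherent_add lp_ops)
  thus ?thesis unfolding Mhat_part_def by blast
 qed
 show "a * b \<in> Mhat_part (t + s)" if ab: "a \<in> Mhat_part t" "b \<in> Mhat_part s"
 proof -
  obtain r s' where r: "a = abs_Mhat r" "coherent r" "ALL k. r k \<in> Mloc_part t"
   and s: "b = abs_Mhat s'" "coherent s'" "ALL k. s' k \<in> Mloc_part s" using ab unfolding Mhat_part_def by blast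
  hence "a * b = abs_Mhat (%k. r k * s' k)" "coherent (%k. r k * s' k)" "ALL k. r k * s' k \<in> Mloc_part (t + s)"
   by (simp_all add: Mhat_ops coherent_mult lp_ops)
  thus ?thesis unfolding Mhat_part_def by blast
 qed
 show "- a \<in> Mhat_part t" if a: "a \<in> Mhat_part t"
 proof -
  obtain r where r: "a = abs_Mhat r" "coherent r" "ALL k. r k \<in> Mloc_part t" using a unfolding Mhat_part_def by blast
  hence "- a = abs_Mhat (%k. - r k)" "coherent (%k. - r k)" "ALL k. - r k \<in> Mloc_part t"
   by (simp_all add: Mhat_uminus coherent_uminus lp_ops)
  thus ?thesis unfolding Mhat_part_def by blast
 qed
 show "0 \<in> Mhat_part t" unfolding Mhat_part_def zero_Mhat_def
  using coherent_const lp_ops(4) by blast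
qed

lemma Mhat_part_sum: "(!!i. i \<in> X ==> f i \<in> Mhat_part t) ==> sum f X \<in> Mhat_part t"
 by (induction X rule: infinite_finite_induct) (auto simp: hp_ops)

lemma ofl_part: "a \<in> Mloc_part t ==> ofl a \<in> Mhat_part t"
 unfolding Mhat_part_def Mhat_of_Mloc_def using coherent_const by blast

lemma Mloc_of_part: "p \<in> poly9_part t ==> Mloc_of p \<in> Mloc_part t"
proof -
 assume "p \<in> poly9_part t"
 hence "abs_M p \<in> M_part (t - 18 * int 0)" unfolding M_part_def by simp
 thus ?thesis unfolding Mloc_of_def Mloc_part_def by blast
qed

lemma poly9_gamma_part: "p \<in> poly9_part t ==> gamP p \<in> poly9_part t"
proof -
 assume p: "p \<in> poly9_part t"
 have k: "keys (gamP p) <= {m. Poly_Mapping.map_key (%i. i + 1) m \<in> keys p}"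
  unfolding poly9_gamma_def by (auto simp: in_keys_iff Poly_Mapping.map_key.rep_eq[OF inj_map_key_shift])
 have "(SUM i:UNIV. lookup (Poly_Mapping.map_key (%i. i + 1) m) i) = (SUM i:UNIV. lookup m i)"
  for m :: mono
 proof -
  have "bij_betw (%i::9. i + 1) UNIV UNIV"
   by (rule bij_betwI[where g = "%i. i - 1"]) auto
  from sum.reindex_bij_betw[OF this, of "lookup m"]
  show ?thesis by (simp add: map_key_shift_lookup)
 qed
 thus ?thesis using p k unfolding poly9_part_def by fastforce
qed

lemma hg_part: "x \<in> Mhat_part t ==> gamH x \<in> Mhat_part t"
proof -
 assume "x \<in> Mhat_part t"
 then obtain r where r: "x = abs_Mhat r" "coherent r" "ALL k. r k \<in> Mloc_part t" unfolding Mhat_part_def by blast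
 have "Mloc_gamma y \<in> Mloc_part t" if y: "y \<in> Mloc_part t" for y :: "'a Mloc"
 proof -
  obtain m i where m: "y = M_frac m i" "m \<in> M_part (t - 18 * int i)" using y unfolding Mloc_part_def by blast
  then obtain p where p: "m = abs_M p" "p \<in> poly9_part (t - 18 * int i)" unfolding M_part_def by blast
  have "Mloc_gamma y = M_frac (abs_M (gamP p)) i"
   unfolding m(1) p(1) M_frac_def by (simp add: Mloc_gamma.abs_eq M_gamma.abs_eq)
  thus ?thesis unfolding Mloc_part_def M_part_def using poly9_gamma_part[OF p(2)] by blast
 qed
 thus ?thesis unfolding r(1) Mhat_gamma_abs[OF r(2)] Mhat_part_def
  using coherent_gamma[OF r(2)] r(3) by blast
qed

subsection \<open>Coordinates of the completed ring\<close>

text \<open>Weights for the filtration by powers of 3, s1, s2 and e2. The letter \<open>Fr a\<close>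
  is e2^a times a monomial but counts a + 1: as e2, e2 x and e2 y are combinations of letters
  \<open>Fr 0\<close>, multiplication by e2 has to raise the weight there too.\<close>

fun lw :: "letter => nat" where
 "lw (Fr a v z) = Suc a" | "lw _ = 0"

definition fil :: "nat => 'w::comm_ring_1 V => bool" where
 "fil k u <-> (ALL l1 l2 l3 e i j. 3 ^ (k - (i + j + lw l1 + lw l2 + lw l3)) dvd u l1 l2 l3 e $ i $ j)"

definition scV :: "'w::comm_ring_1 L => 'w V => 'w V" where
 "scV p u = (%l1 l2 l3. sc p (u l1 l2 l3))"

abbreviation cL :: "'w::comm_ring_1 => 'w L" where "cL w == fps_const (fps_const w)"

lemma V3_eqI: "(!!l1 l2 l3. u l1 l2 l3 = v l1 l2 l3) ==> u = v"
 by (intro ext) simp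

lemma V_eqI: "(!!l1 l2 l3 e. u l1 l2 l3 e = v l1 l2 l3 e) ==> u = (v :: 'w V)"
 by (intro ext)

lemma scV_add: "scV p (u + v) = scV p u + scV p v" and scV_plus: "scV (p + q) u = scV p u + scV q u"
 and scV_mult: "scV p (scV q u) = scV (p * q) u" and scV_0: "scV p 0 = 0" and scV_diff: "scV p (u - v) = scV p u - scV p v"
 and scV_zero: "scV 0 u = 0" and scV_1: "scV 1 u = u" and scV_minus: "scV p (- u) = - scV p u"
 and scV_left_diff: "scV (p - q) u = scV p u - scV q u"
 by (rule V_eqI; simp add: scV_def sc_def alg)+

lemma scV_vs: "scV p (vs a b l c) = vs a b l (sc p c)"
 by (rule V_eqI) (simp add: scV_def vs_def sc_def)

lemma sc_dsingle: "sc p (dsg e q) = dsg e (p * q)"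
 by (rule ext) (simp add: sc_def dsg_def)

lemma fil_0: "fil k 0" and fil_add: "fil k u ==> fil k v ==> fil k (u + v)"
 and fil_minus: "fil k u ==> fil k (- u)" and fil_diff: "fil k u ==> fil k v ==> fil k (u - v)"
 by (auto simp: fil_def dvd_add dvd_diff)

lemma fil_all: "fil 0 u"
 by (simp add: fil_def)

lemma fil_antimono: "m \<le> n ==> fil n u ==> fil m u"
 unfolding fil_def by (meson diff_le_mono dvd_trans le_imp_power_dvd)

lemma pow3_Suc_dvd: "3 ^ (k - n) dvd (x::'w::comm_ring_1) ==> 3 ^ (Suc k - n) dvd 3 * x"
proof -
 assume "3 ^ (k - n) dvd x"
 hence "3 ^ Suc (k - n) dvd 3 * x" by (simp add: mult_dvd_mono)
 moreover have "(3::'w) ^ (Suc k - n) dvd 3 ^ Suc (k - n)" by (rule le_imp_power_dvd) simp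
 ultimately show ?thesis by (rule dvd_trans[rotated])
qed

lemma fil_3: "fil k u ==> fil (Suc k) (scV 3 u)"
 unfolding fil_def scV_def sc_def three_nth using pow3_Suc_dvd by blast

lemma fil_s1: "fil k u ==> fil (Suc k) (scV s1L u)"
 unfolding fil_def
proof (intro allI)
 fix l1 l2 l3 e i j
 assume f: "ALL l1 l2 l3 e i j. 3 ^ (k - (i + j + lw l1 + lw l2 + lw l3)) dvd u l1 l2 l3 e $ i $ j"
 show "3 ^ (Suc k - (i + j + lw l1 + lw l2 + lw l3)) dvd scV s1L u l1 l2 l3 e $ i $ j"
 proof (cases i)
  case (Suc i')
  thus ?thesis using f[rule_format, where i = i' and j = j and ?l1.0 = l1 and ?l2.0 = l2 and ?l3.0 = l3 and e = e]
   by (simp add: scV_def sc_def)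
 qed (simp add: scV_def sc_def)
qed

lemma fil_s2: "fil k u ==> fil (Suc k) (scV s2L u)"
 unfolding fil_def
proof (intro allI)
 fix l1 l2 l3 e i j
 assume f: "ALL l1 l2 l3 e i j. 3 ^ (k - (i + j + lw l1 + lw l2 + lw l3)) dvd u l1 l2 l3 e $ i $ j"
 show "3 ^ (Suc k - (i + j + lw l1 + lw l2 + lw l3)) dvd scV s2L u l1 l2 l3 e $ i $ j"
 proof (cases j)
  case (Suc j')
  thus ?thesis using f[rule_format, where i = i and j = j' and ?l1.0 = l1 and ?l2.0 = l2 and ?l3.0 = l3 and e = e]
   by (simp add: scV_def sc_def)
 qed (simp add: scV_def sc_def)
qed

lemma fil_scV:
 assumes "fil k u" "!!i j. 3 ^ (m - (i + j)) dvd p $ i $ j"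
 shows "fil (k + m) (scV p u)"
 unfolding fil_def
proof (intro allI)
 fix l1 l2 l3 e i j
 let ?w = "lw l1 + lw l2 + lw l3"
 have "3 ^ (k + m - (i + j + lw l1 + lw l2 + lw l3)) dvd p $ a $ b * u l1 l2 l3 e $ (i - a) $ (j - b)"
  if "a \<le> i" "b \<le> j" for a b
 proof -
  have "(3::'a) ^ ((m - (a + b)) + (k - ((i - a) + (j - b) + lw l1 + lw l2 + lw l3)))
    dvd p $ a $ b * u l1 l2 l3 e $ (i - a) $ (j - b)"
   unfolding power_add using assms unfolding fil_def by (intro mult_dvd_mono) blast+
  moreover have "k + m - (i + j + lw l1 + lw l2 + lw l3) \<le> (m - (a + b)) + (k - ((i - a) + (j - b) + lw l1 + lw l2 + lw l3))"
   using that by linarith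
  ultimately show ?thesis using le_imp_power_dvd dvd_trans by blast
 qed
 thus "3 ^ (k + m - (i + j + lw l1 + lw l2 + lw l3)) dvd scV p u l1 l2 l3 e $ i $ j"
  unfolding scV_def sc_def fps_mult_nth fps_sum_nth by (intro dvd_sum) auto
qed

text \<open>Ignoring the exponent of s3 and sending x_i + x_(i+3) + x_(i+6) to 0 lets the
  coordinates descend to M and extend to the localization.\<close>

definition vlab :: "label => 'w::comm_ring_1 => 'w V" where
 "vlab l w = (if lac1 l = 0 & lac2 l = 0 & lac3 l = 0
   then vs (la1 l) (la2 l) (la3 l) (dsg (lae l) (cL w * s1L ^ lai l * s2L ^ laj l)) else 0)"

lemma lmon_nth: "(cL w * s1L ^ i * s2L ^ j) $ i' $ j' = (if i' = i & j' = j then w else 0)"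
proof -
 have "(cL w * s1L ^ i * s2L ^ j) $ i' = (if i' = i then fps_const w * fps_X ^ j else 0)"
  by (simp add: fps_const_power)
 thus ?thesis by simp
qed

lemma dsingle_add: "dsg e (p + q) = dsg e p + dsg e q"
 by (rule ext) (simp add: dsg_def)

lemma vs_plus: "vs a b l (c + c') = vs a b l c + vs a b l c'"
 by (intro ext) (simp add: vs_def)

lemma vlab_add: "vlab l (w + v) = vlab l w + vlab l v"
proof -
 have "cL (w + v) = cL w + cL v" by simp
 thus ?thesis by (simp only: vlab_def distrib_right dsingle_add vs_plus split: if_splits) simp
qed

lemma dsingle_0: "dsg e 0 = 0" and vs_zero: "vs a b l (0 :: 'd::ab_group_add) = 0"
 by (intro ext; simp add: dsg_def vs_def)+

lemma vlab_0: "vlab l 0 = 0"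
 by (simp add: vlab_def dsingle_0 vs_zero)

locale wittk =
 fixes res :: "'w::comm_ring_1 => 'k::field"
 assumes witt: "witt_ring 3 res" and fin: "finite (UNIV :: 'k set)"
begin

lemmas tf = tf[OF witt fin] and sep = sep[OF witt fin] and bij_expand = bij_expand[OF witt fin]

lemma expand_inv: "expand (inv_into UNIV expand p) = (p :: 'w poly9)" and inv_expand: "inv_into UNIV expand (expand p) = (p :: 'w poly9)"
 using bij_expand by (simp_all add: bij_is_surj surj_f_inv_f bij_is_inj)

definition crdP :: "'w poly9 => 'w V" where
 "crdP p = lin (%m w. vlab (ldec m) w) (inv_into UNIV expand p)"

lemma crdP_expand: "crdP (expand q) = lin (%m w. vlab (ldec m) w) q"
 by (simp add: crdP_def inv_expand)

lemma crdP_add: "crdP (p + q) = crdP p + crdP q"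
proof -
 have "crdP (expand a + expand b) = crdP (expand a) + crdP (expand b)" for a b
  unfolding expand_add[symmetric] crdP_expand by (rule lin_add) (rule vlab_add)
 from this[of "inv_into UNIV expand p" "inv_into UNIV expand q"] show ?thesis by (simp only: expand_inv)
qed

lemma crdP_0: "crdP 0 = 0"
 using crdP_add[of 0 0] by (simp only: add_0_left add_cancel_right_left)

lemma crdP_diff: "crdP (p - q) = crdP p - crdP q"
 using crdP_add[of "p - q" q] by (simp add: alg)

lemma crdP_minus: "crdP (- p) = - crdP p"
 using crdP_diff[of 0 p] by (simp add: crdP_0)

lemma crdP_lab: "crdP (pconst w * labp l) = vlab l w"
 unfolding expand_code[symmetric] crdP_expand
 by (subst lin_single) (simp_all add: vlab_0 lab_dec_code)

lemma lab_induct: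
 assumes "P 0" "!!p q. P p ==> P q ==> P (p + q)" "!!w l. P (pconst w * labp l)"
 shows "P (p :: 'w poly9)"
proof -
 have "P (expand q)" for q
  by (induction q rule: poly9_induct) (simp_all add: expand_0 expand_add expand_single assms)
 thus ?thesis using expand_inv by metis
qed

lemma crdP_s: "crdP (s1_poly * p) = scV s1L (crdP p)" "crdP (s2_poly * p) = scV s2L (crdP p)"
 "crdP (s3_poly * p) = crdP p"
proof (induction p rule: lab_induct)
 case (3 w l)
 have *: "s * (pconst w * q) = pconst w * (s * q)" for s q :: "'w poly9" by (simp add: mult_ac)
 { case 1 show ?case by (cases l) (simp add: * lab_poly_Suc crdP_lab vlab_def scV_vs sc_dsingle scV_0 mult_ac) }
 { case 2
  have "cL w * s1L ^ i * s2L ^ Suc j = s2L * (cL w * s1L ^ i * s2L ^ j)" for i j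
   by (simp only: power_Suc mult_ac)
  thus ?case
   by (cases l) (simp add: * lab_poly_Suc crdP_lab vlab_def scV_vs sc_dsingle scV_0 del: power_Suc fps_const_power) }
 { case 3 show ?case by (cases l) (simp add: * lab_poly_Suc crdP_lab vlab_def) }
qed (simp_all add: crdP_0 scV_0 distrib_left crdP_add scV_add)

lemma crdP_e1: "i \<in> {0, 1, 2} ==> crdP (e1p i * p) = 0"
proof (induction p rule: lab_induct)
 case (3 w l)
 have *: "s * (pconst w * q) = pconst w * (s * q)" for s q :: "'w poly9" by (simp add: mult_ac)
 show ?case using 3 by (cases l) (auto simp: * lab_poly_Suc crdP_lab vlab_def)
qed (simp_all add: crdP_0 distrib_left crdP_add)

lemma crdP_const: "crdP (pconst v * p) = scV (cL v) (crdP p)"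
proof (induction p rule: lab_induct)
 case (3 w l)
 have "pconst v * (pconst w * labp l) = pconst (v * w) * labp l" by (simp add: pconst_mult mult.assoc)
 moreover have "cL (v * w) * p * q = cL v * (cL w * p * q)" for p q :: "'w L"
  unfolding fps_const_mult[symmetric] by (simp only: mult.assoc)
 ultimately show ?case
  by (cases "lac1 l = 0 & lac2 l = 0 & lac3 l = 0")
   (simp_all only: crdP_lab vlab_def scV_vs sc_dsingle scV_0 if_True if_False simp_thms)
qed (simp_all only: crdP_0 scV_0 distrib_left crdP_add scV_add mult_zero_right)

lemma crdP_s_pow: "crdP (s1_poly ^ i * p) = scV (s1L ^ i) (crdP p)" "crdP (s2_poly ^ i * p) = scV (s2L ^ i) (crdP p)"
 "crdP (s3_poly ^ i * p) = crdP p"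
 by (induction i arbitrary: p) (simp_all add: scV_1 mult.assoc crdP_s scV_mult del: power_Suc add: power_Suc)

lemma crdP_basis: "crdP (dbp e * letp 0 l1 * letp 1 l2 * letp 2 l3) = vs l1 l2 l3 (dsg e 1)"
 using crdP_lab[of 1 "Label l1 l2 l3 e 0 0 0 0 0 0"] by (simp add: pconst_1 labp_def vlab_def)

sublocale D: dmod "gD :: 'w DV => 'w DV"
proof
 fix x y :: "'w DV"
 show "gD (x + y) = gD x + gD y" by (rule gD_add)
 show "gD (gD (gD x)) = x" by (rule gD_3)
 assume "x + x + x = 0"
 hence "(x + x + x) e = 0" for e by simp
 hence "3 * x e = 0" for e by (simp add: alg)
 thus "x = 0" using tfL[OF tf] by (intro ext) simp
qed

lemma crdP_dbr: "crdP (dbr (d_poly 1) (d_poly 2) (d_poly 0) e * letp 0 l1 * letp 1 l2 * letp 2 l3)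
  = vs l1 l2 l3 (gD (dsg e 1))"
proof -
 define X :: "'w poly9" where "X = letp 0 l1 * letp 1 l2 * letp 2 l3"
 define a b c :: "'w poly9" where "a = d_poly 0" "b = d_poly 1" "c = d_poly 2"
 have A: "crdP (dbr a b c e * X) = vs l1 l2 l3 (dsg e 1)" for e
  using crdP_basis[of e l1 l2 l3] by (simp add: dbp_def a_b_c_def X_def mult.assoc)
 have s: "s1_poly = a + b + c" "s2_poly = a * b + b * c + c * a"
  by (simp_all add: a_b_c_def s1_poly_def s2_poly_def)
 have 2: "c * X = s1_poly * (dbr a b c B1 * X) - dbr a b c Bd1 * X - dbr a b c Bd2 * X"
  "c * a * X = s2_poly * (dbr a b c B1 * X) - dbr a b c Bd12 * X - dbr a b c Bd23 * X"
  "b * b * c * X = dbr a b c Bu * X + s2_poly * (dbr a b c Bd2 * X) - s1_poly * (dbr a b c Bd12 * X)"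
  unfolding s by (simp_all add: alg)
 note V = crdP_diff crdP_add crdP_s A scV_vs sc_dsingle mult_1_right
 have g: "gD (dsg B1 (1::'w L)) = dsg B1 1" "gD (dsg Bd1 (1::'w L)) = dsg Bd2 1"
  "gD (dsg Bd2 (1::'w L)) = dsg B1 s1L - dsg Bd1 1 - dsg Bd2 1"
  "gD (dsg Bd12 (1::'w L)) = dsg Bd23 1"
  "gD (dsg Bd23 (1::'w L)) = dsg B1 s2L - dsg Bd12 1 - dsg Bd23 1"
  "gD (dsg Bu (1::'w L)) = dsg Bu 1 + dsg Bd2 s2L - dsg Bd12 s1L"
  by (simp_all add: DV_eq_iff dsg_def)
 have "crdP (dbr b c a e * X) = vs l1 l2 l3 (gD (dsg e 1))"
 proof (cases e)
  case B1 thus ?thesis using A[of B1] by (simp add: g)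
 next
  case Bd1 thus ?thesis using A[of Bd2] by (simp add: g)
 next
  case Bd2
  show ?thesis unfolding Bd2 dbr.simps(3) g by (subst 2(1)) (simp only: V D.vs_diff D.vs_add)
 next
  case Bd12 thus ?thesis using A[of Bd23] by (simp add: g)
 next
  case Bd23
  show ?thesis unfolding Bd23 dbr.simps(5) g by (subst 2(2)) (simp only: V D.vs_diff D.vs_add)
 next
  case Bu
  show ?thesis unfolding Bu dbr.simps(6) g by (subst 2(3)) (simp only: V D.vs_diff D.vs_add)
 qed
 thus ?thesis by (simp add: a_b_c_def X_def mult.assoc)
qed

lemma gV_Fr: "D.gV (vs a b (Fr n v Z0) c) = vs (Fr n v Z1) a b (gD c)"
 "D.gV (vs a b (Fr n v Z1) c) = vs (Fr n v Z2) a b (gD c)"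
 "D.gV (vs a b (Fr n v Z2) c) = vs (Fr n v Z0) a b (gD c)"
proof -
 have p: "prev3 z = Z0 <-> z = Z1" "prev3 z = Z1 <-> z = Z2" "prev3 z = Z2 <-> z = Z0" for z
  by (cases z; simp)+
 show "D.gV (vs a b (Fr n v Z0) c) = vs (Fr n v Z1) a b (gD c)"
  "D.gV (vs a b (Fr n v Z1) c) = vs (Fr n v Z2) a b (gD c)"
  "D.gV (vs a b (Fr n v Z2) c) = vs (Fr n v Z0) a b (gD c)"
  by (rule ext, rule ext, rule ext, rename_tac l1 l2 l3, case_tac l1;
    simp add: D.gV_def vs_def p D.g_0 D.g_minus)+
qed

lemma crdP_gamma_basis: "crdP (gamP (dbp e * letp 0 l1 * letp 1 l2 * letp 2 l3)) = D.gV (vs l1 l2 l3 (dsg e 1))"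
proof -
 define Y :: "'w poly9" where "Y = dbr (d_poly 1) (d_poly 2) (d_poly 0) e"
 define x y z :: "'w poly9" where "x = pvar 0" "y = pvar 3" "z = pvar 6"
 define R :: "'w poly9" where "R = letp 1 l1 * letp 2 l2"
 have A: "crdP (Y * letr x y z l * R) = vs l l1 l2 (gD (dsg e 1))" for l
  using crdP_dbr[of e l l1 l2] unfolding letp_def[of 0] Y_def R_def x_y_z_def by (simp add: mult.assoc)
 have e1: "z = e1p 0 - x - y" by (simp add: e1p_def x_y_z_def)
 have "gamP (dbp e * letp 0 l1 * letp 1 l2 * letp 2 l3) = Y * letr y z x l3 * R"
  by (simp add: poly9_gamma_mult gamma_dbp gamma_letp Y_def R_def x_y_z_def mult_ac)
 moreover have "crdP (Y * letr y z x l3 * R) = D.gV (vs l1 l2 l3 (dsg e 1))"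
 proof (cases l3 rule: letter_cases9)
  case 1 thus ?thesis using A[of One] by (simp add: D.gV_vs)
 next
  case 2 thus ?thesis using A[of LY] by (simp add: D.gV_vs)
 next
  case 3
  have "Y * z * R = e1p 0 * (Y * R) - Y * letr x y z LX * R - Y * letr x y z LY * R"
   unfolding e1 by (simp add: alg)
  moreover have "letr y z x LY = z" by simp
  ultimately show ?thesis unfolding 3 by (simp only: crdP_diff A D.gV_vs) (simp add: crdP_e1)
 next
  case (4 n) thus ?thesis using A[of "Fr n False Z1"] by (simp add: gV_Fr add_ac)
 next
  case (5 n) thus ?thesis using A[of "Fr n False Z2"] by (simp add: gV_Fr add_ac)
 next
  case (6 n) thus ?thesis using A[of "Fr n False Z0"] by (simp add: gV_Fr add_ac)
 next
  case (7 n) thus ?thesis using A[of "Fr n True Z1"] by (simp add: gV_Fr add_ac)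
 next
  case (8 n) thus ?thesis using A[of "Fr n True Z2"] by (simp add: gV_Fr add_ac)
 next
  case (9 n) thus ?thesis using A[of "Fr n True Z0"] by (simp add: gV_Fr add_ac)
 qed
 ultimately show ?thesis by simp
qed

lemma gV_scV: "D.gV (scV p u) = scV p (D.gV u)"
proof (rule V3_eqI)
 have "gD (- sc p c) = sc p (gD (- c))" "gD (sc p c - sc p c') = sc p (gD (c - c'))" for p :: "'w L" and c c'
  by (simp_all add: DV_eq_iff sc_def alg)
 thus "D.gV (scV p u) l1 l2 l3 = scV p (D.gV u) l1 l2 l3" for l1 l2 l3
  by (cases l1) (simp_all add: D.gV_def scV_def gD_sc)
qed

lemma gamma_pconst: "gamP (pconst w) = pconst w"
proof -
 have "Poly_Mapping.map_key (%i::9. i - 1) 0 = (0 :: mono)"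
  by (rule poly_mapping_eqI) (simp add: map_key_unshift_lookup)
 thus ?thesis unfolding pconst_def poly9_gamma_single by simp
qed

lemma crdP_gamma: "crdP (gamP p) = D.gV (crdP p)"
proof (induction p rule: lab_induct)
 case 1 show ?case by (simp only: poly9_gamma_0 crdP_0 D.gV_0)
next
 case (2 p q) thus ?case by (simp only: poly9_gamma_add crdP_add D.gV_add)
next
 case (3 w l)
 let ?B = "dbp (lae l) * letp 0 (la1 l) * letp 1 (la2 l) * letp 2 (la3 l) :: 'w poly9"
 have g: "gamP (pconst w * labp l) = e1p 1 ^ lac1 l * (e1p 2 ^ lac2 l * (e1p 0 ^ lac3 l *
   (pconst w * (s3_poly ^ lak l * (s1_poly ^ lai l * (s2_poly ^ laj l * gamP ?B))))))"
  by (simp add: labp_def poly9_gamma_mult poly9_gamma_pow gamma_sym gamma_pconst mult_ac)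
 have e0: "crdP (e1p i ^ n * q) = 0" if "i \<in> {0, 1, 2}" "n ~= 0" for i n and q :: "'w poly9"
  using that crdP_e1[of i "e1p i ^ (n - 1) * q"] by (cases n) (auto simp: mult.assoc)
 show ?case
 proof (cases "lac1 l = 0 & lac2 l = 0 & lac3 l = 0")
  case True
  have S: "crdP (pconst w * (s3_poly ^ lak l * (s1_poly ^ lai l * (s2_poly ^ laj l * p)))) =
    scV (cL w * s1L ^ lai l * s2L ^ laj l) (crdP p)" for p
   by (simp add: crdP_const crdP_s_pow scV_mult mult.assoc del: fps_const_power)
  have "crdP (gamP (pconst w * labp l)) =
    scV (cL w * s1L ^ lai l * s2L ^ laj l) (D.gV (vs (la1 l) (la2 l) (la3 l) (dsg (lae l) 1)))"
   unfolding g using True by (simp only: power_0 mult_1_left S crdP_gamma_basis)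
  also have "... = D.gV (crdP (pconst w * labp l))"
   unfolding gV_scV[symmetric] scV_vs sc_dsingle crdP_lab vlab_def using True by simp
  finally show ?thesis .
 next
  case False
  have 1: "vlab l w = 0" using False by (auto simp: vlab_def)
  have "crdP (gamP (pconst w * labp l)) = 0"
  proof (cases "lac1 l = 0")
   case False show ?thesis unfolding g by (rule e0) (use False in auto)
  next
   case a: True
   show ?thesis
   proof (cases "lac2 l = 0")
    case False show ?thesis unfolding g a power_0 mult_1_left by (rule e0) (use False in auto)
   next
    case b: True
    show ?thesis unfolding g a b power_0 mult_1_left by (rule e0) (use False a b in auto)
   qed
  qed
  thus ?thesis by (simp only: crdP_lab 1 D.gV_0)
 qed
qed

text \<open>Multiplication by e2 of the first block: e2 is the sum of the orbit of xy, and modulo x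
  + y + z one has e2 x = x^2 y - z^2 x and e2 y = y^2 z - x^2 y.\<close>

fun eaf :: "(letter => 'd::ab_group_add) => letter => 'd" where
 "eaf f (Fr (Suc a) v z) = f (Fr a v z)"
| "eaf f (Fr 0 False z) = f One"
| "eaf f (Fr 0 True Z0) = f LX - f LY"
| "eaf f (Fr 0 True Z1) = f LY"
| "eaf f (Fr 0 True Z2) = - f LX"
| "eaf f _ = 0"

definition eact :: "'w V => 'w V" where
 "eact u l1 l2 l3 = eaf (%m. u m l2 l3) l1"

lemma eaf_cases:
 obtains a v z where "l = Fr (Suc a) v z" | z where "l = Fr 0 False z" | "l = Fr 0 True Z0"
  | "l = Fr 0 True Z1" | "l = Fr 0 True Z2" | "l = One" | "l = LX" | "l = LY"
proof (cases l)
 case (Fr a v z)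
 thus ?thesis using that by (cases a; cases v; cases z) auto
qed (use that in auto)

lemma eaf_add: "eaf (%m. f m + g m) l = eaf f l + eaf g l"
 and eaf_0: "eaf (%m. 0) l = 0"
 by (cases l rule: eaf_cases; simp)+

lemma eaf_sc: "eaf (%m. sc p (f m)) l = sc p (eaf f l)"
 by (cases l rule: eaf_cases; simp add: sc_def fun_eq_iff alg)

lemma eact_add: "eact (u + v) = eact u + eact v" and eact_scV: "eact (scV p u) = scV p (eact u)"
 and eact_0: "eact 0 = 0"
proof -
 show a: "eact (u + v) = eact u + eact v" for u v by (rule V3_eqI) (simp add: eact_def eaf_add)
 show "eact (scV p u) = scV p (eact u)" by (rule V3_eqI) (simp add: eact_def eaf_sc scV_def)
 show "eact 0 = 0" using a[of 0 0] by (simp only: add_0_left add_cancel_right_left)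
qed

lemma eact_vs:
 "eact (vs One b c d) = vs (Fr 0 False Z0) b c d + vs (Fr 0 False Z1) b c d + vs (Fr 0 False Z2) b c d"
 "eact (vs LX b c d) = vs (Fr 0 True Z0) b c d - vs (Fr 0 True Z2) b c d"
 "eact (vs LY b c d) = vs (Fr 0 True Z1) b c d - vs (Fr 0 True Z0) b c d"
 "eact (vs (Fr a v z) b c d) = vs (Fr (Suc a) v z) b c d"
proof -
 have z: "z = Z0 | z = Z1 | z = Z2" for z by (cases z) auto
 have "eact (vs One b c d) l1 l2 l3 = (vs (Fr 0 False Z0) b c d + vs (Fr 0 False Z1) b c d + vs (Fr 0 False Z2) b c d) l1 l2 l3"
  "eact (vs LX b c d) l1 l2 l3 = (vs (Fr 0 True Z0) b c d - vs (Fr 0 True Z2) b c d) l1 l2 l3"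
  "eact (vs LY b c d) l1 l2 l3 = (vs (Fr 0 True Z1) b c d - vs (Fr 0 True Z0) b c d) l1 l2 l3"
  "eact (vs (Fr a v z) b c d) l1 l2 l3 = vs (Fr (Suc a) v z) b c d l1 l2 l3" for l1 l2 l3
  by (cases l1 rule: eaf_cases; use z in \<open>auto simp: eact_def vs_def\<close>)+
 thus "eact (vs One b c d) = vs (Fr 0 False Z0) b c d + vs (Fr 0 False Z1) b c d + vs (Fr 0 False Z2) b c d"
 "eact (vs LX b c d) = vs (Fr 0 True Z0) b c d - vs (Fr 0 True Z2) b c d"
 "eact (vs LY b c d) = vs (Fr 0 True Z1) b c d - vs (Fr 0 True Z0) b c d"
 "eact (vs (Fr a v z) b c d) = vs (Fr (Suc a) v z) b c d" by (auto intro: V3_eqI)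
qed

lemma fil_eact: "fil k u ==> fil (Suc k) (eact u)"
 unfolding fil_def
proof (intro allI)
 fix l1 l2 l3 e i j
 assume f: "ALL l1 l2 l3 e i j. 3 ^ (k - (i + j + lw l1 + lw l2 + lw l3)) dvd u l1 l2 l3 e $ i $ j"
 hence f': "3 ^ (k - (i + j + lw l1 + lw l2 + lw l3)) dvd u l1 l2 l3 e $ i $ j" for l1 by blast
 show "3 ^ (Suc k - (i + j + lw l1 + lw l2 + lw l3)) dvd eact u l1 l2 l3 e $ i $ j"
  using f'[of One] f'[of LX] f'[of LY]
 proof (cases l1 rule: eaf_cases)
  case (1 a v z) thus ?thesis using f'[of "Fr a v z"] by (simp add: eact_def)
 qed (auto simp: eact_def dvd_diff)
qed

lemma crdP_e2: "crdP (e2p 0 * p) = eact (crdP p)"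
proof (induction p rule: lab_induct)
 case 1 show ?case by (simp only: mult_zero_right crdP_0 eact_0)
next
 case (2 p q) thus ?case by (simp only: distrib_left crdP_add eact_add)
next
 case (3 w l)
 define x y z :: "'w poly9" where "x = pvar 0" "y = pvar 3" "z = pvar 6"
 define q where "q = x * y + y * z + z * x"
 have e: "e2p 0 = q" "e1p 0 = x + y + z" by (simp_all add: e2p_def e1p_def q_def x_y_z_def)
 define Y R :: "'w poly9" where "Y = dbp (lae l)" and "R = letp 1 (la2 l) * letp 2 (la3 l)"
 let ?v = "%m. vs m (la2 l) (la3 l) (dsg (lae l) 1)"
 have A: "crdP (Y * letr x y z m * R) = ?v m" for m
  using crdP_basis[of "lae l" m "la2 l" "la3 l"] unfolding letp_def[of 0] Y_def R_def x_y_z_def by (simp add: mult.assoc)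
 have B: "crdP (Y * (q * letr x y z m) * R) = eact (?v m)" for m
 proof (cases m)
  case One
  have "Y * (q * letr x y z m) * R = Y * letr x y z (Fr 0 False Z0) * R + Y * letr x y z (Fr 0 False Z1) * R
    + Y * letr x y z (Fr 0 False Z2) * R" by (simp add: One q_def alg)
  thus ?thesis unfolding One eact_vs by (simp only: crdP_add A)
 next
  case LX
  have "Y * (q * letr x y z m) * R = e1p 0 * (Y * (x * z) * R) + Y * letr x y z (Fr 0 True Z0) * R
    - Y * letr x y z (Fr 0 True Z2) * R" by (simp add: LX q_def e alg)
  thus ?thesis unfolding LX eact_vs by (simp only: crdP_add crdP_diff A) (simp add: crdP_e1)
 next
  case LY
  have "Y * (q * letr x y z m) * R = e1p 0 * (Y * (x * y) * R) + Y * letr x y z (Fr 0 True Z1) * R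
    - Y * letr x y z (Fr 0 True Z0) * R" by (simp add: LY q_def e alg)
  thus ?thesis unfolding LY eact_vs by (simp only: crdP_add crdP_diff A) (simp add: crdP_e1)
 next
  case (Fr a v z3)
  have "q * letr x y z m = letr x y z (Fr (Suc a) v z3)" unfolding Fr q_def
   by (cases v; cases z3) (simp_all add: mult_ac)
  thus ?thesis unfolding Fr eact_vs by (simp only: A)
 qed
 let ?S = "%p. pconst w * (s3_poly ^ lak l * (s1_poly ^ lai l * (s2_poly ^ laj l * p)))"
 have S: "crdP (?S p) = scV (cL w * s1L ^ lai l * s2L ^ laj l) (crdP p)" for p
  by (simp add: crdP_const crdP_s_pow scV_mult mult.assoc del: fps_const_power)
 have lp: "pconst w * labp l = e1p 0 ^ lac1 l * (e1p 1 ^ lac2 l * (e1p 2 ^ lac3 l * ?S (Y * letr x y z (la1 l) * R)))"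
  "e2p 0 * (pconst w * labp l) = e1p 0 ^ lac1 l * (e1p 1 ^ lac2 l * (e1p 2 ^ lac3 l * ?S (Y * (q * letr x y z (la1 l)) * R)))"
  by (simp_all add: labp_def e(1) Y_def R_def letp_def[of 0] x_y_z_def mult_ac)
 have e0: "crdP (e1p i ^ n * q) = 0" if "i \<in> {0, 1, 2}" "n ~= 0" for i n and q :: "'w poly9"
  using that crdP_e1[of i "e1p i ^ (n - 1) * q"] by (cases n) (auto simp: mult.assoc)
 have C: "crdP (e1p 0 ^ lac1 l * (e1p 1 ^ lac2 l * (e1p 2 ^ lac3 l * p))) =
   (if lac1 l = 0 & lac2 l = 0 & lac3 l = 0 then crdP p else 0)" for p
  using e0[of 0 "lac1 l" "e1p 1 ^ lac2 l * (e1p 2 ^ lac3 l * p)"] e0[of 1 "lac2 l" "e1p 2 ^ lac3 l * p"]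
   e0[of 2 "lac3 l" p] by (cases "lac1 l = 0"; cases "lac2 l = 0"; simp)
 show ?case unfolding lp(2) unfolding lp(1) C S A B by (simp only: eact_scV eact_0 if_distrib[of eact])
qed

lemma lab_dec_inj: "inj ldec"
proof (rule injI)
 fix m n assume "ldec m = ldec n"
 hence "expand (single m (1::'w)) = expand (single n 1)" by (simp add: expand_single)
 hence e: "single m (1::'w) = single n 1" using bij_expand by (simp add: bij_is_inj inj_eq)
 have "(1::'w) ~= 0"
 proof
  assume "(1::'w) = 0"
  hence "res 1 = res 0" by simp
  thus False using res_simps(3,4)[OF witt fin] by simp
 qed
 thus "m = n" using arg_cong[OF e, of keys] by simp
qed

lemma crdP_rel: "p \<in> rel_ideal ==> crdP (q * p) = 0"
proof -
 assume p: "p \<in> rel_ideal"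
 let ?J = "{p. ALL q. crdP (q * p) = 0}"
 have "is_ideal ?J" unfolding is_ideal_def
 proof (intro conjI ballI allI CollectI)
  fix a b q r assume a: "a \<in> ?J"
  { assume "b \<in> ?J"
   thus "crdP (q * (a + b)) = 0" using a by (simp only: distrib_left crdP_add mem_Collect_eq add_0_left) }
  have "q * (r * a) = (q * r) * a" by (simp add: mult.assoc)
  thus "crdP (q * (r * a)) = 0" using a by (simp only: mem_Collect_eq)
 qed (simp only: mult_zero_right crdP_0)
 moreover have "{pvar 0 + pvar 3 + pvar 6, pvar 1 + pvar 4 + pvar 7, pvar 2 + pvar 5 + pvar 8} <= ?J"
 proof -
  have e: "pvar 0 + pvar 3 + pvar 6 = e1p 0" "pvar 1 + pvar 4 + pvar 7 = e1p 1" "pvar 2 + pvar 5 + pvar 8 = e1p 2"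
   by (simp_all add: e1p_def)
  show ?thesis unfolding e using crdP_e1 by (simp add: mult.commute)
 qed
 ultimately show ?thesis using p ideal_spanI unfolding rel_ideal_def by blast
qed

lemma crdP_rel': "p - q \<in> rel_ideal ==> crdP p = crdP q"
 using crdP_rel[of "p - q" 1] by (simp add: crdP_diff)

lemma rep_M_ex: "EX p. m = abs_M p"
 by (induction m rule: M.abs_induct) blast

definition crdM :: "'w M => 'w V" where
 "crdM m = crdP (SOME p. m = abs_M p)"

lemma crdM_abs: "crdM (abs_M p) = crdP p"
proof -
 have "abs_M p = abs_M (SOME q. abs_M p = abs_M q)" by (rule someI) (rule refl)
 hence "p - (SOME q. abs_M p = abs_M q) \<in> rel_ideal" by (simp only: M.abs_eq_iff)
 thus ?thesis unfolding crdM_def using crdP_rel' by metis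
qed

lemma M_Delta_s3: "M_Delta = abs_M s3_poly"
proof -
 have "(\<Prod>i\<in>UNIV. pvar i) = (s3_poly :: 'a::comm_ring_1 poly9)"
  unfolding UNIV_9 by (simp add: s3_poly_def d_poly_def mult_ac)
 thus ?thesis unfolding M_Delta_def by simp
qed

lemma crdM_Delta: "crdM (M_Delta ^ k * m) = crdM m"
proof (induction k)
 case (Suc k)
 have "crdM (M_Delta * m) = crdM m" for m
 proof -
  obtain p where "m = abs_M p" using rep_M_ex by blast
  thus ?thesis by (simp add: M_Delta_s3 times_M.abs_eq crdM_abs crdP_s)
 qed
 thus ?case using Suc by (simp add: mult.assoc)
qed simp

text \<open>The chosen fraction is immaterial because Delta = s3 acts as the identity on
  coordinates.\<close>

definition crd :: "'w Mloc => 'w V" where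
 "crd x = crdM (SOME m. EX i. x = M_frac m i)"

lemma crd_frac: "crd (M_frac m i) = crdM m"
proof -
 have "EX j. M_frac m i = M_frac (SOME n. EX j. M_frac m i = M_frac n j) j" by (rule someI) blast
 then obtain j where "M_frac m i = M_frac (SOME n. EX j. M_frac m i = M_frac n j) j" by blast
 hence *: "frac_rel M_Delta (m, i) (SOME n. EX j. M_frac m i = M_frac n j, j)" by (simp only: M_frac_eq)
 have "crdM m = crdM n" if fr: "frac_rel M_Delta (m, i) (n, j)" for n
 proof -
  obtain l where "M_Delta ^ l * (m * M_Delta ^ j) = M_Delta ^ l * (n * M_Delta ^ i)"
   using fr unfolding frac_rel_def case_prod_conv by blast
  hence "crdM (M_Delta ^ l * (M_Delta ^ j * m)) = crdM (M_Delta ^ l * (M_Delta ^ i * n))"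
   by (simp only: mult.commute)
  thus ?thesis by (simp only: crdM_Delta)
 qed
 from this[OF *] show ?thesis unfolding crd_def by simp
qed

lemma Mloc_cases: "EX p i. (x :: 'w Mloc) = M_frac (abs_M p) i"
proof -
 obtain mi where "x = abs_Mloc mi" by (induction x rule: Mloc.abs_induct) blast
 then obtain m i where "x = M_frac m i" unfolding M_frac_def by (cases mi) auto
 thus ?thesis using rep_M_ex by metis
qed

lemma crd_abs: "crd (M_frac (abs_M p) i) = crdP p"
 by (simp add: crd_frac crdM_abs)

lemma crd_of: "crd (Mloc_of p) = crdP p"
 by (simp add: Mloc_of_def crd_abs)

lemma crdP_s3_pow: "crdP (p * s3_poly ^ i) = crdP p"
 using crdP_s_pow(3)[of i p] by (simp add: mult.commute)

lemma M_power_abs: "abs_M p ^ n = abs_M (p ^ n)"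
 by (induction n) (simp_all add: one_M_def times_M.abs_eq)

lemma crd_add: "crd (x + y) = crd x + crd y"
proof -
 obtain p i q j where x: "x = M_frac (abs_M p) i" "y = M_frac (abs_M q) j" using Mloc_cases by metis
 show ?thesis unfolding x M_frac_simps M_Delta_s3 M_power_abs times_M.abs_eq plus_M.abs_eq crd_abs crdP_add crdP_s3_pow ..
qed

lemma crd_0: "crd 0 = 0"
 using crd_add[of 0 0] by (simp only: add_0_left add_cancel_right_left)

lemma crd_diff: "crd (x - y) = crd x - crd y"
 using crd_add[of "x - y" y] by (simp add: alg)

lemma Mloc_gamma_frac: "Mloc_gamma (M_frac (abs_M p) i) = M_frac (abs_M (gamP p)) i"
 unfolding M_frac_def by (simp add: Mloc_gamma.abs_eq M_gamma.abs_eq)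

lemma crd_gamma: "crd (Mloc_gamma x) = D.gV (crd x)"
proof -
 obtain p i where x: "x = M_frac (abs_M p) i" using Mloc_cases by metis
 show ?thesis unfolding x Mloc_gamma_frac crd_abs by (rule crdP_gamma)
qed

lemma Mloc_of_frac: "Mloc_of q * M_frac (abs_M p) i = M_frac (abs_M (q * p)) i"
 unfolding Mloc_of_def M_frac_simps times_M.abs_eq by simp

lemma crd_mult: "crd (Mloc_of (pconst w) * x) = scV (cL w) (crd x)"
 "crd (Mloc_of s1_poly * x) = scV s1L (crd x)" "crd (Mloc_of s2_poly * x) = scV s2L (crd x)"
 "crd (Mloc_of (e2p 0) * x) = eact (crd x)" "crd (M_frac 1 j * x) = crd x"
 "crd (Mloc_of s3_poly * x) = crd x"
proof -
 obtain p i where x: "x = M_frac (abs_M p) i" using Mloc_cases by metis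
 show "crd (Mloc_of (pconst w) * x) = scV (cL w) (crd x)"
 "crd (Mloc_of s1_poly * x) = scV s1L (crd x)" "crd (Mloc_of s2_poly * x) = scV s2L (crd x)"
 "crd (Mloc_of (e2p 0) * x) = eact (crd x)" "crd (Mloc_of s3_poly * x) = crd x"
  unfolding x Mloc_of_frac crd_abs by (rule crdP_const crdP_s crdP_e2)+
 show "crd (M_frac 1 j * x) = crd x" unfolding x M_frac_simps by (simp add: crd_abs)
qed

end

section \<open>Comparison of the I-adic filtration with the filtration of coordinates\<close>

lemma ideal_span_mono: "S <= ideal_span T ==> ideal_span S <= ideal_span T"
 using ideal_spanI[OF is_ideal_span] by blast

lemma power_list_nilpotent:
 assumes K: "is_ideal K" and g: "!!g. g \<in> set gs ==> g ^ n \<in> K"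
 shows "ideal_power (ideal_span (set gs \<union> K)) (n ^ length gs) <= K"
 using g
proof (induction gs)
 case Nil
 have "{a * b | a b. a \<in> K & b \<in> ideal_power K 0} <= K" using ideal_mult_right[OF K] by blast
 hence "ideal_power K 1 <= K" unfolding One_nat_def ideal_power.simps(2) using ideal_spanI[OF K] by blast
 moreover have "ideal_span K = K" using ideal_spanI[OF K, of K] ideal_span_base by blast
 ultimately show ?case by simp
next
 case (Cons g gs)
 let ?K = "ideal_span (set gs \<union> K)"
 have "ideal_span (set (g # gs) \<union> K) <= ideal_span (insert g ?K)"
  by (rule ideal_span_mono) (auto intro!: ideal_span_base)
 hence 1: "ideal_power (ideal_span (set (g # gs) \<union> K)) n <= ideal_power (ideal_span (insert g ?K)) n"
  using ring_hom_ideal_power[of "%x. x" "ideal_span (set (g # gs) \<union> K)" "ideal_span (insert g ?K)"]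
  by (auto simp: is_ring_hom_def)
 have "g ^ n \<in> ?K" using Cons.prems by (intro ideal_span_base) simp
 hence "ideal_power (ideal_span (insert g ?K)) n <= ?K"
  by (rule power_insert_nilpotent[OF is_ideal_span])
 hence "ideal_power (ideal_span (set (g # gs) \<union> K)) n <= ?K" using 1 by blast
 hence "ideal_power (ideal_span (set (g # gs) \<union> K)) (n * n ^ length gs) <= ideal_power ?K (n ^ length gs)"
  by (rule power_power)
 thus ?case using Cons by simp
qed

lemma Mloc_of_simps: "Mloc_of (p * q) = Mloc_of p * Mloc_of q" "Mloc_of (p + q) = Mloc_of p + Mloc_of q"
 "Mloc_of 1 = 1" "Mloc_of 0 = 0" "Mloc_of (- p) = - Mloc_of p" "Mloc_of (p - q) = Mloc_of p - Mloc_of q"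
proof -
 show a: "Mloc_of (p + q) = Mloc_of p + Mloc_of q" for p q :: "'a poly9" by (rule Mloc_of_add)
 show "Mloc_of (p * q) = Mloc_of p * Mloc_of q"
  unfolding Mloc_of_def M_frac_simps times_M.abs_eq by simp
 show "Mloc_of 1 = 1" unfolding Mloc_of_def one_M_def[symmetric] by (rule M_frac_simps)
 show "Mloc_of 0 = 0" unfolding Mloc_of_def zero_M_def[symmetric] by (rule M_frac_simps)
 show m: "Mloc_of (- p) = - Mloc_of p" for p :: "'a poly9"
  unfolding Mloc_of_def M_frac_simps uminus_M.abs_eq ..
 show "Mloc_of (p - q) = Mloc_of p - Mloc_of q" using a[of p "- q"] m[of q] by simp
qed

lemma Mloc_of_power: "Mloc_of (p ^ n) = Mloc_of p ^ n"
 by (induction n) (simp_all add: Mloc_of_simps)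

lemma Mloc_of_sum: "Mloc_of (sum f X) = (SUM i:X. Mloc_of (f i))"
 by (induction X rule: infinite_finite_induct) (simp_all add: Mloc_of_simps)

lemma Mloc_of_rel: "p - q \<in> rel_ideal ==> Mloc_of p = Mloc_of q"
 unfolding Mloc_of_def by (rule arg_cong[of _ _ "%m. M_frac m 0"]) (simp only: M.abs_eq_iff)

lemma Mloc_of_e1: "i \<in> {0, 1, 2} ==> Mloc_of (e1p i) = 0"
proof -
 assume "i \<in> {0, 1, 2}"
 hence "e1p i - 0 \<in> rel_ideal"
  unfolding rel_ideal_def by (auto simp: e1p_def intro!: ideal_span_base)
 thus ?thesis using Mloc_of_rel Mloc_of_simps(4) by metis
qed

lemma pconst_3: "pconst 3 = 3"
proof -
 have "pconst (1 + 1 + 1) = 1 + (1::'a poly9) + 1" by (simp only: pconst_add pconst_1)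
 thus ?thesis by simp
qed

lemma ninth_power_diff: "EX q. (x - y) ^ 9 = x ^ 9 - y ^ 9 + 3 * (q :: 'a::comm_ring_1)"
proof -
 have c: "(a + 3 * b) ^ 3 = a ^ 3 + 3 * (3 * (a * a * b) + 9 * (a * b * b) + 9 * (b * b * b))" for a b :: 'a
  by (simp add: power3_eq_cube alg)
 have d: "(x - y) ^ 3 = (x ^ 3 - y ^ 3) + 3 * (x * y * y - x * x * y)" for x y :: 'a
  by (simp add: power3_eq_cube alg)
 have p: "a ^ 9 = (a ^ 3) ^ 3" for a :: 'a by (simp flip: power_mult)
 show ?thesis
  unfolding p[of "x - y"] p[of x] p[of y] d[of x y] c d[of "x ^ 3" "y ^ 3"]
  by (metis (no_types, opaque_lifting) add.assoc distrib_left)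
qed

lemma pvar_cubed: "pvar 0 ^ 3 = e1p 0 * pvar 0 ^ 2 - e2p 0 * pvar 0 + d_poly 0"
 by (simp add: e1p_def e2p_def d_poly_def power3_eq_cube power2_eq_square alg)

lemma d_cubed: "d_poly 0 ^ 3 = s1_poly * d_poly 0 ^ 2 - s2_poly * d_poly 0 + s3_poly"
 unfolding s1_poly_def s2_poly_def s3_poly_def
 by (simp add: power3_eq_cube power2_eq_square alg)

definition loc_ideal :: "'w::comm_ring_1 poly9 set" where
 "loc_ideal = {p. Mloc_of p \<in> Mloc_I}"

lemma is_ideal_Mloc_I: "is_ideal Mloc_I"
 unfolding Mloc_I_def by (rule is_ideal_span)

lemma loc_ideal_ideal: "is_ideal loc_ideal"
 using is_ideal_Mloc_I unfolding loc_ideal_def is_ideal_def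
 by (simp only: mem_Collect_eq Mloc_of_simps Ball_def) blast

lemma loc_ideal_3: "3 \<in> loc_ideal"
 unfolding loc_ideal_def pconst_3[symmetric] Mloc_I_def by (auto intro: ideal_span_base)

lemma loc_ideal_pvar: "pvar i - pvar 0 \<in> (loc_ideal :: 'w::comm_ring_1 poly9 set)"
proof -
 have *: "i \<in> {0, 1, 2, 3, 4, 5, 6, 7} ==> pvar i - pvar (i + 1) \<in> (loc_ideal :: 'w poly9 set)" for i :: 9
  unfolding loc_ideal_def Mloc_I_def by (auto intro: ideal_span_base)
 have s: "pvar (i + 1) - pvar 0 \<in> (loc_ideal :: 'w poly9 set)"
  if "i \<in> {0, 1, 2, 3, 4, 5, 6, 7}" "pvar i - pvar 0 \<in> (loc_ideal :: 'w poly9 set)" for i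
  using ideal_trans[OF loc_ideal_ideal ideal_sym[OF loc_ideal_ideal *[OF that(1)]] that(2)] .
 have 0: "pvar 0 - pvar 0 \<in> (loc_ideal :: 'w poly9 set)" by (simp add: ideal_0[OF loc_ideal_ideal])
 have "i \<in> {0, 1, 2, 3, 4, 5, 6, 7, 8}" using UNIV_9 by blast
 thus ?thesis
  using 0 s[of 0] s[of 1] s[of 2] s[of 3] s[of 4] s[of 5] s[of 6] s[of 7] by auto
qed

lemma loc_ideal_d: "d_poly i - pvar 0 ^ 3 \<in> loc_ideal"
 unfolding d_poly_def power3_eq_cube
 by (intro ideal_cong_mult[OF loc_ideal_ideal] loc_ideal_pvar)

lemma loc_ideal_tripleI:
 "a - x \<in> loc_ideal ==> b - x \<in> loc_ideal ==> c - x \<in> loc_ideal ==> a + b + c \<in> loc_ideal"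
proof -
 assume "a - x \<in> loc_ideal" "b - x \<in> loc_ideal" "c - x \<in> loc_ideal"
 hence "(a - x) + (b - x) + (c - x) + x * 3 \<in> loc_ideal"
  using ideal_add[OF loc_ideal_ideal] ideal_mult[OF loc_ideal_ideal loc_ideal_3] by blast
 thus ?thesis by (simp add: alg)
qed

lemma loc_ideal_sym: "s1_poly \<in> loc_ideal" "s2_poly \<in> loc_ideal" "e2p i \<in> loc_ideal"
proof -
 show "s1_poly \<in> loc_ideal" unfolding s1_poly_def by (rule loc_ideal_tripleI loc_ideal_d)+
 show "s2_poly \<in> loc_ideal" unfolding s2_poly_def
  by (rule loc_ideal_tripleI[of _ "pvar 0 ^ 3 * pvar 0 ^ 3"]; intro ideal_cong_mult[OF loc_ideal_ideal] loc_ideal_d)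
 show "e2p i \<in> loc_ideal" unfolding e2p_def
  by (rule loc_ideal_tripleI[of _ "pvar 0 * pvar 0"]; intro ideal_cong_mult[OF loc_ideal_ideal] loc_ideal_pvar)
qed

lemma loc_ideal_power: "p \<in> loc_ideal ==> Mloc_of (p ^ n) \<in> Ipow n"
 unfolding Mloc_of_power loc_ideal_def by (intro power_in) simp

lemma letr_in: "EX q. letp i l = e2p i ^ (lw l - 1) * q"
 by (cases l rule: letter_cases9) (auto simp: letp_def e2p_def)

lemma letp_power: "Mloc_of (letp i l) \<in> Ipow (lw l - 1)"
proof -
 obtain q where "letp i l = (e2p i ^ (lw l - 1) * q :: 'a poly9)" using letr_in by blast
 hence "Mloc_of (letp i l :: 'a poly9) = Mloc_of (e2p i ^ (lw l - 1)) * Mloc_of q" by (simp add: Mloc_of_simps)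
 thus ?thesis using loc_ideal_power[OF loc_ideal_sym(3)] ideal_mult_right[OF is_ideal_power] by metis
qed

lemma Mloc_gamma_9: "(Mloc_gamma ^^ 9) (x :: 'a::comm_ring_1 Mloc) = x"
proof -
 obtain mi where "x = abs_Mloc mi" by (induction x rule: Mloc.abs_induct) blast
 then obtain m i where m: "x = M_frac m i" unfolding M_frac_def by (cases mi) auto
 obtain p where p: "m = abs_M p" by (induction m rule: M.abs_induct) blast
 have "(Mloc_gamma ^^ n) (M_frac (abs_M p) i) = M_frac (abs_M ((gamP ^^ n) p)) i" for n
  by (induction n) (simp_all add: M_frac_def Mloc_gamma.abs_eq M_gamma.abs_eq)
 thus ?thesis unfolding m p by (simp add: poly9_gamma_9)
qed

context wittk
begin

lemma gV_fil_pos: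
 assumes "fil k u" shows "fil k (D.gV u)"
 unfolding fil_def
proof (intro allI)
 fix l1 l2 l3 e i j
 let ?n = "%i j. i + j + lw l1 + lw l2 + lw l3"
 have u: "3 ^ (k - (i + j + lw m + lw l2 + lw l3)) dvd u l2 l3 m e $ i $ j" for m e i j
  using assms unfolding fil_def by (metis add.assoc add.commute)
 define c where "c = gact (u l2 l3) l1"
 have c: "3 ^ (k - ?n i j) dvd c e $ i $ j" for e i j
 proof (cases l1)
  case One thus ?thesis using u[of i j One e] by (simp add: c_def)
 next
  case LX thus ?thesis using u[of i j LY e] by (simp add: c_def)
 next
  case LY thus ?thesis using u[of i j LY e] u[of i j LX e] by (simp add: c_def dvd_diff)
 next
  case (Fr a v z) thus ?thesis using u[of i j "Fr a v (prev3 z)" e] by (simp add: c_def)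
 qed
 have s1: "3 ^ (k - ?n i j) dvd (s1L * c e) $ i $ j" for e
  unfolding s1L_nth using dvd_trans[OF le_imp_power_dvd c[of "i - 1" j e], of "k - ?n i j"] by auto
 have s2: "3 ^ (k - ?n i j) dvd (s2L * c e) $ i $ j" for e
  unfolding s2L_nth using dvd_trans[OF le_imp_power_dvd c[of i "j - 1" e], of "k - ?n i j"] by auto
 have "D.gV u l1 l2 l3 = gD c" by (simp add: D.gV_def c_def)
 thus "3 ^ (k - (i + j + lw l1 + lw l2 + lw l3)) dvd D.gV u l1 l2 l3 e $ i $ j"
  using s1 s2 c by (cases e) (simp_all add: dvd_add dvd_diff del: fps_mult_fps_X_commute)
qed

text \<open>The steps of \<open>fil\<close> are not visibly preserved by multiplication in the ring,
  so each is replaced by the largest ideal inside it; \<open>Jk\<close> then consists of the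
  multipliers that raise the step by one.\<close>

definition Fk :: "nat => 'w Mloc set" where
 "Fk k = {n. ALL r. fil k (crd (r * n))}"

definition Jk :: "'w Mloc set" where
 "Jk = {m. ALL k. ALL n:Fk k. m * n \<in> Fk (Suc k)}"

lemma is_ideal_Fk: "is_ideal (Fk k)"
 unfolding is_ideal_def Fk_def
proof (intro conjI ballI allI CollectI)
 fix r s a b assume a: "a \<in> {n. ALL r. fil k (crd (r * n))}"
 show "fil k (crd (s * (r * a)))" using a by (simp flip: mult.assoc)
 assume "b \<in> {n. ALL r. fil k (crd (r * n))}"
 thus "fil k (crd (r * (a + b)))" using a by (simp only: distrib_left crd_add fil_add mem_Collect_eq)
qed (simp only: mult_zero_right crd_0 fil_0)

lemma is_ideal_Jk: "is_ideal Jk"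
 unfolding is_ideal_def Jk_def
proof (intro conjI ballI allI CollectI)
 fix r a b k n assume a: "a \<in> {m. ALL k. ALL n:Fk k. m * n \<in> Fk (Suc k)}" and n: "n \<in> Fk k"
 show "r * a * n \<in> Fk (Suc k)" using a n ideal_mult[OF is_ideal_Fk] by (simp add: mult.assoc)
 assume "b \<in> {m. ALL k. ALL n:Fk k. m * n \<in> Fk (Suc k)}"
 thus "(a + b) * n \<in> Fk (Suc k)" using a n ideal_add[OF is_ideal_Fk] by (simp add: distrib_right)
qed (simp add: ideal_0[OF is_ideal_Fk])

lemma JkI: "(!!x k. fil k (crd x) ==> fil (Suc k) (crd (m * x))) ==> m \<in> Jk"
 unfolding Jk_def Fk_def
proof (intro CollectI allI ballI)
 fix k n r assume a: "!!x k. fil k (crd x) ==> fil (Suc k) (crd (m * x))" and n: "n \<in> {n. ALL r. fil k (crd (r * n))}"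
 have "fil (Suc k) (crd (m * (r * n)))" using n by (intro a) blast
 thus "fil (Suc k) (crd (r * (m * n)))" by (simp only: mult.left_commute)
qed

lemma Jk_gens: "Mloc_of (pconst 3) \<in> Jk" "Mloc_of s1_poly \<in> Jk" "Mloc_of s2_poly \<in> Jk" "Mloc_of (e2p 0) \<in> Jk"
proof -
 have "cL (3::'w) = 3" by (simp add: numeral_fps_const)
 thus "Mloc_of (pconst 3) \<in> Jk" by (intro JkI) (simp add: crd_mult fil_3)
qed (intro JkI; simp only: crd_mult fil_s1 fil_s2 fil_eact)+

lemma Fk_gamma: "n \<in> Fk k ==> Mloc_gamma n \<in> Fk k"
 unfolding Fk_def
proof (intro CollectI allI)
 fix r :: "'w Mloc" assume n: "n \<in> {n. ALL r. fil k (crd (r * n))}"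
 define s where "s = (Mloc_gamma ^^ 8) r"
 have "r = Mloc_gamma s" using Mloc_gamma_9[of r] unfolding s_def by (simp add: numeral_eq_Suc)
 hence "crd (r * Mloc_gamma n) = D.gV (crd (s * n))" by (simp add: Mloc_gamma_simps(2)[symmetric] crd_gamma)
 thus "fil k (crd (r * Mloc_gamma n))" using n gV_fil_pos by simp
qed

lemma Jk_gamma: "m \<in> Jk ==> Mloc_gamma m \<in> Jk"
 unfolding Jk_def
proof (intro CollectI allI ballI)
 fix k n assume m: "m \<in> {m. ALL k. ALL n:Fk k. m * n \<in> Fk (Suc k)}" and n: "n \<in> Fk k"
 have g: "(Mloc_gamma ^^ i) n \<in> Fk k" for i by (induction i) (simp_all add: n Fk_gamma)
 define s where "s = (Mloc_gamma ^^ 8) n"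
 have s: "n = Mloc_gamma s" using Mloc_gamma_9[of n] unfolding s_def by (simp add: numeral_eq_Suc)
 have "m * s \<in> Fk (Suc k)" using m g[of 8] unfolding s_def by blast
 thus "Mloc_gamma m * n \<in> Fk (Suc k)" unfolding s Mloc_gamma_simps(2)[symmetric] by (rule Fk_gamma)
qed

text \<open>The cubic equation of x_0 becomes x_0^3 = d1 modulo e1 and e2, that of d1 becomes d1^3 =
  s3 modulo s1 and s2, and all four elements give multipliers in \<open>Jk\<close>. The action of
  gamma passes to the other variables.\<close>

lemma Jk_pvar: "Mloc_of (pvar i ^ 9) - Mloc_of s3_poly \<in> Jk"
proof -
 define K where "K = {p. Mloc_of p \<in> Jk}"
 have K: "is_ideal K" using is_ideal_Jk unfolding K_def is_ideal_def by (simp add: Mloc_of_simps)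
 have g: "e1p 0 \<in> K" "e2p 0 \<in> K" "s1_poly \<in> K" "s2_poly \<in> K"
  using Jk_gens ideal_0[OF is_ideal_Jk] by (simp_all add: K_def Mloc_of_e1)
 have "pvar 0 ^ 2 * e1p 0 - pvar 0 * e2p 0 \<in> K" using g ideal_mult[OF K] ideal_minus[OF K] by blast
 hence 1: "pvar 0 ^ 3 - d_poly 0 \<in> K" by (simp add: pvar_cubed mult.commute)
 have "d_poly 0 ^ 2 * s1_poly - d_poly 0 * s2_poly \<in> K" using g ideal_mult[OF K] ideal_minus[OF K] by blast
 hence 2: "d_poly 0 ^ 3 - s3_poly \<in> K" by (simp add: d_cubed mult.commute)
 have "(pvar 0 ^ 3) ^ 3 - d_poly 0 ^ 3 \<in> K"
  unfolding power3_eq_cube[of "pvar 0 ^ 3"] power3_eq_cube[of "d_poly 0"] by (intro ideal_cong_mult[OF K] 1)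
 hence "pvar 0 ^ 9 - s3_poly \<in> K" using ideal_trans[OF K _ 2] by (simp flip: power_mult)
 hence 3: "Mloc_of (pvar 0 ^ 9) - Mloc_of s3_poly \<in> Jk" by (simp add: K_def Mloc_of_simps)
 have 4: "Mloc_of (pvar (of_nat n) ^ 9) - Mloc_of s3_poly \<in> Jk" for n
 proof (induction n)
  case (Suc n)
  have "Mloc_gamma (Mloc_of (pvar (of_nat n) ^ 9) - Mloc_of (s3_poly :: 'w poly9)) = Mloc_of (pvar (of_nat (Suc n)) ^ 9) - Mloc_of s3_poly"
   by (simp add: Mloc_gamma_simps Mloc_gamma_of poly9_gamma_pow poly9_gamma_pvar gamma_sym add.commute)
  thus ?case using Jk_gamma[OF Suc] by (simp only:)
 qed (simp add: 3)
 have "i \<in> {0, 1, 2, 3, 4, 5, 6, 7, 8}" using UNIV_9 by blast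
 thus ?thesis using 4[of 0] 4[of 1] 4[of 2] 4[of 3] 4[of 4] 4[of 5] 4[of 6] 4[of 7] 4[of 8]
  by auto
qed

lemma Jk_diff: "Mloc_of (pvar i - pvar j) ^ 9 \<in> Jk"
proof -
 obtain q :: "'w poly9" where q: "(pvar i - pvar j) ^ 9 = pvar i ^ 9 - pvar j ^ 9 + 3 * q" using ninth_power_diff by blast
 have "Mloc_of (pvar i - pvar j) ^ 9 = ((Mloc_of (pvar i ^ 9) - Mloc_of s3_poly) - (Mloc_of (pvar j ^ 9) - Mloc_of s3_poly))
   + Mloc_of (pconst 3) * Mloc_of q"
  unfolding Mloc_of_power[symmetric] q by (simp add: Mloc_of_simps pconst_3 del: Mloc_of_power)
 thus ?thesis
  using Jk_pvar Jk_gens(1) ideal_minus[OF is_ideal_Jk] ideal_add[OF is_ideal_Jk] ideal_mult_right[OF is_ideal_Jk] by metis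
qed

text \<open>The eight differences x_i - x_(i+1) have their ninth powers in \<open>Jk\<close>, and
  \<open>power_list_nilpotent\<close> turns eight generators with exponent 9 into 9^8.\<close>

definition cI :: nat where "cI = 9 ^ 8"

lemma Ipow_Jk: "Ipow cI <= Jk"
proof -
 let ?gs = "map (%i. Mloc_of (pvar i - pvar (i + 1))) [0, 1, 2, 3, 4, 5, 6, 7 :: 9] :: 'w Mloc list"
 have 1: "ideal_power (ideal_span (set ?gs \<union> Jk)) (9 ^ length ?gs) <= Jk"
  by (rule power_list_nilpotent[OF is_ideal_Jk]) (auto simp: Jk_diff simp del: diff_add_cancel)
 have "Mloc_I <= ideal_span (set ?gs \<union> Jk)"
  unfolding Mloc_I_def using Jk_gens(1) by (intro ideal_span_mono) (auto intro!: ideal_span_base)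
 hence "ideal_power Mloc_I n <= ideal_power (ideal_span (set ?gs \<union> Jk)) n" for n
  using ring_hom_ideal_power[of "%x. x" Mloc_I "ideal_span (set ?gs \<union> Jk)"] by (auto simp: is_ring_hom_def)
 thus ?thesis using 1 unfolding cI_def by (auto simp del: ideal_power.simps)
qed

lemma Jk_Fk: "ideal_power Jk k <= Fk k"
proof (induction k)
 case 0 show ?case by (simp add: Fk_def fil_all)
next
 case (Suc k)
 have "{a * b | a b. a \<in> Jk & b \<in> ideal_power Jk k} <= Fk (Suc k)" using Suc unfolding Jk_def by blast
 thus ?case unfolding ideal_power.simps(2) using ideal_spanI[OF is_ideal_Fk] by blast
qed

lemma fil_crd: "x \<in> Ipow (cI * k) ==> fil k (crd x)"
proof -
 assume "x \<in> Ipow (cI * k)"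
 hence "x \<in> Fk k" using power_power[OF Ipow_Jk] Jk_Fk by blast
 hence "fil k (crd (1 * x))" unfolding Fk_def by blast
 thus ?thesis by simp
qed

definition pos_deg :: "letter => letter => letter => dbasis => nat => nat => nat" where
 "pos_deg l1 l2 l3 e i j = 3 * i + 6 * j + db_deg e + let_deg l1 + let_deg l2 + let_deg l3"

text \<open>The exponent of s3 has been forgotten, so a position determines the degree only modulo
  18; k is the exponent that the degree t restores.\<close>

definition Vt :: "int => 'w V set" where
 "Vt t = {u. ALL l1 l2 l3 e i j. u l1 l2 l3 e $ i $ j ~= 0 --> (EX k. t = - 2 * int (pos_deg l1 l2 l3 e i j) - 18 * k)}"

lemma vlab_nth: "vlab l w l1 l2 l3 e $ i $ j =
  (if l = Label l1 l2 l3 e i j (lak l) 0 0 0 then w else 0)"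
proof -
 have "dsg a (cL w * s1L ^ m * s2L ^ n) e $ i $ j = (if e = a & i = m & j = n then w else 0)" for a m n
  by (cases "e = a") (simp_all only: dsg_def lmon_nth if_True if_False simp_thms fps_zero_nth)
 thus ?thesis by (cases l) (auto simp: vlab_def vs_def)
qed

lemma hmg_crdP:
 assumes "hmg d p"
 obtains q where "p = (SUM m:keys q. pconst (lookup q m) * labp (ldec m))"
  "!!m. m \<in> keys q ==> lab_deg (ldec m) = d"
  "!!l1 l2 l3 e i j. crdP p l1 l2 l3 e $ i $ j =
    (SUM m:keys q. if ldec m = Label l1 l2 l3 e i j (lak (ldec m)) 0 0 0 then lookup q m else 0)"
proof -
 define q where "q = part d (inv_into UNIV expand p)"
 have q: "expand q = p" unfolding q_def part_expand[symmetric] expand_inv using part_hmg[OF assms, of d] by simp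
 have s: "sum f X l1 l2 l3 e $ i $ j = (SUM m:X. f m l1 l2 l3 e $ i $ j)" for f :: "mono => 'w V" and X l1 l2 l3 e i j
  by (induction X rule: infinite_finite_induct) auto
 show ?thesis
 proof
  show "p = (SUM m:keys q. pconst (lookup q m) * labp (ldec m))"
   using q by (simp add: expand_def lin_def)
  show "lab_deg (ldec m) = d" if "m \<in> keys q" for m
   using that hmg_part[of d "inv_into UNIV expand p"] unfolding lab_deg_dec q_def hmg_def by blast
  show "crdP p l1 l2 l3 e $ i $ j =
    (SUM m:keys q. if ldec m = Label l1 l2 l3 e i j (lak (ldec m)) 0 0 0 then lookup q m else 0)" for l1 l2 l3 e i j
   unfolding q[symmetric] crdP_expand lin_def s vlab_nth ..
 qed
qed

lemma hmg_poly9_part: "p \<in> poly9_part t ==> p ~= 0 ==> EX d. t = - 2 * int d & hmg d p"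
proof -
 assume p: "p \<in> poly9_part t" "p ~= 0"
 obtain m where m: "m \<in> keys p" using p(2) by fastforce
 have *: "ALL m:keys p. t = - 2 * int (degm m)" using p(1) unfolding poly9_part_def degm_def by blast
 hence "t = - 2 * int (degm m)" using m by blast
 moreover have "hmg (degm m) p" unfolding hmg_def
 proof
  fix n assume "n \<in> keys p"
  hence "t = - 2 * int (degm n)" using * by blast
  thus "degm n = degm m" using \<open>t = - 2 * int (degm m)\<close> by linarith
 qed
 ultimately show ?thesis by blast
qed

lemma part_poly9: "hmg d p ==> p \<in> poly9_part (- 2 * int d)"
 unfolding hmg_def poly9_part_def degm_def by auto

lemma Mloc_part_cases:
 assumes "x \<in> Mloc_part t"
 obtains "x = 0" | d p n where "t = 18 * int n - 2 * int d" "hmg d p" "x = M_frac 1 n * Mloc_of p"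
proof -
 obtain m n where m: "x = M_frac m n" "m \<in> M_part (t - 18 * int n)" using assms unfolding Mloc_part_def by blast
 then obtain p where p: "m = abs_M p" "p \<in> poly9_part (t - 18 * int n)" unfolding M_part_def by blast
 have x: "x = M_frac 1 n * Mloc_of p" unfolding m(1) p(1) Mloc_of_def M_frac_simps by simp
 show ?thesis
 proof (cases "p = 0")
  case True thus ?thesis using x that(1) by (simp add: Mloc_of_simps)
 next
  case False
  then obtain d where d: "t - 18 * int n = - 2 * int d" "hmg d p" using hmg_poly9_part[OF p(2)] by blast
  hence "t = 18 * int n - 2 * int d" by linarith
  thus ?thesis using that(2) d(2) x by blast
 qed
qed

lemma crd_part:
 assumes "x \<in> Mloc_part t"
 shows "crd x \<in> Vt t"
 using assms
proof (cases rule: Mloc_part_cases)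
 case 1 thus ?thesis by (simp add: crd_0 Vt_def)
next
 case (2 d p n)
 obtain q where q: "!!m. m \<in> keys q ==> lab_deg (ldec m) = d"
  "!!l1 l2 l3 e i j. crdP p l1 l2 l3 e $ i $ j =
    (SUM m:keys q. if ldec m = Label l1 l2 l3 e i j (lak (ldec m)) 0 0 0 then lookup q m else 0)"
  by (rule hmg_crdP[OF 2(2)]) blast
 show ?thesis unfolding Vt_def
 proof (intro CollectI allI impI)
  fix l1 l2 l3 e i j assume "crd x l1 l2 l3 e $ i $ j ~= 0"
  hence "crdP p l1 l2 l3 e $ i $ j ~= 0" unfolding 2(3) crd_mult crd_of .
  moreover have "crdP p l1 l2 l3 e $ i $ j = 0"
   if "!!m. m \<in> keys q ==> ldec m ~= Label l1 l2 l3 e i j (lak (ldec m)) 0 0 0"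
   unfolding q(2) by (rule sum.neutral) (use that in simp)
  ultimately obtain m where m: "m \<in> keys q" "ldec m = Label l1 l2 l3 e i j (lak (ldec m)) 0 0 0"
   by blast
  have "lab_deg (Label l1 l2 l3 e i j (lak (ldec m)) 0 0 0) = d" using q(1)[OF m(1)] m(2) by simp
  hence "t = - 2 * int (pos_deg l1 l2 l3 e i j) - 18 * (int (lak (ldec m)) - int n)"
   unfolding 2(1) lab_deg_def pos_deg_def by simp
  thus "EX k. t = - 2 * int (pos_deg l1 l2 l3 e i j) - 18 * k" by blast
 qed
qed

text \<open>The loss of 3 comes from the three letters: \<open>Fr a\<close> has weight a + 1 but is
  only seen to lie in the a-th power of I, through its factor e2^a.\<close>

lemma Ipow_lab:
 assumes "lac1 l = 0" "lac2 l = 0" "lac3 l = 0"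
  "3 ^ (k - (lai l + laj l + lw (la1 l) + lw (la2 l) + lw (la3 l))) dvd w"
 shows "Mloc_of (pconst w * labp l :: 'w poly9) \<in> Ipow (k - 3)"
proof -
 define r where "r = k - (lai l + laj l + lw (la1 l) + lw (la2 l) + lw (la3 l))"
 obtain v where v: "w = 3 ^ r * v" using assms(4) unfolding r_def by (auto simp: dvd_def)
 have p3: "pconst (3 ^ n) = (3 ^ n :: 'w poly9)" for n
  by (induction n) (simp_all add: pconst_1 pconst_mult pconst_3)
 have e: "Mloc_of (pconst w * labp l :: 'w poly9) = Mloc_of (pconst v * s3_poly ^ lak l * dbp (lae l)) *
   (Mloc_of (3 ^ r) * (Mloc_of (s1_poly ^ lai l) * (Mloc_of (s2_poly ^ laj l) *
   (Mloc_of (letp 0 (la1 l)) * (Mloc_of (letp 1 (la2 l)) * Mloc_of (letp 2 (la3 l)))))))"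
  unfolding Mloc_of_simps(1)[symmetric] v pconst_mult p3 labp_def assms(1-3)
  by (rule arg_cong[of _ _ Mloc_of]) (simp add: mult_ac)
 have "Mloc_of (3 ^ r) * (Mloc_of (s1_poly ^ lai l) * (Mloc_of (s2_poly ^ laj l) *
   (Mloc_of (letp 0 (la1 l)) * (Mloc_of (letp 1 (la2 l)) * Mloc_of (letp 2 (la3 l)))))) \<in>
   (Ipow (r + (lai l + (laj l + ((lw (la1 l) - 1) + ((lw (la2 l) - 1) + (lw (la3 l) - 1)))))) :: 'w Mloc set)"
  by (intro power_mult letp_power loc_ideal_power loc_ideal_3 loc_ideal_sym)
 moreover have "k - 3 \<le> r + (lai l + (laj l + ((lw (la1 l) - 1) + ((lw (la2 l) - 1) + (lw (la3 l) - 1)))))"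
  unfolding r_def by linarith
 ultimately show ?thesis unfolding e
  using power_antimono ideal_mult[OF is_ideal_power] by blast
qed

lemma Ipow_crd:
 assumes x: "x \<in> Mloc_part t" and f: "fil k (crd x)"
 shows "x \<in> Ipow (k - 3)"
 using x
proof (cases rule: Mloc_part_cases)
 case 1 thus ?thesis by (simp only: ideal_0[OF is_ideal_power])
next
 case (2 d p n)
 obtain q where q: "p = (SUM m:keys q. pconst (lookup q m) * labp (ldec m))"
  "!!m. m \<in> keys q ==> lab_deg (ldec m) = d"
  "!!l1 l2 l3 e i j. crdP p l1 l2 l3 e $ i $ j =
    (SUM m:keys q. if ldec m = Label l1 l2 l3 e i j (lak (ldec m)) 0 0 0 then lookup q m else 0)"
  by (rule hmg_crdP[OF 2(2)]) blast
 have fp: "fil k (crdP p)" using f unfolding 2(3) crd_mult crd_of .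
 have "Mloc_of (pconst (lookup q m) * labp (ldec m)) \<in> Ipow (k - 3)"
  if m: "m \<in> keys q" for m
 proof -
  define l where "l = ldec m"
  show ?thesis
  proof (cases "lac1 l = 0 & lac2 l = 0 & lac3 l = 0")
   case True
   have l: "l = Label (la1 l) (la2 l) (la3 l) (lae l) (lai l) (laj l) (lak l) 0 0 0"
    using True by (cases l) auto
   have "crdP p (la1 l) (la2 l) (la3 l) (lae l) $ (lai l) $ (laj l) =
     (SUM m':keys q. if m' = m then lookup q m' else 0)"
    unfolding q(3)
   proof (rule sum.cong[OF refl])
    fix m' assume m': "m' \<in> keys q"
    let ?L = "%k. Label (la1 l) (la2 l) (la3 l) (lae l) (lai l) (laj l) k 0 0 0"
    \<comment> \<open>Homogeneity makes up for the missing exponent of s3: two labels of the same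
      degree that agree elsewhere are equal.\<close>
    have "ldec m' = ?L (lak (ldec m')) <-> m' = m"
    proof
     assume a: "ldec m' = ?L (lak (ldec m'))"
     have "lab_deg (?L (lak (ldec m'))) = lab_deg (?L (lak l))"
      using q(2)[OF m'] q(2)[OF m] a l unfolding l_def[symmetric] by metis
     hence "lak (ldec m') = lak l" by (simp add: lab_deg_def)
     hence "ldec m' = ldec m" using a l unfolding l_def[symmetric] by metis
     thus "m' = m" using lab_dec_inj by (simp add: inj_eq)
    next
     assume "m' = m" thus "ldec m' = ?L (lak (ldec m'))" using l l_def by simp
    qed
    thus "(if ldec m' = ?L (lak (ldec m')) then lookup q m' else 0)
      = (if m' = m then lookup q m' else 0)" by simp
   qed
   also have "... = lookup q m" using m by simp
   finally have "crdP p (la1 l) (la2 l) (la3 l) (lae l) $ (lai l) $ (laj l) = lookup q m" .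
   thus ?thesis unfolding l_def[symmetric] using fp True unfolding fil_def by (intro Ipow_lab) metis+
  next
   case False
   have z: "Mloc_of (e1p i) ^ n = (0 :: 'w Mloc)" if "i \<in> {0, 1, 2}" "n ~= 0" for i n
    using that(2) Mloc_of_e1[OF that(1), where 'a = 'w] by (cases n) simp_all
   have "Mloc_of (labp l :: 'w poly9) = 0"
    using False z[of 0 "lac1 l"] z[of 1 "lac2 l"] z[of 2 "lac3 l"]
    unfolding labp_def Mloc_of_simps Mloc_of_power by auto
   thus ?thesis unfolding l_def[symmetric] Mloc_of_simps by (simp add: ideal_0[OF is_ideal_power] del: ideal_power.simps)
  qed
 qed
 hence "Mloc_of p \<in> Ipow (k - 3)" by (subst q(1), unfold Mloc_of_sum) (rule ideal_sum[OF is_ideal_power])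
 thus ?thesis unfolding 2(3) by (rule ideal_mult[OF is_ideal_power])
qed

definition restr :: "(letter \<times> letter \<times> letter \<times> dbasis \<times> nat \<times> nat) set => 'w V => 'w V" where
 "restr X u = (%l1 l2 l3 e. Abs_fps (%i. Abs_fps (%j. if (l1, l2, l3, e, i, j) \<in> X then u l1 l2 l3 e $ i $ j else 0)))"

lemma Mloc_part_M_frac: "M_frac 1 n \<in> Mloc_part (18 * int n)"
proof -
 have "(1 :: 'a::comm_ring_1 M) \<in> M_part (18 * int n - 18 * int n)" using M_1_part by simp
 thus "M_frac (1 :: 'a M) n \<in> Mloc_part (18 * int n)" unfolding Mloc_part_def by blast
qed

lemma restr_crd:
 assumes u: "u \<in> Vt t" and X: "finite X"
 shows "EX x:Mloc_part t. crd x = restr X u"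
 using X
proof (induction X rule: finite_induct)
 case empty
 have "restr {} u = 0" by (rule V_eqI) (simp add: restr_def fps_eq_iff)
 thus ?case using lp_ops(4) crd_0 by metis
next
 case (insert P X)
 obtain l1 l2 l3 e i j where P: "P = (l1, l2, l3, e, i, j)" by (cases P) auto
 define w where "w = u l1 l2 l3 e $ i $ j"
 have r: "restr (insert P X) u = vlab (Label l1 l2 l3 e i j k 0 0 0) w + restr X u" for k
 proof (rule V_eqI)
  fix m1 m2 m3 f
  show "restr (insert P X) u m1 m2 m3 f = (vlab (Label l1 l2 l3 e i j k 0 0 0) w + restr X u) m1 m2 m3 f"
   using insert.hyps(2) unfolding P
   by (auto simp: fps_eq_iff restr_def vlab_nth w_def)
 qed
 have "EX y:Mloc_part t. EX k. crd y = vlab (Label l1 l2 l3 e i j k 0 0 0) w"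
 proof (cases "w = 0")
  case True
  thus ?thesis by (intro bexI[of _ 0] exI) (simp_all only: vlab_0 crd_0 lp_ops)
 next
  case False
  then obtain k where k: "t = - 2 * int (pos_deg l1 l2 l3 e i j) - 18 * k" using u unfolding Vt_def w_def by blast
  let ?L = "Label l1 l2 l3 e i j (nat k) 0 0 0"
  let ?y = "M_frac 1 (nat (- k)) * Mloc_of (pconst w * labp ?L)"
  have "?y \<in> Mloc_part (18 * int (nat (- k)) + - 2 * int (lab_deg ?L))"
   by (intro lp_ops(2) Mloc_part_M_frac Mloc_of_part part_poly9 hmg_pconst_mult hmg_lab_poly)
  moreover have "18 * int (nat (- k)) + - 2 * int (lab_deg ?L) = t"
   unfolding k lab_deg_def pos_deg_def by (cases "k \<ge> 0") simp_all
  moreover have "crd ?y = vlab ?L w" by (simp only: crd_mult crd_of crdP_lab)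
  ultimately show ?thesis by metis
 qed
 then obtain y k where y: "y \<in> Mloc_part t" "crd y = vlab (Label l1 l2 l3 e i j k 0 0 0) w" by blast
 obtain x where "x \<in> Mloc_part t" "crd x = restr X u" using insert.IH by blast
 hence "y + x \<in> Mloc_part t" "crd (y + x) = restr (insert P X) u"
  using y lp_ops(1) by (simp_all only: r[of k] crd_add)
 thus ?case by blast
qed

definition trunc_set :: "nat => (letter \<times> letter \<times> letter \<times> dbasis \<times> nat \<times> nat) set" where
 "trunc_set k = {(l1, l2, l3, e, i, j). i + j + lw l1 + lw l2 + lw l3 < k}"

lemma finite_trunc_set: "finite (trunc_set k)"
proof -
 have "finite {l. lw l < k}"
 proof (rule finite_subset)
  have "l \<in> {One, LX, LY} \<union> (%(a, v, z). Fr a v z) ` ({..<k} \<times> UNIV \<times> {Z0, Z1, Z2})" if "lw l < k" for l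
  proof (cases l)
   case (Fr a v z)
   hence "(a, v, z) \<in> {..<k} \<times> UNIV \<times> {Z0, Z1, Z2}" using that by (cases z) auto
   thus ?thesis unfolding Fr by (intro UnI2 image_eqI[of _ _ "(a, v, z)"]) simp_all
  qed simp_all
  thus "{l. lw l < k} <= {One, LX, LY} \<union> (%(a, v, z). Fr a v z) ` ({..<k} \<times> UNIV \<times> {Z0, Z1, Z2})" by blast
  show "finite ({One, LX, LY} \<union> (%(a, v, z). Fr a v z) ` ({..<k} \<times> (UNIV :: bool set) \<times> {Z0, Z1, Z2}))"
   by simp
 qed
 moreover have "finite {B1, Bd1, Bd2, Bd12, Bd23, Bu}" by simp
 ultimately have "finite ({l. lw l < k} \<times> {l. lw l < k} \<times> {l. lw l < k} \<times> {B1, Bd1, Bd2, Bd12, Bd23, Bu} \<times> {..<k} \<times> {..<k})"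
  by (intro finite_cartesian_product) simp_all
 moreover have "trunc_set k <= {l. lw l < k} \<times> {l. lw l < k} \<times> {l. lw l < k} \<times> {B1, Bd1, Bd2, Bd12, Bd23, Bu} \<times> {..<k} \<times> {..<k}"
 proof
  fix P assume "P \<in> trunc_set k"
  then obtain l1 l2 l3 e i j where P: "P = (l1, l2, l3, e, i, j)" and s: "i + j + lw l1 + lw l2 + lw l3 < k"
   unfolding trunc_set_def by auto
  have "e \<in> {B1, Bd1, Bd2, Bd12, Bd23, Bu}" by (cases e) simp_all
  moreover have "lw l1 < k" "lw l2 < k" "lw l3 < k" "i < k" "j < k" using s by linarith+
  ultimately show "P \<in> {l. lw l < k} \<times> {l. lw l < k} \<times> {l. lw l < k} \<times> {B1, Bd1, Bd2, Bd12, Bd23, Bu} \<times> {..<k} \<times> {..<k}"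
   unfolding P by (intro SigmaI CollectI) simp_all
 qed
 ultimately show ?thesis by (rule finite_subset[rotated])
qed

lemma fil_trunc: "fil k (u - restr (trunc_set k) u)"
 unfolding fil_def restr_def trunc_set_def by (auto simp: not_less)

lemma fil_zero: "(!!k. fil k u) ==> u = (0 :: 'w V)"
proof (rule V_eqI)
 fix l1 l2 l3 e assume f: "!!k. fil k u"
 have "3 ^ n dvd u l1 l2 l3 e $ i $ j" for n i j
  using f[of "n + (i + j + lw l1 + lw l2 + lw l3)"] unfolding fil_def by (metis add_diff_cancel_right')
 hence "u l1 l2 l3 e $ i $ j = 0" for i j by (rule sep)
 thus "u l1 l2 l3 e = 0 l1 l2 l3 e" by (simp add: fps_eq_iff)
qed

text \<open>Limits are taken coefficientwise. At a position of weight w the k-th term is controlled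
  only modulo 3^(k - w), which explains the shift of the index by w.\<close>

lemma fil_complete:
 fixes U :: "nat => 'w V"
 assumes "!!k. fil k (U (Suc k) - U k)"
 shows "EX u. ALL k. fil k (u - U k)"
proof -
 have compl: "ALL x::nat => 'w. (ALL n. 3 ^ n dvd x (Suc n) - x n) --> (EX y. ALL n. 3 ^ n dvd y - x n)"
  using witt unfolding witt_ring_def by simp
 let ?w = "%l1 l2 l3 i j. i + j + lw l1 + lw l2 + lw l3"
 have "EX y. ALL n. 3 ^ n dvd y - U (n + ?w l1 l2 l3 i j) l1 l2 l3 e $ i $ j" for l1 l2 l3 e i j
 proof -
  have "3 ^ n dvd U (Suc n + ?w l1 l2 l3 i j) l1 l2 l3 e $ i $ j - U (n + ?w l1 l2 l3 i j) l1 l2 l3 e $ i $ j" for n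
  proof -
   have "3 ^ (n + ?w l1 l2 l3 i j - ?w l1 l2 l3 i j) dvd
     (U (Suc (n + ?w l1 l2 l3 i j)) - U (n + ?w l1 l2 l3 i j)) l1 l2 l3 e $ i $ j"
    using assms[of "n + ?w l1 l2 l3 i j"] unfolding fil_def by blast
   thus ?thesis by (simp only: add_diff_cancel_right' minus_apply fps_sub_nth add_Suc)
  qed
  thus ?thesis using compl[rule_format, of "%n. U (n + ?w l1 l2 l3 i j) l1 l2 l3 e $ i $ j"] by blast
 qed
 note ex = this
 define Y where "Y l1 l2 l3 e i j = (SOME y. ALL n. 3 ^ n dvd y - U (n + ?w l1 l2 l3 i j) l1 l2 l3 e $ i $ j)"
  for l1 l2 l3 e i j
 have Y: "3 ^ n dvd Y l1 l2 l3 e i j - U (n + ?w l1 l2 l3 i j) l1 l2 l3 e $ i $ j" for l1 l2 l3 e i j n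
  using someI_ex[OF ex] unfolding Y_def by blast
 define u where "u = (%l1 l2 l3 e. Abs_fps (%i. Abs_fps (Y l1 l2 l3 e i)))"
 have "fil k (u - U k)" for k
  unfolding fil_def
 proof (intro allI)
  fix l1 l2 l3 e i j
  show "3 ^ (k - ?w l1 l2 l3 i j) dvd (u - U k) l1 l2 l3 e $ i $ j"
  proof (cases "?w l1 l2 l3 i j \<le> k")
   case True
   thus ?thesis using Y[of "k - ?w l1 l2 l3 i j" l1 l2 l3 e i j] by (simp add: u_def)
  next
   case False
   hence "k - ?w l1 l2 l3 i j = 0" by linarith
   thus ?thesis by (simp only: power_0 one_dvd)
  qed
 qed
 thus ?thesis by blast
qed

end

lemma Mhat_gamma_9: "(gamH ^^ 9) (x :: 'a::comm_ring_1 Mhat) = x"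
proof -
 obtain r where r: "coherent r" "x = abs_Mhat r" using Mhat_cases by blast
 have "coherent (%k. (Mloc_gamma ^^ n) (r k)) & (gamH ^^ n) (abs_Mhat r) = abs_Mhat (%k. (Mloc_gamma ^^ n) (r k))" for n
  by (induction n) (simp_all add: r Mhat_gamma_abs coherent_gamma)
 thus ?thesis unfolding r(2) by (simp add: Mloc_gamma_9)
qed

lemma sum_in:
 assumes "0 \<in> A" "!!x y. x \<in> A ==> y \<in> A ==> x + y \<in> A" "!!i. i \<in> X ==> f i \<in> A"
 shows "sum f X \<in> A"
 using assms(3) by (induction X rule: infinite_finite_induct) (simp_all add: assms(1,2))

text \<open>The coefficients are lifted to W and b1 and s3 are set to 1. Since the lifts are chosen
  representatives, sums and products are respected only modulo 9.\<close>

definition La :: "'w::comm_ring_1 S => 'w L" where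
 "La a = Abs_fps (%i. Abs_fps (%j. SUM x:keys (a $ i $ j). rep_mod9 (lookup (a $ i $ j) x)))"

definition S_seq :: "'w::comm_ring_1 S => nat => nat => 'w Mloc" where
 "S_seq a i j = (\<Sum>(m, k) \<in> keys (a $ i $ j).
   Mloc_of (pconst (rep_mod9 (lookup (a $ i $ j) (m, k))) * s1_poly ^ i * s2_poly ^ j)
   * s3_power k)"

lemma S_seq_Ipow: "S_seq a i j \<in> Ipow (i + j)"
 unfolding S_seq_def
proof (rule ideal_sum[OF is_ideal_power], clarify)
 fix m k
 let ?w = "rep_mod9 (lookup (a $ i $ j) (m, k))"
 have "Mloc_of (s1_poly ^ i) * Mloc_of (s2_poly ^ j) \<in> Ipow (i + j)"
  by (intro power_mult loc_ideal_power loc_ideal_sym)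
 hence "Mloc_of (pconst ?w) * (Mloc_of (s1_poly ^ i) * Mloc_of (s2_poly ^ j)) * s3_power k \<in> Ipow (i + j)"
  by (rule ideal_mult_right[OF is_ideal_power ideal_mult[OF is_ideal_power]])
 thus "Mloc_of (pconst ?w * s1_poly ^ i * s2_poly ^ j) * s3_power k \<in> Ipow (i + j)"
  by (simp only: Mloc_of_simps mult.assoc)
qed

lemma S_value_seq: "S_value a = abs_Mhat (%K. \<Sum>i<K. \<Sum>j<K. S_seq a i j)"
 unfolding S_value_def S_seq_def ..

lemma coherent_S_seq: "coherent (%K. \<Sum>i<K. \<Sum>j<K. S_seq a i j)"
 unfolding coherent_def
proof
 fix K
 have a: "(\<Sum>j<Suc K. S_seq a i j) = (\<Sum>j<K. S_seq a i j) + S_seq a i K" for i by simp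
 have "(\<Sum>i<Suc K. \<Sum>j<Suc K. S_seq a i j) - (\<Sum>i<K. \<Sum>j<K. S_seq a i j)
   = (\<Sum>i<K. S_seq a i K) + (\<Sum>j<Suc K. S_seq a K j)"
  unfolding sum.lessThan_Suc[of "%i. \<Sum>j<Suc K. S_seq a i j"] a sum.distrib by simp
 moreover have "(\<Sum>i<K. S_seq a i K) \<in> Ipow K" "(\<Sum>j<Suc K. S_seq a K j) \<in> Ipow K"
  by (rule ideal_sum[OF is_ideal_power], rule subsetD[OF power_antimono S_seq_Ipow], simp)+
 ultimately show "(\<Sum>i<Suc K. \<Sum>j<Suc K. S_seq a i j) - (\<Sum>i<K. \<Sum>j<K. S_seq a i j) \<in> Ipow K"
  by (simp only: ideal_add[OF is_ideal_power])
qed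

context wittk
begin

lemma s3_power_eq: "s3_power k = M_frac 1 (nat (- k)) * Mloc_of (s3_poly ^ nat k)"
 unfolding s3_power_def Mloc_of_def M_frac_simps M_Delta_s3 M_power_abs by simp

lemma S_value_part:
 assumes "a \<in> S_part n t"
 shows "S_value a \<in> Mhat_part t"
proof -
 have "S_seq a i j \<in> Mloc_part t" for i j
  unfolding S_seq_def
 proof (rule sum_in)
  show "0 \<in> Mloc_part t" by (rule lp_ops)
  show "x + y \<in> Mloc_part t" if "x \<in> Mloc_part t" "y \<in> Mloc_part t" for x y :: "'a Mloc" using that by (rule lp_ops)
  fix mk assume mk: "mk \<in> keys (a $ i $ j)"
  obtain m k where e: "mk = (m, k)" by (cases mk)
  have t: "t = - 6 * int i - 12 * int j - 18 * k" using assms mk unfolding S_part_def e by fastforce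
  have "Mloc_of (pconst (rep_mod9 (lookup (a $ i $ j) (m, k))) * s1_poly ^ i * s2_poly ^ j)
    \<in> Mloc_part (- 2 * int (0 + 3 * i + 6 * j))"
   by (intro Mloc_of_part part_poly9 hmg_mult hmg_pconst hmg_power hmg_s1 hmg_s2)
  moreover have "s3_power k \<in> Mloc_part (18 * int (nat (- k)) + - 2 * int (9 * nat k))"
   unfolding s3_power_eq by (intro lp_ops(2) Mloc_part_M_frac Mloc_of_part part_poly9 hmg_power hmg_s3)
  ultimately have "Mloc_of (pconst (rep_mod9 (lookup (a $ i $ j) (m, k))) * s1_poly ^ i * s2_poly ^ j) * s3_power k
    \<in> Mloc_part (- 2 * int (0 + 3 * i + 6 * j) + (18 * int (nat (- k)) + - 2 * int (9 * nat k)))"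
   by (rule lp_ops(2))
  moreover have "- 2 * int (0 + 3 * i + 6 * j) + (18 * int (nat (- k)) + - 2 * int (9 * nat k)) = t"
   unfolding t by (cases "k \<ge> 0") simp_all
  ultimately show "(case mk of (m, k) => Mloc_of (pconst (rep_mod9 (lookup (a $ i $ j) (m, k))) * s1_poly ^ i * s2_poly ^ j) * s3_power k) \<in> Mloc_part t"
   unfolding e by simp
 qed
 hence "(\<Sum>i<K. \<Sum>j<K. S_seq a i j) \<in> Mloc_part t" for K
  by (intro sum_in) (auto intro: lp_ops)
 thus ?thesis unfolding S_value_seq Mhat_part_def using coherent_S_seq by blast
qed

text \<open>\<open>crdH x\<close> will be the only such u. By \<open>fil_crd\<close>,
  \<open>cI * k\<close> is an I-adic precision at which the coordinates are determined to order
  k.\<close>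

definition apx :: "'w Mhat => 'w V => bool" where
 "apx x u <-> (ALL k. EX m. x - ofl m \<in> Fil (cI * k) & fil k (u - crd m))"

lemma crd_close: "x - ofl m \<in> Fil (cI * k) ==> x - ofl m' \<in> Fil (cI * k) ==> fil k (crd m - crd m')"
proof -
 assume a: "x - ofl m \<in> Fil (cI * k)" "x - ofl m' \<in> Fil (cI * k)"
 have "(x - ofl m') - (x - ofl m) \<in> Fil (cI * k)" by (rule Fil_diff[OF a(2,1)])
 hence "ofl (m - m') \<in> Fil (cI * k)" by (simp add: ofl_simps)
 hence "fil k (crd (m - m'))" by (intro fil_crd) (simp only: ofl_Fil)
 thus ?thesis by (simp only: crd_diff)
qed

lemma apxD: "apx x u ==> x - ofl m \<in> Fil (cI * k) ==> fil k (u - crd m)"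
proof -
 assume a: "apx x u" "x - ofl m \<in> Fil (cI * k)"
 then obtain m' where m': "x - ofl m' \<in> Fil (cI * k)" "fil k (u - crd m')" unfolding apx_def by blast
 have "fil k ((u - crd m') + (crd m' - crd m))" by (intro fil_add m' crd_close[OF m'(1) a(2)])
 thus ?thesis by simp
qed

lemma apx_unique: "apx x u ==> apx x v ==> u = v"
proof -
 assume a: "apx x u" "apx x v"
 have "fil k (u - v)" for k
 proof -
  obtain m where m: "x - ofl m \<in> Fil (cI * k)" "fil k (u - crd m)" using a(1) unfolding apx_def by blast
  have "fil k ((u - crd m) - (v - crd m))" by (intro fil_diff m apxD[OF a(2) m(1)])
  thus ?thesis by simp
 qed
 hence "u - v = 0" by (rule fil_zero)
 thus ?thesis by (simp only: right_minus_eq)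
qed

lemma apx_ex: "EX u. apx x u"
proof -
 obtain r where r: "coherent r" "x = abs_Mhat r" using Mhat_cases by blast
 have c: "x - ofl (r K) \<in> Fil K" for K unfolding r(2) by (rule abs_approx[OF r(1)])
 have "fil k (crd (r (cI * Suc k)) - crd (r (cI * k)))" for k
  by (rule crd_close[OF Fil_antimono[OF _ c] c]) simp
 then obtain u where "!!k. fil k (u - crd (r (cI * k)))" using fil_complete[of "%k. crd (r (cI * k))"] by blast
 thus ?thesis unfolding apx_def using c by blast
qed

definition crdH :: "'w Mhat => 'w V" where
 "crdH x = (THE u. apx x u)"

lemma crdH_eqI: "apx x u ==> crdH x = u"
 unfolding crdH_def using apx_unique by blast

lemma apx_crdH: "apx x (crdH x)"
 using apx_ex crdH_eqI by metis

lemma crdH_approx: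
 obtains m where "x - ofl m \<in> Fil (cI * k)" "fil k (crdH x - crd m)"
 using apx_crdH[of x] unfolding apx_def by blast

lemma crdH_add: "crdH (x + y) = crdH x + crdH y"
proof (rule crdH_eqI, unfold apx_def, intro allI)
 fix k
 obtain m where m: "x - ofl m \<in> Fil (cI * k)" "fil k (crdH x - crd m)" by (rule crdH_approx)
 obtain n where n: "y - ofl n \<in> Fil (cI * k)" "fil k (crdH y - crd n)" by (rule crdH_approx)
 have "(x - ofl m) + (y - ofl n) \<in> Fil (cI * k)" by (intro Fil_add m n)
 moreover have "fil k ((crdH x - crd m) + (crdH y - crd n))" by (intro fil_add m n)
 ultimately show "EX m. x + y - ofl m \<in> Fil (cI * k) & fil k (crdH x + crdH y - crd m)"
  by (intro exI[of _ "m + n"]) (simp only: ofl_simps crd_add add_diff_add[symmetric])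
qed

lemma crdH_0: "crdH 0 = 0"
 using crdH_add[of 0 0] by (simp only: add_0_left add_cancel_right_left)

lemma crdH_diff: "crdH (x - y) = crdH x - crdH y"
 using crdH_add[of "x - y" y] by (simp add: alg)

lemma crdH_gamma: "crdH (gamH x) = D.gV (crdH x)"
proof (rule crdH_eqI, unfold apx_def, intro allI)
 fix k
 obtain m where m: "x - ofl m \<in> Fil (cI * k)" "fil k (crdH x - crd m)" by (rule crdH_approx)
 have "gamH (x - ofl m) \<in> Fil (cI * k)" by (intro hg_Fil m)
 moreover have "fil k (D.gV (crdH x - crd m))" by (intro gV_fil_pos m)
 ultimately show "EX m. gamH x - ofl m \<in> Fil (cI * k) & fil k (D.gV (crdH x) - crd m)"
  by (intro exI[of _ "Mloc_gamma m"]) (simp only: hg_simps hg_ofl crd_gamma D.gV_diff)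
qed

lemma crdH_ofl: "crdH (ofl m) = crd m"
 by (rule crdH_eqI) (auto simp: apx_def Fil_zero fil_0 intro!: exI[of _ m])

lemma crdH_of: "crdH (Mhat_of p) = crdP p"
 by (simp only: Mhat_of_def crdH_ofl crd_of)

lemma crd_s3: "crd (s3_power k * x) = crd x"
proof -
 have "crd (Mloc_of (s3_poly ^ n) * x) = crd x" for n
  by (induction n arbitrary: x) (simp_all add: Mloc_of_simps mult.assoc crd_mult)
 thus ?thesis unfolding s3_power_eq by (simp only: mult.assoc crd_mult)
qed

lemma crd_s_pow: "crd (Mloc_of (s1_poly ^ i) * x) = scV (s1L ^ i) (crd x)"
 "crd (Mloc_of (s2_poly ^ i) * x) = scV (s2L ^ i) (crd x)"
 by (induction i arbitrary: x) (simp_all only: power_0 power_Suc Mloc_of_simps mult.assoc crd_mult mult_1_left scV_1 scV_mult[symmetric])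

lemma crd_sum: "crd (sum f X) = (SUM i:X. crd (f i))"
 by (induction X rule: infinite_finite_induct) (simp_all only: sum.infinite sum.empty sum.insert crd_0 crd_add not_False_eq_True)

lemma scV_sum: "scV (sum f X) u = (SUM i:X. scV (f i) u)"
 by (induction X rule: infinite_finite_induct) (simp_all only: sum.infinite sum.empty sum.insert scV_zero scV_plus not_False_eq_True)

lemma cL_sum: "cL (sum f X) = (SUM i:X. cL (f i))"
 by (induction X rule: infinite_finite_induct) (simp_all flip: fps_const_add)

lemma crd_S_seq: "crd (S_seq a i j * x) = scV (cL (La a $ i $ j) * s1L ^ i * s2L ^ j) (crd x)"
proof -
 have "crd (S_seq a i j * x) = (SUM mk:keys (a $ i $ j).
   scV (cL (rep_mod9 (lookup (a $ i $ j) mk)) * s1L ^ i * s2L ^ j) (crd x))"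
  unfolding S_seq_def sum_distrib_right crd_sum
  by (rule sum.cong) (auto simp only: Mloc_of_simps mult.assoc crd_mult crd_s_pow crd_s3 scV_mult case_prod_conv)
 also have "... = scV (cL (La a $ i $ j) * s1L ^ i * s2L ^ j) (crd x)"
  unfolding La_def by (simp only: fps_nth_Abs_fps cL_sum sum_distrib_right scV_sum)
 finally show ?thesis .
qed

lemma crdH_S_value: "crdH (S_value a * x) = scV (La a) (crdH x)"
proof (rule crdH_eqI, unfold apx_def, intro allI)
 fix k
 obtain m where m: "x - ofl m \<in> Fil (cI * k)" "fil k (crdH x - crd m)" by (rule crdH_approx)
 define K where "K = cI * k"
 define z where "z = (\<Sum>i<K. \<Sum>j<K. S_seq a i j)"
 \<comment> \<open>The part of \<open>La a\<close> below K in both variables, which is the effect of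
   the partial sum z. As k is at most K, the omitted terms have order at least k.\<close>
 define T :: "'w L" where "T = (\<Sum>i<K. \<Sum>j<K. cL (La a $ i $ j) * s1L ^ i * s2L ^ j)"
 have z: "S_value a - ofl z \<in> Fil (cI * k)"
  unfolding S_value_seq z_def K_def by (rule abs_approx[OF coherent_S_seq])
 have "S_value a * (x - ofl m) + (S_value a - ofl z) * ofl m \<in> Fil (cI * k)"
  using m(1) z by (intro Fil_add Fil_mult Fil_mult_right)
 hence 1: "S_value a * x - ofl (z * m) \<in> Fil (cI * k)"
  by (simp add: ofl_simps left_diff_distrib right_diff_distrib)
 have 2: "crd (z * m) = scV T (crd m)"
  unfolding z_def T_def sum_distrib_right crd_sum crd_S_seq scV_sum ..
 have nth: "T $ i $ j = (if i < K & j < K then La a $ i $ j else 0)" for i j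
 proof -
  have "T $ i $ j = (\<Sum>i'<K. \<Sum>j'<K. if i = i' & j = j' then La a $ i' $ j' else 0)"
   unfolding T_def fps_sum_nth lmon_nth ..
  also have "... = (\<Sum>i'<K. if i = i' then (\<Sum>j'<K. if j = j' then La a $ i' $ j' else 0) else 0)"
   by (intro sum.cong) auto
  finally show ?thesis by (simp add: sum.delta)
 qed
 have "k \<le> K" unfolding K_def cI_def by simp
 hence "3 ^ (k - (i + j)) dvd (La a - T) $ i $ j" for i j
  by (cases "i < K & j < K") (simp_all add: nth not_less, auto)
 hence "fil (0 + k) (scV (La a - T) (crd m))" by (intro fil_scV fil_all)
 moreover have "fil (k + 0) (scV (La a) (crdH x - crd m))" using m(2) by (intro fil_scV) simp_all
 ultimately have "fil k (scV (La a) (crdH x - crd m) + scV (La a - T) (crd m))" by (intro fil_add) simp_all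
 moreover have "scV (La a) (X - Y) + scV (La a - T) Y = scV (La a) X - scV T Y" for X Y
  by (rule V_eqI) (simp add: scV_def sc_def alg)
 ultimately have "fil k (scV (La a) (crdH x) - crd (z * m))" by (simp only: 2)
 thus "EX m. S_value a * x - ofl m \<in> Fil (cI * k) & fil k (scV (La a) (crdH x) - crd m)" using 1 by blast
qed

lemma Vt_nth: "u \<in> Vt t ==> ~ (EX k. t = - 2 * int (pos_deg l1 l2 l3 e i j) - 18 * k) ==> u l1 l2 l3 e $ i $ j = 0"
 unfolding Vt_def by blast

lemma crdH_abs: "coherent r ==> fil k (crdH (abs_Mhat r) - crd (r (cI * k)))"
 by (rule apxD[OF apx_crdH abs_approx])

lemma crdH_part: "x \<in> Mhat_part t ==> crdH x \<in> Vt t"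
proof -
 assume "x \<in> Mhat_part t"
 then obtain r where r: "x = abs_Mhat r" "coherent r" "ALL k. r k \<in> Mloc_part t" unfolding Mhat_part_def by blast
 show ?thesis unfolding Vt_def
 proof (intro CollectI allI impI, rule ccontr)
  fix l1 l2 l3 e i j assume a: "crdH x l1 l2 l3 e $ i $ j ~= 0" "~ (EX k. t = - 2 * int (pos_deg l1 l2 l3 e i j) - 18 * k)"
  let ?w = "i + j + lw l1 + lw l2 + lw l3"
  have "3 ^ n dvd crdH x l1 l2 l3 e $ i $ j" for n
  proof -
   have "fil (n + ?w) (crdH x - crd (r (cI * (n + ?w))))" unfolding r(1) by (rule crdH_abs[OF r(2)])
   hence "3 ^ (n + ?w - ?w) dvd (crdH x - crd (r (cI * (n + ?w)))) l1 l2 l3 e $ i $ j" unfolding fil_def by blast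
   moreover have "crd (r (cI * (n + ?w))) l1 l2 l3 e $ i $ j = 0"
    by (rule Vt_nth[OF crd_part a(2)]) (use r(3) in blast)
   ultimately show ?thesis by (simp only: add_diff_cancel_right' minus_apply fps_sub_nth diff_0_right)
  qed
  thus False using sep a(1) by blast
 qed
qed

lemma crdH_inj_0:
 assumes "x \<in> Mhat_part t" "crdH x = 0"
 shows "x = 0"
proof (rule Fil_separated)
 fix K :: nat
 obtain r where r: "x = abs_Mhat r" "coherent r" "ALL k. r k \<in> Mloc_part t" using assms(1) unfolding Mhat_part_def by blast
 \<comment> \<open>The additional 3 makes up for the loss in \<open>Ipow_crd\<close>.\<close>
 define k where "k = K + 3"
 have "fil k (0 - crd (r (cI * k)))" using crdH_abs[OF r(2), of k] assms(2) unfolding r(1) by (simp only:)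
 hence "fil k (- (0 - crd (r (cI * k))))" by (rule fil_minus)
 hence "r (cI * k) \<in> Ipow (k - 3)" using r(3) by (intro Ipow_crd[of _ t]) simp_all
 hence "ofl (r (cI * k)) \<in> Fil K" by (simp add: ofl_Fil k_def)
 moreover have "K \<le> cI * k" unfolding k_def cI_def by simp
 hence "x - ofl (r (cI * k)) \<in> Fil K" unfolding r(1) by (rule Fil_antimono[OF _ abs_approx[OF r(2)]])
 ultimately have "(x - ofl (r (cI * k))) + ofl (r (cI * k)) \<in> Fil K" by (intro Fil_add)
 thus "x \<in> Fil K" by simp
qed

lemma crdH_surj:
 assumes u: "u \<in> Vt t"
 shows "EX x:Mhat_part t. crdH x = u"
proof -
 obtain m where m: "!!k. m k \<in> Mloc_part t" "!!k. crd (m k) = restr (trunc_set k) u"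
  using restr_crd[OF u finite_trunc_set] by metis
 have f: "fil k (u - crd (m k))" for k unfolding m(2) by (rule fil_trunc)
 \<comment> \<open>The shift by 3 again compensates for \<open>Ipow_crd\<close>, so that the
   sequence is coherent for the powers of I.\<close>
 define r where "r = (%k. m (k + 3))"
 have r: "r k \<in> Mloc_part t" "fil (k + 3) (u - crd (r k))" for k unfolding r_def by (rule m f)+
 have c: "coherent r" unfolding coherent_def
 proof
  fix k
  have "fil (k + 3) (u - crd (r (Suc k)))" by (rule fil_antimono[OF _ r(2)]) simp
  hence "fil (k + 3) ((u - crd (r k)) - (u - crd (r (Suc k))))" by (rule fil_diff[OF r(2)])
  hence "fil (k + 3) (crd (r (Suc k) - r k))" by (simp add: crd_diff)
  moreover have "r (Suc k) - r k \<in> Mloc_part t"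
   using lp_ops(1)[OF r(1) lp_ops(3)[OF r(1)], of "Suc k" k] by simp
  ultimately show "r (Suc k) - r k \<in> Ipow k" using Ipow_crd[of "r (Suc k) - r k" t "k + 3"] by simp
 qed
 have "apx (abs_Mhat r) u" unfolding apx_def
 proof (intro allI exI conjI)
  fix k
  show "abs_Mhat r - ofl (r (cI * k)) \<in> Fil (cI * k)" by (rule abs_approx[OF c])
  have "k \<le> cI * k + 3" unfolding cI_def by simp
  thus "fil k (u - crd (r (cI * k)))" by (rule fil_antimono[OF _ r(2)])
 qed
 hence "crdH (abs_Mhat r) = u" by (rule crdH_eqI)
 thus ?thesis using c r(1) unfolding Mhat_part_def by blast
qed

lemma crdH_inj: "x \<in> Mhat_part t ==> y \<in> Mhat_part t ==> crdH x = crdH y ==> x = y"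
proof -
 assume a: "x \<in> Mhat_part t" "y \<in> Mhat_part t" "crdH x = crdH y"
 have "x + - y \<in> Mhat_part t" using a by (intro hp_ops)
 hence "x - y = 0" using a(3) by (intro crdH_inj_0[of _ t]) (simp_all add: crdH_diff)
 thus ?thesis by simp
qed

definition hV :: "int => 'w V => 'w Mhat" where
 "hV t u = (SOME x. x \<in> Mhat_part t & crdH x = u)"

lemma hV: "u \<in> Vt t ==> hV t u \<in> Mhat_part t" "u \<in> Vt t ==> crdH (hV t u) = u"
 using someI_ex[of "%x. x \<in> Mhat_part t & crdH x = u"] crdH_surj[of u t] unfolding hV_def by blast+

lemma S_value_gamma: "(a :: 'w S) \<in> S_part n t ==> gamH (S_value a) = S_value a"
proof (rule crdH_inj[of _ t])
 assume a: "a \<in> S_part n t"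
 show "S_value a \<in> Mhat_part t" by (rule S_value_part[OF a])
 thus "gamH (S_value a) \<in> Mhat_part t" by (rule hg_part)
 have "crdH (gamH (S_value a * 1)) = scV (La a) (D.gV (crdH 1))"
  by (simp only: crdH_gamma crdH_S_value gV_scV)
 also have "... = crdH (S_value a * 1)" by (simp only: crdH_gamma[symmetric] hg_simps crdH_S_value)
 finally show "crdH (gamH (S_value a)) = crdH (S_value a)" by simp
qed

end

section \<open>Coefficients modulo 9 and the relations of the presentation\<close>

lemma abs_mod9_eq: "abs_mod9 a = abs_mod9 b <-> 9 dvd a - (b :: 'w::comm_ring_1)"
 by (simp add: mod9.abs_eq_iff ideal9_def)

lemma abs_rep_mod9: "abs_mod9 (rep_mod9 x) = x"
 by (rule Quotient_abs_rep[OF Quotient_mod9])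

lemma abs_mod9_simps: "abs_mod9 (a + b) = abs_mod9 a + abs_mod9 b" "abs_mod9 (a * b) = abs_mod9 a * abs_mod9 b"
 "abs_mod9 0 = 0" "abs_mod9 1 = 1"
 by (simp_all add: plus_mod9.abs_eq times_mod9.abs_eq zero_mod9_def one_mod9_def)

lemma abs_mod9_sum: "abs_mod9 (sum f X) = (SUM x:X. abs_mod9 (f x))"
 by (induction X rule: infinite_finite_induct) (simp_all add: abs_mod9_simps)

definition sumall :: "('a \<Rightarrow>\<^sub>0 'b::comm_monoid_add) => 'b" where
 "sumall p = (SUM x:keys p. lookup p x)"

lemma sumall_superset: "finite X ==> keys p <= X ==> sumall p = (SUM x:X. lookup p x)"
 unfolding sumall_def by (intro sum.mono_neutral_left) (auto simp: in_keys_iff)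

lemma sumall_single: "sumall (single x v) = v"
 using sumall_superset[of "{x}" "single x v"] by simp

lemma sumall_0: "sumall 0 = 0"
 by (simp add: sumall_def)

lemma sumall_add: "sumall (p + q) = sumall p + sumall q"
proof -
 let ?X = "keys p \<union> keys q"
 have "sumall (p + q) = (SUM x:?X. lookup (p + q) x)"
  by (rule sumall_superset) (use Poly_Mapping.keys_add[of p q] in auto)
 also have "... = (SUM x:?X. lookup p x) + (SUM x:?X. lookup q x)"
  by (simp add: lookup_add sum.distrib)
 also have "... = sumall p + sumall q"
  using sumall_superset[of ?X p] sumall_superset[of ?X q] by simp
 finally show ?thesis .
qed

lemma sumall_sum: "sumall (sum f X) = (SUM x:X. sumall (f x))"
 by (induction X rule: infinite_finite_induct) (simp_all add: sumall_0 sumall_add)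

lemma poly_mapping_induct_add:
 fixes P :: "('a \<Rightarrow>\<^sub>0 'b::comm_monoid_add) => bool"
 assumes "P 0" "!!m w. P (single m w)" "!!p q. P p ==> P q ==> P (p + q)"
 shows "P p"
proof (induction p rule: update_induct)
 case const
 thus ?case using assms(1) by simp
next
 case (update p a b)
 have "Poly_Mapping.update a b p = p + single a b"
  using update(1) by (intro poly_mapping_eqI)
   (auto simp: lookup_update lookup_add lookup_single when_def in_keys_iff)
 thus ?case using assms update by metis
qed

lemma sumall_mult:
 fixes p q :: "'a::comm_monoid_add \<Rightarrow>\<^sub>0 'b::semiring_0"
 shows "sumall (p * q) = sumall p * sumall q"
proof (induction p rule: poly_mapping_induct_add)
 case (2 m w)
 show ?case
  by (induction q rule: poly_mapping_induct_add)
    (simp_all add: sumall_0 sumall_add distrib_left mult_single sumall_single)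
qed (simp_all add: sumall_0 sumall_add distrib_right)

text \<open>Evaluation at b1 = s3 = 1 over W/9, which is a true ring homomorphism. \<open>La\<close>
  is a lift of it, and this gives the congruences modulo 9 for \<open>La\<close>.\<close>

definition Lm :: "'w::comm_ring_1 S => 'w mod9 fps fps" where
 "Lm a = Abs_fps (%i. Abs_fps (%j. sumall (a $ i $ j)))"

definition abL :: "'w::comm_ring_1 L => 'w mod9 fps fps" where
 "abL p = Abs_fps (%i. Abs_fps (%j. abs_mod9 (p $ i $ j)))"

lemma Lm_add: "Lm (a + b) = Lm a + Lm b"
 by (simp add: Lm_def fps_eq_iff sumall_add)

lemma Lm_mult: "Lm (a * b) = Lm a * Lm b"
 by (simp add: Lm_def fps_eq_iff fps_mult_nth fps_sum_nth sumall_sum sumall_mult)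

lemma abL_add: "abL (a + b) = abL a + abL b"
 by (simp add: abL_def fps_eq_iff abs_mod9_simps)

lemma abL_mult: "abL (a * b) = abL a * abL b"
 by (simp add: abL_def fps_eq_iff fps_mult_nth fps_sum_nth abs_mod9_sum abs_mod9_simps)

lemma abL_La: "abL (La a) = Lm a"
 by (simp add: abL_def La_def Lm_def fps_eq_iff sumall_def abs_mod9_sum abs_rep_mod9)

lemma num_nth: "(numeral n * p) $ i $ j = numeral n * (p $ i $ j :: 'w::comm_ring_1)"
proof -
 have "(numeral n :: 'w fps fps) = fps_const (fps_const (numeral n))" by (simp add: numeral_fps_const)
 thus ?thesis by (simp only: fps_mult_left_const_nth)
qed

definition eq9 :: "'w::comm_ring_1 L => 'w L => bool" where
 "eq9 p q <-> (EX X. p = q + 9 * X)"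

lemma abL_eq: "abL p = abL q <-> eq9 p q"
proof
 assume "abL p = abL q"
 hence "abs_mod9 (p $ i $ j) = abs_mod9 (q $ i $ j)" for i j by (simp add: abL_def fps_eq_iff)
 hence "EX x. p $ i $ j - q $ i $ j = 9 * x" for i j unfolding abs_mod9_eq dvd_def .
 then obtain X where X: "!!i j. p $ i $ j - q $ i $ j = 9 * X i j" by metis
 have "p = q + 9 * Abs_fps (%i. Abs_fps (%j. X i j))"
  using X by (simp add: fps_eq_iff num_nth) (simp add: X[symmetric])
 thus "eq9 p q" unfolding eq9_def by blast
next
 assume "eq9 p q"
 then obtain X where X: "p = q + 9 * X" unfolding eq9_def by blast
 have "abs_mod9 (p $ i $ j) = abs_mod9 (q $ i $ j)" for i j
  unfolding abs_mod9_eq X by (simp add: num_nth)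
 thus "abL p = abL q" by (simp add: abL_def)
qed

lemma eq9_refl: "eq9 p p" and eq9_sym: "eq9 p q ==> eq9 q p" and eq9_trans: "eq9 p q ==> eq9 q r ==> eq9 p r"
 and eq9_add: "eq9 p q ==> eq9 p' q' ==> eq9 (p + p') (q + q')"
 and eq9_mult: "eq9 p q ==> eq9 p' q' ==> eq9 (p * p') (q * q')"
 by (simp_all flip: abL_eq add: abL_add abL_mult)

lemma La_add: "eq9 (La (a + b)) (La a + La b)" and La_mult: "eq9 (La (a * b)) (La a * La b)"
 by (simp_all flip: abL_eq add: abL_La Lm_add Lm_mult abL_add abL_mult)

lemma La_0: "La 0 = 0"
 by (simp add: La_def fps_eq_iff)

lemma La_S_monom: "eq9 (La (S_monom w m i j k)) (cL w * s1L ^ i * s2L ^ j)"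
 unfolding abL_eq[symmetric] abL_La
 by (simp only: Lm_def abL_def fps_eq_iff fps_nth_Abs_fps lmon_nth S_monom_def)
  (simp add: sumall_single sumall_0 abs_mod9_simps)

text \<open>Inverse to \<open>La\<close> on a homogeneous part: the degree fixes the exponent of b1,
  and together with the exponents of s1 and s2 that of s3. The division is exact where
  \<open>hom_L\<close> allows a nonzero coefficient.\<close>

definition sig :: "int => int => 'w::comm_ring_1 L => 'w S" where
 "sig m ta p = Abs_fps (%i. Abs_fps (%j. single (m, (- ta - 6 * int i - 12 * int j) div 18) (abs_mod9 (p $ i $ j))))"

definition hom_L :: "int => 'w::comm_ring_1 L => bool" where
 "hom_L ta p <-> (ALL i j. p $ i $ j ~= 0 --> (EX k. ta = - 6 * int i - 12 * int j - 18 * k))"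

lemma sig_part: "hom_L ta p ==> sig m ta p \<in> S_part (2 * m) ta"
 unfolding S_part_def
proof (intro CollectI allI ballI, clarify)
 fix i j m' k assume h: "hom_L ta p" and k: "(m', k) \<in> keys (sig m ta p $ i $ j)"
 have e: "m' = m" "k = (- ta - 6 * int i - 12 * int j) div 18" "abs_mod9 (p $ i $ j) ~= 0"
  using k by (auto simp: sig_def split: if_splits)
 have "p $ i $ j ~= 0" using e(3) abs_mod9_simps(3) by metis
 then obtain k' where "ta = - 6 * int i - 12 * int j - 18 * k'" using h unfolding hom_L_def by blast
 thus "2 * m = 2 * m' & ta = - 6 * int i - 12 * int j - 18 * k" using e by simp
qed

lemma La_sig: "eq9 (La (sig m ta p)) p"
 unfolding abL_eq[symmetric] abL_La by (simp add: Lm_def abL_def sig_def sumall_single)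

lemma S_part_La:
 assumes "a \<in> S_part n ta"
 shows "hom_L ta (La a)"
 unfolding hom_L_def
proof (intro allI impI)
 fix i j assume "La a $ i $ j ~= 0"
 hence "keys (a $ i $ j) ~= {}" unfolding La_def by auto
 then obtain m k where "(m, k) \<in> keys (a $ i $ j)" by (metis ex_in_conv surj_pair)
 thus "EX k. ta = - 6 * int i - 12 * int j - 18 * k" using assms unfolding S_part_def by fastforce
qed

lemma S_part_odd: "odd n ==> a \<in> S_part n ta ==> a = 0"
proof -
 assume n: "odd n" and a: "a \<in> S_part n ta"
 have "keys (a $ i $ j) = {}" for i j
 proof (rule ccontr)
  assume "keys (a $ i $ j) ~= {}"
  then obtain m k where "(m, k) \<in> keys (a $ i $ j)" by (metis ex_in_conv surj_pair)
  hence "n = 2 * m" using a unfolding S_part_def by fastforce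
  thus False using n by simp
 qed
 thus ?thesis by (simp add: fps_eq_iff)
qed

lemma sig_La: "a \<in> S_part (2 * m) ta ==> a = sig m ta (La a)"
proof -
 assume a: "a \<in> S_part (2 * m) ta"
 have "a $ i $ j = sig m ta (La a) $ i $ j" for i j
 proof -
  let ?k = "(- ta - 6 * int i - 12 * int j) div 18"
  have k: "keys (a $ i $ j) <= {(m, ?k)}"
   using a unfolding S_part_def by fastforce
  have "abs_mod9 (La a $ i $ j) = sumall (a $ i $ j)"
   using abL_La[of a] by (simp add: abL_def Lm_def fps_eq_iff)
  also have "... = lookup (a $ i $ j) (m, ?k)"
   using sumall_superset[OF _ k] by simp
  finally have "sig m ta (La a) $ i $ j = single (m, ?k) (lookup (a $ i $ j) (m, ?k))"
   by (simp add: sig_def)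
  also have "... = a $ i $ j"
   using k by (intro poly_mapping_eqI) (auto simp: lookup_single when_def in_keys_iff)
  finally show ?thesis by simp
 qed
 thus ?thesis by (simp add: fps_eq_iff)
qed

lemma S_monom_mult_nth: "(a * S_monom w m i0 j0 k) $ i $ j =
  (if i0 \<le> i & j0 \<le> j then a $ (i - i0) $ (j - j0) * single (m, k) (abs_mod9 w) else 0)"
proof -
 let ?c = "single (m, k) (abs_mod9 w)"
 have "(a * S_monom w m i0 j0 k) $ i $ j =
   (\<Sum>i'=0..i. \<Sum>j'=0..j. a $ i' $ j' * (if i - i' = i0 & j - j' = j0 then ?c else 0))"
  by (simp add: fps_mult_nth fps_sum_nth S_monom_def)
 also have "... = (\<Sum>i'=0..i. \<Sum>j'=0..j. if i' = i - i0 & j' = j - j0 then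
   (if i0 \<le> i & j0 \<le> j then a $ i' $ j' * ?c else 0) else 0)"
 proof (intro sum.cong refl)
  fix i' j' assume "i' \<in> {0..i}" "j' \<in> {0..j}"
  hence "i - i' = i0 <-> i0 \<le> i & i' = i - i0" "j - j' = j0 <-> j0 \<le> j & j' = j - j0" by auto
  thus "a $ i' $ j' * (if i - i' = i0 & j - j' = j0 then ?c else 0) = (if i' = i - i0 & j' = j - j0 then
   (if i0 \<le> i & j0 \<le> j then a $ i' $ j' * ?c else 0) else 0)" by simp
 qed
 also have "... = (\<Sum>i'=0..i. if i' = i - i0 then (\<Sum>j'=0..j. if j' = j - j0 then
   (if i0 \<le> i & j0 \<le> j then a $ i' $ j' * ?c else 0) else 0) else 0)"
  by (intro sum.cong refl) auto
 also have "... = (if i0 \<le> i & j0 \<le> j then a $ (i - i0) $ (j - j0) * ?c else 0)"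
  by (simp only: sum.delta finite_atLeastAtMost) auto
 finally show ?thesis .
qed

text \<open>The preimage in W[[s1, s2]] of the relations of one generator; these are the two ideals
  of \<open>small\<close>.\<close>

definition relL :: "gen => 'w::comm_ring_1 L => bool" where
 "relL x p <-> (if x \<in> {Gen_1, Gen_c} then EX X Y Z. p = 9 * X + 3 * s1L * Y + 3 * s2L * Z else EX X. p = 3 * X)"

lemma relL_eq9: "eq9 p q ==> relL x p ==> relL x q"
proof -
 assume "eq9 p q" and r: "relL x p"
 then obtain X where X: "q = p + 9 * X" using eq9_sym unfolding eq9_def by blast
 show ?thesis
 proof (cases "x \<in> {Gen_1, Gen_c}")
  case True
  then obtain A B C where "p = 9 * A + 3 * s1L * B + 3 * s2L * C" using r unfolding relL_def by auto
  hence "q = 9 * (A + X) + 3 * s1L * B + 3 * s2L * C" unfolding X by (simp add: alg)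
  thus ?thesis unfolding relL_def if_P[OF True] by blast
 next
  case False
  then obtain A where "p = 3 * A" using r unfolding relL_def by auto
  hence "q = 3 * (A + 3 * X)" unfolding X by (simp add: alg)
  thus ?thesis unfolding relL_def if_not_P[OF False] by blast
 qed
qed

lemma s_monom_simps: "cL 3 * s1L ^ 1 * s2L ^ 0 = 3 * s1L" "cL 3 * s1L ^ 0 * s2L ^ 1 = 3 * s2L"
 "cL 3 * s1L ^ 0 * s2L ^ 0 = 3"
 by (simp_all add: numeral_fps_const[symmetric])

lemma relations_La: "v \<in> relations ==> relL x (La (v x))"
proof -
 assume "v \<in> relations"
 then obtain p q r where v: "v x = p x * S_monom 3 0 1 0 0 + q x * S_monom 3 0 0 1 0
      + (if x \<in> {Gen_1, Gen_c} then 0 else r x * S_monom 3 0 0 0 0)" unfolding relations_def by blast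
 have m: "eq9 (La (a * S_monom 3 0 1 0 0)) (La a * (3 * s1L))" "eq9 (La (a * S_monom 3 0 0 1 0)) (La a * (3 * s2L))"
  "eq9 (La (a * S_monom 3 0 0 0 0)) (La a * 3)" for a :: "'a S"
  using eq9_trans[OF La_mult eq9_mult[OF eq9_refl La_S_monom]] s_monom_simps by metis+
 show ?thesis
 proof (cases "x \<in> {Gen_1, Gen_c}")
  case True
  have "eq9 (La (v x)) (La (p x) * (3 * s1L) + La (q x) * (3 * s2L))"
   unfolding v if_P[OF True] add_0_right by (rule eq9_trans[OF La_add eq9_add[OF m(1,2)]])
  moreover have "La (p x) * (3 * s1L) + La (q x) * (3 * s2L) = 9 * 0 + 3 * s1L * La (p x) + 3 * s2L * La (q x)"
   by (simp add: mult_ac)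
  hence "relL x (La (p x) * (3 * s1L) + La (q x) * (3 * s2L))" using True unfolding relL_def by metis
  ultimately show ?thesis using relL_eq9 eq9_sym by blast
 next
  case False
  have "eq9 (La (v x)) (La (p x) * (3 * s1L) + La (q x) * (3 * s2L) + La (r x) * 3)"
   unfolding v if_not_P[OF False]
   by (rule eq9_trans[OF La_add eq9_add[OF eq9_trans[OF La_add eq9_add[OF m(1,2)]] m(3)]])
  moreover have "La (p x) * (3 * s1L) + La (q x) * (3 * s2L) + La (r x) * 3 = 3 * (La (p x) * s1L + La (q x) * s2L + La (r x))"
   by (simp add: alg)
  hence "relL x (La (p x) * (3 * s1L) + La (q x) * (3 * s2L) + La (r x) * 3)" using False unfolding relL_def by metis
  ultimately show ?thesis using relL_eq9 eq9_sym by blast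
 qed
qed

lemma sig_rel:
 "sig m ta (9 * X + 3 * s1L * Y + 3 * s2L * Z) = sig m (ta + 6) Y * S_monom 3 0 1 0 0 + sig m (ta + 12) Z * S_monom 3 0 0 1 0"
 "sig m ta (3 * X) = sig m ta X * S_monom 3 0 0 0 0"
proof -
 have n9: "abs_mod9 (9 * a + b) = abs_mod9 b" for a b :: 'a by (simp add: abs_mod9_eq)
 have "sig m ta (9 * X + 3 * s1L * Y + 3 * s2L * Z) $ i $ j =
   (sig m (ta + 6) Y * S_monom 3 0 1 0 0 + sig m (ta + 12) Z * S_monom 3 0 0 1 0) $ i $ j" for i j
 proof -
  have c: "(9 * X + 3 * s1L * Y + 3 * s2L * Z) $ i $ j =
    9 * X $ i $ j + ((if i = 0 then 0 else Y $ (i - 1) $ j * 3) + (if j = 0 then 0 else Z $ i $ (j - 1) * 3))"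
   unfolding mult.assoc fps_add_nth num_nth s1L_nth s2L_nth by (simp add: mult.commute add.assoc)
  show ?thesis
   unfolding fps_add_nth S_monom_mult_nth unfolding sig_def fps_nth_Abs_fps c n9
   by (cases i; cases j; simp add: abs_mod9_simps mult_single single_add alg)
 qed
 thus "sig m ta (9 * X + 3 * s1L * Y + 3 * s2L * Z) = sig m (ta + 6) Y * S_monom 3 0 1 0 0 + sig m (ta + 12) Z * S_monom 3 0 0 1 0"
  by (simp add: fps_eq_iff)
 have "sig m ta (3 * X) $ i $ j = (sig m ta X * S_monom 3 0 0 0 0) $ i $ j" for i j
  unfolding S_monom_mult_nth unfolding sig_def fps_nth_Abs_fps num_nth
  by (simp add: abs_mod9_simps mult_single mult.commute)
 thus "sig m ta (3 * X) = sig m ta X * S_monom 3 0 0 0 0" by (simp add: fps_eq_iff)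
qed

text \<open>Cofactors found over W[[s1, s2]] are returned to S by \<open>sig\<close>. A component of
  odd cohomological degree is 0, since b1 has degree 2.\<close>

lemma relations_iff:
 assumes v: "v \<in> free_part n t"
 shows "v \<in> relations <-> (ALL x. relL x (La (v x)))"
proof
 assume r: "ALL x. relL x (La (v x))"
 have "EX p q r. v x = p * S_monom 3 0 1 0 0 + q * S_monom 3 0 0 1 0
      + (if x \<in> {Gen_1, Gen_c} then 0 else r * S_monom 3 0 0 0 0)" for x
 proof -
  define k ta where "k = int n - int (fst (gen_deg x))" and "ta = t - snd (gen_deg x)"
  have vx: "v x \<in> S_part k ta" using v unfolding free_part_def k_def ta_def by blast
  show ?thesis
  proof (cases "even k")
   case False
   hence "v x = 0" using S_part_odd vx by blast
   thus ?thesis by (intro exI[of _ 0]) simp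
  next
   case True
   then obtain m where m: "k = 2 * m" by (elim evenE)
   have s: "v x = sig m ta (La (v x))" using sig_La vx unfolding m by blast
   show ?thesis
   proof (cases "x \<in> {Gen_1, Gen_c}")
    case t: True
    then obtain X Y Z where "La (v x) = 9 * X + 3 * s1L * Y + 3 * s2L * Z"
     using r[rule_format, of x] unfolding relL_def by auto
    hence "v x = sig m (ta + 6) Y * S_monom 3 0 1 0 0 + sig m (ta + 12) Z * S_monom 3 0 0 1 0 + 0"
     using s sig_rel(1)[of m ta X Y Z] by simp
    thus ?thesis using t by auto
   next
    case f: False
    then obtain X where "La (v x) = 3 * X" using r[rule_format, of x] unfolding relL_def by auto
    hence "v x = 0 * S_monom 3 0 1 0 0 + 0 * S_monom 3 0 0 1 0 + sig m ta X * S_monom 3 0 0 0 0"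
     using s sig_rel(2)[of m ta X] by simp
    thus ?thesis unfolding if_not_P[OF f] by blast
   qed
  qed
 qed
 hence "ALL x. EX T. v x = fst T * S_monom 3 0 1 0 0 + fst (snd T) * S_monom 3 0 0 1 0
      + (if x \<in> {Gen_1, Gen_c} then 0 else snd (snd T) * S_monom 3 0 0 0 0)" by (metis fst_conv snd_conv)
 from choice[OF this] obtain T where "ALL x. v x = fst (T x) * S_monom 3 0 1 0 0 + fst (snd (T x)) * S_monom 3 0 0 1 0
      + (if x \<in> {Gen_1, Gen_c} then 0 else snd (snd (T x)) * S_monom 3 0 0 0 0)" by blast
 thus "v \<in> relations" unfolding relations_def
  by (intro CollectI exI[of _ "%x. fst (T x)"] exI[of _ "%x. fst (snd (T x))"] exI[of _ "%x. snd (snd (T x))"])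
qed (use relations_La in blast)

subsection \<open>Generators in coordinates\<close>

text \<open>With s3 set to 1 a degree is meaningful only modulo 18. The projections built from this
  one commute with gamma, so primitives found without regard to the grading can be made
  homogeneous.\<close>

definition prL :: "int => 'w::comm_ring_1 L => 'w L" where
 "prL ta p = Abs_fps (%i. Abs_fps (%j. if 18 dvd ta + 6 * int i + 12 * int j then p $ i $ j else 0))"

definition prD :: "int => 'w::comm_ring_1 DV => 'w DV" where
 "prD ta c = (%e. prL (ta + 2 * int (db_deg e)) (c e))"

definition pr :: "int => 'w::comm_ring_1 V => 'w V" where
 "pr t u = (%l1 l2 l3. prD (t + 2 * int (let_deg l1) + 2 * int (let_deg l2) + 2 * int (let_deg l3)) (u l1 l2 l3))"

lemma prL_nth: "prL ta p $ i $ j = (if 18 dvd ta + 6 * int i + 12 * int j then p $ i $ j else 0)"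
 by (simp add: prL_def)

lemma prL_add: "prL ta (p + q) = prL ta p + prL ta q" and prL_minus: "prL ta (- p) = - prL ta p"
 and prL_diff: "prL ta (p - q) = prL ta p - prL ta q" and prL_0: "prL ta 0 = 0"
 by (simp_all add: fps_eq_iff prL_nth)

lemma prL_num: "prL ta (numeral n * p) = numeral n * prL ta p"
 by (simp add: fps_eq_iff prL_nth num_nth del: fps_mult_nth)

lemma prL_cL: "prL ta (cL w * p) = cL w * prL ta p"
 by (simp add: fps_eq_iff prL_nth)

lemma dvd18_cong: "a - b = 18 * c ==> (18 dvd a) = (18 dvd (b::int))"
proof -
 assume "a - b = 18 * c"
 hence "a = b + 18 * c" by simp
 thus ?thesis by (metis dvd_add_left_iff dvd_triv_left)
qed

lemma prL_s1: "prL ta (s1L * p) = s1L * prL (ta + 6) p"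
proof -
 have "prL ta (s1L * p) $ i $ j = (s1L * prL (ta + 6) p) $ i $ j" for i j
  unfolding prL_nth s1L_nth by (cases i) (simp_all add: add_ac)
 thus ?thesis by (simp only: fps_eq_iff) blast
qed

lemma prL_s2: "prL ta (s2L * p) = s2L * prL (ta + 12) p"
proof -
 have "prL ta (s2L * p) $ i $ j = (s2L * prL (ta + 12) p) $ i $ j" for i j
  unfolding prL_nth s2L_nth by (cases j) (simp_all add: add_ac)
 thus ?thesis by (simp only: fps_eq_iff) blast
qed

lemma prL_period: "ta - ta' = 18 * c ==> prL ta p = prL ta' p"
proof -
 assume a: "ta - ta' = 18 * c"
 have "18 dvd ta + 6 * int i + 12 * int j <-> 18 dvd ta' + 6 * int i + 12 * int j" for i j
  by (rule dvd18_cong[of _ _ c]) (use a in simp)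
 thus ?thesis by (simp add: fps_eq_iff prL_nth)
qed

lemma prD_gD: "gD (prD ta c) = prD ta (gD c)"
proof -
 have p: "prL (ta + 24) x = prL (ta + 6) x" "prL (ta + 30) x = prL (ta + 12) x" "prL (ta + 18) x = prL ta x" for x :: "'a L"
  by (rule prL_period[of _ _ 1], simp)+
 show ?thesis unfolding DV_eq_iff
  by (simp add: prD_def prL_add prL_diff prL_minus prL_s1 prL_s2 add.assoc p)
qed

lemma prD_add: "prD ta (c + c') = prD ta c + prD ta c'" and prD_minus: "prD ta (- c) = - prD ta c"
 and prD_diff: "prD ta (c - c') = prD ta c - prD ta c'" and prD_0: "prD ta 0 = 0"
 by (simp_all add: prD_def fun_eq_iff prL_add prL_minus prL_diff prL_0)

lemma pr_add: "pr t (u + v) = pr t u + pr t v" and pr_diff: "pr t (u - v) = pr t u - pr t v" and pr_0: "pr t 0 = 0"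
 by (rule V3_eqI; simp add: pr_def prD_add prD_diff prD_0)+

lemma pr_vs: "pr t (vs a b l c) = vs a b l (prD (t + 2 * int (let_deg a) + 2 * int (let_deg b) + 2 * int (let_deg l)) c)"
 by (rule V3_eqI) (auto simp: pr_def vs_def prD_0)

lemma invD_nth: "invD p q B1 = p - s1L * (s2L * q) - 3 * q" "invD p q Bd1 = 2 * (s2L * q)"
 "invD p q Bd2 = - (2 * (s2L * q))" "invD p q Bd12 = 4 * (s1L * q)" "invD p q Bd23 = 2 * (s1L * q)"
 "invD p q Bu = - (6 * q)"
 by (simp_all add: invD_def sc_def dsg_def alg)

lemma prD_invD: "prD t (invD p q) = invD (prL t p) (prL (t + 18) q)"
proof -
 have p: "prL (t + 18) q = prL t q" by (rule prL_period[of _ _ 1]) simp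
 show ?thesis unfolding DV_eq_iff invD_nth prD_def
  by (simp add: prL_add prL_diff prL_minus prL_num prL_s1 prL_s2 p p[unfolded add.commute[of t]] invD_nth)
qed

section \<open>Normal forms of classes\<close>

fun gf :: "dbasis => gen" where
 "gf B1 = Gen_f0" | "gf Bd1 = Gen_f1" | "gf Bd2 = Gen_f2" | "gf Bd12 = Gen_f3" | "gf Bd23 = Gen_f4" | "gf Bu = Gen_f5"

fun gF :: "dbasis => gen" where
 "gF B1 = Gen_F0" | "gF Bd1 = Gen_F1" | "gF Bd2 = Gen_F2" | "gF Bd12 = Gen_F3" | "gF Bd23 = Gen_F4" | "gF Bu = Gen_F5"

lemma gen_cases:
 obtains "x = Gen_1" | "x = Gen_delta" | "x = Gen_c" | "x = Gen_c_delta" | e where "x = gf e" | e where "x = gF e"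
proof (cases x)
 case Gen_f0 show ?thesis by (rule that(5)[of B1]) (simp add: Gen_f0) next
 case Gen_f1 show ?thesis by (rule that(5)[of Bd1]) (simp add: Gen_f1) next
 case Gen_f2 show ?thesis by (rule that(5)[of Bd2]) (simp add: Gen_f2) next
 case Gen_f3 show ?thesis by (rule that(5)[of Bd12]) (simp add: Gen_f3) next
 case Gen_f4 show ?thesis by (rule that(5)[of Bd23]) (simp add: Gen_f4) next
 case Gen_f5 show ?thesis by (rule that(5)[of Bu]) (simp add: Gen_f5) next
 case Gen_F0 show ?thesis by (rule that(6)[of B1]) (simp add: Gen_F0) next
 case Gen_F1 show ?thesis by (rule that(6)[of Bd1]) (simp add: Gen_F1) next
 case Gen_F2 show ?thesis by (rule that(6)[of Bd2]) (simp add: Gen_F2) next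
 case Gen_F3 show ?thesis by (rule that(6)[of Bd12]) (simp add: Gen_F3) next
 case Gen_F4 show ?thesis by (rule that(6)[of Bd23]) (simp add: Gen_F4) next
 case Gen_F5 show ?thesis by (rule that(6)[of Bu]) (simp add: Gen_F5)
qed (use that in simp_all)

lemma gen_deg_f: "gen_deg (gf e) = (1, - 2 - 2 * int (db_deg e))" and gen_deg_F: "gen_deg (gF e) = (2, - 4 - 2 * int (db_deg e))"
 by (cases e; simp)+

lemma gf_simps: "gf e ~= Gen_1" "gf e ~= Gen_c" "gF e ~= Gen_1" "gF e ~= Gen_c"
 "gf e ~= Gen_delta" "gf e ~= Gen_c_delta" "gF e ~= Gen_delta" "gF e ~= Gen_c_delta" "gf e ~= gF e'"
 "gf e = gf e' <-> e = e'" "gF e = gF e' <-> e = e'"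
 by (cases e; cases e'; simp)+

lemma relL_add: "relL x p ==> relL x q ==> relL x (p + q)"
 and relL_mult: "relL x p ==> relL x (r * p)"
proof -
 have 1: "(9 * X + 3 * s1L * Y + 3 * s2L * Z) + (9 * X' + 3 * s1L * Y' + 3 * s2L * Z')
   = 9 * (X + X') + 3 * s1L * (Y + Y') + 3 * s2L * (Z + Z')" for X Y Z X' Y' Z' :: "'a L"
  by (simp add: alg)
 have 2: "r * (9 * X + 3 * s1L * Y + 3 * s2L * Z) = 9 * (r * X) + 3 * s1L * (r * Y) + 3 * s2L * (r * Z)" for X Y Z :: "'a L"
  by (simp add: alg)
 have 3: "3 * X + 3 * Y = 3 * (X + Y)" "r * (3 * X) = 3 * (r * X)" for X Y :: "'a L" by (simp_all add: alg)
 show "relL x p ==> relL x q ==> relL x (p + q)"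
 proof (cases "x \<in> {Gen_1, Gen_c}")
  case True
  assume "relL x p" "relL x q"
  thus ?thesis unfolding relL_def if_P[OF True] using 1 by blast
 next
  case False
  assume "relL x p" "relL x q"
  thus ?thesis unfolding relL_def if_not_P[OF False] using 3 by blast
 qed
 show "relL x p ==> relL x (r * p)"
 proof (cases "x \<in> {Gen_1, Gen_c}")
  case True
  assume "relL x p"
  thus ?thesis unfolding relL_def if_P[OF True] using 2 by blast
 next
  case False
  assume "relL x p"
  thus ?thesis unfolding relL_def if_not_P[OF False] using 3 by blast
 qed
qed

lemma relL_minus: "relL x p ==> relL x (- p)"
 using relL_mult[of x p "- 1"] by simp

lemma relL_diff: "relL x p ==> relL x q ==> relL x (p - q)"
 using relL_add[of x p "- q"] relL_minus[of x q] by simp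

lemma relL_9: "relL x (9 * X)"
proof (cases "x \<in> {Gen_1, Gen_c}")
 case True
 have "9 * X = 9 * X + 3 * s1L * 0 + 3 * s2L * 0" by simp
 thus ?thesis unfolding relL_def if_P[OF True] by blast
next
 case False
 have "9 * X = 3 * (3 * X)" by simp
 thus ?thesis unfolding relL_def if_not_P[OF False] by blast
qed

lemma relL_eq9_diff: "eq9 p q ==> relL x (p - q)"
 unfolding eq9_def using relL_9 by auto

context wittk
begin

lemma small_relL: fixes p q :: "'w L" shows "small p q <-> relL Gen_1 p & relL Gen_delta q" "small p q <-> relL Gen_c p & relL Gen_c_delta q"
 by (simp_all add: small_def[OF tf] relL_def)

text \<open>In even degrees classes are invariants modulo norms, with 1, delta and the F_i as
  generators. In odd degrees they are the kernel of the norm modulo gamma - 1, with c-bar, c-bar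
  delta and the f_i.\<close>

definition Yr :: "nat => (gen => 'w L) => 'w V" where
 "Yr n c = (if even n then vs One One One (invD (c Gen_1) (c Gen_delta)) + D.trpair (%e. c (gF e))
   else vs LX One One (%e. c (gf e)) + vs LX LX LX (invD (c Gen_c) (c Gen_c_delta)))"

definition okgen :: "nat => gen => bool" where
 "okgen n x <-> even n = even (fst (gen_deg x))"

definition triv :: "nat => 'w V => bool" where
 "triv n y <-> (if even n then EX b. y = D.nV b else EX b. y = D.gV b - b)"

lemma triv_add: "triv n y ==> triv n z ==> triv n (y + z)"
proof (cases "even n")
 case True
 assume "triv n y" "triv n z"
 then obtain b c where "y = D.nV b" "z = D.nV c" unfolding triv_def if_P[OF True] by blast
 hence "y + z = D.nV (b + c)" by (simp only: D.nV_add)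
 thus ?thesis unfolding triv_def if_P[OF True] by blast
next
 case False
 assume "triv n y" "triv n z"
 then obtain b c where "y = D.gV b - b" "z = D.gV c - c" unfolding triv_def if_not_P[OF False] by blast
 hence "y + z = D.gV (b + c) - (b + c)" by (simp add: D.gV_add)
 thus ?thesis unfolding triv_def if_not_P[OF False] by blast
qed

lemma triv_minus: "triv n y ==> triv n (- y)"
proof (cases "even n")
 case True
 assume "triv n y"
 then obtain b where "y = D.nV b" unfolding triv_def if_P[OF True] by blast
 hence "- y = D.nV (- b)" using D.nV_diff[of 0 b] D.nV_diff[of 0 0] by (simp only: diff_0 diff_self)
 thus ?thesis unfolding triv_def if_P[OF True] by blast
next
 case False
 assume "triv n y"
 then obtain b where "y = D.gV b - b" unfolding triv_def if_not_P[OF False] by blast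
 hence "- y = D.gV (- b) - (- b)" by (simp add: D.gV_minus)
 thus ?thesis unfolding triv_def if_not_P[OF False] by blast
qed

lemma triv_diff: "triv n y ==> triv n z ==> triv n (y - z)"
 using triv_add[of n y "- z"] triv_minus[of n z] by simp

lemma eqv_triv: "odd n ==> D.eqv u v <-> triv n (u - v)"
 unfolding D.eqv_def triv_def by (auto simp: alg)

lemma trg_sc: "D.trg c + D.trg c + D.trg c = sc 3 (trD c)"
proof -
 have "(D.trg c + D.trg c + D.trg c) e = sc 3 (trD c) e" for e by (simp add: sc_def trD_def alg)
 thus ?thesis by (rule ext)
qed

lemma kertr: "D.trg x = 0 ==> EX m. x = gD m - (m :: 'w DV)"
 using trD_0[OF tf, of x] unfolding trD_def .

lemma sc_3: "(c + c + c) e = 3 * c e" for c :: "'w DV"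
 by simp

lemma DV_3: "(!!e. relL (h e) (q e)) ==> (!!e. h e \<notin> {Gen_1, Gen_c}) ==> EX c. q = c + c + (c :: 'w DV)"
proof -
 assume a: "!!e. relL (h e) (q e)" "!!e. h e \<notin> {Gen_1, Gen_c}"
 have "EX X. q e = 3 * X" for e using a(1)[of e] unfolding relL_def if_not_P[OF a(2)] .
 then obtain c where "!!e. q e = 3 * c e" by metis
 hence "q = c + c + c" by (intro ext) (simp add: sc_3)
 thus ?thesis by blast
qed

lemma DV_3': "q = c + c + (c :: 'w DV) ==> h \<notin> {Gen_1, Gen_c} ==> relL h (q e)"
proof -
 assume "q = c + c + c" and h: "h \<notin> {Gen_1, Gen_c}"
 hence "q e = 3 * c e" by (simp only: sc_3)
 thus ?thesis unfolding relL_def if_not_P[OF h] by blast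
qed

text \<open>This is where the relations of the presentation arise: \<open>even_inj\<close> and
  \<open>odd_inj\<close> give their necessity, \<open>even_conv\<close> and \<open>odd_conv\<close>
  their sufficiency, and \<open>invD_norm_iff\<close> decides the part spanned by 1 and delta, or by
  c-bar and c-bar delta.\<close>

lemma Yr_triv: "triv n (Yr n c) <-> (ALL x. okgen n x --> relL x (c x))"
proof (cases "even n")
 case True
 have ok: "(ALL x. okgen n x --> relL x (c x)) <-> relL Gen_1 (c Gen_1) & relL Gen_delta (c Gen_delta) & (ALL e. relL (gF e) (c (gF e)))"
 proof
  assume a: "relL Gen_1 (c Gen_1) & relL Gen_delta (c Gen_delta) & (ALL e. relL (gF e) (c (gF e)))"
  show "ALL x. okgen n x --> relL x (c x)"
  proof (intro allI impI)
   fix x assume "okgen n x" thus "relL x (c x)" using a True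
    by (cases x rule: gen_cases) (auto simp: okgen_def gen_deg_f gen_deg_F)
  qed
 qed (use True in \<open>auto simp: okgen_def gen_deg_F\<close>)
 show ?thesis unfolding ok
 proof
  assume "triv n (Yr n c)"
  then obtain b where b: "vs One One One (invD (c Gen_1) (c Gen_delta)) + D.trpair (%e. c (gF e)) = D.nV b"
   unfolding triv_def Yr_def if_P[OF True] by blast
  from D.even_inj[OF b] obtain m q where "invD (c Gen_1) (c Gen_delta) = sc 3 (trD m)" "(%e. c (gF e)) = q + q + q"
   unfolding trg_sc by blast
  thus "relL Gen_1 (c Gen_1) & relL Gen_delta (c Gen_delta) & (ALL e. relL (gF e) (c (gF e)))"
   using invD_norm_iff[OF tf, of "c Gen_1" "c Gen_delta"] small_relL(1)[of "c Gen_1" "c Gen_delta"]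
    DV_3'[of "%e. c (gF e)" q "gF _"] by (auto simp: gf_simps)
 next
  assume a: "relL Gen_1 (c Gen_1) & relL Gen_delta (c Gen_delta) & (ALL e. relL (gF e) (c (gF e)))"
  then obtain m where m: "invD (c Gen_1) (c Gen_delta) = sc 3 (trD m)"
   using invD_norm_iff[OF tf] small_relL(1) by blast
  obtain q where q: "(%e. c (gF e)) = q + q + q" using DV_3[of gF "%e. c (gF e)"] a by (auto simp: gf_simps)
  show "triv n (Yr n c)" unfolding triv_def Yr_def if_P[OF True] m q trg_sc[symmetric] D.even_conv by blast
 qed
next
 case False
 have ok: "(ALL x. okgen n x --> relL x (c x)) <-> relL Gen_c (c Gen_c) & relL Gen_c_delta (c Gen_c_delta) & (ALL e. relL (gf e) (c (gf e)))"
 proof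
  assume a: "relL Gen_c (c Gen_c) & relL Gen_c_delta (c Gen_c_delta) & (ALL e. relL (gf e) (c (gf e)))"
  show "ALL x. okgen n x --> relL x (c x)"
  proof (intro allI impI)
   fix x assume "okgen n x" thus "relL x (c x)" using a False
    by (cases x rule: gen_cases) (auto simp: okgen_def gen_deg_f gen_deg_F)
  qed
 qed (use False in \<open>auto simp: okgen_def gen_deg_f\<close>)
 show ?thesis unfolding ok
 proof
  assume "triv n (Yr n c)"
  hence b: "D.eqv (vs LX One One (%e. c (gf e)) + vs LX LX LX (invD (c Gen_c) (c Gen_c_delta))) 0"
   unfolding eqv_triv[OF False] Yr_def if_not_P[OF False] by (simp only: diff_0_right)
  from D.odd_inj[OF gD_invD b] obtain m q where "invD (c Gen_c) (c Gen_c_delta) = sc 3 (trD m)" "(%e. c (gf e)) = q + q + q"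
   unfolding trg_sc by blast
  thus "relL Gen_c (c Gen_c) & relL Gen_c_delta (c Gen_c_delta) & (ALL e. relL (gf e) (c (gf e)))"
   using invD_norm_iff[OF tf, of "c Gen_c" "c Gen_c_delta"] small_relL(2)[of "c Gen_c" "c Gen_c_delta"]
    DV_3'[of "%e. c (gf e)" q "gf _"] by (auto simp: gf_simps)
 next
  assume a: "relL Gen_c (c Gen_c) & relL Gen_c_delta (c Gen_c_delta) & (ALL e. relL (gf e) (c (gf e)))"
  then obtain m where m: "invD (c Gen_c) (c Gen_c_delta) = sc 3 (trD m)"
   using invD_norm_iff[OF tf] small_relL(2) by blast
  obtain q where q: "(%e. c (gf e)) = q + q + q" using DV_3[of gf "%e. c (gf e)"] a by (auto simp: gf_simps)
  have "D.eqv (Yr n c) 0" unfolding Yr_def if_not_P[OF False] m q trg_sc[symmetric] by (rule D.odd_conv)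
  thus "triv n (Yr n c)" unfolding eqv_triv[OF False] by (simp only: diff_0_right)
 qed
qed

lemma trpair_add: "D.trpair (q + q') = D.trpair q + D.trpair q'"
proof -
 let ?H = "%q. vs LX LX One q + vs LY LX One q + vs LY LY One q"
 have h: "?H (q + q') = ?H q + ?H q'" by (simp add: D.vs_add)
 show ?thesis unfolding D.trpair_def Let_def h D.gV_add by (simp only: add_ac)
qed

lemma trpair_sc: "D.trpair (sc p q) = scV p (D.trpair q)"
 unfolding D.trpair_def Let_def scV_add gV_scV[symmetric] scV_vs by (simp only: scV_add scV_vs)

lemma invD_add: "invD (p + p') (q + q') = invD p q + invD p' (q' :: 'w L)" and invD_sc: "invD (r * p) (r * q) = sc r (invD p (q :: 'w L))"
 by (simp_all add: DV_eq_iff invD_nth sc_def alg)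

lemma Yr_add: "Yr n (%x. c x + c' x) = Yr n c + Yr n c'"
proof -
 have l: "(%e. c (h e) + c' (h e)) = (%e. c (h e)) + (%e. c' (h e))" for h :: "dbasis => gen"
  by (rule ext) simp
 show ?thesis unfolding Yr_def invD_add l trpair_add D.vs_add by (cases "even n") (simp_all only: if_True if_False add_ac)
qed

lemma Yr_sc: "Yr n (%x. p * c x) = scV p (Yr n c)"
proof -
 have l: "(%e. p * c (h e)) = sc p (%e. c (h e))" for h :: "dbasis => gen"
  by (rule ext) (simp add: sc_def)
 show ?thesis unfolding Yr_def invD_sc l trpair_sc
  by (cases "even n") (simp_all only: if_True if_False scV_add scV_vs)
qed

lemma Yr_diff: "Yr n (%x. c x - c' x) = Yr n c - Yr n c'"
 using Yr_add[of n "%x. c x - c' x" c'] by (simp add: alg)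

lemma Yr_inv: "even n ==> D.gV (Yr n c) = Yr n c"
 unfolding Yr_def by (simp only: if_True D.gV_add D.gV_vs gD_invD D.gV_trpair)

lemma nV_LX: "D.nV (vs LX One One q) = 0"
 by (simp only: D.nV_def sum_9 numeral_eq_Suc) (simp add: D.calc numeral_eq_Suc)

lemma Yr_norm: "odd n ==> D.nV (Yr n c) = 0"
proof -
 assume n: "odd n"
 let ?p = "invD (c Gen_c) (c Gen_c_delta)"
 have "D.nV (vs LX LX LX ?p) = 0"
 proof (rule D.invariant_zero[OF D.gV_nV])
  show "D.Fzero (D.nV (vs LX LX LX ?p))" by (rule D.Fzero_nV[OF D.Fzero_vs]) (simp add: anyF_def)
 qed (simp_all add: D.nV_vs gD_invD)
 thus ?thesis unfolding Yr_def if_not_P[OF n] D.nV_add nV_LX by (simp only: add_0_left)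
qed

lemma Yr_surj:
 assumes "if even n then D.gV a = a else D.nV a = 0"
 shows "EX c. triv n (a - Yr n c)"
proof (cases "even n")
 case True
 obtain p q b where p: "gD p = p" "a = vs One One One p + D.trpair q + D.nV b"
  using D.even_surj[OF kertr, of a] assms True by (simp only: if_True) blast
 obtain p0 q0 m where m: "p = invD p0 q0 + sc 3 (trD m)" using gD_inv[OF tf p(1)] by blast
 define c where "c x = (if x = Gen_1 then p0 else if x = Gen_delta then q0 else q (SOME e. x = gF e))" for x
 have cF: "(%e. c (gF e)) = q" by (rule ext) (simp add: c_def gf_simps)
 have "vs One One One (sc 3 (trD m)) = D.nV (vs One One One m + vs LX LX One 0 - vs LX LY One 0)"
  using D.even_conv[of m 0] D.trpair_def[of 0] unfolding trg_sc
  by (simp only: add_0_left add_0_right D.vs_0 D.gV_0 Let_def)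
 moreover have "a - Yr n c = vs One One One (sc 3 (trD m)) + D.nV b"
  unfolding Yr_def if_P[OF True] cF p(2) m by (simp add: c_def D.vs_add)
 ultimately have "a - Yr n c = D.nV (vs One One One m + vs LX LX One 0 - vs LX LY One 0 + b)" by (simp only: D.nV_add)
 thus ?thesis unfolding triv_def if_P[OF True] by blast
next
 case False
 obtain q p where p: "gD p = p" "D.eqv a (vs LX One One q + vs LX LX LX p)"
  using D.odd_surj[OF kertr, of a] assms False by (simp only: if_False) blast
 obtain p0 q0 m where m: "p = invD p0 q0 + sc 3 (trD m)" using gD_inv[OF tf p(1)] by blast
 define c where "c x = (if x = Gen_c then p0 else if x = Gen_c_delta then q0 else q (SOME e. x = gf e))" for x
 have cf: "(%e. c (gf e)) = q" by (rule ext) (simp add: c_def gf_simps)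
 have 1: "triv n (vs LX LX LX (sc 3 (trD m)))"
  using D.odd_conv[of 0 m] unfolding trg_sc eqv_triv[OF False] by (simp only: add_0_left D.vs_0 diff_0_right)
 have "a - Yr n c = (a - (vs LX One One q + vs LX LX LX p)) + vs LX LX LX (sc 3 (trD m))"
  unfolding Yr_def if_not_P[OF False] cf m by (simp add: c_def D.vs_add)
 thus ?thesis using triv_add[OF p(2)[unfolded eqv_triv[OF False]] 1] by metis
qed

lemma pr_gV: "pr t (D.gV u) = D.gV (pr t u)"
proof (rule V3_eqI)
 fix l1 l2 l3
 let ?t = "t + 2 * int (let_deg l1) + 2 * int (let_deg l2) + 2 * int (let_deg l3)"
 have "gact (pr t u l2 l3) l1 = prD ?t (gact (u l2 l3) l1)"
  by (cases l1) (simp_all add: pr_def prD_minus prD_diff add_ac)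
 thus "pr t (D.gV u) l1 l2 l3 = D.gV (pr t u) l1 l2 l3" by (simp add: D.gV_def prD_gD) (simp add: pr_def D.gV_def)
qed

lemma pr_nV: "pr t (D.nV u) = D.nV (pr t u)"
proof -
 have "pr t ((D.gV ^^ k) u) = (D.gV ^^ k) (pr t u)" for k by (induction k) (simp_all add: pr_gV)
 moreover have "pr t (sum F X) = (SUM k:X. pr t (F k))" for F :: "nat => 'w V" and X
  by (induction X rule: infinite_finite_induct) (simp_all only: sum.infinite sum.empty sum.insert pr_0 pr_add not_False_eq_True)
 ultimately show ?thesis unfolding D.nV_def by simp
qed

lemma pr_nth: "pr t u l1 l2 l3 e $ i $ j = (if EX k. t = - 2 * int (pos_deg l1 l2 l3 e i j) - 18 * k then u l1 l2 l3 e $ i $ j else 0)"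
proof -
 have "(EX k. t = - 2 * int (pos_deg l1 l2 l3 e i j) - 18 * k) <-> 18 dvd t + 2 * int (pos_deg l1 l2 l3 e i j)"
 proof
  assume "18 dvd t + 2 * int (pos_deg l1 l2 l3 e i j)"
  then obtain k where "t + 2 * int (pos_deg l1 l2 l3 e i j) = 18 * k" by (elim dvdE)
  hence "t = - 2 * int (pos_deg l1 l2 l3 e i j) - 18 * (- k)" by simp
  thus "EX k. t = - 2 * int (pos_deg l1 l2 l3 e i j) - 18 * k" by blast
 qed auto
 thus ?thesis unfolding pr_def prD_def prL_nth pos_deg_def by (simp add: alg)
qed

lemma pr_Vt: "pr t u \<in> Vt t"
 unfolding Vt_def by (auto simp only: mem_Collect_eq pr_nth split: if_splits)

lemma pr_id: "u \<in> Vt t ==> pr t u = u"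
 by (rule V_eqI) (auto simp: fps_eq_iff pr_nth Vt_nth)

lemma pr_trpair: "pr t (D.trpair q) = D.trpair (prD (t + 4) q)"
 unfolding D.trpair_def Let_def pr_add pr_gV pr_vs by (simp add: add.assoc)

lemma pr_Yr: "pr t (Yr n c) = Yr n (%x. prL (t - snd (gen_deg x)) (c x))"
proof -
 have F: "prD (t + 4) (%e. c (gF e)) = (%e. prL (t - snd (gen_deg (gF e))) (c (gF e)))"
  and f: "prD (t + 2) (%e. c (gf e)) = (%e. prL (t - snd (gen_deg (gf e))) (c (gf e)))"
  unfolding prD_def gen_deg_F gen_deg_f by (simp_all add: alg)
 show ?thesis
  by (cases "even n") (simp_all add: Yr_def pr_add pr_vs pr_trpair F f prD_invD add.assoc)
qed

lemma prL_hom: "hom_L ta (prL ta p)"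
 unfolding hom_L_def prL_nth
proof (intro allI impI)
 fix i j assume "(if 18 dvd ta + 6 * int i + 12 * int j then p $ i $ j else 0) ~= 0"
 hence "18 dvd ta + 6 * int i + 12 * int j" by (metis)
 then obtain k where "ta + 6 * int i + 12 * int j = 18 * k" by (elim dvdE)
 hence "ta = - 6 * int i - 12 * int j - 18 * (- k)" by simp
 thus "EX k. ta = - 6 * int i - 12 * int j - 18 * k" by blast
qed

lemma hom_prL: "hom_L ta p ==> prL ta p = p"
proof -
 assume h: "hom_L ta p"
 have "18 dvd ta + 6 * int i + 12 * int j" if nz: "p $ i $ j ~= 0" for i j
 proof -
  obtain k where "ta = - 6 * int i - 12 * int j - 18 * k" using h nz unfolding hom_L_def by blast
  hence "ta + 6 * int i + 12 * int j = 18 * (- k)" by simp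
  thus ?thesis by (metis dvd_triv_left)
 qed
 thus "prL ta p = p" unfolding fps_eq_iff prL_nth by auto
qed

lemma triv_Vt: "triv n y ==> y \<in> Vt t ==> if even n then EX b:Vt t. y = D.nV b else EX b:Vt t. y = D.gV b - b"
proof (cases "even n")
 case True
 assume "triv n y" and y: "y \<in> Vt t"
 then obtain b where "y = D.nV b" unfolding triv_def if_P[OF True] by blast
 hence "y = D.nV (pr t b)" using pr_id[OF y] pr_nV by metis
 thus ?thesis using True pr_Vt by auto
next
 case False
 assume "triv n y" and y: "y \<in> Vt t"
 then obtain b where "y = D.gV b - b" unfolding triv_def if_not_P[OF False] by blast
 hence "y = D.gV (pr t b) - pr t b" using pr_id[OF y] pr_gV pr_diff by metis
 thus ?thesis using False pr_Vt by auto
qed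

end

subsection \<open>Cocycles from elements\<close>

abbreviation "cry == cyc.carry gamH"
abbreviation "crs9 == cyc.cross gamH 1"
abbreviation "crs3 == cyc.cross gamH 3"
abbreviation "hact == cyc_act gamH"

lemma carrier_C9: "carrier C9 = {0..<9}"
 by (simp add: C9_def carrier_integer_mod_group)

lemma mult_C9: "mult C9 = mul9" "one C9 = 0" "mult C3 = mul9" "one C3 = 0"
 by (simp_all add: C9_def C3_def integer_mod_group_def mul9_def[abs_def])

lemma carrier_C3: "carrier C3 = {0, 3, 6}"
 by (simp add: C3_def)

lemma C3_sub: "carrier C3 <= carrier C9"
 by (auto simp: carrier_C3 carrier_C9)

lemma cyc9: "cyc C9 (gamH :: 'w::comm_ring_1 Mhat => _) 1 9 (Mhat_part t)"
proof
 show "carrier C9 = (%i. int (1 * i)) ` {..<9}"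
 proof -
  have "{0..<9} = int ` {..<9}" by (metis image_int_atLeastLessThan lessThan_atLeast0 of_nat_0 of_nat_numeral)
  thus ?thesis by (simp add: carrier_C9)
 qed
qed (simp_all add: mult_C9 hg_simps Mhat_gamma_9 hp_ops hg_part)

lemma cyc3: "cyc C3 (gamH :: 'w::comm_ring_1 Mhat => _) 3 3 (Mhat_part t)"
proof
 show "carrier C3 = (%i. int (3 * i)) ` {..<3}"
 proof -
  have "{..<3} = {0, 1, 2 :: nat}" by auto
  thus ?thesis by (simp add: carrier_C3)
 qed
qed (simp_all add: mult_C9 hg_simps Mhat_gamma_9 hp_ops hg_part)

text \<open>Cochains have to vanish off the tuples of group elements, which \<open>carry\<close> and
  \<open>cross\<close> do not respect.\<close>

definition cut :: "nat => (int list => 'm::zero) => int list => 'm" where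
 "cut n f gs = (if length gs = n & set gs <= carrier C9 then f gs else 0)"

lemma hact_simps: "hact g (x + y) = hact g x + hact g y" "hact g (x * y) = hact g x * hact g y"
 "hact g (0 :: 'w::comm_ring_1 Mhat) = 0" "hact g (1 :: 'w Mhat) = 1" "hact g (x - y) = hact g x - hact g y"
proof -
 have "(gamH ^^ k) (a + b) = (gamH ^^ k) a + (gamH ^^ k) b"
  "(gamH ^^ k) (a * b) = (gamH ^^ k) a * (gamH ^^ k) b"
  "(gamH ^^ k) (0 :: 'w Mhat) = 0" "(gamH ^^ k) (1 :: 'w Mhat) = 1"
  "(gamH ^^ k) (a - b) = (gamH ^^ k) a - (gamH ^^ k) b" for k and a b :: "'b::comm_ring_1 Mhat"
  by (induction k) (simp_all add: hg_simps)
 note * = this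
 show "hact g (x + y) = hact g x + hact g y" "hact g (x * y) = hact g x * hact g y"
 "hact g (0 :: 'w::comm_ring_1 Mhat) = 0" "hact g (1 :: 'w Mhat) = 1" "hact g (x - y) = hact g x - hact g y"
  unfolding cyc_act_def by (rule *)+
qed

lemma cry_simps: "cry f (g # h # gs) = (if g + h \<ge> 9 then hact (mul9 g h) (f gs) else 0)"
 "cry f [] = 0" "cry f [g] = 0"
 by (simp_all add: cyc.carry.simps[OF cyc9])

lemma cup_b1: "cup C9 hact 2 b1_cocycle f (a # b # gs) = (if a \<in> carrier C9 & b \<in> carrier C9 then cry f (a # b # gs) else 0)"
proof -
 have "mul9 a (mul9 b 0) = mul9 a b" if "b \<in> carrier C9"
  using that by (simp add: carrier_C9 mul9_def)
 thus ?thesis by (simp add: cup_def b1_cocycle_def cry_simps mult_C9 numeral_2_eq_2)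
qed

lemma b1_power_Suc: "b1_power (Suc k) (a # b # gs) =
  (if a \<in> carrier C9 & b \<in> carrier C9 & a + b \<ge> 9 then hact (mul9 a b) (b1_power k gs) else 0)"
 by (simp add: cup_b1 cry_simps)

lemma b1_power_short: "length gs < 2 ==> b1_power (Suc k) gs = 0"
 by (simp add: cup_def b1_cocycle_def)

lemma b1_power_tup: "b1_power k gs ~= (0 :: 'a::comm_ring_1 Mhat) ==> length gs = 2 * k & set gs <= carrier C9"
proof (induction k arbitrary: gs)
 case (Suc k)
 show ?case
 proof (cases "length gs < 2")
  case True thus ?thesis using Suc.prems b1_power_short by blast
 next
  case False
  then obtain a b hs where gs: "gs = a # b # hs" by (cases gs; cases "tl gs") auto
  have "a \<in> carrier C9 & b \<in> carrier C9" "hact (mul9 a b) (b1_power k hs) ~= (0 :: 'a Mhat)"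
   using Suc.prems unfolding gs b1_power_Suc by (auto split: if_splits)
  moreover from this have "b1_power k hs ~= (0 :: 'a Mhat)" by (auto simp: hact_simps)
  ultimately show ?thesis using Suc.IH[of hs] unfolding gs by auto
 qed
qed (auto split: if_splits)

lemma foldr_C9: "set gs <= carrier C9 ==> 0 \<le> foldr mul9 gs 0"
 by (induction gs) (auto simp: mul9_def)

text \<open>In the cup product the product of the first 2 k arguments acts on f. Iterated carries
  apply the products of consecutive pairs one after the other, with the same effect.\<close>

lemma cup_b1_power:
 fixes f :: "int list => 'a::comm_ring_1 Mhat"
 shows "cup C9 hact (2 * k) (b1_power k) f gs =
  (if length gs \<ge> 2 * k & set (take (2 * k) gs) <= carrier C9 then (cry ^^ k) f gs else 0)"
proof (induction k arbitrary: gs)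
 case 0
 show ?case by (simp add: cup_def mult_C9 cyc_act_def)
next
 case (Suc k)
 show ?case
 proof (cases "length gs < 2")
  case True
  hence "take (2 * Suc k) gs = gs" by simp
  hence "b1_power (Suc k) (take (2 * Suc k) gs) = (0 :: 'a Mhat)" using True b1_power_short by metis
  moreover have "~ 2 * Suc k \<le> length gs" using True by simp
  ultimately show ?thesis unfolding cup_def by (simp only: mult_zero_left simp_thms if_False)
 next
  case False
  then obtain a b hs where gs: "gs = a # b # hs" by (cases gs; cases "tl gs") auto
  let ?xs = "take (2 * k) hs"
  let ?ab = "a \<in> carrier C9 & b \<in> carrier C9"
  have t: "take (2 * Suc k) gs = a # b # ?xs" "drop (2 * Suc k) gs = drop (2 * k) hs" by (simp_all add: gs)
  have "cup C9 hact (2 * Suc k) (b1_power (Suc k)) f gs =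
    (if ?ab & a + b \<ge> 9 then hact (mul9 a b) (cup C9 hact (2 * k) (b1_power k) f hs) else 0)"
  proof (cases "?ab & a + b \<ge> 9 & b1_power k ?xs ~= (0 :: 'a Mhat)")
   case True
   have xs: "set ?xs <= carrier C9" using b1_power_tup True by blast
   have "mul9 a (mul9 b (foldr mul9 ?xs 0)) = mul9 (mul9 a b) (foldr mul9 ?xs 0)" by (simp add: mul9_assoc)
   moreover have "hact (mul9 (mul9 a b) (foldr mul9 ?xs 0)) x = hact (mul9 a b) (hact (foldr mul9 ?xs 0) x)" for x :: "'a Mhat"
    by (rule cyc.act_mul9[OF cyc9]) (simp_all add: foldr_C9 xs, simp add: mul9_def)
   ultimately show ?thesis unfolding cup_def t b1_power_Suc using True by (simp add: mult_C9 hact_simps)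
  next
   case False
   thus ?thesis unfolding cup_def t b1_power_Suc by (auto simp: hact_simps)
  qed
  also have "... = (if length gs \<ge> 2 * Suc k & set (take (2 * Suc k) gs) <= carrier C9 then (cry ^^ Suc k) f gs else 0)"
   unfolding Suc t by (auto simp: gs cry_simps hact_simps)
  finally show ?thesis .
 qed
qed

lemma cup_b1_power_cut:
 assumes "!!gs. ~ (length gs = n & set gs <= carrier C9) ==> f gs = 0"
 shows "cup C9 hact (2 * k) (b1_power k) f = cut (2 * k + n) ((cry ^^ k) f)"
proof
 fix gs
 have z: "f (drop (2 * k) gs) = 0 ==> cup C9 hact (2 * k) (b1_power k) f gs = 0"
  by (simp add: cup_def hact_simps)
 show "cup C9 hact (2 * k) (b1_power k) f gs = cut (2 * k + n) ((cry ^^ k) f) gs"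
 proof (cases "length gs = 2 * k + n & set gs <= carrier C9")
  case True
  hence "length gs \<ge> 2 * k & set (take (2 * k) gs) <= carrier C9" using set_take_subset[of "2 * k" gs] by auto
  thus ?thesis unfolding cup_b1_power cut_def using True by simp
 next
  case False
  show ?thesis
  proof (cases "length gs \<ge> 2 * k & set (take (2 * k) gs) <= carrier C9")
   case True
   have "set gs = set (take (2 * k) gs) \<union> set (drop (2 * k) gs)" by (metis append_take_drop_id set_append)
   hence "~ (length (drop (2 * k) gs) = n & set (drop (2 * k) gs) <= carrier C9)" using True False by auto
   thus ?thesis using z assms False by (auto simp: cut_def)
  next
   case f: False
   have "~ (length gs = 2 * k + n & set gs <= carrier C9)" by fact
   thus ?thesis unfolding cup_b1_power cut_def by (simp only: if_not_P[OF f] if_False)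
  qed
 qed
qed

lemma b1_power_cut: "b1_power k = cut (2 * k) ((cry ^^ k) (%_. 1))"
proof
 fix gs
 show "b1_power k gs = cut (2 * k) ((cry ^^ k) (%_. 1 :: 'a Mhat)) gs"
 proof (induction k arbitrary: gs)
  case (Suc k)
  show ?case
  proof (cases "length gs < 2")
   case True thus ?thesis using b1_power_short by (auto simp: cut_def)
  next
   case False
   then obtain a b hs where gs: "gs = a # b # hs" by (cases gs; cases "tl gs") auto
   show ?thesis unfolding gs b1_power_Suc Suc by (auto simp: cut_def cry_simps hact_simps)
  qed
 qed (auto simp: cut_def)
qed

text \<open>By \<open>Zr_rep\<close> every cocycle of positive degree is cohomologous to one of
  these: a power of b1 times an invariant, or times a crossed homomorphism.\<close>

definition Zr :: "nat => 'w::comm_ring_1 Mhat => int list => 'w Mhat" where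
 "Zr n a = (cry ^^ (n div 2)) (if even n then (%_. a) else crs9 a)"

definition okp :: "nat => 'w::comm_ring_1 Mhat => bool" where
 "okp n a <-> (if even n then gamH a = a else cyc.nrm C9 gamH a = 0)"

lemma hact_1: "hact (int 1) x = gamH x"
 by (simp add: cyc_act_def)

lemma nrm_sum: "cyc.nrm C9 gamH a = (\<Sum>k<9. (gamH ^^ k) a)"
proof -
 have "{0..<9} = int ` {..<9}" by (metis image_int_atLeastLessThan lessThan_atLeast0 of_nat_0 of_nat_numeral)
 thus ?thesis unfolding cyc.nrm_def[OF cyc9] carrier_C9
  by (simp add: sum.reindex cyc_act_def)
qed

lemma n_cases: "(n::nat) > 0 ==> (!!k. n = 2 * k + 2 ==> P) ==> (!!k. n = 2 * k + 1 ==> P) ==> P"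
proof -
 assume n: "(n::nat) > 0" and 1: "!!k. n = 2 * k + 2 ==> P" and 2: "!!k. n = 2 * k + 1 ==> P"
 show P
 proof (cases "even n")
  case True
  then obtain m where "n = 2 * m" by (elim evenE)
  hence "n = 2 * (m - 1) + 2" using n by simp
  thus ?thesis by (rule 1)
 next
  case False
  then obtain m where "n = 2 * m + 1" by (elim oddE)
  thus ?thesis by (rule 2)
 qed
qed

lemma Zr_even: "Zr (2 * k + 2) a = (cry ^^ Suc k) (%_. a)" and Zr_odd: "Zr (2 * k + 1) a = (cry ^^ k) (crs9 a)"
 by (simp_all add: Zr_def)

lemma cry_pow_diff: "(cry ^^ k) (%gs. f gs - f' gs) = (%gs. (cry ^^ k) f gs - (cry ^^ k) f' gs)"
 by (rule cyc.carry_pow_diff[OF cyc9])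

lemma crs_diff: "crs9 (a - b) = (%gs. crs9 a gs - crs9 b gs)"
 by (rule ext) (simp add: cyc.cross_def[OF cyc9] cyc.psum_def[OF cyc9] hact_simps sum_subtractf del: One_nat_def)

lemma Zr_diff: "Zr n (a - b) = (%gs. Zr n a gs - Zr n b gs)"
proof (cases "even n")
 case True
 show ?thesis unfolding Zr_def if_P[OF True] by (rule cry_pow_diff)
next
 case False
 show ?thesis unfolding Zr_def if_not_P[OF False] crs_diff by (rule cry_pow_diff)
qed

abbreviation "coc9 t == cyc.coc C9 gamH (Mhat_part t)"
abbreviation "cob9 t == cyc.cob C9 gamH (Mhat_part t)"

lemma Zr_coc:
 assumes "n > 0" "a \<in> Mhat_part t" "okp n a"
 shows "coc9 t n (Zr n a)"
proof (rule n_cases[OF assms(1)])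
 fix k assume n: "n = 2 * k + 2"
 have "coc9 t (2 * Suc k + 0) ((cry ^^ Suc k) (%_. a))"
  using assms unfolding n okp_def by (intro cyc.coc_carry_pow[OF cyc9] cyc.coc_const[OF cyc9]) (simp_all add: cyc_act_def)
 thus ?thesis unfolding n Zr_even by simp
next
 fix k assume n: "n = 2 * k + 1"
 have "coc9 t (2 * k + 1) ((cry ^^ k) (crs9 a))"
  using assms unfolding n okp_def by (intro cyc.coc_carry_pow[OF cyc9] cyc.coc_cross[OF cyc9]) simp_all
 thus ?thesis unfolding n Zr_odd by simp
qed

lemma Zr_rep:
 assumes "n > 0" "coc9 t n f"
 shows "EX a:Mhat_part t. okp n a & cob9 t (n - 1) (%gs. f gs - Zr n a gs)"
proof (rule n_cases[OF assms(1)])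
 fix k assume n: "n = 2 * k + 2"
 have e: "2 * k + 2 - 1 = 2 * k + 1" by simp
 show ?thesis using cyc.even_rep[OF cyc9, of t k f] assms(2) unfolding n Zr_even okp_def hact_1 e by simp
next
 fix k assume n: "n = 2 * k + 1"
 have e: "2 * k + 1 - 1 = 2 * k" by simp
 show ?thesis using cyc.odd_rep[OF cyc9, of t k f] assms(2) unfolding n Zr_odd okp_def e by simp
qed

context wittk
begin

lemma crdH_nrm: "crdH (cyc.nrm C9 gamH a) = D.nV (crdH a)"
proof -
 have "crdH ((gamH ^^ k) a) = (D.gV ^^ k) (crdH a)" for k by (induction k) (simp_all add: crdH_gamma)
 moreover have "crdH (sum F X) = (SUM k:X. crdH (F k))" for F :: "nat => 'w Mhat" and X
  by (induction X rule: infinite_finite_induct) (simp_all only: sum.infinite sum.empty sum.insert crdH_0 crdH_add not_False_eq_True)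
 ultimately show ?thesis unfolding nrm_sum D.nV_def by simp
qed

lemma nrm_part: "b \<in> Mhat_part t ==> cyc.nrm C9 gamH b \<in> Mhat_part t"
proof -
 assume b: "b \<in> Mhat_part t"
 have "(gamH ^^ k) b \<in> Mhat_part t" for k by (induction k) (simp_all add: b hg_part)
 thus ?thesis unfolding nrm_sum by (intro Mhat_part_sum)
qed

lemma okp_crdH: "a \<in> Mhat_part t ==> okp n a <-> (if even n then D.gV (crdH a) = crdH a else D.nV (crdH a) = 0)"
proof (cases "even n")
 case True
 assume a: "a \<in> Mhat_part t"
 have "gamH a = a <-> D.gV (crdH a) = crdH a"
  unfolding crdH_gamma[symmetric] using crdH_inj[OF hg_part[OF a] a] by metis
 thus ?thesis using True unfolding okp_def by simp
next
 case False
 assume a: "a \<in> Mhat_part t"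
 have "cyc.nrm C9 gamH a = 0 <-> D.nV (crdH a) = 0"
  unfolding crdH_nrm[symmetric] using crdH_inj_0[OF nrm_part[OF a]] crdH_0 by metis
 thus ?thesis using False unfolding okp_def by simp
qed

lemma Zr_cob:
 assumes "n > 0" "a \<in> Mhat_part t" "okp n a"
 shows "cob9 t (n - 1) (Zr n a) <-> triv n (crdH a)"
proof (rule n_cases[OF assms(1)])
 fix k assume n: "n = 2 * k + 2"
 have ev: "even n" by (simp add: n)
 have e: "2 * k + 2 - 1 = 2 * k + 1" by simp
 have "cob9 t (n - 1) (Zr n a) <-> (EX b:Mhat_part t. a = cyc.nrm C9 gamH b)"
  unfolding n Zr_even e using assms ev by (intro cyc.even_cob[OF cyc9]) (simp_all add: okp_def cyc_act_def)
 also have "... <-> triv n (crdH a)"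
 proof
  assume "EX b:Mhat_part t. a = cyc.nrm C9 gamH b"
  thus "triv n (crdH a)" unfolding triv_def if_P[OF ev] using crdH_nrm by blast
 next
  assume "triv n (crdH a)"
  then obtain b where b: "b \<in> Vt t" "crdH a = D.nV b" using triv_Vt[of n "crdH a" t] crdH_part[OF assms(2)] ev by auto
  have "crdH (cyc.nrm C9 gamH (hV t b)) = crdH a" unfolding crdH_nrm hV(2)[OF b(1)] b(2) ..
  thus "EX b:Mhat_part t. a = cyc.nrm C9 gamH b"
   using crdH_inj[OF nrm_part[OF hV(1)[OF b(1)]] assms(2)] hV(1)[OF b(1)] by metis
 qed
 finally show ?thesis .
next
 fix k assume n: "n = 2 * k + 1"
 have od: "odd n" by (simp add: n)
 have e: "2 * k + 1 - 1 = 2 * k" by simp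
 have "cob9 t (n - 1) (Zr n a) <-> (EX b:Mhat_part t. a = gamH b - b)"
  unfolding n Zr_odd e using cyc.odd_cob[OF cyc9, of t k a] by (simp add: cyc_act_def)
 also have "... <-> triv n (crdH a)"
 proof
  assume "EX b:Mhat_part t. a = gamH b - b"
  thus "triv n (crdH a)" unfolding triv_def if_not_P[OF od]
   by (elim bexE) (simp only: crdH_gamma crdH_diff, blast)
 next
  assume "triv n (crdH a)"
  then obtain b where b: "b \<in> Vt t" "crdH a = D.gV b - b" using triv_Vt[of n "crdH a" t] crdH_part[OF assms(2)] od by auto
  have "crdH (gamH (hV t b) - hV t b) = crdH a" unfolding crdH_diff crdH_gamma hV(2)[OF b(1)] b(2) ..
  moreover have "gamH (hV t b) - hV t b \<in> Mhat_part t"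
   using hp_ops(1)[OF hg_part[OF hV(1)[OF b(1)]] hp_ops(3)[OF hV(1)[OF b(1)]]] by simp
  ultimately show "EX b:Mhat_part t. a = gamH b - b"
   using crdH_inj[OF _ assms(2)] hV(1)[OF b(1)] by metis
 qed
 finally show ?thesis .
qed

definition eqc :: "nat => int => (int list => 'w Mhat) => (int list => 'w Mhat) => bool" where
 "eqc n t f g <-> cob9 t (n - 1) (%gs. f gs - g gs)"

lemma eqc_sym: "eqc n t f g ==> eqc n t g f"
 unfolding eqc_def using cyc.cob_diff[OF cyc9 cyc.cob_zero[OF cyc9, of "n - 1" "%_. 0"], of t "%gs. f gs - g gs"] by simp

lemma eqc_trans: "eqc n t f g ==> eqc n t g h ==> eqc n t f h"
 unfolding eqc_def using cyc.cob_add[OF cyc9, of t "n - 1" "%gs. f gs - g gs" "%gs. g gs - h gs"] by simp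

lemma okp_diff: "okp n a ==> okp n b ==> okp n (a - b)"
proof -
 have "(gamH ^^ k) (a - b) = (gamH ^^ k) a - (gamH ^^ k) b" for k by (induction k) (simp_all add: hg_simps)
 thus "okp n a ==> okp n b ==> okp n (a - b)" unfolding okp_def nrm_sum by (auto simp: hg_simps sum_subtractf)
qed

lemma Mhat_part_diff: "a \<in> Mhat_part t ==> b \<in> Mhat_part t ==> a - b \<in> Mhat_part t"
 using hp_ops(1)[of a t "- b"] hp_ops(3)[of b t] by simp

lemma eqc_Zr:
 assumes "n > 0" "a \<in> Mhat_part t" "okp n a" "b \<in> Mhat_part t" "okp n b"
 shows "eqc n t (Zr n a) (Zr n b) <-> triv n (crdH a - crdH b)"
 unfolding eqc_def Zr_diff[symmetric] crdH_diff[symmetric]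
 using assms by (intro Zr_cob okp_diff Mhat_part_diff)

end

subsection \<open>Restriction to the subgroup of order 3\<close>

lemma Mhat_of_simps: "Mhat_of (p + q) = Mhat_of p + Mhat_of q" "Mhat_of (p * q) = Mhat_of p * Mhat_of q"
 "Mhat_of 1 = 1" "Mhat_of 0 = 0" "Mhat_of (- p) = - Mhat_of p" "Mhat_of (p - q) = Mhat_of p - Mhat_of q"
 by (simp_all add: Mhat_of_def Mloc_of_simps ofl_simps)

lemma hg_of: "gamH (Mhat_of p) = Mhat_of (gamP p)"
 by (simp add: Mhat_of_def hg_ofl Mloc_gamma_of)

lemma Mhat_of_part: "p \<in> poly9_part t ==> Mhat_of p \<in> Mhat_part t"
 unfolding Mhat_of_def by (intro ofl_part Mloc_of_part)

lemma Mhat_of_x6: "Mhat_of (pvar 6) = - Mhat_of (pvar 0) - (Mhat_of (pvar 3) :: 'a::comm_ring_1 Mhat)"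
 and Mhat_of_x7: "Mhat_of (pvar 7) = - Mhat_of (pvar 1) - (Mhat_of (pvar 4) :: 'a Mhat)"
proof -
 have "Mhat_of (e1p 0) = (0 :: 'a Mhat)" "Mhat_of (e1p 1) = (0 :: 'a Mhat)"
  by (simp_all add: Mhat_of_def Mloc_of_e1 ofl_simps)
 hence "(Mhat_of (pvar 0) + Mhat_of (pvar 3)) + Mhat_of (pvar 6) = (0 :: 'a Mhat)"
  "(Mhat_of (pvar 1) + Mhat_of (pvar 4)) + Mhat_of (pvar 7) = (0 :: 'a Mhat)"
  by (simp_all add: e1p_def Mhat_of_simps)
 hence "- (Mhat_of (pvar 0) + Mhat_of (pvar 3)) = (Mhat_of (pvar 6) :: 'a Mhat)"
  "- (Mhat_of (pvar 1) + Mhat_of (pvar 4)) = (Mhat_of (pvar 7) :: 'a Mhat)"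
  using minus_unique by blast+
 thus "Mhat_of (pvar 6) = - Mhat_of (pvar 0) - (Mhat_of (pvar 3) :: 'a Mhat)"
  "Mhat_of (pvar 7) = - Mhat_of (pvar 1) - (Mhat_of (pvar 4) :: 'a Mhat)"
  by simp_all
qed

lemma hact_3: "hact 3 x = gamH (gamH (gamH x))" and hact_0: "hact 0 x = x"
 and hact_6: "hact 6 x = hact 3 (hact 3 x)" and hact_333: "hact 3 (hact 3 (hact 3 x)) = x"
proof -
 have 9: "(gamH ^^ 9) x = x" by (rule Mhat_gamma_9)
 show "hact 3 x = gamH (gamH (gamH x))" "hact 0 x = x" "hact 6 x = hact 3 (hact 3 x)"
  by (simp_all add: cyc_act_def numeral_eq_Suc)
 show "hact 3 (hact 3 (hact 3 x)) = x" using 9 by (simp add: cyc_act_def numeral_eq_Suc)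
qed

abbreviation "coc3 t == cyc.coc C3 gamH (Mhat_part t)"
abbreviation "cob3 t == cyc.cob C3 gamH (Mhat_part t)"
abbreviation "kap3 == cyc.kap C3 gamH 3"
abbreviation "hd3 == bar_diff hact"

lemma tup3_def: "cyc.tup C3 m gs <-> length gs = m & set gs <= {0, 3, 6}"
 and tup9_def: "cyc.tup C9 m gs <-> length gs = m & set gs <= carrier C9"
 by (simp_all add: cyc.tup_def[OF cyc3] cyc.tup_def[OF cyc9] carrier_C3)

lemma tup3_tup9: "cyc.tup C3 m gs ==> cyc.tup C9 m gs"
 by (auto simp: tup3_def tup9_def carrier_C9)

lemma coc3_iff: "coc3 t m f <-> (ALL gs. cyc.tup C3 m gs --> f gs \<in> Mhat_part t) & (ALL gs. cyc.tup C3 (Suc m) gs --> hd3 f gs = 0)"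
 and coc9_iff: "coc9 t m f <-> (ALL gs. cyc.tup C9 m gs --> f gs \<in> Mhat_part t) & (ALL gs. cyc.tup C9 (Suc m) gs --> hd3 f gs = 0)"
 by (simp_all add: cyc.coc_def[OF cyc3] cyc.coc_def[OF cyc9])

lemma coc_res: "coc9 t m f ==> coc3 t m f"
 unfolding coc3_iff coc9_iff using tup3_tup9 by blast

lemma cob_res: "cob9 t m f ==> cob3 t m f"
 unfolding cyc.cob_def[OF cyc3] cyc.cob_def[OF cyc9] using tup3_tup9 by blast

lemma bar_diff_map:
 assumes "!!x y. \<phi> (x + y) = \<phi> x + \<phi> y" "\<phi> (hact (hd gs) (f (tl gs))) = hact (hd gs) (\<phi> (f (tl gs)))"
 shows "hd3 (%hs. \<phi> (f hs)) gs = \<phi> (hd3 f gs)"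
 unfolding bar_diff_def bar_tail_hom[of \<phi>, OF assms(1)] assms by simp

lemma coc3_map:
 assumes "!!x y. \<phi> (x + y) = \<phi> x + \<phi> y" "!!x. \<phi> (hact 3 x) = hact 3 (\<phi> x)"
  "!!x. x \<in> Mhat_part t ==> \<phi> x \<in> Mhat_part t'" "coc3 t m f"
 shows "coc3 t' m (%gs. \<phi> (f gs))"
proof -
 have 0: "\<phi> 0 = 0" using assms(1)[of 0 0] by simp
 have "hd3 (%hs. \<phi> (f hs)) gs = \<phi> (hd3 f gs)" if gs: "cyc.tup C3 (Suc m) gs" for gs
 proof (rule bar_diff_map[OF assms(1)])
  have "hd gs \<in> {0, 3, 6}" using gs unfolding tup3_def by (cases gs) auto
  thus "\<phi> (hact (hd gs) (f (tl gs))) = hact (hd gs) (\<phi> (f (tl gs)))"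
   by (auto simp: hact_0 hact_6 assms(2))
 qed
 thus ?thesis using assms(3,4) 0 unfolding coc3_iff by simp
qed

lemma total3: "cyc.total C3 gamH 3 u = hact 6 (u 0) + hact 3 (u 3) + u 6"
 unfolding cyc.total_def[OF cyc3] carrier_C3 by (simp add: hact_0 add.assoc)

lemma kap3_eq: "kap3 f gs = hact 6 (f (3 # 0 # gs) - hact 3 (f (0 # 0 # gs))) + hact 3 (f (3 # 3 # gs) - hact 3 (f (0 # 3 # gs)))
  + (f (3 # 6 # gs) - hact 3 (f (0 # 6 # gs)))"
 unfolding cyc.kap_def[OF cyc3] total3 by simp

lemma kap3_map:
 assumes "!!x y. \<phi> (x + y) = \<phi> x + \<phi> y" "!!x. \<phi> (hact 3 x) = hact 3 (\<phi> x)"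
 shows "kap3 (%gs. \<phi> (f gs)) gs = \<phi> (kap3 f gs)"
proof -
 have d: "\<phi> (x - y) = \<phi> x - \<phi> y" for x y using assms(1)[of "x - y" y] by (simp add: alg)
 show ?thesis unfolding kap3_eq by (simp only: assms d hact_6)
qed

definition ccup :: "(int list => 'w::comm_ring_1 Mhat) => (int list => 'w Mhat) => int list => 'w Mhat" where
 "ccup c f = cup C3 hact 1 c f"

lemma mul9_0_C3: "g \<in> {0, 3, 6} ==> mul9 g 0 = g"
 by (auto simp: mul9_def)

lemma ccup_Cons: "g \<in> {0, 3, 6} ==> ccup c f (g # gs) = c [g] * hact g (f gs)"
 using mul9_0_C3[of g] by (simp add: ccup_def cup_def mult_C9)

lemma coc3_1_rel: "coc3 t 1 c ==> g \<in> {0, 3, 6} ==> h \<in> {0, 3, 6} ==> c [mul9 g h] = c [g] + hact g (c [h])"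
proof -
 assume c: "coc3 t 1 c" and gh: "g \<in> {0, 3, 6}" "h \<in> {0, 3, 6}"
 have "hd3 c [g, h] = 0" using c gh unfolding coc3_iff by (auto simp: tup3_def)
 hence "hact g (c [h]) + (- c [mul9 g h] + c [g]) = 0" by (simp add: bar_diff_def)
 hence "c [mul9 g h] = c [mul9 g h] + (hact g (c [h]) + (- c [mul9 g h] + c [g]))" by simp
 thus ?thesis by (simp add: alg)
qed

lemma hact_mul9: "g \<in> {0, 3, 6} ==> h \<in> {0, 3, 6} ==> hact (mul9 g h) x = hact g (hact h x)"
 by (rule cyc.act_mul9[OF cyc9]) auto

lemma coc3_ccup:
 assumes c: "coc3 t 1 c" and f: "coc3 t' m f" and m: "m > 0"
 shows "coc3 (t + t') (Suc m) (ccup c f)"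
 unfolding coc3_iff
proof (intro conjI allI impI)
 fix gs assume "cyc.tup C3 (Suc m) gs"
 then obtain g hs where gs: "gs = g # hs" "g \<in> {0, 3, 6}" "cyc.tup C3 m hs" by (cases gs) (auto simp: tup3_def)
 have "c [g] \<in> Mhat_part t" "f hs \<in> Mhat_part t'" using c f gs unfolding coc3_iff by (auto simp: tup3_def)
 moreover have "hact g x \<in> Mhat_part t'" if "x \<in> Mhat_part t'" for x using that by (rule cyc.act_A[OF cyc9])
 ultimately show "ccup c f gs \<in> Mhat_part (t + t')" unfolding gs(1) ccup_Cons[OF gs(2)] by (intro hp_ops(2)) blast+
next
 fix gs assume "cyc.tup C3 (Suc (Suc m)) gs"
 then obtain g h hs where gs: "gs = g # h # hs" "g \<in> {0, 3, 6}" "h \<in> {0, 3, 6}" "cyc.tup C3 m hs"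
  by (cases gs; cases "tl gs") (auto simp: tup3_def)
 have m9: "mul9 g h \<in> {0, 3, 6}" using gs(2,3) by (auto simp: mul9_def)
 have "hd3 f (h # hs) = 0" using f gs unfolding coc3_iff by (auto simp: tup3_def)
 hence t0: "btl f (h # hs) = - hact h (f hs)" by (simp add: bar_diff_def eq_neg_iff_add_eq_0 add.commute)
 have "btl (%hs. ccup c f (g # hs)) (h # hs) = btl (%hs. c [g] * hact g (f hs)) (h # hs)"
  by (rule arg_cong[of _ _ "%F. btl F (h # hs)"], rule ext) (rule ccup_Cons[OF gs(2)])
 also have "... = c [g] * hact g (btl f (h # hs))"
  by (rule bar_tail_hom[of "%x. c [g] * hact g x"]) (simp add: hact_simps distrib_left)
 finally have b: "btl (%hs. ccup c f (g # hs)) (h # hs) = - c [g] * hact g (hact h (f hs))"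
  unfolding t0 using hact_simps(5)[of g 0 "hact h (f hs)"] by (simp add: hact_simps)
 have "hd3 (ccup c f) gs = hact g (c [h] * hact h (f hs)) - (c [g] + hact g (c [h])) * hact g (hact h (f hs)) + c [g] * hact g (hact h (f hs))"
  unfolding gs(1) bar_diff_def list.sel btl.simps b ccup_Cons[OF gs(3)] ccup_Cons[OF m9]
   coc3_1_rel[OF c gs(2,3)] hact_mul9[OF gs(2,3)] by simp
 also have "... = 0" by (simp add: hact_simps alg)
 finally show "hd3 (ccup c f) gs = 0" .
qed

lemma coc3_1_vals:
 assumes "coc3 t 1 c"
 shows "c [0] = 0" "c [6] = c [3] + hact 3 (c [3])" "c [3] + hact 3 (c [3]) + hact 6 (c [3]) = 0"
proof -
 have m: "mul9 0 0 = 0" "mul9 3 3 = 6" "mul9 6 3 = 0" by (simp_all add: mul9_def)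
 show 0: "c [0] = 0" using coc3_1_rel[OF assms, of 0 0] by (simp add: m hact_0)
 show 6: "c [6] = c [3] + hact 3 (c [3])" using coc3_1_rel[OF assms, of 3 3] by (simp add: m)
 show "c [3] + hact 3 (c [3]) + hact 6 (c [3]) = 0"
  using coc3_1_rel[OF assms, of 6 3] by (simp add: m 0 6)
qed

lemma coc3_1_eq: "coc3 t 1 c ==> coc3 t 1 c' ==> c [3] = c' [3] ==> cyc.tup C3 1 gs ==> c gs = c' gs"
proof -
 assume c: "coc3 t 1 c" "coc3 t 1 c'" "c [3] = c' [3]" and "cyc.tup C3 1 gs"
 then obtain g where "gs = [g]" "g \<in> {0, 3, 6}" by (cases gs) (auto simp: tup3_def)
 thus ?thesis using coc3_1_vals(1,2)[OF c(1)] coc3_1_vals(1,2)[OF c(2)] c(3) by auto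
qed

lemma kap3_ccup: "coc3 t 1 c ==> kap3 (ccup c f) gs =
  hact 6 (c [3] * hact 3 (f (0 # gs))) + hact 3 (c [3] * hact 3 (f (3 # gs))) + c [3] * hact 3 (f (6 # gs))"
 unfolding kap3_eq by (simp add: ccup_Cons coc3_1_vals(1) hact_simps)

lemma cry_pow_cong:
 assumes "!!gs. cyc.tup C3 m gs ==> f gs = f' gs" "cyc.tup C3 (2 * k + m) gs"
 shows "(cry ^^ k) f gs = (cry ^^ k) f' gs"
 using assms(2)
proof (induction k arbitrary: gs)
 case (Suc k)
 then obtain a b hs where gs: "gs = a # b # hs" "cyc.tup C3 (2 * k + m) hs"
  by (cases gs; cases "tl gs") (auto simp: tup3_def)
 show ?case unfolding gs(1) using Suc.IH[OF gs(2)] by (simp add: cry_simps)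
qed (use assms(1) in simp)

text \<open>On {0, 3, 6} the carry cocycle of C9 is that of C3, so the same \<open>cry\<close>
  computes products with b1 for both groups.\<close>

lemma cup_C3: "cup C3 hact (2 * k) (res_C3 (b1_power k)) f gs =
  (if length gs \<ge> 2 * k & set (take (2 * k) gs) <= carrier C3 then (cry ^^ k) f gs else 0)"
proof (cases "set (take (2 * k) gs) <= carrier C3")
 case True
 hence "cup C3 hact (2 * k) (res_C3 (b1_power k)) f gs = cup C9 hact (2 * k) (b1_power k) f gs"
  by (simp add: cup_def res_C3_def mult_C9)
 thus ?thesis unfolding cup_b1_power using True C3_sub by auto
qed (simp add: cup_def res_C3_def)

lemma detect_coboundary:
 assumes n: "n = m + 2 * k" "n > 0"
  and F: "!!gs. ~ (length gs = n & set gs <= carrier C9) ==> F gs = 0"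
  and D: "!!gs. ~ (length gs = m & set gs <= carrier C3) ==> D gs = 0"
  and c: "cob3 t (n - 1) (%gs. F gs - (cry ^^ k) D gs)"
 shows "res_C3 F - cup C3 hact (2 * k) (res_C3 (b1_power k)) D \<in> coboundaries C3 hact n (Mhat_part t)"
proof -
 let ?f = "res_C3 F - cup C3 hact (2 * k) (res_C3 (b1_power k)) D"
 have nS: "n = Suc (n - 1)" using n(2) by simp
 have "?f gs = F gs - (cry ^^ k) D gs" if gs: "cyc.tup C3 n gs" for gs
 proof -
  have "set gs <= carrier C3" "length gs = n" using gs by (auto simp: tup3_def carrier_C3)
  moreover from this have "set (take (2 * k) gs) <= carrier C3" using set_take_subset[of "2 * k" gs] by blast
  ultimately show ?thesis unfolding minus_apply cup_C3 res_C3_def using n(1) by simp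
 qed
 hence "cob3 t (n - 1) ?f" using c nS by (intro cyc.cob_cong[OF cyc3 c]) (metis)
 moreover have "?f gs = 0" if gs: "~ cyc.tup C3 n gs" for gs
 proof -
  have "res_C3 F gs = 0" using F[of gs] gs by (auto simp: res_C3_def tup3_def carrier_C3)
  moreover have "cup C3 hact (2 * k) (res_C3 (b1_power k)) D gs = 0"
  proof (cases "length gs \<ge> 2 * k & set (take (2 * k) gs) <= carrier C3")
   case True
   have "set gs = set (take (2 * k) gs) \<union> set (drop (2 * k) gs)" by (metis append_take_drop_id set_append)
   hence "~ (length (drop (2 * k) gs) = m & set (drop (2 * k) gs) <= carrier C3)"
    using True gs n(1) by (auto simp: tup3_def carrier_C3)
   thus ?thesis unfolding cup_def using D by (simp add: hact_simps)
  next
   case False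
   thus ?thesis unfolding cup_C3 by (simp only: if_False)
  qed
  ultimately show ?thesis by simp
 qed
 ultimately have "?f \<in> coboundaries C3 hact (Suc (n - 1)) (Mhat_part t)"
  unfolding cyc.coboundaries_iff[OF cyc3] using nS by metis
 thus ?thesis using nS by simp
qed

lemma pconst_part: "p \<in> poly9_part t ==> pconst w * p \<in> poly9_part t"
 using p9_ops(2)[OF p9_ops(7)] by fastforce

lemma rho_bar_form:
 assumes "x \<in> rho_bar"
 shows "EX a b. x = Mhat_of (pconst a * pvar 0 + pconst b * pvar 3)"
proof -
 obtain a b c where x: "x = Mhat_of (pconst a * pvar 0 + pconst b * pvar 3 + pconst c * pvar 6)"
  using assms unfolding rho_bar_def by auto
 have "x = Mhat_of (pconst (a + - c) * pvar 0 + pconst (b + - c) * pvar 3)"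
  unfolding x Mhat_of_simps pconst_add pconst_minus Mhat_of_x6 by (simp add: alg)
 thus ?thesis by blast
qed

lemma rho_bar_mem: "Mhat_of (pconst a * pvar 0 + pconst b * pvar 3) \<in> rho_bar"
 unfolding rho_bar_def by (rule image_eqI[of _ _ "(a, b, 0)"]) (simp_all add: pconst_0)

lemma rho_bar_part: "x \<in> rho_bar ==> x \<in> Mhat_part (- 2)"
 using rho_bar_form[of x] by (auto intro!: Mhat_of_part p9_ops(1) pconst_part p9_ops(6))

lemma hact_3_of: "hact 3 (Mhat_of p) = Mhat_of (gamP (gamP (gamP p)))"
 by (simp add: hact_3 hg_of)

lemma unit_9: "(u::'w::comm_ring_1) * w = 1 + 3 * s ==> 9 dvd u * (w * (1 - 3 * s)) - 1"
proof -
 assume a: "u * w = 1 + 3 * s"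
 have "u * (w * (1 - 3 * s)) - 1 = (1 + 3 * s) * (1 - 3 * s) - 1" unfolding a[symmetric] by (simp add: mult.assoc)
 also have "... = 9 * (- (s * s))" by (simp add: alg)
 finally show ?thesis by simp
qed

section \<open>The chosen generator of degree one and the units it introduces\<close>

locale wc = wittk res for res :: "'w::comm_ring_1 => 'k::field" +
 fixes c1 :: "int list => 'w Mhat"
 assumes gen: "generates_H1 c1"
begin

lemma c1_cocycle: "c1 \<in> cocycles C3 hact 1 rho_bar"
 using gen unfolding generates_H1_def by blast

lemma c1_coc: "coc3 (- 2) 1 c1" and c1_zero: "~ (length gs = 1 & set gs <= carrier C3) ==> c1 gs = 0"
proof -
 have "c1 \<in> cocycles C3 hact 1 (Mhat_part (- 2))"
  using c1_cocycle rho_bar_part unfolding cocycles_def cochains_def by (auto split: if_splits)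
 hence *: "coc3 (- 2) 1 c1 & (ALL gs. ~ cyc.tup C3 1 gs --> c1 gs = 0)" unfolding cyc.cocycles_iff[OF cyc3] .
 thus "coc3 (- 2) 1 c1" by blast
 show "~ (length gs = 1 & set gs <= carrier C3) ==> c1 gs = 0" using * by (simp add: tup3_def carrier_C3)
qed

definition al_be :: "'w \<times> 'w" where
 "al_be = (SOME ab. c1 [3] = Mhat_of (pconst (fst ab) * pvar 0 + pconst (snd ab) * pvar 3))"

definition "al = fst al_be"
definition "be = snd al_be"

definition U :: "'w poly9" where
 "U = pconst al * pvar 0 + pconst be * pvar 3"

lemma c1_3: "c1 [3] = Mhat_of U"
proof -
 have "c1 [3] \<in> rho_bar" using c1_cocycle unfolding cocycles_def cochains_def by (auto simp: carrier_C3 split: if_splits)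
 then obtain a b where "c1 [3] = Mhat_of (pconst (fst (a, b)) * pvar 0 + pconst (snd (a, b)) * pvar 3)"
  using rho_bar_form by fastforce
 from someI[of "%ab. c1 [3] = Mhat_of (pconst (fst ab) * pvar 0 + pconst (snd ab) * pvar 3)", OF this]
 show ?thesis unfolding U_def al_def be_def al_be_def .
qed

lemma crdP_X: "crdP (pconst w * pvar 0) = vs LX One One (dsg B1 (cL w))"
 and crdP_Y: "crdP (pconst w * pvar 3) = vs LY One One (dsg B1 (cL w))"
proof -
 have *: "pvar 0 = (labp (Label LX One One B1 0 0 0 0 0 0) :: 'w poly9)" "pvar 3 = (labp (Label LY One One B1 0 0 0 0 0 0) :: 'w poly9)"
  by (simp_all add: labp_def dbp_def letp_def)
 show "crdP (pconst w * pvar 0) = vs LX One One (dsg B1 (cL w))"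
  "crdP (pconst w * pvar 3) = vs LY One One (dsg B1 (cL w))"
  unfolding * by (simp_all add: crdP_lab vlab_def)
qed

text \<open>The class of a crossed homomorphism with value a x_0 + b x_3 at 3 is a + b in W/3. As c1
  generates, the crossed homomorphism through x_0, of class 1, is a multiple of it.\<close>

lemma eta_unit: "EX w s. (al + be) * w = 1 + 3 * s"
proof -
 let ?x = "Mhat_of (pvar 0) :: 'w Mhat"
 define f where "f gs = (if length gs = 1 & set gs <= carrier C3 then crs3 ?x gs else 0)" for gs
 have x: "?x \<in> Mhat_part (- 2)" by (intro Mhat_of_part p9_ops)
 have "cyc.nrm C3 gamH ?x = ?x + hact 3 ?x + hact 6 ?x"
  unfolding cyc.nrm_def[OF cyc3] carrier_C3 by (simp add: hact_0 add.assoc)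
 also have "... = 0" by (simp add: hact_6 hact_3_of poly9_gamma_pvar Mhat_of_x6)
 finally have fc: "coc3 (- 2) 1 (crs3 ?x)" by (rule cyc.coc_cross[OF cyc3 x])
 have v3: "crs3 ?x [3] = ?x" using cyc.cross_s[OF cyc3, of ?x] by simp
 have "f \<in> cocycles C3 hact 1 rho_bar"
 proof -
  have "f gs \<in> rho_bar" if gs: "length gs = 1" "set gs <= carrier C3" for gs
  proof -
   obtain g where g: "gs = [g]" "g \<in> {0, 3, 6}" using gs by (cases gs) (auto simp: carrier_C3)
   have "crs3 ?x [6] = ?x + Mhat_of (pvar 3)" "crs3 ?x [0] = 0"
    using coc3_1_vals(1,2)[OF fc] v3 by (simp_all add: hact_3_of poly9_gamma_pvar)
   moreover have "0 \<in> (rho_bar :: 'w Mhat set)" "?x \<in> rho_bar" "?x + Mhat_of (pvar 3) \<in> rho_bar"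
    using rho_bar_mem[of 0 0] rho_bar_mem[of 1 0] rho_bar_mem[of 1 1]
    by (simp_all add: pconst_0 pconst_1 Mhat_of_simps)
   ultimately show ?thesis using g v3 by (auto simp: f_def carrier_C3)
  qed
  moreover have "coboundary_map C3 hact 1 f = 0"
  proof
   fix gs
   have "hd3 f gs = 0" if gs: "cyc.tup C3 2 gs" for gs
   proof -
    have "hd3 f gs = hd3 (crs3 ?x) gs"
     by (rule cyc.d_cong[OF cyc3, of 1]) (use gs in \<open>simp_all add: f_def tup3_def carrier_C3 numeral_2_eq_2\<close>)
    also have "... = 0" using fc gs unfolding coc3_iff by (simp add: numeral_2_eq_2)
    finally show ?thesis .
   qed
   thus "coboundary_map C3 hact 1 f gs = (0 :: int list => 'w Mhat) gs"
    unfolding cobmap_bar[OF mult_C9(3)] by (simp add: tup3_def carrier_C3)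
  qed
  ultimately show ?thesis unfolding cocycles_def cochains_def by (auto simp: f_def)
 qed
 then obtain w where "f - (%gs. Mhat_of (pconst w) * c1 gs) \<in> coboundaries C3 hact 1 rho_bar"
  using gen unfolding generates_H1_def by blast
 then obtain z where z: "z \<in> cochains C3 0 rho_bar" "f - (%gs. Mhat_of (pconst w) * c1 gs) = coboundary_map C3 hact 0 z"
  by auto
 have "z [] \<in> rho_bar" using z(1) unfolding cochains_def by (auto split: if_splits)
 then obtain a b where ab: "z [] = Mhat_of (pconst a * pvar 0 + pconst b * pvar 3)" using rho_bar_form by blast
 have "(f - (%gs. Mhat_of (pconst w) * c1 gs)) [3] = hact 3 (z []) - z []"
  unfolding z(2) by (simp add: coboundary_map_def carrier_C3)
 hence "?x - Mhat_of (pconst w) * Mhat_of U = hact 3 (z []) - z []"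
  by (simp add: f_def carrier_C3 v3 c1_3)
 hence "Mhat_of (pvar 0 - pconst w * U) = Mhat_of (pconst a * pvar 3 + pconst b * (- pvar 0 - pvar 3) - (pconst a * pvar 0 + pconst b * pvar 3))"
  unfolding ab hact_3_of by (simp add: Mhat_of_simps poly9_gamma_add poly9_gamma_mult gamma_pconst poly9_gamma_pvar Mhat_of_x6)
 hence "crdH (Mhat_of (pvar 0 - pconst w * U)) = crdH (Mhat_of (pconst a * pvar 3 + pconst b * (- pvar 0 - pvar 3) - (pconst a * pvar 0 + pconst b * pvar 3)))"
  by simp
 hence "crdP (pconst 1 * pvar 0 - (pconst (w * al) * pvar 0 + pconst (w * be) * pvar 3))
   = crdP (pconst a * pvar 3 - pconst b * pvar 0 - pconst b * pvar 3 - pconst a * pvar 0 - pconst b * pvar 3)"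
  unfolding crdH_of U_def pconst_mult pconst_1 by (simp add: alg)
 hence e: "vs LX One One (dsg B1 (cL 1)) - (vs LX One One (dsg B1 (cL (w * al))) + vs LY One One (dsg B1 (cL (w * be))))
  = vs LY One One (dsg B1 (cL a)) - vs LX One One (dsg B1 (cL b)) - vs LY One One (dsg B1 (cL b))
   - vs LX One One (dsg B1 (cL a)) - vs LY One One (dsg B1 (cL b))"
  by (simp only: crdP_diff crdP_add crdP_X crdP_Y)
 have "1 - w * al = - b - a" "- (w * be) = a - b - b"
  using arg_cong[OF e, of "%u. u LX One One B1 $ 0 $ 0"] arg_cong[OF e, of "%u. u LY One One B1 $ 0 $ 0"]
  by (simp_all add: vs_def dsg_def)
 \<comment> \<open>The sum of the coordinates of x_0 and x_3 annihilates coboundaries modulo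
   3.\<close>
 hence "1 - w * al + - (w * be) = - b - a + (a - b - b)" by (simp only:)
 hence "(al + be) * w = 1 + 3 * b" by (simp add: alg)
 thus ?thesis by blast
qed

text \<open>The factor between the class detecting a generator and its normal form, in terms of
  c1(3) = al x_0 + be x_3. The norm form for the F_i comes from \<open>kap3_c12\<close>; the cube
  for c-bar comes from \<open>crdP_Ucube\<close>, and its sign from \<open>kap3_c123\<close>. Modulo
  3 the norm form is the square of al + be.\<close>

definition unit :: "gen => 'w" where
 "unit x = (if x \<in> {Gen_1, Gen_delta} then 1 else if x \<in> range gf then al + be
   else if x \<in> range gF then - (al * al - al * be + be * be) else - ((al + be) * (al + be) * (al + be)))"

lemma unit_simps: "unit Gen_1 = 1" "unit Gen_delta = 1" "unit (gf e) = al + be"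
 "unit (gF e) = - (al * al - al * be + be * be)" "unit Gen_c = - ((al + be) * (al + be) * (al + be))"
 "unit Gen_c_delta = - ((al + be) * (al + be) * (al + be))"
proof -
 have r: "Gen_c \<notin> range gf" "Gen_c \<notin> range gF" "Gen_c_delta \<notin> range gf" "Gen_c_delta \<notin> range gF" "gF e \<notin> range gf"
  using gf_simps by (auto simp: eq_commute)
 show "unit Gen_1 = 1" "unit Gen_delta = 1" by (simp_all add: unit_def)
 show "unit (gf e) = al + be" "unit (gF e) = - (al * al - al * be + be * be)"
  "unit Gen_c = - ((al + be) * (al + be) * (al + be))" "unit Gen_c_delta = - ((al + be) * (al + be) * (al + be))"
  unfolding unit_def using r gf_simps by (simp_all)
qed

lemma unit_inv: "EX w. 9 dvd unit x * w - 1"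
proof -
 obtain w s where w: "(al + be) * w = 1 + 3 * s" using eta_unit by blast
 have F: "- (al * al - al * be + be * be) * (- (w * w)) = 1 + 3 * (2 * s + 3 * s * s - al * be * w * w)"
 proof -
  have "- (al * al - al * be + be * be) * (- (w * w)) = ((al + be) * w) * ((al + be) * w) - 3 * (al * be * w * w)"
   by (simp add: alg)
  thus ?thesis unfolding w by (simp add: alg)
 qed
 have c: "- ((al + be) * (al + be) * (al + be)) * (- (w * w * w)) = 1 + 3 * (3 * s + 9 * s * s + 9 * s * s * s)"
 proof -
  have "- ((al + be) * (al + be) * (al + be)) * (- (w * w * w)) = ((al + be) * w) * ((al + be) * w) * ((al + be) * w)"
   by (simp add: alg)
  thus ?thesis unfolding w by (simp add: alg)
 qed
 show ?thesis
 proof (cases x rule: gen_cases)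
  case 1 thus ?thesis by (intro exI[of _ 1]) (simp add: unit_simps)
 next
  case 2 thus ?thesis by (intro exI[of _ 1]) (simp add: unit_simps)
 next
  case 3 thus ?thesis using unit_9[OF c] by (auto simp only: unit_simps)
 next
  case 4 thus ?thesis using unit_9[OF c] by (auto simp only: unit_simps)
 next
  case (5 e) thus ?thesis using unit_9[OF w] by (auto simp only: unit_simps)
 next
  case (6 e) thus ?thesis using unit_9[OF F] by (auto simp only: unit_simps)
 qed
qed

definition ex :: "gen => gen => 'w L" where
 "ex x = (%y. if y = x then cL (unit x) else 0)"

definition tr :: "'w Mhat => 'w Mhat" where
 "tr y = y + gamH y + gamH (gamH y)"

text \<open>The element x x' + y x' + y y' of the first two blocks, which is fixed by gamma^3 and
  enters \<open>trpair\<close>.\<close>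

definition hpoly :: "'w poly9" where
 "hpoly = pvar 0 * pvar 1 + pvar 3 * pvar 1 + pvar 3 * pvar 4"

lemma crdP_1: "crdP 1 = vs One One One (dsg B1 1)"
 using crdP_basis[of B1 One One One] by (simp add: dbp_def letp_def)

lemma crdP_wbasis: "crdP (pconst w * (dbp e * (letp 0 l1 * (letp 1 l2 * letp 2 l3)))) = vs l1 l2 l3 (dsg e (cL w))"
 unfolding crdP_const crdP_basis[unfolded mult.assoc] scV_vs sc_dsingle by simp

lemma delta_expand: "delta_poly = - (s1_poly * (s2_poly * 1)) - (3 * s3_poly + 0)
  + (s2_poly * (pconst 2 * dbp Bd1)) - (s2_poly * (pconst 2 * dbp Bd2)) + s1_poly * (pconst 4 * dbp Bd12)
  + s1_poly * (pconst 2 * dbp Bd23) - pconst 6 * (dbp Bu :: 'w poly9)"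
proof -
 have "pconst (1 + 1) = (2 :: 'w poly9)" "pconst (1 + 1 + 1 + 1) = (4 :: 'w poly9)" "pconst (1 + 1 + 1 + 1 + 1 + 1) = (6 :: 'w poly9)"
  by (simp_all only: pconst_add pconst_1) simp_all
 hence p: "pconst 2 = (2 :: 'w poly9)" "pconst 4 = (4 :: 'w poly9)" "pconst 6 = (6 :: 'w poly9)" by simp_all
 show ?thesis unfolding p s1_poly_def s2_poly_def s3_poly_def delta_poly_def dbp_def dbr.simps
  by (simp add: alg)
qed

lemma crdP_delta_mult:
 assumes "!!e. crdP (dbp e * X) = vs l1 l2 l3 (dsg e r)"
 shows "crdP (delta_poly * X) = vs l1 l2 l3 (sc r deltaD)"
proof -
 have X: "crdP X = vs l1 l2 l3 (dsg B1 r)" using assms[of B1] by (simp add: dbp_def)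
 have n: "cL 2 = (2 :: 'w L)" "cL 3 = (3 :: 'w L)" "cL 4 = (4 :: 'w L)" "cL 6 = (6 :: 'w L)" by (simp_all add: numeral_fps_const)
 have "delta_poly * X = - (s1_poly * (s2_poly * X)) - pconst 3 * (s3_poly * X)
  + (s2_poly * (pconst 2 * (dbp Bd1 * X))) - (s2_poly * (pconst 2 * (dbp Bd2 * X))) + s1_poly * (pconst 4 * (dbp Bd12 * X))
  + s1_poly * (pconst 2 * (dbp Bd23 * X)) - pconst 6 * (dbp Bu * X)"
  unfolding delta_expand pconst_3 by (simp add: alg)
 hence "crdP (delta_poly * X) = - vs l1 l2 l3 (dsg B1 (s1L * (s2L * r))) - vs l1 l2 l3 (dsg B1 (3 * r))
  + vs l1 l2 l3 (dsg Bd1 (s2L * (2 * r))) - vs l1 l2 l3 (dsg Bd2 (s2L * (2 * r))) + vs l1 l2 l3 (dsg Bd12 (s1L * (4 * r)))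
  + vs l1 l2 l3 (dsg Bd23 (s1L * (2 * r))) - vs l1 l2 l3 (dsg Bu (6 * r))"
  by (simp only: crdP_add crdP_diff crdP_minus crdP_s crdP_const X assms scV_vs sc_dsingle n)
 also have "... = vs l1 l2 l3 (sc r deltaD)"
  unfolding D.vs_minus[symmetric] D.vs_diff[symmetric] D.vs_add[symmetric]
  by (rule arg_cong[of _ _ "vs l1 l2 l3"]) (simp add: DV_eq_iff dsg_def sc_def alg)
 finally show ?thesis .
qed

text \<open>The factors 1, -2, 4 of \<open>eqv_triple\<close> add up to the binomial coefficient 3
  for each mixed monomial in al and be, so the product collapses to the exact cube of al +
  be.\<close>

lemma crdP_Ucube:
 assumes d: "gD d = d"
  and P: "!!k l1 l2 l3. crdP (P * (pconst k * (letp 0 l1 * (letp 1 l2 * letp 2 l3)))) = vs l1 l2 l3 (sc (cL k) d)"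
 shows "D.eqv (crdP (P * - (U * gamP U * gamP (gamP U)))) (vs LX LX LX (sc (cL (unit Gen_c)) d))"
proof -
 let ?F = "%l1 l2 l3 k. P * (pconst k * (letp 0 l1 * (letp 1 l2 * letp 2 l3))) :: 'w poly9"
 have "P * - (U * gamP U * gamP (gamP U)) =
   ?F LX LX LX (- (al * al * al)) + ?F LY LX LX (- (be * al * al)) + ?F LX LY LX (- (al * be * al)) + ?F LX LX LY (- (al * al * be))
   + ?F LY LY LX (- (be * be * al)) + ?F LY LX LY (- (be * al * be)) + ?F LX LY LY (- (al * be * be)) + ?F LY LY LY (- (be * be * be))"
  unfolding U_def poly9_gamma_add poly9_gamma_mult gamma_pconst poly9_gamma_pvar letp_def letr.simps pconst_minus pconst_mult
  by (simp add: alg)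
 hence e: "crdP (P * - (U * gamP U * gamP (gamP U))) =
   vs LX LX LX (sc (cL (- (al * al * al))) d) + vs LY LX LX (sc (cL (- (be * al * al))) d) + vs LX LY LX (sc (cL (- (al * be * al))) d)
   + vs LX LX LY (sc (cL (- (al * al * be))) d)
   + vs LY LY LX (sc (cL (- (be * be * al))) d) + vs LY LX LY (sc (cL (- (be * al * be))) d) + vs LX LY LY (sc (cL (- (al * be * be))) d)
   + vs LY LY LY (sc (cL (- (be * be * be))) d)"
  by (simp only: crdP_add P)
 have g: "gD (sc q d) = sc q d" for q by (simp only: gD_sc d)
 let ?E = "%c. vs LX LX LX (c :: 'w DV)"
 have m: "D.eqv (vs LY LX LX (sc q d)) (?E (sc q d))" "D.eqv (vs LX LY LX (sc q d)) (?E (sc q d + sc q d + sc q d + sc q d))"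
  "D.eqv (vs LX LX LY (sc q d)) (?E (- sc q d - sc q d))" "D.eqv (vs LY LY LX (sc q d)) (?E (sc q d))"
  "D.eqv (vs LY LX LY (sc q d)) (?E (sc q d + sc q d + sc q d + sc q d))" "D.eqv (vs LX LY LY (sc q d)) (?E (- sc q d - sc q d))"
  "D.eqv (vs LY LY LY (sc q d)) (?E (sc q d))" for q
  using D.eqv_triple[of "sc q d"] by (simp_all only: g)
 let ?s = "%k. sc (cL k) d"
 have "D.eqv (crdP (P * - (U * gamP U * gamP (gamP U))))
   (?E (?s (- (al * al * al))) + ?E (?s (- (be * al * al)))
   + ?E (?s (- (al * be * al)) + ?s (- (al * be * al)) + ?s (- (al * be * al)) + ?s (- (al * be * al)))
   + ?E (- ?s (- (al * al * be)) - ?s (- (al * al * be)))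
   + ?E (?s (- (be * be * al))) + ?E (?s (- (be * al * be)) + ?s (- (be * al * be)) + ?s (- (be * al * be)) + ?s (- (be * al * be)))
   + ?E (- ?s (- (al * be * be)) - ?s (- (al * be * be))) + ?E (?s (- (be * be * be))))"
  unfolding e by (intro D.eqv_add m D.eqv_refl)
 also have "... = ?E (?s (unit Gen_c))"
 proof -
  define A B where "A = cL al" and "B = cL be"
  have c: "cL (- (x * y * z)) = - (cL x * cL y * cL z)" for x y z :: 'w by simp
  have u: "cL (unit Gen_c) = - ((A + B) * (A + B) * (A + B))" unfolding unit_simps A_def B_def by simp
  show ?thesis unfolding c u A_def[symmetric] B_def[symmetric] D.vs_add[symmetric]
   by (rule arg_cong[of _ _ "vs LX LX LX"], rule ext) (simp add: sc_def alg)
 qed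
 finally show ?thesis .
qed

text \<open>Read off by applying \<open>kap\<close> on C3 to the detecting cocycles until degree 0
  or 1 is reached. A crossed homomorphism of C9 with value a at 1 has the value \<open>tr a\<close>
  at 3 (\<open>crs9_3\<close>), so in odd degrees the trace disappears from the element.\<close>

definition gel :: "gen => 'w Mhat" where
 "gel x = (if x = Gen_1 then 1 else if x = Gen_delta then Mhat_of delta_poly
   else if x = Gen_c then Mhat_of (- (U * gamP U * gamP (gamP U)))
   else if x = Gen_c_delta then Mhat_of (delta_poly * - (U * gamP U * gamP (gamP U)))
   else if x \<in> range gf then Mhat_of (dbp (SOME e. x = gf e) * U)
   else tr (Mhat_of (dbp (SOME e. x = gF e)) * Mhat_of (pconst (unit x) * hpoly)))"

lemma gel_simps: "gel Gen_1 = 1" "gel Gen_delta = Mhat_of delta_poly"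
 "gel Gen_c = Mhat_of (- (U * gamP U * gamP (gamP U)))"
 "gel Gen_c_delta = Mhat_of (delta_poly * - (U * gamP U * gamP (gamP U)))"
 "gel (gf e) = Mhat_of (dbp e * U)" "gel (gF e) = tr (Mhat_of (dbp e) * Mhat_of (pconst (unit (gF e)) * hpoly))"
proof -
 have r: "gF e \<notin> range gf" using gf_simps by (auto simp: eq_commute)
 show "gel (gf e) = Mhat_of (dbp e * U)" unfolding gel_def using gf_simps by simp
 show "gel (gF e) = tr (Mhat_of (dbp e) * Mhat_of (pconst (unit (gF e)) * hpoly))" unfolding gel_def using r gf_simps by simp
qed (simp_all add: gel_def)

lemma U_part: "U \<in> poly9_part (- 2)" "hpoly \<in> poly9_part (- 4)" "delta_poly \<in> poly9_part (- 18)" "dbp e \<in> poly9_part (- 2 * int (db_deg e))"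
proof -
 show "U \<in> poly9_part (- 2)" unfolding U_def by (intro p9_ops(1) pconst_part p9_ops(6))
 show "hpoly \<in> poly9_part (- 4)" unfolding hpoly_def
  using p9_ops(2)[OF p9_ops(6) p9_ops(6)] by (intro p9_ops(1)) simp_all
 show "dbp e \<in> poly9_part (- 2 * int (db_deg e))" by (intro part_poly9 hmg_dbp)
 have d: "d_poly i - d_poly j \<in> poly9_part (- 6)" for i j
  using p9_ops(1)[OF part_poly9[OF hmg_d_poly] p9_ops(3)[OF part_poly9[OF hmg_d_poly]], of i j] by simp
 show "delta_poly \<in> poly9_part (- 18)" unfolding delta_poly_def
  using p9_ops(2)[OF p9_ops(2)[OF d d] d] by simp
qed

lemma tr_part: "x \<in> Mhat_part t ==> tr x \<in> Mhat_part t"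
 unfolding tr_def by (intro hp_ops(1) hg_part)

lemma gel_part: "gel x \<in> Mhat_part (snd (gen_deg x))"
proof -
 have c: "- (U * gamP U * gamP (gamP U)) \<in> poly9_part (- 6)"
  using p9_ops(3)[OF p9_ops(2)[OF p9_ops(2)[OF U_part(1) poly9_gamma_part[OF U_part(1)]] poly9_gamma_part[OF poly9_gamma_part[OF U_part(1)]]]]
  by simp
 show ?thesis
 proof (cases x rule: gen_cases)
  case 1
  have "Mhat_of 1 \<in> Mhat_part 0" by (intro Mhat_of_part p9_ops)
  thus ?thesis by (simp add: 1 gel_simps Mhat_of_simps)
 next
  case 2 show ?thesis unfolding 2 gel_simps using Mhat_of_part[OF U_part(3)] by simp
 next
  case 3 show ?thesis unfolding 3 gel_simps using Mhat_of_part[OF c] by simp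
 next
  case 4 show ?thesis unfolding 4 gel_simps using Mhat_of_part[OF p9_ops(2)[OF U_part(3) c]] by simp
 next
  case (5 e)
  have "- 2 * int (db_deg e) + - 2 = - 2 - 2 * int (db_deg e)" by simp
  thus ?thesis unfolding 5 gel_simps gen_deg_f snd_conv
   using Mhat_of_part[OF p9_ops(2)[OF U_part(4)[of e] U_part(1)]] by (simp only:)
 next
  case (6 e)
  have "Mhat_of (dbp e) * Mhat_of (pconst (unit (gF e)) * hpoly) \<in> Mhat_part (- 2 * int (db_deg e) + - 4)"
   by (intro hp_ops(2) Mhat_of_part pconst_part U_part)
  moreover have "- 2 * int (db_deg e) + - 4 = - 4 - 2 * int (db_deg e)" by simp
  ultimately show ?thesis unfolding 6 gel_simps gen_deg_F snd_conv by (intro tr_part) (simp only:)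
 qed
qed

lemma triv_0: "triv n 0"
 by (auto simp: triv_def D.gV_0 intro!: exI[of _ 0]) (simp add: D.nV_def D.gV_0, metis D.nV_diff D.nV_def diff_self)

lemma gel_triv: "okgen n x ==> triv n (crdH (gel x) - Yr n (ex x))"
proof -
 assume ok: "okgen n x"
 have z: "invD 0 0 = (0 :: 'w DV)" "D.trpair 0 = 0" "vs a b l (0 :: 'w DV) = 0" for a b l
  by (simp add: DV_eq_iff invD_nth, simp add: D.trpair_def Let_def D.vs_0 D.gV_0, rule D.vs_0)
 have exz: "(%e. ex x (h e)) = 0" if "!!e. h e ~= x" for h
  using that by (auto simp: ex_def fun_eq_iff)
 have w: "crdP (pconst k * (letp 0 l1 * (letp 1 l2 * letp 2 l3))) = vs l1 l2 l3 (dsg B1 (cL k))" for k l1 l2 l3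
  using crdP_wbasis[of k B1 l1 l2 l3] by (simp add: dbp_def)
 have wd: "crdP (delta_poly * (pconst k * (letp 0 l1 * (letp 1 l2 * letp 2 l3)))) = vs l1 l2 l3 (sc (cL k) deltaD)" for k l1 l2 l3
  by (rule crdP_delta_mult) (simp add: crdP_wbasis[symmetric] mult_ac)
 have eq: "triv n (u - v)" if "u = v" for u v using that triv_0 by simp
 show ?thesis
 proof (cases x rule: gen_cases)
  case 1
  have ev: "even n" using ok by (simp add: okgen_def 1)
  have "Yr n (ex x) = vs One One One (invD 1 0) + D.trpair 0"
   unfolding Yr_def if_P[OF ev] using exz[of gF] by (simp add: 1 ex_def unit_simps gf_simps)
  moreover have "invD 1 0 = (dsg B1 1 :: 'w DV)" by (simp add: DV_eq_iff invD_nth dsg_def)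
  moreover have "crdH (gel x) = vs One One One (dsg B1 1)"
   using crdH_of[of 1] by (simp add: 1 gel_simps Mhat_of_simps crdP_1)
  ultimately show ?thesis by (intro eq) (simp only: z add_0_right)
 next
  case 2
  have ev: "even n" using ok by (simp add: okgen_def 2)
  have "Yr n (ex x) = vs One One One (invD 0 1) + D.trpair 0"
   unfolding Yr_def if_P[OF ev] using exz[of gF] by (simp add: 2 ex_def unit_simps gf_simps)
  moreover have "invD 0 1 = sc 1 (deltaD :: 'w DV)" by (simp add: DV_eq_iff invD_nth sc_def alg)
  moreover have "crdH (gel x) = vs One One One (sc 1 deltaD)"
   using wd[of 1 One One One] by (simp add: 2 gel_simps crdH_of pconst_1 letp_def)
  ultimately show ?thesis by (intro eq) (simp only: z add_0_right)
 next
  case 3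
  have od: "odd n" using ok by (simp add: okgen_def 3)
  have "Yr n (ex x) = vs LX One One 0 + vs LX LX LX (invD (cL (unit Gen_c)) 0)"
   unfolding Yr_def if_not_P[OF od] using exz[of gf] by (simp add: 3 ex_def gf_simps)
  moreover have "invD (cL (unit Gen_c)) 0 = sc (cL (unit Gen_c)) (dsg B1 1)" by (simp add: DV_eq_iff invD_nth sc_def dsg_def)
  moreover have "D.eqv (crdP (1 * - (U * gamP U * gamP (gamP U)))) (vs LX LX LX (sc (cL (unit Gen_c)) (dsg B1 1)))"
  proof (rule crdP_Ucube)
   show "gD (dsg B1 1) = (dsg B1 1 :: 'w DV)" by (simp add: DV_eq_iff dsg_def)
   show "crdP (1 * (pconst k * (letp 0 l1 * (letp 1 l2 * letp 2 l3)))) = vs l1 l2 l3 (sc (cL k) (dsg B1 1))" for k l1 l2 l3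
    using w by (simp add: sc_dsingle)
  qed
  ultimately show ?thesis unfolding eqv_triv[OF od] 3 gel_simps crdH_of by (simp only: z add_0_left mult_1_left)
 next
  case 4
  have od: "odd n" using ok by (simp add: okgen_def 4)
  have "Yr n (ex x) = vs LX One One 0 + vs LX LX LX (invD 0 (cL (unit Gen_c)))"
   unfolding Yr_def if_not_P[OF od] using exz[of gf] by (simp add: 4 ex_def gf_simps unit_simps)
  moreover have "invD 0 q = sc q deltaD" for q :: "'w L" by (simp add: DV_eq_iff invD_nth sc_def alg)
  moreover have "D.eqv (crdP (delta_poly * - (U * gamP U * gamP (gamP U)))) (vs LX LX LX (sc (cL (unit Gen_c)) deltaD))"
  proof (rule crdP_Ucube[OF _ wd])
   have "gD (invD 0 1) = invD 0 (1 :: 'w L)" by (rule gD_invD)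
   moreover have "invD 0 1 = (deltaD :: 'w DV)" by (simp add: DV_eq_iff invD_nth alg)
   ultimately show "gD deltaD = (deltaD :: 'w DV)" by simp
  qed
  ultimately show ?thesis unfolding eqv_triv[OF od] 4 gel_simps crdH_of by (simp only: z add_0_left)
 next
  case (5 e)
  have od: "odd n" using ok by (simp add: okgen_def 5 gen_deg_f)
  have "(%e'. ex x (gf e')) = dsg e (cL (al + be))" by (auto simp: ex_def 5 unit_simps gf_simps dsg_def fun_eq_iff)
  hence 1: "Yr n (ex x) = vs LX One One (dsg e (cL (al + be))) + vs LX LX LX (invD 0 0)"
   unfolding Yr_def if_not_P[OF od] by (simp add: 5 ex_def gf_simps(1-8)[THEN not_sym])
  have "dbp e * U = pconst al * (dbp e * (letp 0 LX * (letp 1 One * letp 2 One))) + pconst be * (dbp e * (letp 0 LY * (letp 1 One * letp 2 One)))"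
   by (simp add: U_def letp_def alg)
  hence 2: "crdP (dbp e * U) = vs LX One One (dsg e (cL al)) + vs LY One One (dsg e (cL be))"
   by (simp only: crdP_add crdP_wbasis)
  have "dsg e (cL (al + be)) = dsg e (cL al) + dsg e (cL be)" by (simp add: dsingle_add[symmetric])
  moreover have "D.eqv (vs LX One One (dsg e (cL al)) + vs LY One One (dsg e (cL be))) (vs LX One One (dsg e (cL al)) + vs LX One One (dsg e (cL be)))"
   by (intro D.eqv_add D.eqv_refl D.eqv_single(3))
  ultimately show ?thesis using 1 2 unfolding eqv_triv[OF od] 5 gel_simps crdH_of by (simp only: z add_0_right D.vs_add)
 next
  case (6 e)
  have ev: "even n" using ok by (simp add: okgen_def 6 gen_deg_F)
  let ?u = "unit (gF e)"
  have "(%e'. ex x (gF e')) = dsg e (cL ?u)" by (auto simp: ex_def 6 gf_simps dsg_def fun_eq_iff)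
  hence 1: "Yr n (ex x) = vs One One One (invD 0 0) + D.trpair (dsg e (cL ?u))"
   unfolding Yr_def if_P[OF ev] by (simp add: 6 ex_def gf_simps(1-8)[THEN not_sym])
  have "dbp e * (pconst ?u * hpoly) = pconst ?u * (dbp e * (letp 0 LX * (letp 1 LX * letp 2 One)))
   + pconst ?u * (dbp e * (letp 0 LY * (letp 1 LX * letp 2 One))) + pconst ?u * (dbp e * (letp 0 LY * (letp 1 LY * letp 2 One)))"
   by (simp add: hpoly_def letp_def alg)
  hence 2: "crdH (Mhat_of (dbp e) * Mhat_of (pconst ?u * hpoly)) =
   vs LX LX One (dsg e (cL ?u)) + vs LY LX One (dsg e (cL ?u)) + vs LY LY One (dsg e (cL ?u))"
   unfolding Mhat_of_simps(2)[symmetric] crdH_of by (simp only: crdP_add crdP_wbasis)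
  have "crdH (gel x) = D.trpair (dsg e (cL ?u))"
   unfolding 6 gel_simps tr_def crdH_add crdH_gamma 2 D.trpair_def Let_def ..
  thus ?thesis using 1 by (intro eq) (simp only: z add_0_left)
 qed
qed

end

section \<open>Cup products on C3 and detection of the generators\<close>

context wc
begin

definition c2 :: "int list => 'w Mhat" where "c2 = (%gs. gamH (c1 gs))"
definition c3 :: "int list => 'w Mhat" where "c3 = (%gs. gamH (c2 gs))"

lemma hg_hact3: "gamH (hact 3 x) = hact 3 (gamH x)"
 by (simp add: hact_3)

lemma c2_coc: "coc3 (- 2) 1 c2" and c3_coc: "coc3 (- 2) 1 c3"
proof -
 show *: "coc3 (- 2) 1 c2" unfolding c2_def by (rule coc3_map[OF _ _ _ c1_coc]) (simp_all add: hg_simps hg_hact3 hg_part)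
 show "coc3 (- 2) 1 c3" unfolding c3_def by (rule coc3_map[OF _ _ _ *]) (simp_all add: hg_simps hg_hact3 hg_part)
qed

definition "c12 = ccup c1 c2"
definition "c123 = ccup c1 (ccup c2 c3)"

lemma c12_coc: "coc3 (- 4) 2 c12" and c23_coc: "coc3 (- 4) 2 (ccup c2 c3)" and c123_coc: "coc3 (- 6) 3 c123"
proof -
 show "coc3 (- 4) 2 c12" unfolding c12_def using coc3_ccup[OF c1_coc c2_coc] by (simp add: numeral_2_eq_2)
 show *: "coc3 (- 4) 2 (ccup c2 c3)" using coc3_ccup[OF c2_coc c3_coc] by (simp add: numeral_2_eq_2)
 show "coc3 (- 6) 3 c123" unfolding c123_def using coc3_ccup[OF c1_coc *] by (simp add: numeral_eq_Suc)
qed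

lemma det_simps: "detecting c1 Gen_1 = b1_power 0" "detecting c1 Gen_delta = (%gs. Mhat_of delta_poly * b1_power 0 gs)"
 "detecting c1 Gen_c = c123" "detecting c1 Gen_c_delta = (%gs. Mhat_of delta_poly * c123 gs)"
 "detecting c1 (gf e) = (%gs. tr (Mhat_of (dbp e) * c1 gs))"
 "detecting c1 (gF e) = (%gs. tr (Mhat_of (dbp e) * c12 gs))"
proof -
 have c: "gamH \<circ> c1 = c2" "gamH \<circ> c2 = c3" by (auto simp: c2_def c3_def)
 have d: "(d_poly 0)\<^sup>2 = d_poly 0 * d_poly 0" by (rule power2_eq_square)
 show "detecting c1 Gen_1 = b1_power 0" "detecting c1 Gen_delta = (%gs. Mhat_of delta_poly * b1_power 0 gs)"
  "detecting c1 Gen_c = c123" "detecting c1 Gen_c_delta = (%gs. Mhat_of delta_poly * c123 gs)"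
  unfolding detecting_def Let_def c c123_def ccup_def poly_mult_def by simp_all
 show "detecting c1 (gf e) = (%gs. tr (Mhat_of (dbp e) * c1 gs))"
  "detecting c1 (gF e) = (%gs. tr (Mhat_of (dbp e) * c12 gs))"
  unfolding detecting_def Let_def c c12_def ccup_def poly_mult_def tr3_def tr_def
  by (cases e; simp add: dbp_def Mhat_of_simps d)+
qed

lemma tr_0: "tr 0 = 0" and tr_add: "tr (x + y) = tr x + tr y" and tr_hact3: "tr (hact 3 x) = hact 3 (tr x)"
 by (simp_all add: tr_def hg_simps hact_simps hg_hact3)

lemma ccup_zero:
 assumes "!!gs. ~ (length gs = 1 & set gs <= carrier C3) ==> c gs = 0"
  "!!gs. ~ (length gs = m & set gs <= carrier C3) ==> f gs = 0" "~ (length gs = Suc m & set gs <= carrier C3)"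
 shows "ccup c f gs = 0"
proof (cases gs)
 case Nil
 thus ?thesis using assms(1)[of "[]"] by (simp add: ccup_def cup_def)
next
 case (Cons g hs)
 show ?thesis
 proof (cases "g \<in> carrier C3")
  case True
  hence "f hs = 0" using assms(3) Cons by (intro assms(2)) auto
  thus ?thesis by (simp add: ccup_def cup_def Cons hact_simps)
 next
  case False
  hence "c [g] = 0" by (intro assms(1)) simp
  thus ?thesis by (simp add: ccup_def cup_def Cons)
 qed
qed

lemma detecting_zero: "~ (length gs = fst (gen_deg x) & set gs <= carrier C3) ==> detecting c1 x gs = 0"
proof -
 assume a: "~ (length gs = fst (gen_deg x) & set gs <= carrier C3)"
 have z2: "~ (length gs = 1 & set gs <= carrier C3) ==> c2 gs = 0" for gs unfolding c2_def using c1_zero by (simp add: hg_simps)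
 have z3: "~ (length gs = 1 & set gs <= carrier C3) ==> c3 gs = 0" for gs unfolding c3_def using z2 by (simp add: hg_simps)
 have z12: "~ (length gs = Suc 1 & set gs <= carrier C3) ==> c12 gs = 0" for gs unfolding c12_def by (rule ccup_zero[OF c1_zero z2])
 have z23: "~ (length gs = Suc 1 & set gs <= carrier C3) ==> ccup c2 c3 gs = 0" for gs by (rule ccup_zero[OF z2 z3])
 have z123: "~ (length gs = Suc (Suc 1) & set gs <= carrier C3) ==> c123 gs = 0" for gs unfolding c123_def by (rule ccup_zero[OF c1_zero z23])
 show ?thesis
 proof (cases x rule: gen_cases)
  case 1 thus ?thesis using a by (auto simp: det_simps)
 next
  case 2 thus ?thesis using a by (auto simp: det_simps)
 next
  case 3 thus ?thesis using a z123 by (simp add: det_simps numeral_eq_Suc)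
 next
  case 4 thus ?thesis using a z123 by (simp add: det_simps numeral_eq_Suc)
 next
  case (5 e) thus ?thesis using a c1_zero by (simp add: det_simps gen_deg_f tr_0)
 next
  case (6 e) thus ?thesis using a z12 by (simp add: det_simps gen_deg_F tr_0 numeral_eq_Suc)
 qed
qed

abbreviation "u1 == Mhat_of U"
abbreviation "u2 == Mhat_of (gamP U)"
abbreviation "u3 == Mhat_of (gamP (gamP U))"

lemma c_vals: "c1 [3] = u1" "c2 [3] = u2" "c3 [3] = u3"
 by (simp_all add: c1_3 c2_def c3_def hg_of)

text \<open>Writing a prime for gamma^3, the value is u1' u2'' - u1 u2 because u2 has norm zero. It
  is bilinear in u1 and u2, which have the same coefficients al and be, and the resulting quadratic
  form is the norm form up to sign.\<close>

lemma kap3_c12: "kap3 c12 [] = Mhat_of (pconst (unit (gF e)) * hpoly)"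
proof -
 note v2 = coc3_1_vals[OF c2_coc, unfolded c_vals]
 have "kap3 c12 [] = hact 3 u1 * hact 6 u2 + u1 * (hact 3 u2 + hact 6 u2)"
  unfolding c12_def kap3_ccup[OF c1_coc] v2(1,2) c_vals by (simp add: hact_simps hact_6)
 also have "hact 3 u2 + hact 6 u2 = - u2" using v2(3) by (simp add: eq_neg_iff_add_eq_0 add_ac)
 also have "hact 3 u1 * hact 6 u2 + u1 * - u2 = Mhat_of (pconst (unit (gF e)) * hpoly)"
 proof -
  have "(9::9) + 1 = 0 + 1" by (simp only: nine_eq_0)
  hence t: "(10::9) = 1" by simp
  have e: "(3::9) + 1 + 1 + 1 + 1 + 1 + 1 + 1 = 1" "(0::9) + 1 + 1 + 1 + 1 + 1 + 1 + 1 = 7" "(3::9) + 1 + 1 + 1 = 6"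
   "(0::9) + 1 + 1 + 1 = 3" "(0::9) + 1 = 1" "(3::9) + 1 = 4"
   by (simp_all add: t)
  have h: "hact 3 u1 = Mhat_of (pconst al * pvar 3 + pconst be * pvar 6)"
   "hact 6 u2 = Mhat_of (pconst al * pvar 7 + pconst be * pvar 1)"
   "u2 = Mhat_of (pconst al * pvar 1 + pconst be * pvar 4)"
   unfolding hact_6 hact_3_of U_def poly9_gamma_add poly9_gamma_mult gamma_pconst poly9_gamma_pvar e by (simp_all add: t)
  show ?thesis
   unfolding h(1,2) unfolding h(3) unfolding U_def hpoly_def unit_simps Mhat_of_simps pconst_minus pconst_add pconst_mult Mhat_of_x6 Mhat_of_x7
    minus_mult_left[symmetric] diff_conv_add_uminus
   by (simp add: alg)
 qed
 finally show ?thesis .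
qed

text \<open>With a prime for gamma^3 the trace is u1 u2 u3 + u2 u3 u1' + u3 u1' u2', since gamma
  takes u3 to u1'. These terms appear, with a minus sign, once u2'' is eliminated by u2 + u2' + u2''
  = 0.\<close>

lemma kap3_c123: "kap3 c123 [3] = - tr (u1 * u2 * u3) + 0"
proof -
 note v2 = coc3_1_vals[OF c2_coc, unfolded c_vals]
 have "kap3 c123 [3] = hact 3 u1 * hact 6 u2 * u3 + u1 * (hact 3 u2 + hact 6 u2) * u3"
  unfolding c123_def kap3_ccup[OF c1_coc] c_vals
  by (simp add: ccup_Cons c_vals v2(1,2) hact_simps hact_6 hact_333 mult.assoc)
 also have "hact 3 u2 + hact 6 u2 = - u2" using v2(3) by (simp add: eq_neg_iff_add_eq_0 add_ac)
 also have "hact 3 u1 * hact 6 u2 * u3 + u1 * - u2 * u3 = - tr (u1 * u2 * u3) + 0"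
 proof -
  have g: "gamH u1 = u2" "gamH u2 = u3" "gamH u3 = hact 3 u1" by (simp_all add: hg_of hact_3)
  hence "tr (u1 * u2 * u3) = u1 * u2 * u3 + u2 * u3 * hact 3 u1 + u3 * hact 3 u1 * hact 3 u2"
   unfolding tr_def hg_simps by (simp add: hg_hact3 g)
  moreover have h6: "hact 6 u2 = - u2 - hact 3 u2" using \<open>hact 3 u2 + hact 6 u2 = - u2\<close> by (metis add_diff_cancel_left')
  ultimately show ?thesis unfolding h6 by (simp only:) (simp add: alg)
 qed
 finally show ?thesis .
qed

lemma crs9_3: "crs9 a [3] = tr a"
proof -
 have "crs9 a [int (1 * 3)] = (\<Sum>j<3. hact (int (1 * j)) a)"
  using cyc.cross_C[OF cyc9, of a 3] cyc.psum_def[OF cyc9, of a 3] by (simp only:)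
 thus ?thesis by (simp add: cyc_act_def numeral_eq_Suc tr_def del: One_nat_def)
qed

lemma dbp_inv: "hact 3 (Mhat_of (dbp e)) = Mhat_of (dbp e :: 'w poly9)"
proof -
 have d4: "d_poly 4 = (d_poly 1 :: 'w poly9)" using arg_cong[OF d_poly_3, of gamP] unfolding gamma_d_poly by simp
 have "gamP (gamP (gamP (dbp e))) = (dbp e :: 'w poly9)"
  unfolding gamma_dbp gamma_dbr gamma_d_poly d_poly_3
  using d4 by (simp add: gamma_d_poly d_poly_3 dbp_def)
 thus ?thesis by (simp add: hact_3_of)
qed

lemma delta_inv: "gamH (Mhat_of delta_poly) = Mhat_of (delta_poly :: 'w poly9)"
proof -
 have m: "gamP (a - b) = gamP a - gamP b" for a b :: "'w poly9"
  by (rule ring_hom_minus[OF poly9_gamma_hom])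
 have "gamP delta_poly = (delta_poly :: 'w poly9)"
  unfolding delta_poly_def poly9_gamma_mult m gamma_d_poly by (simp add: d_poly_3 mult_ac)
 thus ?thesis by (simp add: hg_of)
qed

lemma okp_gel: "okgen n x ==> okp n (gel x)"
proof -
 assume ok: "okgen n x"
 from gel_triv[OF ok] have t: "triv n (crdH (gel x) - Yr n (ex x))" .
 show ?thesis
 proof (cases "even n")
  case True
  obtain b where "crdH (gel x) - Yr n (ex x) = D.nV b" using t unfolding triv_def if_P[OF True] by blast
  hence "crdH (gel x) = Yr n (ex x) + D.nV b" by (simp add: alg)
  thus ?thesis unfolding okp_crdH[OF gel_part] if_P[OF True] by (simp only: D.gV_add Yr_inv[OF True] D.gV_nV)
 next
  case False
  obtain b where "crdH (gel x) - Yr n (ex x) = D.gV b - b" using t unfolding triv_def if_not_P[OF False] by blast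
  hence "crdH (gel x) = Yr n (ex x) + (D.gV b - b)" by (simp add: alg)
  thus ?thesis unfolding okp_crdH[OF gel_part] if_not_P[OF False]
   by (simp only: D.nV_add Yr_norm[OF False] D.nV_diff D.nV_gV diff_self add_0_left)
 qed
qed

lemma cry_pow_cob: "cob3 t m (%gs. f gs - g gs) ==> cob3 t (2 * k + m) (%gs. (cry ^^ k) f gs - (cry ^^ k) g gs)"
 unfolding cry_pow_diff[symmetric] by (rule cyc.cob_carry_pow[OF cyc3])

text \<open>On C3 a cocycle is cohomologous to b1 times its image under \<open>kap3\<close>, so
  identifying it only requires that image.\<close>

lemma detect_kap:
 assumes D: "coc3 t (Suc (Suc m)) D" and k: "!!gs. cyc.tup C3 m gs ==> kap3 D gs = f gs"
 shows "cob3 t (Suc m) (%gs. cry f gs - D gs)"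
proof -
 have "cob3 t (Suc m) (%gs. 0 - (D gs - cry (kap3 D) gs))"
  by (rule cyc.cob_diff[OF cyc3 cyc.cob_zero[OF cyc3] cyc.reduce[OF cyc3 D]]) simp
 thus ?thesis
 proof (rule cyc.cob_cong[OF cyc3])
  fix gs assume gs: "cyc.tup C3 (Suc (Suc m)) gs"
  have "(cry ^^ 1) (kap3 D) gs = (cry ^^ 1) f gs" by (rule cry_pow_cong[of m]) (use gs k in simp_all)
  thus "0 - (D gs - cry (kap3 D) gs) = cry f gs - D gs" by simp
 qed
qed

text \<open>For 1 and delta the two cocycles agree, and for the f_i they come from crossed
  homomorphisms with the same value at 3. For the F_i, c-bar and c-bar delta the detecting cocycle
  has degree 2 or 3, and its image under \<open>kap3\<close> is compared with an element or a
  crossed homomorphism.\<close>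

theorem gel_detect:
 assumes n: "n = fst (gen_deg x) + 2 * k" "n > 0"
 shows "cob3 (snd (gen_deg x)) (n - 1) (%gs. Zr n (gel x) gs - (cry ^^ k) (detecting c1 x) gs)"
proof -
 have ok: "okgen n x" using n by (simp add: okgen_def)
 have coc: "coc3 (snd (gen_deg x)) m (crs9 (gel x))" if "m = 1" "odd n" for m
 proof -
  have "cyc.nrm C9 gamH (gel x) = 0" using okp_gel[OF ok] that(2) by (simp add: okp_def)
  from cyc.coc_cross[OF cyc9 gel_part this] show ?thesis unfolding that(1) by (rule coc_res)
 qed
 have even0: ?thesis if x: "fst (gen_deg x) = 0" "detecting c1 x [] = gel x"
 proof (rule cyc.cob_zero[OF cyc3])
  fix gs assume gs: "cyc.tup C3 (Suc (n - 1)) gs"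
  have n': "n = 2 * k" using n x by simp
  have "Zr n (gel x) gs = (cry ^^ k) (%_. gel x) gs" unfolding n' by (simp add: Zr_def)
  also have "... = (cry ^^ k) (detecting c1 x) gs"
   by (rule cry_pow_cong[of 0]) (use gs n(2) n' x(2) in \<open>auto simp: tup3_def\<close>)
  finally show "Zr n (gel x) gs - (cry ^^ k) (detecting c1 x) gs = 0" by simp
 qed
 have odd3: ?thesis if x: "fst (gen_deg x) = 3" "coc3 (snd (gen_deg x)) 3 (detecting c1 x)" "kap3 (detecting c1 x) [3] = tr (gel x)"
 proof -
  have n': "n = 2 * Suc k + 1" using n x by simp
  have "cob3 (snd (gen_deg x)) (Suc 1) (%gs. cry (crs9 (gel x)) gs - detecting c1 x gs)"
  proof (rule detect_kap)
   show 3: "coc3 (snd (gen_deg x)) (Suc (Suc 1)) (detecting c1 x)" using x(2) by (simp add: numeral_eq_Suc)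
   show "kap3 (detecting c1 x) gs = crs9 (gel x) gs" if "cyc.tup C3 1 gs" for gs
   proof (rule coc3_1_eq[OF _ coc _ that])
    show "coc3 (snd (gen_deg x)) 1 (kap3 (detecting c1 x))" using cyc.coc_kap[OF cyc3 3] by simp
    show "kap3 (detecting c1 x) [3] = crs9 (gel x) [3]" unfolding x(3) crs9_3 ..
   qed (simp_all add: n')
  qed
  from cry_pow_cob[OF this, of k] show ?thesis
   unfolding n' Zr_odd[of "Suc k"] by (simp add: funpow_Suc_right del: funpow.simps)
 qed
 show ?thesis
 proof (cases x rule: gen_cases)
  case 1 show ?thesis by (rule even0) (simp_all add: 1 det_simps gel_simps)
 next
  case 2 show ?thesis by (rule even0) (simp_all add: 2 det_simps gel_simps)
 next
  case 3
  have "- tr (u1 * u2 * u3) + 0 = tr (gel x)" by (simp add: 3 gel_simps tr_def Mhat_of_simps hg_simps)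
  thus ?thesis by (intro odd3) (simp_all add: 3 det_simps c123_coc kap3_c123)
 next
  case 4
  let ?d = "Mhat_of delta_poly :: 'w Mhat"
  have h: "?d * (x + y) = ?d * x + ?d * y" "?d * hact 3 x = hact 3 (?d * x)" for x y :: "'w Mhat"
   by (simp_all add: distrib_left hact_simps) (simp add: hact_3 delta_inv)
  have "coc3 (- 24) 3 (%gs. ?d * c123 gs)"
   by (rule coc3_map[OF h _ c123_coc]) (use hp_ops(2)[OF Mhat_of_part[OF U_part(3)]] in fastforce)
  moreover have "kap3 (%gs. ?d * c123 gs) [3] = tr (gel x)"
   unfolding kap3_map[of "%x. ?d * x", OF h] kap3_c123
   by (simp add: 4 gel_simps tr_def Mhat_of_simps hg_simps delta_inv alg)
  ultimately show ?thesis by (intro odd3) (simp_all add: 4 det_simps)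
 next
  case (5 e)
  have n': "n = 2 * k + 1" using n by (simp add: 5 gen_deg_f)
  let ?p = "Mhat_of (dbp e) :: 'w Mhat"
  have h: "tr (?p * (x + y)) = tr (?p * x) + tr (?p * y)" "tr (?p * hact 3 x) = hact 3 (tr (?p * x))" for x y :: "'w Mhat"
  proof -
   show "tr (?p * (x + y)) = tr (?p * x) + tr (?p * y)" by (simp add: distrib_left tr_add)
   have "?p * hact 3 x = hact 3 (?p * x)" by (simp add: hact_simps dbp_inv)
   thus "tr (?p * hact 3 x) = hact 3 (tr (?p * x))" by (simp add: tr_hact3)
  qed
  have c: "coc3 (snd (gen_deg x)) 1 (%gs. tr (?p * c1 gs))"
  proof (rule coc3_map[OF h _ c1_coc])
   fix y :: "'w Mhat" assume "y \<in> Mhat_part (- 2)"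
   hence "tr (?p * y) \<in> Mhat_part (- 2 * int (db_deg e) + - 2)" by (intro tr_part hp_ops(2) Mhat_of_part U_part)
   moreover have "- 2 * int (db_deg e) + - 2 = snd (gen_deg x)" by (simp add: 5 gen_deg_f)
   ultimately show "tr (?p * y) \<in> Mhat_part (snd (gen_deg x))" by simp
  qed
  show ?thesis
  proof (rule cyc.cob_zero[OF cyc3])
   fix gs assume gs: "cyc.tup C3 (Suc (n - 1)) gs"
   have "crs9 (gel x) hs = detecting c1 x hs" if "cyc.tup C3 1 hs" for hs
    unfolding 5 det_simps
    by (rule coc3_1_eq[OF coc[unfolded 5, OF refl] c[unfolded 5] _ that]) (simp_all add: n' crs9_3 gel_simps c_vals Mhat_of_simps del: One_nat_def)
   hence "(cry ^^ k) (crs9 (gel x)) gs = (cry ^^ k) (detecting c1 x) gs"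
    using gs n' by (intro cry_pow_cong[of 1]) simp_all
   thus "Zr n (gel x) gs - (cry ^^ k) (detecting c1 x) gs = 0" unfolding n' Zr_odd by simp
  qed
 next
  case (6 e)
  have n': "n = 2 * k + 2" using n by (simp add: 6 gen_deg_F)
  let ?p = "Mhat_of (dbp e) :: 'w Mhat"
  have h: "tr (?p * (x + y)) = tr (?p * x) + tr (?p * y)" "tr (?p * hact 3 x) = hact 3 (tr (?p * x))" for x y :: "'w Mhat"
  proof -
   show "tr (?p * (x + y)) = tr (?p * x) + tr (?p * y)" by (simp add: distrib_left tr_add)
   have "?p * hact 3 x = hact 3 (?p * x)" by (simp add: hact_simps dbp_inv)
   thus "tr (?p * hact 3 x) = hact 3 (tr (?p * x))" by (simp add: tr_hact3)
  qed
  have c: "coc3 (snd (gen_deg x)) 2 (%gs. tr (?p * c12 gs))"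
  proof (rule coc3_map[OF h _ c12_coc])
   fix y :: "'w Mhat" assume "y \<in> Mhat_part (- 4)"
   hence "tr (?p * y) \<in> Mhat_part (- 2 * int (db_deg e) + - 4)" by (intro tr_part hp_ops(2) Mhat_of_part U_part)
   moreover have "- 2 * int (db_deg e) + - 4 = snd (gen_deg x)" by (simp add: 6 gen_deg_F)
   ultimately show "tr (?p * y) \<in> Mhat_part (snd (gen_deg x))" by simp
  qed
  have "cob3 (snd (gen_deg x)) (Suc 0) (%gs. cry (%_. gel x) gs - detecting c1 x gs)"
  proof (rule detect_kap)
   show "coc3 (snd (gen_deg x)) (Suc (Suc 0)) (detecting c1 x)" using c by (simp add: 6 det_simps numeral_eq_Suc)
   have "kap3 (detecting c1 x) [] = gel x"
    unfolding 6 det_simps kap3_map[of "%y. tr (?p * y)", OF h] kap3_c12[of e] gel_simps ..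
   thus "kap3 (detecting c1 x) gs = gel x" if "cyc.tup C3 0 gs" for gs using that by (simp add: tup3_def)
  qed
  from cry_pow_cob[OF this, of k] show ?thesis
   unfolding n' Zr_even by (simp add: funpow_Suc_right del: funpow.simps)
 qed
qed

end

subsection \<open>The classes in degree \<open>(n, t)\<close>\<close>

lemma free_part_add: "v \<in> free_part n t ==> w \<in> free_part n t ==> (%x. v x + w x) \<in> free_part n t"
 and free_part_minus: "v \<in> free_part n t ==> (%x. - v x) \<in> free_part n t"
 and free_part_0: "(%x. 0) \<in> free_part n t"
proof -
 have S: "a \<in> S_part k ta ==> b \<in> S_part k ta ==> a + b \<in> S_part k ta" "a \<in> S_part k ta ==> - a \<in> S_part k ta"
  "0 \<in> S_part k ta" for a b :: "'a S" and k ta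
 proof -
  show "a + b \<in> S_part k ta" if ab: "a \<in> S_part k ta" "b \<in> S_part k ta"
   unfolding S_part_def
  proof (intro CollectI allI ballI)
   fix i j x assume "x \<in> keys ((a + b) $ i $ j)"
   hence "x \<in> keys (a $ i $ j) | x \<in> keys (b $ i $ j)"
    using Poly_Mapping.keys_add[of "a $ i $ j" "b $ i $ j"] by auto
   moreover have "ALL x:keys (a $ i $ j). case x of (m, n) => k = 2 * m & ta = - 6 * int i - 12 * int j - 18 * n"
    "ALL x:keys (b $ i $ j). case x of (m, n) => k = 2 * m & ta = - 6 * int i - 12 * int j - 18 * n"
    using ab unfolding S_part_def by simp_all
   ultimately show "case x of (m, n) => k = 2 * m & ta = - 6 * int i - 12 * int j - 18 * n"
    by (elim disjE) (drule bspec, assumption+)+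
  qed
 qed (simp_all add: S_part_def)
 show "v \<in> free_part n t ==> w \<in> free_part n t ==> (%x. v x + w x) \<in> free_part n t"
  "v \<in> free_part n t ==> (%x. - v x) \<in> free_part n t" "(%x. 0) \<in> free_part n t"
  unfolding free_part_def using S by blast+
qed

context wc
begin

text \<open>By \<open>gel_triv\<close> a generator is detected by \<open>unit\<close> times its
  normal form; rescaling here makes the generator itself correspond to the detected class.\<close>

definition cv :: "(gen => 'w S) => gen => 'w L" where
 "cv v x = cL (unit x) * La (v x)"

definition av :: "nat => int => (gen => 'w S) => 'w Mhat" where
 "av n t v = hV t (Yr n (cv v))"

lemma Yr_cv_Vt: "v \<in> free_part n t ==> Yr n (cv v) \<in> Vt t"
proof -
 assume v: "v \<in> free_part n t"
 have "prL (t - snd (gen_deg x)) (cv v x) = cv v x" for x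
 proof -
  have "v x \<in> S_part (int n - int (fst (gen_deg x))) (t - snd (gen_deg x))" using v unfolding free_part_def by blast
  thus ?thesis unfolding cv_def prL_cL using hom_prL[OF S_part_La] by metis
 qed
 hence "pr t (Yr n (cv v)) = Yr n (cv v)" unfolding pr_Yr by simp
 thus ?thesis using pr_Vt by metis
qed

lemma av_part: "v \<in> free_part n t ==> av n t v \<in> Mhat_part t" and crdH_av: "v \<in> free_part n t ==> crdH (av n t v) = Yr n (cv v)"
 unfolding av_def by (rule hV[OF Yr_cv_Vt]; assumption)+

lemma okp_av: "v \<in> free_part n t ==> okp n (av n t v)"
 by (simp add: okp_crdH[OF av_part] crdH_av Yr_inv Yr_norm)

lemma relL_unit: "relL x (cL (unit x) * p) <-> relL x p"
proof
 assume a: "relL x (cL (unit x) * p)"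
 obtain w where "9 dvd unit x * w - 1" using unit_inv by blast
 then obtain s where s: "unit x * w - 1 = 9 * s" by (elim dvdE)
 have "cL w * (cL (unit x) * p) = cL (unit x * w - 1) * p + p"
  unfolding fps_const_sub[symmetric] fps_const_mult[symmetric] by (simp add: alg)
 also have "cL (unit x * w - 1) = 9 * cL s" unfolding s fps_const_mult[symmetric] by (simp add: numeral_fps_const)
 finally have "p = cL w * (cL (unit x) * p) - 9 * (cL s * p)" by (simp add: alg)
 moreover have "relL x (cL w * (cL (unit x) * p) - 9 * (cL s * p))" by (intro relL_diff relL_mult[OF a] relL_9)
 ultimately show "relL x p" by simp
qed (rule relL_mult)

lemma av_triv:
 assumes "v \<in> free_part n t"
 shows "triv n (crdH (av n t v)) <-> v \<in> relations"
proof -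
 have "relL x (La (v x))" if "~ okgen n x" for x
 proof -
  have "odd (int n - int (fst (gen_deg x)))" using that by (auto simp: okgen_def)
  moreover have "v x \<in> S_part (int n - int (fst (gen_deg x))) (t - snd (gen_deg x))" using assms unfolding free_part_def by blast
  ultimately have "v x = 0" by (rule S_part_odd)
  thus ?thesis using relL_9[of x 0] by (simp add: La_0)
 qed
 thus ?thesis
  unfolding crdH_av[OF assms] Yr_triv cv_def relL_unit relations_iff[OF assms] by blast
qed

text \<open>Multiples of 9 satisfy the relations of every generator, so the choice of lifts from W/9
  does not affect classes.\<close>

lemma triv_eq9: "(!!x. eq9 (c x) (c' x)) ==> triv n (Yr n c - Yr n c')"
 unfolding Yr_diff[symmetric] Yr_triv using relL_eq9_diff by blast

lemma cv_eq9: "eq9 (La (v x)) p ==> eq9 (cv v x) (cL (unit x) * p)"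
 unfolding cv_def by (intro eq9_mult eq9_refl)

lemma av_add:
 assumes "v \<in> free_part n t" "w \<in> free_part n t"
 shows "triv n (crdH (av n t (%x. v x + w x)) - (crdH (av n t v) + crdH (av n t w)))"
 unfolding crdH_av[OF assms(1)] crdH_av[OF assms(2)] crdH_av[OF free_part_add[OF assms]] Yr_add[symmetric]
 by (rule triv_eq9) (use cv_eq9[OF La_add] in \<open>simp add: cv_def distrib_left\<close>)

lemma av_surj:
 assumes a: "a \<in> Mhat_part t" "okp n a"
 shows "EX v:free_part n t. triv n (crdH a - crdH (av n t v))"
proof -
 obtain c where c: "triv n (crdH a - Yr n c)" using Yr_surj[of n "crdH a"] a(2) unfolding okp_crdH[OF a(1)] by blast
 \<comment> \<open>The normal form was found without regard to the grading. Passing to homogeneous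
   parts fixes the coordinates of a and preserves triviality.\<close>
 define c' where "c' x = prL (t - snd (gen_deg x)) (c x)" for x
 have "triv n (pr t (crdH a - Yr n c))"
 proof (cases "even n")
  case True
  then obtain b where "crdH a - Yr n c = D.nV b" using c unfolding triv_def by auto
  thus ?thesis unfolding triv_def if_P[OF True] using pr_nV by metis
 next
  case False
  then obtain b where "crdH a - Yr n c = D.gV b - b" using c unfolding triv_def by auto
  thus ?thesis unfolding triv_def if_not_P[OF False] using pr_gV pr_diff by metis
 qed
 hence 1: "triv n (crdH a - Yr n c')" unfolding pr_diff pr_id[OF crdH_part[OF a(1)]] pr_Yr c'_def .
 \<comment> \<open>Inverses modulo 9 are enough, as classes ignore multiples of 9.\<close>
 obtain w where w: "!!x. 9 dvd unit x * w x - 1" using unit_inv by metis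
 define v where "v x = (if okgen n x then sig ((int n - int (fst (gen_deg x))) div 2) (t - snd (gen_deg x)) (cL (w x) * c' x) else 0)" for x
 have h: "hom_L (t - snd (gen_deg x)) (cL (w x) * c' x)" for x
  unfolding c'_def prL_cL[symmetric] by (rule prL_hom)
 have v: "v \<in> free_part n t" unfolding free_part_def
 proof (intro CollectI allI)
  fix x
  show "v x \<in> S_part (int n - int (fst (gen_deg x))) (t - snd (gen_deg x))"
  proof (cases "okgen n x")
   case True
   hence "int n - int (fst (gen_deg x)) = 2 * ((int n - int (fst (gen_deg x))) div 2)" by (auto simp: okgen_def)
   thus ?thesis using sig_part[OF h[of x], of "(int n - int (fst (gen_deg x))) div 2"] True by (simp add: v_def)
  qed (simp add: v_def S_part_def)
 qed
 have "triv n (Yr n c' - Yr n (cv v))"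
  unfolding Yr_diff[symmetric] Yr_triv
 proof (intro allI impI relL_eq9_diff)
  fix x assume ok: "okgen n x"
  have "eq9 (La (v x)) (cL (w x) * c' x)" using ok La_sig by (simp add: v_def)
  hence "eq9 (cv v x) (cL (unit x) * (cL (w x) * c' x))" by (rule cv_eq9)
  moreover obtain s where s: "unit x * w x - 1 = 9 * s" using w[of x] by (elim dvdE)
  have "cL (unit x) * (cL (w x) * c' x) = cL (unit x * w x - 1) * c' x + c' x"
   unfolding fps_const_sub[symmetric] fps_const_mult[symmetric] by (simp add: alg)
  hence "cL (unit x) * (cL (w x) * c' x) = c' x + 9 * (cL s * c' x)"
   unfolding s fps_const_mult[symmetric] by (simp add: numeral_fps_const alg)
  hence "eq9 (cL (unit x) * (cL (w x) * c' x)) (c' x)" unfolding eq9_def by blast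
  ultimately show "eq9 (c' x) (cv v x)" using eq9_trans eq9_sym by blast
 qed
 hence "triv n ((crdH a - Yr n c') + (Yr n c' - Yr n (cv v)))" by (rule triv_add[OF 1])
 thus ?thesis using v crdH_av[OF v] by (intro bexI[of _ v]) simp_all
qed

definition Zv :: "nat => int => (gen => 'w S) => int list => 'w Mhat" where
 "Zv n t v = cut n (Zr n (av n t v))"

abbreviation "Zh n t == cocycles C9 hact n (Mhat_part t)"
abbreviation "Bh n t == coboundaries C9 hact n (Mhat_part t)"

lemma Zh_iff: "f \<in> Zh n t <-> coc9 t n f & (ALL gs. ~ (length gs = n & set gs <= carrier C9) --> f gs = 0)"
 unfolding cyc.cocycles_iff[OF cyc9] tup9_def ..

lemma Bh_iff: "n > 0 ==> f \<in> Bh n t <-> cob9 t (n - 1) f & (ALL gs. ~ (length gs = n & set gs <= carrier C9) --> f gs = 0)"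
 using cyc.coboundaries_iff[OF cyc9, of f "n - 1" t] unfolding tup9_def by simp

lemma cob_cut: "n > 0 ==> cob9 t (n - 1) (%gs. f gs - cut n g gs) <-> cob9 t (n - 1) (%gs. f gs - g gs)"
proof -
 assume n: "n > 0"
 have "cut n g gs = g gs" if "cyc.tup C9 (Suc (n - 1)) gs" for gs using that n by (simp add: cut_def tup9_def)
 thus ?thesis
  using cyc.cob_cong[OF cyc9, of t "n - 1" "%gs. f gs - cut n g gs" "%gs. f gs - g gs"]
   cyc.cob_cong[OF cyc9, of t "n - 1" "%gs. f gs - g gs" "%gs. f gs - cut n g gs"] by auto
qed

lemma cut_coc: "coc9 t n f ==> cut n f \<in> Zh n t"
proof -
 assume f: "coc9 t n f"
 have "hd3 (cut n f) gs = hd3 f gs" if "cyc.tup C9 (Suc n) gs" for gs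
  by (rule cyc.d_cong[OF cyc9, of n]) (use that in \<open>simp_all add: cut_def tup9_def\<close>)
 hence "coc9 t n (cut n f)" using f unfolding coc9_iff by (simp add: cut_def tup9_def)
 thus ?thesis unfolding Zh_iff by (simp add: cut_def)
qed

lemma Zv_in: "n > 0 ==> v \<in> free_part n t ==> Zv n t v \<in> Zh n t"
 unfolding Zv_def by (intro cut_coc Zr_coc av_part okp_av)

text \<open>A relation instead of a map, because a class determines its cocycle only up to
  coboundaries and \<open>av\<close> is additive only up to trivial elements.\<close>

definition Th :: "nat => int => (gen => 'w S) => (int list => 'w Mhat) => bool" where
 "Th n t v f <-> v \<in> free_part n t & f \<in> Zh n t & eqc n t f (Zr n (av n t v))"

lemma Th_ex1: "n > 0 ==> v \<in> free_part n t ==> EX f. Th n t v f"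
proof -
 assume n: "n > 0" and v: "v \<in> free_part n t"
 have "cob9 t (n - 1) (%gs. Zv n t v gs - Zv n t v gs)" by (rule cyc.cob_zero[OF cyc9]) simp
 hence "eqc n t (Zv n t v) (Zr n (av n t v))" unfolding eqc_def using cob_cut[OF n] unfolding Zv_def by blast
 thus ?thesis using v Zv_in[OF n v] unfolding Th_def by blast
qed

lemma Th_ex2: "n > 0 ==> f \<in> Zh n t ==> EX v. Th n t v f"
proof -
 assume n: "n > 0" and f: "f \<in> Zh n t"
 obtain a where a: "a \<in> Mhat_part t" "okp n a" "eqc n t f (Zr n a)"
  using Zr_rep[OF n] f unfolding Zh_iff eqc_def by blast
 obtain v where v: "v \<in> free_part n t" "triv n (crdH a - crdH (av n t v))" using av_surj[OF a(1,2)] by blast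
 have "eqc n t (Zr n a) (Zr n (av n t v))" using v n a by (simp add: eqc_Zr av_part okp_av)
 thus ?thesis using f v(1) eqc_trans[OF a(3)] unfolding Th_def by blast
qed

lemma eqc_add: "eqc n t f f' ==> eqc n t g g' ==> eqc n t (%gs. f gs + g gs) (%gs. f' gs + g' gs)"
 unfolding eqc_def using cyc.cob_add[OF cyc9, of t "n - 1" "%gs. f gs - f' gs" "%gs. g gs - g' gs"] by (simp add: alg)

lemma Zr_add: "Zr n (a + b) = (%gs. Zr n a gs + Zr n b gs)"
proof -
 have "Zr n ((a + b) - b) gs = Zr n (a + b) gs - Zr n b gs" for gs unfolding Zr_diff ..
 thus ?thesis by (simp add: fun_eq_iff alg)
qed

lemma okp_add: "okp n a ==> okp n b ==> okp n (a + b)"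
proof -
 have "(gamH ^^ k) (a + b) = (gamH ^^ k) a + (gamH ^^ k) b" for k by (induction k) (simp_all add: hg_simps)
 thus "okp n a ==> okp n b ==> okp n (a + b)" unfolding okp_def nrm_sum by (auto simp: hg_simps sum.distrib)
qed

lemma Zh_add: "f \<in> Zh n t ==> g \<in> Zh n t ==> (%gs. f gs + g gs) \<in> Zh n t"
 unfolding Zh_iff coc9_iff by (simp add: hp_ops cyc.d_add[OF cyc9])

lemma Th_add: "n > 0 ==> Th n t v f ==> Th n t w g ==> Th n t (%x. v x + w x) (%gs. f gs + g gs)"
proof -
 assume n: "n > 0" and a: "Th n t v f" "Th n t w g"
 have v: "v \<in> free_part n t" "w \<in> free_part n t" using a unfolding Th_def by blast+
 have "eqc n t (%gs. f gs + g gs) (Zr n (av n t v + av n t w))"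
  unfolding Zr_add using a unfolding Th_def by (intro eqc_add) blast+
 moreover have "eqc n t (Zr n (av n t v + av n t w)) (Zr n (av n t (%x. v x + w x)))"
  using triv_minus[OF av_add[OF v]] n v
  by (simp add: eqc_Zr av_part okp_av okp_add hp_ops free_part_add crdH_add)
 ultimately show ?thesis using a eqc_trans unfolding Th_def by (simp add: free_part_add Zh_add)
qed

lemma Th_triv: "n > 0 ==> Th n t v f ==> v \<in> pres_rel n t <-> f \<in> Bh n t"
proof -
 assume n: "n > 0" and a: "Th n t v f"
 have v: "v \<in> free_part n t" and f: "f \<in> Zh n t" and e: "eqc n t f (Zr n (av n t v))" using a unfolding Th_def by blast+
 have "v \<in> pres_rel n t <-> cob9 t (n - 1) (Zr n (av n t v))"
  unfolding pres_rel_def using v av_triv[OF v] Zr_cob[OF n av_part[OF v] okp_av[OF v]] by blast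
 also have "... <-> eqc n t f (%_. 0)"
 proof
  assume "cob9 t (n - 1) (Zr n (av n t v))"
  hence "eqc n t (Zr n (av n t v)) (%_. 0)" unfolding eqc_def by simp
  thus "eqc n t f (%_. 0)" by (rule eqc_trans[OF e])
 next
  assume "eqc n t f (%_. 0)"
  hence "eqc n t (Zr n (av n t v)) (%_. 0)" by (rule eqc_trans[OF eqc_sym[OF e]])
  thus "cob9 t (n - 1) (Zr n (av n t v))" unfolding eqc_def by simp
 qed
 also have "... <-> f \<in> Bh n t" unfolding Bh_iff[OF n] eqc_def using f unfolding Zh_iff by simp
 finally show ?thesis .
qed

lemma S_value_cry: "gamH p = p ==> p * cry f gs = cry (%hs. p * f hs) gs"
proof -
 assume p: "gamH p = p"
 have "hact g p = p" for g
 proof -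
  have "(gamH ^^ k) p = p" for k by (induction k) (simp_all add: p)
  thus ?thesis by (simp add: cyc_act_def)
 qed
 thus ?thesis by (cases gs; cases "tl gs") (auto simp: cry_simps hact_simps)
qed

lemma S_value_Zr: "gamH p = p ==> p * Zr n a gs = Zr n (p * a) gs"
proof -
 assume p: "gamH p = p"
 have h: "hact g p = p" for g
 proof -
  have "(gamH ^^ k) p = p" for k by (induction k) (simp_all add: p)
  thus ?thesis by (simp add: cyc_act_def)
 qed
 have c: "p * (cry ^^ k) f gs = (cry ^^ k) (%hs. p * f hs) gs" for k f gs
  by (induction k arbitrary: gs) (simp_all add: S_value_cry[OF p])
 have "p * crs9 a gs = crs9 (p * a) gs" for gs
  by (simp add: cyc.cross_def[OF cyc9] cyc.psum_def[OF cyc9] sum_distrib_left hact_simps h del: One_nat_def)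
 thus ?thesis unfolding Zr_def c by simp
qed

lemma S_value_eqc:
 assumes p: "gamH p = p" "p \<in> Mhat_part s" and e: "eqc n t f g"
 shows "eqc n (t + s) (%gs. p * f gs) (%gs. p * g gs)"
proof -
 have h: "hact g p = p" for g
 proof -
  have "(gamH ^^ k) p = p" for k by (induction k) (simp_all add: p(1))
  thus ?thesis by (simp add: cyc_act_def)
 qed
 obtain z where z: "!!hs. cyc.tup C9 (n - 1) hs ==> z hs \<in> Mhat_part t"
  "!!gs. cyc.tup C9 (Suc (n - 1)) gs ==> f gs - g gs = hd3 z gs"
  using e unfolding eqc_def cyc.cob_def[OF cyc9] by blast
 have "p * f gs - p * g gs = hd3 (%hs. p * z hs) gs" if "cyc.tup C9 (Suc (n - 1)) gs" for gs
  using z(2)[OF that] bar_diff_map[of "%x. p * x" gs z] by (simp add: distrib_left hact_simps h right_diff_distrib[symmetric])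
 moreover have "p * z hs \<in> Mhat_part (t + s)" if "cyc.tup C9 (n - 1) hs" for hs
  using hp_ops(2)[OF p(2) z(1)[OF that]] by (simp add: add.commute)
 ultimately show ?thesis unfolding eqc_def cyc.cob_def[OF cyc9]
  by (intro exI[of _ "%hs. p * z hs"]) auto
qed

lemma eqc_cry: "n > 0 ==> eqc n t f g ==> eqc (2 * k + n) t ((cry ^^ k) f) ((cry ^^ k) g)"
 unfolding eqc_def using cyc.cob_carry_pow[OF cyc9, of t "n - 1" "%gs. f gs - g gs" k]
 unfolding cry_pow_diff by simp

lemma Zr_cry: "(cry ^^ k) (Zr n a) = Zr (2 * k + n) a"
proof -
 have "(2 * k + n) div 2 = k + n div 2" "even (2 * k + n) = even n" by simp_all
 thus ?thesis unfolding Zr_def by (simp add: funpow_add)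
qed

lemma av_mult:
 assumes a: "a \<in> S_part (2 * m) s" and v: "v \<in> free_part n t" and av: "(%x. a * v x) \<in> free_part n' (t + s)" and nn: "even n = even n'"
 shows "triv n (crdH (av n' (t + s) (%x. a * v x)) - crdH (S_value a * av n t v))"
proof -
 have Y: "Yr n' = Yr n" unfolding Yr_def nn ..
 have "triv n (Yr n (cv (%x. a * v x)) - Yr n (%x. La a * cv v x))"
 proof (rule triv_eq9)
  fix x show "eq9 (cv (%x. a * v x) x) (La a * cv v x)"
   using eq9_mult[OF eq9_refl La_mult, of "cL (unit x)" a "v x"] by (simp add: cv_def mult_ac)
 qed
 thus ?thesis unfolding crdH_av[OF av] crdH_S_value crdH_av[OF v] Yr_sc Y .
qed

theorem Th_smult:
 assumes n: "n > 0" "0 < int n + 2 * m" and a: "a \<in> S_part (2 * m) s"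
  and f: "Th n t v f" and f': "Th (nat (int n + 2 * m)) (t + s) (%x. a * v x) f'"
 shows "cup C9 hact (2 * nat (- m)) (b1_power (nat (- m))) f'
   - cup C9 hact (2 * nat m) (b1_power (nat m)) (%gs. S_value a * f gs)
   \<in> Bh (n + 2 * nat m) (t + s)"
proof -
 \<comment> \<open>The degree of the product. Both sides are compared in degree
   \<open>n + 2 * nat m\<close>, which equals \<open>n' + 2 * nat (- m)\<close>, after
   multiplication by the power of b1 on the respective side.\<close>
 define n' where "n' = nat (int n + 2 * m)"
 have n': "n' > 0" "even n = even n'" "2 * nat (- m) + n' = 2 * nat m + n"
  using n by (auto simp: n'_def even_nat_iff) 
 let ?N = "2 * nat m + n"
 have v: "v \<in> free_part n t" "f \<in> Zh n t" and e: "eqc n t f (Zr n (av n t v))" using f unfolding Th_def by blast+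
 have v': "(%x. a * v x) \<in> free_part n' (t + s)" "f' \<in> Zh n' (t + s)"
  and e': "eqc n' (t + s) f' (Zr n' (av n' (t + s) (%x. a * v x)))" using f' unfolding Th_def n'_def by blast+
 note Sg = S_value_gamma[OF a] and Sp = S_value_part[OF a]
 have c1: "cup C9 hact (2 * nat (- m)) (b1_power (nat (- m))) f' = cut ?N ((cry ^^ nat (- m)) f')"
  using cup_b1_power_cut[of n' f' "nat (- m)"] v'(2) n'(3) unfolding Zh_iff by simp
 have c2: "cup C9 hact (2 * nat m) (b1_power (nat m)) (%gs. S_value a * f gs) = cut ?N ((cry ^^ nat m) (%gs. S_value a * f gs))"
  by (rule cup_b1_power_cut) (use v(2) in \<open>simp add: Zh_iff\<close>)
 let ?b = "av n' (t + s) (%x. a * v x)"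
 have e1: "eqc ?N (t + s) ((cry ^^ nat (- m)) f') (Zr ?N ?b)"
  using eqc_cry[OF n'(1) e', of "nat (- m)"] unfolding Zr_cry n'(3) .
 have e2: "eqc ?N (t + s) ((cry ^^ nat m) (%gs. S_value a * f gs)) (Zr ?N (S_value a * av n t v))"
  using eqc_cry[OF n(1) S_value_eqc[OF Sg Sp e], of "nat m"] unfolding S_value_Zr[OF Sg] Zr_cry[symmetric] .
 have ok: "okp ?N ?b" using okp_av[OF v'(1)] n'(2) by (simp add: okp_def)
 have Sa: "S_value a * av n t v \<in> Mhat_part (t + s)" using hp_ops(2)[OF Sp av_part[OF v(1)]] by (simp add: add.commute)
 have ok2: "okp ?N (S_value a * av n t v)"
 proof -
  have "(gamH ^^ k) (S_value a * x) = S_value a * (gamH ^^ k) x" for k x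
   by (induction k) (simp_all add: hg_simps Sg)
  thus ?thesis using okp_av[OF v(1)] unfolding okp_def nrm_sum by (auto simp: hg_simps Sg sum_distrib_left[symmetric])
 qed
 have tN: "triv ?N = triv n" unfolding triv_def by (simp add: fun_eq_iff)
 have "eqc ?N (t + s) (Zr ?N ?b) (Zr ?N (S_value a * av n t v))"
  using av_mult[OF a v(1) v'(1) n'(2)] n(1) by (simp add: eqc_Zr[OF _ av_part[OF v'(1)] ok Sa ok2] tN)
 hence E: "eqc ?N (t + s) ((cry ^^ nat (- m)) f') ((cry ^^ nat m) (%gs. S_value a * f gs))"
  using eqc_trans[OF e1] eqc_sym[OF e2] eqc_trans by blast
 have N: "?N > 0" using n(1) by simp
 have eN: "n + 2 * nat m = ?N" by simp
 let ?F = "(cry ^^ nat (- m)) f'" and ?G = "(cry ^^ nat m) (%gs. S_value a * f gs)"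
 have "cob9 (t + s) (?N - 1) (%gs. cut ?N ?F gs - cut ?N ?G gs)"
  by (rule cyc.cob_cong[OF cyc9 E[unfolded eqc_def]]) (use N in \<open>simp add: cut_def tup9_def\<close>)
 thus ?thesis unfolding c1 c2 eN Bh_iff[OF N] fun_diff_def by (simp add: cut_def)
qed

lemma free_part_smult:
 fixes v :: "gen => 'w S"
 assumes "v \<in> free_part n t" "a \<in> S_part (2 * m) s" "0 < int n + 2 * m"
 shows "(%x. a * v x) \<in> free_part (nat (int n + 2 * m)) (t + s)"
proof -
 have S: "a * b \<in> S_part (k + l) (\<sigma> + ta)" if ab: "a \<in> S_part k \<sigma>" "b \<in> S_part l ta" for a b :: "'w S" and k l \<sigma> ta
  unfolding S_part_def
 proof (intro CollectI allI ballI, clarify)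
  fix i j p q assume "(p, q) \<in> keys ((a * b) $ i $ j)"
  hence "(p, q) \<in> keys (\<Sum>i'=0..i. \<Sum>j'=0..j. a $ i' $ j' * b $ (i - i') $ (j - j'))"
   by (simp add: fps_mult_nth fps_sum_nth)
  then obtain i' where i': "i' \<in> {0..i}" "(p, q) \<in> keys (\<Sum>j'=0..j. a $ i' $ j' * b $ (i - i') $ (j - j'))"
   using subsetD[OF keys_sum] by fast
  then obtain j' where j': "j' \<in> {0..j}" "(p, q) \<in> keys (a $ i' $ j' * b $ (i - i') $ (j - j'))"
   using subsetD[OF keys_sum] by fast
  have ij: "i' \<le> i" "j' \<le> j" "(p, q) \<in> keys (a $ i' $ j' * b $ (i - i') $ (j - j'))"
   using i' j' by auto
  then obtain x y where xy: "x \<in> keys (a $ i' $ j')" "y \<in> keys (b $ (i - i') $ (j - j'))" "(p, q) = x + y"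
   using Poly_Mapping.keys_mult by blast
  have "k = 2 * fst x & \<sigma> = - 6 * int i' - 12 * int j' - 18 * snd x" using ab(1) xy(1) unfolding S_part_def by fastforce
  moreover have "l = 2 * fst y & ta = - 6 * int (i - i') - 12 * int (j - j') - 18 * snd y" using ab(2) xy(2) unfolding S_part_def by fastforce
  moreover have "p = fst x + fst y" "q = snd x + snd y" using xy(3) by (metis fst_conv fst_add, metis snd_conv snd_add)
  ultimately show "k + l = 2 * p & \<sigma> + ta = - 6 * int i - 12 * int j - 18 * q" using ij(1,2) by (auto simp: of_nat_diff)
 qed
 show ?thesis unfolding free_part_def
 proof (intro CollectI allI)
  fix x
  have "v x \<in> S_part (int n - int (fst (gen_deg x))) (t - snd (gen_deg x))" using assms(1) unfolding free_part_def by blast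
  from S[OF assms(2) this] show "a * v x \<in> S_part (int (nat (int n + 2 * m)) - int (fst (gen_deg x))) (t + s - snd (gen_deg x))"
   using assms(3) by (simp add: alg)
 qed
qed

theorem Th_detect:
 assumes n: "n = fst (gen_deg x) + 2 * k" "n > 0" and f: "Th n (snd (gen_deg x)) (gen_mult (S_monom 1 (int k) 0 0 0) x) f"
 shows "res_C3 f - cup C3 hact (2 * k) (res_C3 (b1_power k)) (detecting c1 x) \<in> coboundaries C3 hact n (Mhat_part (snd (gen_deg x)))"
  and "x = Gen_1 ==> f - b1_power k \<in> Bh n 0"
proof -
 let ?t = "snd (gen_deg x)" and ?v = "gen_mult (S_monom 1 (int k) 0 0 0 :: 'w S) x"
 have v: "?v \<in> free_part n ?t" "f \<in> Zh n ?t" and e: "eqc n ?t f (Zr n (av n ?t ?v))" using f unfolding Th_def by blast+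
 have ok: "okgen n x" using n by (simp add: okgen_def)
 have "triv n (Yr n (cv ?v) - Yr n (ex x))"
 proof (rule triv_eq9)
  fix y show "eq9 (cv ?v y) (ex x y)"
   using cv_eq9[of ?v y "if y = x then 1 else 0"] La_S_monom[of 1 "int k" 0 0 0] eq9_refl[of 0]
   by (auto simp: gen_mult_def ex_def La_0 split: if_splits)
 qed
 hence "triv n ((crdH (gel x) - Yr n (ex x)) - (Yr n (cv ?v) - Yr n (ex x)))" by (rule triv_diff[OF gel_triv[OF ok]])
 hence "triv n (crdH (gel x) - crdH (av n ?t ?v))" by (simp add: crdH_av[OF v(1)])
 hence "eqc n ?t (Zr n (gel x)) (Zr n (av n ?t ?v))"
  by (simp add: eqc_Zr n(2) gel_part okp_gel[OF ok] av_part[OF v(1)] okp_av[OF v(1)])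
 hence E: "eqc n ?t f (Zr n (gel x))" using eqc_trans[OF e eqc_sym] by blast
 have "cob3 ?t (n - 1) (%gs. (f gs - Zr n (gel x) gs) + (Zr n (gel x) gs - (cry ^^ k) (detecting c1 x) gs))"
  by (intro cyc.cob_add[OF cyc3] cob_res[OF E[unfolded eqc_def]] gel_detect n)
 hence "cob3 ?t (n - 1) (%gs. f gs - (cry ^^ k) (detecting c1 x) gs)" by simp
 thus "res_C3 f - cup C3 hact (2 * k) (res_C3 (b1_power k)) (detecting c1 x) \<in> coboundaries C3 hact n (Mhat_part ?t)"
  by (intro detect_coboundary[OF n _ detecting_zero]) (use v(2) in \<open>auto simp: Zh_iff\<close>)
 assume x: "x = Gen_1"
 have n': "n = 2 * k" using n x by simp
 have "Zr n (gel x) = (cry ^^ k) (%_. 1)" unfolding n' by (simp add: Zr_def x gel_simps)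
 hence "cob9 0 (n - 1) (%gs. f gs - cut n ((cry ^^ k) (%_. 1)) gs)"
  unfolding cob_cut[OF n(2)] using E x unfolding eqc_def by simp
 thus "f - b1_power k \<in> Bh n 0"
  unfolding Bh_iff[OF n(2)] b1_power_cut n'[symmetric] fun_diff_def using v(2) by (simp add: Zh_iff cut_def)
qed

end

subsection \<open>The isomorphism\<close>

lemma comm_group_add_grp:
 fixes A :: "'a::ab_group_add set"
 assumes "0 \<in> A" "!!x y. x \<in> A ==> y \<in> A ==> x + y \<in> A" "!!x. x \<in> A ==> - x \<in> A"
 shows "comm_group (add_grp A)"
proof (rule comm_groupI)
 fix x assume "x \<in> carrier (add_grp A)"
 thus "EX y:carrier (add_grp A). y \<otimes>\<^bsub>add_grp A\<^esub> x = \<one>\<^bsub>add_grp A\<^esub>"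
  using assms(3) by (intro bexI[of _ "- x"]) (simp_all add: add_grp_def)
qed (simp_all add: add_grp_def assms(1,2) add_ac)

lemma subgroup_add_grp:
 fixes A :: "'a::ab_group_add set"
 assumes A: "0 \<in> A" "!!x y. x \<in> A ==> y \<in> A ==> x + y \<in> A" "!!x. x \<in> A ==> - x \<in> A"
  and B: "B <= A" "0 \<in> B" "!!x y. x \<in> B ==> y \<in> B ==> x + y \<in> B" "!!x. x \<in> B ==> - x \<in> B"
 shows "B \<lhd> add_grp A"
proof -
 interpret comm_group "add_grp A" by (rule comm_group_add_grp[OF A])
 have "subgroup B (add_grp A)"
 proof
  fix x assume x: "x \<in> B"
  have "inv\<^bsub>add_grp A\<^esub> x = - x"
   by (rule inv_equality) (use x B A in \<open>auto simp: add_grp_def\<close>)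
  thus "inv\<^bsub>add_grp A\<^esub> x \<in> B" using B(4)[OF x] by simp
 qed (use B in \<open>auto simp: add_grp_def\<close>)
 thus ?thesis by (rule subgroup_imp_normal)
qed

lemma rcoset_add_grp: "B #>\<^bsub>add_grp A\<^esub> x = {b + x | b. b \<in> B}"
 by (auto simp: r_coset_def add_grp_def)

text \<open>T is an additive correspondence, total on both sides, under which R and B match. Hence
  sending v to all its partners is a homomorphism onto the cosets of B with kernel R.\<close>

lemma quot_iso:
 fixes P R :: "'a::ab_group_add set" and Z B :: "'b::ab_group_add set"
 assumes P: "0 \<in> P" "!!x y. x \<in> P ==> y \<in> P ==> x + y \<in> P" "!!x. x \<in> P ==> - x \<in> P"
  and Z: "0 \<in> Z" "!!x y. x \<in> Z ==> y \<in> Z ==> x + y \<in> Z" "!!x. x \<in> Z ==> - x \<in> Z"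
  and B: "B <= Z" "0 \<in> B" "!!x y. x \<in> B ==> y \<in> B ==> x + y \<in> B" "!!x. x \<in> B ==> - x \<in> B"
  and R: "R <= P"
  and T: "!!v f. T v f ==> v \<in> P & f \<in> Z" "!!v. v \<in> P ==> EX f. T v f" "!!f. f \<in> Z ==> EX v. T v f"
   "!!v f w g. T v f ==> T w g ==> T (v + w) (f + g)" "!!v f. T v f ==> v \<in> R <-> f \<in> B"
   "!!v f b. T v f ==> b \<in> B ==> T v (f + b)"
 shows "(%X. the_elem ((%v. {f. T v f}) ` X)) \<in> iso (add_grp P Mod R) (add_grp Z Mod B)"
  and "!!v f. v \<in> P ==> f \<in> the_elem ((%v. {f. T v f}) ` (R #>\<^bsub>add_grp P\<^esub> v)) ==> T v f"
proof -
 let ?h = "%v. {f. T v f}" and ?Q = "add_grp Z Mod B"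
 have T00: "T v 0" if "T v f" "f \<in> B" for v f using T(6)[OF that(1) B(4)[OF that(2)]] by simp
 have R0: "0 \<in> R"
 proof -
  obtain f where f: "T 0 f" using T(2) P(1) by blast
  obtain w where w: "T w (- f)" using T(3) Z(3) T(1)[OF f] by blast
  from T(4)[OF f w] have "w \<in> R" using T(5) B(2) by force
  thus ?thesis using T(5)[OF w] T(5)[OF f] B(4)[of "- f"] by simp
 qed
 have fB: "f \<in> B" if "T 0 f" for f using T(5)[OF that] R0 by blast
 have neg: "T (- v) (- f)" if vf: "T v f" for v f
 proof -
  obtain h where h: "T (- v) h" using T(2) P(3) T(1)[OF vf] by blast
  have "f + h \<in> B" using T(4)[OF vf h] by (auto intro: fB)
  from T(6)[OF h B(4)[OF this]] show ?thesis by simp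
 qed
 have hB: "?h v = B #>\<^bsub>add_grp Z\<^esub> f0" if f0: "T v f0" for v f0
  unfolding rcoset_add_grp
 proof (intro equalityI subsetI CollectI)
  fix f assume "f \<in> ?h v"
  hence "f - f0 \<in> B" using fB[of "f - f0"] T(4)[OF _ neg[OF f0], of v f] by simp
  thus "EX b. f = b + f0 & b \<in> B" by (intro exI[of _ "f - f0"]) simp
 next
  fix f assume "f \<in> {b + f0 | b. b \<in> B}"
  thus "T v f" using T(6)[OF f0] by (auto simp: add.commute)
 qed
 have car: "carrier ?Q = {B #>\<^bsub>add_grp Z\<^esub> f | f. f \<in> Z}"
  unfolding FactGroup_def RCOSETS_def by (auto simp: add_grp_def)
 have nB: "B \<lhd> add_grp Z" by (rule subgroup_add_grp[OF Z B])
 have hom: "?h \<in> hom (add_grp P) ?Q"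
 proof (rule homI)
  fix v assume "v \<in> carrier (add_grp P)"
  then obtain f where f: "T v f" using T(2) by (auto simp: add_grp_def)
  thus "?h v \<in> carrier ?Q" unfolding hB[OF f] car using T(1) by blast
  fix w assume "w \<in> carrier (add_grp P)"
  then obtain g where g: "T w g" using T(2) by (auto simp: add_grp_def)
  show "?h (v \<otimes>\<^bsub>add_grp P\<^esub> w) = ?h v \<otimes>\<^bsub>?Q\<^esub> ?h w"
   using hB[OF T(4)[OF f g]] normal.rcos_sum[OF nB, of f g] T(1)[OF f] T(1)[OF g]
   unfolding hB[OF f] hB[OF g] FactGroup_def by (simp add: add_grp_def)
 qed
 interpret group_hom "add_grp P" ?Q ?h
  using comm_group.axioms(2)[OF comm_group_add_grp[OF P]] normal.factorgroup_is_group[OF nB] hom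
  by (simp add: group_hom_def group_hom_axioms_def)
 have "v \<in> R <-> ?h v = B" if v: "v \<in> P" for v
 proof -
  obtain f where f: "T v f" using T(2) v by blast
  have "?h v = B" if "f \<in> B" using hB[OF T00[OF f that]] by (simp add: rcoset_add_grp)
  thus ?thesis using T(5)[OF f] f by blast
 qed
 hence ker: "kernel (add_grp P) ?Q ?h = R"
  using R unfolding kernel_def by (auto simp: add_grp_def FactGroup_def)
 have "?h ` P = carrier ?Q"
 proof (intro equalityI subsetI)
  fix F assume "F \<in> carrier ?Q"
  then obtain f where f: "F = B #>\<^bsub>add_grp Z\<^esub> f" "f \<in> Z" unfolding car by blast
  obtain v where v: "T v f" using T(3) f(2) by blast
  thus "F \<in> ?h ` P" using hB[OF v] T(1)[OF v] f(1) by blast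
 qed (use hom in \<open>auto simp: hom_def add_grp_def\<close>)
 from FactGroup_iso_set[unfolded ker] this
 show "(%X. the_elem (?h ` X)) \<in> iso (add_grp P Mod R) ?Q" by (simp add: add_grp_def)
 fix v f assume v: "v \<in> P" and f: "f \<in> the_elem (?h ` (R #>\<^bsub>add_grp P\<^esub> v))"
 obtain g where g: "T v g" using T(2) v by blast
 have "?h w = ?h v" if w: "w \<in> R #>\<^bsub>add_grp P\<^esub> v" for w
 proof -
  obtain r where r: "w = r + v" "r \<in> R" using w unfolding rcoset_add_grp by blast
  obtain b where b: "T r b" using T(2) R r(2) by blast
  have "T r 0" using T00[OF b] T(5)[OF b] r(2) by blast
  from T(4)[OF this g] have "T w g" by (simp add: r(1))
  thus ?thesis by (simp only: hB[OF g] hB)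
 qed
 moreover have "v \<in> R #>\<^bsub>add_grp P\<^esub> v" unfolding rcoset_add_grp using R0 by force
 ultimately have "the_elem (?h ` (R #>\<^bsub>add_grp P\<^esub> v)) = ?h v" by (intro the_elem_image_unique) blast+
 with f show "T v f" by blast
qed

lemma single_power: "single k (1 :: 'a::comm_ring_1) ^ n = single (int n * k) 1"
 by (induction n) (simp_all add: mult_single alg)

lemma lookup_single_mult:
 fixes q :: "int \<Rightarrow>\<^sub>0 'a::comm_ring_1"
 shows "lookup (single k a * q) j = a * lookup q (j - k)"
 by (induction q rule: poly_mapping_induct_add)
  (auto simp: mult_single lookup_add lookup_single when_def distrib_left)

lemma E6_part_ops: "p \<in> E6_part t ==> q \<in> E6_part s ==> p * q \<in> E6_part (t + (s :: int) )"
 "0 \<in> E6_part t" "single j a \<in> E6_part (- 2 * j)"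
 for p q :: "'a::comm_ring_1 E6"
proof -
 show "p \<in> E6_part t ==> q \<in> E6_part s ==> p * q \<in> E6_part (t + s)"
  unfolding E6_part_def using Poly_Mapping.keys_mult[of p q] by fastforce
qed (auto simp: E6_part_def)

lemma E6_part_add: "p \<in> E6_part t ==> q \<in> E6_part t ==> p + q \<in> E6_part t"
 and E6_part_minus: "p \<in> E6_part t ==> - p \<in> E6_part t" for p q :: "'a::comm_ring_1 E6"
 unfolding E6_part_def using Poly_Mapping.keys_add[of p q] by auto

lemma E6_part_power: "p \<in> E6_part t ==> p ^ n \<in> E6_part (int n * t)" for p :: "'a::comm_ring_1 E6"
proof (induction n)
 case 0
 have "(1 :: 'a E6) = single 0 1" by simp
 thus ?case using E6_part_ops(3)[of 0 "1 :: 'a E0"] by simp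
next
 case (Suc n)
 thus ?case using E6_part_ops(1)[of p t "p ^ n" "int n * t"] by (simp add: alg)
qed

text \<open>The action sends u to h u, and the images of u and of its inverse have product 1. Hence
  h is a unit of degree 0, and the image of the inverse can only have a coefficient at exponent
  -1.\<close>

lemma action_part:
 fixes \<Gamma> :: "'w::comm_ring_1 E6 => 'w E6"
 assumes "E6_C9_action res \<Gamma>" and p: "p \<in> E6_part t"
 shows "\<Gamma> p \<in> E6_part t"
proof -
 obtain \<phi> h where hom: "is_ring_hom \<Gamma>" and \<phi>: "!!a. \<Gamma> (single 0 a) = single 0 (\<phi> a)"
  and u: "\<Gamma> (single 1 1) = single 1 (h :: 'w E0)"
  using assms(1) unfolding E6_C9_action_def stabilizer_action_def by blast
 note H = hom[unfolded is_ring_hom_def]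
 have m: "\<Gamma> (a * b) = \<Gamma> a * \<Gamma> b" for a b using H by blast
 have pw: "\<Gamma> (a ^ n) = \<Gamma> a ^ n" for a n by (rule ring_hom_power[OF hom])
 define q where "q = \<Gamma> (single (- 1) 1)"
 have "single 1 h * q = \<Gamma> (single 1 1 * single (- 1) 1)" unfolding q_def m u ..
 also have "... = 1" using H by (simp add: mult_single)
 finally have q1: "h * lookup q (j - 1) = lookup 1 j" for j
  using lookup_single_mult[of 1 h q j] by simp
 have "q \<in> E6_part 2" unfolding E6_part_def
 proof (intro CollectI ballI, rule ccontr)
  fix j assume j: "j \<in> keys q" "2 ~= - 2 * j"
  have inv: "h * lookup q (- 1) = 1" using q1[of 0] by (simp add: lookup_one)
  have "h * lookup q j = 0" using q1[of "j + 1"] j(2) by (simp add: lookup_one when_def)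
  moreover have "h * lookup q (- 1) * lookup q j = h * lookup q j * lookup q (- 1)"
   by (simp only: mult.assoc mult.commute[of "lookup q (- 1)" "lookup q j"])
  ultimately have "h * lookup q (- 1) * lookup q j = 0" by (simp only: mult_zero_left)
  thus False using inv j(1) by (simp add: in_keys_iff)
 qed
 hence single: "\<Gamma> (single j a) \<in> E6_part (- 2 * j)" for j a
 proof -
  have "single j a = single 0 a * (single 1 1 ^ nat j * single (- 1) 1 ^ nat (- j))"
   unfolding single_power by (cases "j \<ge> 0") (simp_all add: mult_single)
  hence e: "\<Gamma> (single j a) = single 0 (\<phi> a) * (single 1 h ^ nat j * q ^ nat (- j))"
   by (simp only: m pw \<phi> u q_def)
  have "single 0 (\<phi> a) * (single 1 h ^ nat j * q ^ nat (- j)) \<in> E6_part (- 2 * 0 + (int (nat j) * (- 2 * 1) + int (nat (- j)) * 2))"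
   by (intro E6_part_ops(1,3) E6_part_power \<open>q \<in> E6_part 2\<close>)
  moreover have "- 2 * 0 + (int (nat j) * (- 2 * 1) + int (nat (- j)) * 2) = - 2 * j" by (cases "j \<ge> 0") simp_all
  ultimately show ?thesis unfolding e by simp
 qed
 show ?thesis
 proof (cases "p = 0")
  case True
  thus ?thesis using ring_hom_0[OF hom] by (simp add: E6_part_ops)
 next
  case False
  then obtain j where j: "j \<in> keys p" by fastforce
  have t: "t = - 2 * j" using p j unfolding E6_part_def by blast
  have "i = j" if "i \<in> keys p" for i using p that t unfolding E6_part_def by auto
  hence "p = single j (lookup p j)"
   by (intro poly_mapping_eqI) (auto simp: lookup_single when_def in_keys_iff)
  thus ?thesis using single[of j "lookup p j"] t by simp
 qed
qed

lemma S_part_S_monom: "S_monom 1 k 0 0 0 \<in> S_part (2 * k) 0"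
 unfolding S_part_def S_monom_def by auto

section \<open>Transport along the given isomorphism\<close>

context wc
begin

context
 fixes \<Gamma> :: "'w E6 => 'w E6" and \<theta> :: "'w E6 => 'w Mhat"
 assumes act: "E6_C9_action res \<Gamma>" and th: "graded_WC9_iso \<Gamma> \<theta>"
begin

lemma th_add: "\<theta> (p + q) = \<theta> p + \<theta> q" and th_act: "\<theta> (\<Gamma> p) = gamH (\<theta> p)"
 and th_bij: "bij_betw \<theta> (E6_part t) (Mhat_part t)"
 using th unfolding graded_WC9_iso_def by blast+

lemma th_0: "\<theta> 0 = 0"
 using th_add[of 0 0] by simp

lemma th_minus: "\<theta> (- p) = - \<theta> p"
 using th_add[of p "- p"] th_0 by (simp add: eq_neg_iff_add_eq_0 add.commute)

lemma th_inj: "p \<in> E6_part t ==> q \<in> E6_part t ==> \<theta> p = \<theta> q ==> p = q"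
 using th_bij[of t] unfolding bij_betw_def inj_on_def by blast

lemma th_part: "p \<in> E6_part t ==> \<theta> p \<in> Mhat_part t"
 using th_bij[of t] unfolding bij_betw_def by blast

abbreviation "gE == cyc_act \<Gamma>"
abbreviation "cpt f == (%gs. \<theta> (f gs))"
abbreviation "E6c n t == cochains C9 n (E6_part t)"

lemma cob_th: "\<theta> (coboundary_map C9 gE n f gs) = coboundary_map C9 hact n (cpt f) gs"
proof -
 have "\<theta> ((\<Gamma> ^^ k) x) = (gamH ^^ k) (\<theta> x)" for k x by (induction k) (simp_all add: th_act)
 thus ?thesis
  unfolding cobmap_bar[OF mult_C9(1)] bar_diff_def
  by (simp add: th_add th_0 cyc_act_def bar_tail_hom[of \<theta>, OF th_add])
qed

lemma cob_E6:
 assumes f: "f \<in> E6c n t"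
 shows "coboundary_map C9 gE n f \<in> E6c (Suc n) t"
proof -
 \<comment> \<open>The tail of the bar differential does not involve the action, so the closure
   lemma for it can be applied with the identity as action; the remaining term is handled by
   \<open>action_part\<close>.\<close>
 have id: "cyc C9 (id :: 'w E6 => _) 1 9 (E6_part t)"
 proof
  have "{0..<9} = int ` {..<9}" by (metis image_int_atLeastLessThan lessThan_atLeast0 of_nat_0 of_nat_numeral)
  thus "carrier C9 = (%i. int (1 * i)) ` {..<9}" by (simp add: carrier_C9)
 qed (simp_all add: mult_C9 E6_part_ops E6_part_add E6_part_minus)
 have fv: "f hs \<in> E6_part t" if "length hs = n" "set hs <= carrier C9" for hs
  using f that unfolding cochains_def by (auto split: if_splits)
 have "bar_diff gE f gs \<in> E6_part t" if gs: "length gs = Suc n" "set gs <= carrier C9" for gs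
 proof -
  have "btl f gs \<in> E6_part t"
   by (rule cyc.bar_tail_A[OF id]) (use gs in \<open>auto simp: cyc.tup_def[OF id] intro: fv\<close>)
  moreover have "(\<Gamma> ^^ k) x \<in> E6_part t" if "x \<in> E6_part t" for k x
   by (induction k) (simp_all add: that action_part[OF act])
  moreover have "f (tl gs) \<in> E6_part t" by (rule fv) (use gs in \<open>cases gs; simp\<close>)+
  ultimately show ?thesis unfolding bar_diff_def cyc_act_def by (intro E6_part_add)
 qed
 thus ?thesis unfolding cochains_def cobmap_bar[OF mult_C9(1)] by simp
qed

lemma th_lift:
 assumes g: "g \<in> cochains C9 n (Mhat_part t)"
 shows "EX f:E6c n t. cpt f = g"
proof -
 define f where "f gs = (if length gs = n & set gs <= carrier C9 then inv_into (E6_part t) \<theta> (g gs) else 0)" for gs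
 have r: "\<theta> ` E6_part t = Mhat_part t" using th_bij[of t] unfolding bij_betw_def by blast
 have g': "g gs \<in> Mhat_part t" if "length gs = n" "set gs <= carrier C9" for gs
  using g that unfolding cochains_def by (auto split: if_splits)
 have "f \<in> E6c n t" unfolding cochains_def f_def using g' r by (auto intro: inv_into_into)
 moreover have "cpt f = g"
 proof
  fix gs show "cpt f gs = g gs"
   using g g'[of gs] r th_0 unfolding cochains_def f_def by (auto simp: f_inv_into_f split: if_splits)
 qed
 ultimately show ?thesis by blast
qed

lemma th_cochain: "f \<in> E6c n t ==> cpt f \<in> cochains C9 n (Mhat_part t)"
 unfolding cochains_def using th_part th_0 by (auto split: if_splits)

lemma th_cochain_inj: "f \<in> E6c n t ==> g \<in> E6c n t ==> cpt f = cpt g ==> f = g"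
proof
 fix gs assume fg: "f \<in> E6c n t" "g \<in> E6c n t" "cpt f = cpt g"
 show "f gs = g gs"
 proof (cases "length gs = n & set gs <= carrier C9")
  case True
  hence "f gs \<in> E6_part t" "g gs \<in> E6_part t" using fg(1,2) unfolding cochains_def by (auto split: if_splits)
  thus ?thesis using th_inj fun_cong[OF fg(3), of gs] by blast
 next
  case False
  thus ?thesis using fg(1,2) unfolding cochains_def by (auto split: if_splits)
 qed
qed

lemma Z_iff: "f \<in> cocycles C9 gE n (E6_part t) <-> f \<in> E6c n t & cpt f \<in> Zh n t"
proof -
 have "coboundary_map C9 gE n f = 0 <-> coboundary_map C9 hact n (cpt f) = 0" if f: "f \<in> E6c n t"
 proof -
  have "coboundary_map C9 gE n f = 0 <-> cpt (coboundary_map C9 gE n f) = cpt 0"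
   using th_cochain_inj[OF cob_E6[OF f], of 0] by (auto simp: cochains_def E6_part_ops)
  thus ?thesis unfolding cob_th by (simp add: th_0 zero_fun_def)
 qed
 thus ?thesis unfolding cocycles_def using th_cochain by blast
qed

lemma B_iff: "n > 0 ==> f \<in> coboundaries C9 gE n (E6_part t) <-> f \<in> E6c n t & cpt f \<in> Bh n t"
proof -
 assume "n > 0"
 then obtain m where n: "n = Suc m" by (cases n) auto
 show ?thesis unfolding n coboundaries.simps
 proof
  assume "f \<in> coboundary_map C9 gE m ` E6c m t"
  then obtain z where z: "f = coboundary_map C9 gE m z" "z \<in> E6c m t" by blast
  thus "f \<in> E6c (Suc m) t & cpt f \<in> coboundary_map C9 hact m ` cochains C9 m (Mhat_part t)"
   using cob_E6 cob_th th_cochain by auto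
 next
  assume a: "f \<in> E6c (Suc m) t & cpt f \<in> coboundary_map C9 hact m ` cochains C9 m (Mhat_part t)"
  then obtain y where y: "cpt f = coboundary_map C9 hact m y" "y \<in> cochains C9 m (Mhat_part t)" by blast
  obtain z where z: "z \<in> E6c m t" "cpt z = y" using th_lift[OF y(2)] by blast
  have "cpt f = cpt (coboundary_map C9 gE m z)" unfolding cob_th z(2) y(1) ..
  hence "f = coboundary_map C9 gE m z" using th_cochain_inj a cob_E6[OF z(1)] by blast
  thus "f \<in> coboundary_map C9 gE m ` E6c m t" using z(1) by blast
 qed
qed

definition Tt :: "nat => int => (gen => 'w S) => (int list => 'w E6) => bool" where
 "Tt n t v f <-> f \<in> cocycles C9 gE n (E6_part t) & Th n t v (cpt f)"

lemma Zh_cochain: "g \<in> Zh n t ==> g \<in> cochains C9 n (Mhat_part t)"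
 unfolding cocycles_def by blast

lemma Zh_minus: "g \<in> Zh n t ==> (%gs. - g gs) \<in> Zh n t"
 unfolding Zh_iff coc9_iff by (simp add: hp_ops cyc.d_uminus[OF cyc9])

lemma Bh_ops: "n > 0 ==> g \<in> Bh n t ==> h \<in> Bh n t ==> (%gs. g gs + h gs) \<in> Bh n t"
 "n > 0 ==> g \<in> Bh n t ==> (%gs. - g gs) \<in> Bh n t" "n > 0 ==> (%gs. 0) \<in> Bh n t"
 "n > 0 ==> g \<in> Bh n t ==> g \<in> Zh n t"
proof -
 have z: "cob9 t m (%_. 0)" for m by (rule cyc.cob_zero[OF cyc9]) simp
 show "n > 0 ==> g \<in> Bh n t ==> h \<in> Bh n t ==> (%gs. g gs + h gs) \<in> Bh n t"
  by (auto simp: Bh_iff intro: cyc.cob_add[OF cyc9])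
 show "n > 0 ==> g \<in> Bh n t ==> (%gs. - g gs) \<in> Bh n t"
  using cyc.cob_diff[OF cyc9 z] by (fastforce simp: Bh_iff)
 show "n > 0 ==> (%gs. 0) \<in> Bh n t" using z by (simp add: Bh_iff)
 show "n > 0 ==> g \<in> Bh n t ==> g \<in> Zh n t"
  by (auto simp: Bh_iff Zh_iff dest: cyc.cob_coc[OF cyc9])
qed

lemma E6c_ops: "f \<in> E6c n t ==> g \<in> E6c n t ==> f + g \<in> E6c n t" "f \<in> E6c n t ==> - f \<in> E6c n t" "0 \<in> E6c n t"
 for f g :: "int list => 'w E6"
 unfolding cochains_def by (auto simp: E6_part_ops split: if_splits intro!: E6_part_add E6_part_minus)

lemma free_ops: "v \<in> free_part n t ==> w \<in> free_part n t ==> v + w \<in> free_part n t"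
 "v \<in> free_part n t ==> - v \<in> free_part n t" "0 \<in> free_part n t"
 using free_part_add[of v n t w] free_part_minus[of v n t] free_part_0[of n t]
 by (simp_all add: plus_fun_def fun_Compl_def zero_fun_def)

abbreviation "TT n t Y == the_elem ((%v. {f. Tt n t v f}) ` Y)"

lemma main_iso:
 assumes n: "n > 0"
 shows "TT n t \<in> iso (pres_module n t) (E2_page \<Gamma> n t)"
  and "!!v f. v \<in> free_part n t ==> f \<in> TT n t (pres_class n t v) ==> Tt n t v f"
proof -
 let ?Z = "cocycles C9 gE n (E6_part t)" and ?B = "coboundaries C9 gE n (E6_part t)"
 have ca: "cpt (f + g) = (%gs. \<theta> (f gs) + \<theta> (g gs))" "cpt (- f) = (%gs. - \<theta> (f gs))" "cpt 0 = (%_. 0)" for f g :: "int list => 'w E6"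
  by (auto simp: th_add th_minus th_0)
 note iff = Z_iff B_iff[OF n]
 have Zz: "0 \<in> ?Z" "!!x y. x \<in> ?Z ==> y \<in> ?Z ==> x + y \<in> ?Z" "!!x. x \<in> ?Z ==> - x \<in> ?Z"
  unfolding iff ca using Bh_ops(4)[OF n Bh_ops(3)[OF n]] E6c_ops Zh_add Zh_minus by blast+
 have Bb: "?B <= ?Z" "0 \<in> ?B" "!!x y. x \<in> ?B ==> y \<in> ?B ==> x + y \<in> ?B" "!!x. x \<in> ?B ==> - x \<in> ?B"
  unfolding iff ca subset_iff using Bh_ops[OF n] E6c_ops by blast+
 have T1: "Tt n t v f ==> v \<in> free_part n t & f \<in> ?Z" for v f unfolding Tt_def Th_def by blast
 have T2: "EX f. Tt n t v f" if "v \<in> free_part n t" for v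
 proof -
  obtain g where g: "Th n t v g" using Th_ex1[OF n \<open>v \<in> free_part n t\<close>] by blast
  hence "g \<in> Zh n t" unfolding Th_def by blast
  then obtain f where "f \<in> E6c n t" "cpt f = g" using th_lift[OF Zh_cochain] by blast
  thus ?thesis using g \<open>g \<in> Zh n t\<close> unfolding Tt_def Z_iff by blast
 qed
 have T3: "EX v. Tt n t v f" if "f \<in> ?Z" for f
  using Th_ex2[OF n, of "cpt f" t] that unfolding Tt_def Z_iff by blast
 have T4: "Tt n t (v + w) (f + g)" if "Tt n t v f" "Tt n t w g" for v w f g
  using Th_add[OF n, of t v "cpt f" w "cpt g"] that Zz(2) unfolding Tt_def ca plus_fun_def[of v w] by blast
 have T5: "v \<in> pres_rel n t <-> f \<in> ?B" if "Tt n t v f" for v f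
  using Th_triv[OF n, of t v "cpt f"] that unfolding Tt_def iff by blast
 have T6: "Tt n t v (f + b)" if "Tt n t v f" "b \<in> ?B" for v f b
 proof -
  have b: "cob9 t (n - 1) (cpt b)" using that(2) unfolding iff Bh_iff[OF n] by blast
  have f: "f \<in> ?Z" "Th n t v (cpt f)" using that(1) unfolding Tt_def by blast+
  have "f + b \<in> ?Z" using Zz(2)[OF f(1)] Bb(1) that(2) by blast
  moreover have "eqc n t (cpt (f + b)) (cpt f)" unfolding eqc_def ca using b by simp
  hence "Th n t v (cpt (f + b))" using f(2) eqc_trans calculation unfolding Th_def Z_iff by blast
  ultimately show ?thesis unfolding Tt_def by blast
 qed
 have R: "pres_rel n t <= free_part n t" unfolding pres_rel_def by blast
 note Q = quot_iso[of "free_part n t" ?Z ?B "pres_rel n t" "Tt n t", OF free_ops(3) free_ops(1) free_ops(2) Zz Bb R T1 T2 T3 T4 T5 T6]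
 show "TT n t \<in> iso (pres_module n t) (E2_page \<Gamma> n t)"
  unfolding pres_module_def E2_page_def cohomology_def by (rule Q(1))
 show "!!v f. v \<in> free_part n t ==> f \<in> TT n t (pres_class n t v) ==> Tt n t v f"
  unfolding pres_class_def by (rule Q(2))
qed

lemma main:
 "EX \<Phi> :: nat => int => (gen => 'w S) set => (int list => 'w E6) set.
  (ALL n>0. ALL t. \<Phi> n t \<in> iso (pres_module n t) (E2_page \<Gamma> n t)) &
  (ALL n>0. ALL t m s a v. 0 < int n + 2 * m --> a \<in> S_part (2 * m) s --> v \<in> free_part n t -->
    (let n' = nat (int n + 2 * m) in
    ALL f:\<Phi> n t (pres_class n t v). ALL f':\<Phi> n' (t + s) (pres_class n' (t + s) (%x. a * v x)).
     E2_smult \<theta> m s a n t f f')) &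
  (ALL x k. 0 < fst (gen_deg x) + 2 * k -->
    (let n = fst (gen_deg x) + 2 * k; t = snd (gen_deg x) in
    ALL f:\<Phi> n t (pres_class n t (gen_mult (S_monom 1 (int k) 0 0 0) x)).
     E2_detected \<theta> c1 k x f))"
proof (intro exI[of _ TT] conjI allI impI)
 fix n :: nat and t :: int
 assume n: "0 < n"
 show "TT n t \<in> iso (pres_module n t) (E2_page \<Gamma> n t)"
  by (rule main_iso(1)[OF n])
 fix m s and a :: "'w S" and v :: "gen => 'w S"
 assume a: "0 < int n + 2 * m" "a \<in> S_part (2 * m) s" "v \<in> free_part n t"
 show "let n' = nat (int n + 2 * m) in
    ALL f:TT n t (pres_class n t v).
    ALL f':TT n' (t + s) (pres_class n' (t + s) (%x. a * v x)).
     E2_smult \<theta> m s a n t f f'"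
  unfolding Let_def
 proof (intro ballI)
  fix f f'
  assume f: "f \<in> TT n t (pres_class n t v)"
   and f': "f' \<in> TT (nat (int n + 2 * m)) (t + s) (pres_class (nat (int n + 2 * m)) (t + s) (%x. a * v x))"
  have n': "0 < nat (int n + 2 * m)" using a(1) by simp
  have "Th n t v (cpt f)" "Th (nat (int n + 2 * m)) (t + s) (%x. a * v x) (cpt f')"
   using main_iso(2)[OF n a(3) f] main_iso(2)[OF n' free_part_smult[OF a(3,2,1)] f'] unfolding Tt_def by blast+
  thus "E2_smult \<theta> m s a n t f f'" unfolding E2_smult_def by (rule Th_smult[OF n a(1,2)])
 qed
next
 fix x k
 assume n: "0 < fst (gen_deg x) + 2 * k"
 have "gen_mult (S_monom 1 (int k) 0 0 0 :: 'w S) x \<in> free_part (fst (gen_deg x) + 2 * k) (snd (gen_deg x))"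
  using S_part_S_monom[of "int k"] by (auto simp: free_part_def gen_mult_def S_part_def)
 note I = main_iso(2)[OF n this]
 show "let n = fst (gen_deg x) + 2 * k; t = snd (gen_deg x) in
    ALL f:TT n t (pres_class n t (gen_mult (S_monom 1 (int k) 0 0 0) x)).
     E2_detected \<theta> c1 k x f"
  unfolding Let_def
 proof (intro ballI)
  fix f assume "f \<in> TT (fst (gen_deg x) + 2 * k) (snd (gen_deg x)) (pres_class (fst (gen_deg x) + 2 * k) (snd (gen_deg x)) (gen_mult (S_monom 1 (int k) 0 0 0) x))"
  from I[OF this] have T: "Th (fst (gen_deg x) + 2 * k) (snd (gen_deg x)) (gen_mult (S_monom 1 (int k) 0 0 0) x) (cpt f)"
   unfolding Tt_def by blast
  show "E2_detected \<theta> c1 k x f"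
   unfolding E2_detected_def using Th_detect[OF refl n T] by auto
 qed
qed

end

end

theorem theorem0p6:
  fixes res :: "'w::comm_ring_1 \<Rightarrow> 'k::field"
    and \<Gamma> :: "'w E6 \<Rightarrow> 'w E6"
    and \<theta> :: "'w E6 \<Rightarrow> 'w Mhat"
    and c1 :: "int list \<Rightarrow> 'w Mhat"
  assumes "CARD('k) = 3 ^ 6"
    and "witt_ring 3 res"
    and "E6_C9_action res \<Gamma>"
    and "graded_WC9_iso \<Gamma> \<theta>"
    and "generates_H1 c1"
  shows "\<exists>\<Phi> :: nat \<Rightarrow> int \<Rightarrow> (gen \<Rightarrow> 'w S) set \<Rightarrow> (int list \<Rightarrow> 'w E6) set.
    (\<forall>n>0. \<forall>t. \<Phi> n t \<in> iso (pres_module n t) (E2_page \<Gamma> n t)) \<and>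
    (\<forall>n>0. \<forall>t m s a v. 0 < int n + 2 * m \<longrightarrow> a \<in> S_part (2 * m) s \<longrightarrow> v \<in> free_part n t \<longrightarrow>
       (let n' = nat (int n + 2 * m) in
        \<forall>f \<in> \<Phi> n t (pres_class n t v). \<forall>f' \<in> \<Phi> n' (t + s) (pres_class n' (t + s) (\<lambda>x. a * v x)).
          E2_smult \<theta> m s a n t f f')) \<and>
    (\<forall>x k. 0 < fst (gen_deg x) + 2 * k \<longrightarrow>
       (let n = fst (gen_deg x) + 2 * k; t = snd (gen_deg x) in
        \<forall>f \<in> \<Phi> n t (pres_class n t (gen_mult (S_monom 1 (int k) 0 0 0) x)).
          E2_detected \<theta> c1 k x f))"
proof -
 have "finite (UNIV :: 'k set)"
 proof (rule ccontr)
  assume "infinite (UNIV :: 'k set)"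
  thus False using assms(1) by simp
 qed
 then interpret wc res c1 by unfold_locales (rule assms(2), assumption, rule assms(5))
 show ?thesis by (rule main[OF assms(3,4)])
qed

end
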